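(* Let $\mathcal X$ be a smooth projective geometrically irreducible curve of genus $g_{\mathcal X}$ over $\mathbb F_q$, let $D=P_1+\cdots+P_N$ be a sum of distinct $\mathbb F_q$-rational points, and let $G$ be a divisor with $\operatorname{Supp}G\cap\operatorname{Supp}D=\emptyset$. Let $\eta$ be a differential of $\mathcal X$ over $\mathbb F_q$ with $v_P(\eta)=-1$ and $\operatorname{Res}_P(\eta)=1$ for every $P\in\operatorname{Supp}D$, put $K=\operatorname{div}(\eta)$ and $A=D-G+K$ (so that $C_L(D,A)=C_L(D,G)^\perp$ and $C_L(D,G)\cap C_L(D,A)=\operatorname{Hull}(C_L(D,G))$). Then the following hold. (1) As divisors, $G\vee A-D=K-(G\wedge A)$, so that $L(G\vee A-D)=L(K-G\wedge A)$, the Serre dual of $H^1(\mathcal X,\mathcal O_{\mathcal X}(G\wedge A))$. (2) $R(G,A)\subseteq L(K-G\wedge A)$, so the quotient $\operatorname{Hull}(C_L(D,G))/C_L(D,G\wedge A)$ is isomorphic to the subquotient $R(G,A)/R_0(G,A)$ of $H^1(\mathcal X,\mathcal O_{\mathcal X}(G\wedge A))^\vee$, and $$0\le\varepsilon(G,A)\le\ell(K-G\wedge A)=\dim_{\mathbb F_q}H^1(\mathcal X,\mathcal O_{\mathcal X}(G\wedge A)).$$ (3) If $G\wedge A$ is non-special, then $\varepsilon(G,A)=0$ and $\operatorname{Hull}(C_L(D,G))=C_L(D,G\wedge A)$.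
   Context: For a divisor $G$, $L(G)=\{h\in\mathbb F_q(\mathcal X)^*:\operatorname{div}(h)+G\ge 0\}\cup\{0\}$, $\ell(G)=\dim_{\mathbb F_q}L(G)$. If $\operatorname{Supp} G\cap \operatorname{Supp} D=\emptyset$, then $C_L(D,G)\subseteq\mathbb F_q^N$ is the image of $\operatorname{ev}:L(G)\to\mathbb F_q^N$, $h\mapsto(h(P_1),\dots,h(P_N))$. The dual $C^\perp$ is taken with respect to the standard bilinear form on $\mathbb F_q^N$ and $\operatorname{Hull}(C)=C\cap C^\perp$. The meet $G_1\wedge G_2$ and join $G_1\vee G_2$ of two divisors are their coefficientwise minimum and maximum. Define $$R(G,A)=\bigl(L(G)+L(A)\bigr)\cap L(G\vee A-D),\qquad R_0(G,A)=L(G-D)+L(A-D)\subseteq R(G,A),$$ and the excess $\varepsilon(G,A)=\dim_{\mathbb F_q}R(G,A)/R_0(G,A)$. A divisor $B$ is non-special if its index of speciality $\ell(K-B)=\ell(B)-\deg B-1+g_{\mathcal X}$ is zero. *)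

theory Defs
  imports
    "HOL-Computational_Algebra.Polynomial"
    "HOL-Analysis.Finite_Cartesian_Product"
    "HOL-Library.Function_Algebras"
    "HOL-Library.Set_Algebras"
begin

text \<open>
  A smooth projective geometrically irreducible curve over a finite field is given by its
  function field: the type \<open>'a\<close> is \<open>F\<^sub>q(X)\<close>, the type \<open>'k\<close> is \<open>F\<^sub>q\<close>, and \<open>\<iota>\<close> is the inclusion of
  the constants.  The closed points of \<open>X\<close> are the normalized discrete valuations of \<open>'a\<close> that
  are trivial on the constants.  Sums and differences of divisors, adeles, differentials and
  functionals are the pointwise ones of \<open>Function_Algebras\<close>, meet and join of divisors are
  \<open>inf\<close> and \<open>sup\<close> of functions, and sums of subspaces and of cosets are those of \<open>Set_Algebras\<close>.
\<close>

section \<open>Subspaces and quotients\<close>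

definition quotient_space :: "'v::ab_group_add set \<Rightarrow> 'v set \<Rightarrow> 'v set set" where
  "quotient_space V W = (\<lambda>v. v +o W) ` V"

text \<open>Adding \<open>W\<close> makes \<open>0\<close> times a coset equal to \<open>W\<close>, not to \<open>{0}\<close>.\<close>

definition coset_scale ::
  "('k \<Rightarrow> 'v \<Rightarrow> 'v::ab_group_add) \<Rightarrow> 'v set \<Rightarrow> 'k \<Rightarrow> 'v set \<Rightarrow> 'v set" where
  "coset_scale s W c S = s c ` S + W"

definition linear_bij ::
  "('k \<Rightarrow> 'v::plus \<Rightarrow> 'v) \<Rightarrow> ('k \<Rightarrow> 'w::plus \<Rightarrow> 'w) \<Rightarrow> ('v \<Rightarrow> 'w) \<Rightarrow> 'v set \<Rightarrow> 'w set \<Rightarrow> bool"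
  where
  "linear_bij s1 s2 f V W \<longleftrightarrow>
     bij_betw f V W \<and>
     (\<forall>x\<in>V. \<forall>y\<in>V. f (x + y) = f x + f y) \<and>
     (\<forall>c. \<forall>x\<in>V. f (s1 c x) = s2 c (f x))"

definition quotient_isomorphic ::
  "('k \<Rightarrow> 'v \<Rightarrow> 'v) \<Rightarrow> 'v::ab_group_add set \<Rightarrow> 'v set \<Rightarrow>
   ('k \<Rightarrow> 'w \<Rightarrow> 'w) \<Rightarrow> 'w::ab_group_add set \<Rightarrow> 'w set \<Rightarrow> bool" where
  "quotient_isomorphic s V W s' V' W' \<longleftrightarrow>
     (\<exists>f. linear_bij (coset_scale s W) (coset_scale s' W') f
            (quotient_space V W) (quotient_space V' W'))"

text \<open>A finite set of representatives whose classes form a basis of \<open>V/W\<close>.\<close>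

definition quotient_basis ::
  "('k::field \<Rightarrow> 'v \<Rightarrow> 'v) \<Rightarrow> 'v::ab_group_add set \<Rightarrow> 'v set \<Rightarrow> 'v set \<Rightarrow> bool" where
  "quotient_basis s V W B \<longleftrightarrow>
     finite B \<and> B \<subseteq> V \<and> V \<subseteq> module.span s B + W \<and>
     (\<forall>c. (\<Sum>b\<in>B. s (c b) b) \<in> W \<longrightarrow> (\<forall>b\<in>B. c b = 0))"

definition finite_dim_quotient ::
  "('k::field \<Rightarrow> 'v \<Rightarrow> 'v) \<Rightarrow> 'v::ab_group_add set \<Rightarrow> 'v set \<Rightarrow> bool" where
  "finite_dim_quotient s V W \<longleftrightarrow> (\<exists>B. quotient_basis s V W B)"

definition quotient_dim ::
  "('k::field \<Rightarrow> 'v \<Rightarrow> 'v) \<Rightarrow> 'v::ab_group_add set \<Rightarrow> 'v set \<Rightarrow> nat" where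
  "quotient_dim s V W =
     (if finite_dim_quotient s V W then card (SOME B. quotient_basis s V W B) else 0)"


section \<open>Function fields and places\<close>

text \<open>
  The last condition, that the constants are algebraically closed in the function field, is
  geometric irreducibility of the curve, as a finite field is perfect.
\<close>

definition function_field :: "('k::{field,finite} \<Rightarrow> 'a::field) \<Rightarrow> bool" where
  "function_field \<iota> \<longleftrightarrow>
     \<iota> 1 = 1 \<and> (\<forall>a b. \<iota> (a + b) = \<iota> a + \<iota> b) \<and> (\<forall>a b. \<iota> (a * b) = \<iota> a * \<iota> b) \<and>
     (\<exists>x. (\<forall>p. p \<noteq> 0 \<longrightarrow> poly (map_poly \<iota> p) x \<noteq> 0) \<and>
       (\<exists>B. finite B \<and> (\<forall>f. \<exists>c.
          (\<forall>b\<in>B. c b \<in> {poly (map_poly \<iota> p) x / poly (map_poly \<iota> r) x | p r. r \<noteq> 0}) \<and>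
          f = (\<Sum>b\<in>B. c b * b)))) \<and>
     (\<forall>f. (\<exists>p. p \<noteq> 0 \<and> poly (map_poly \<iota> p) f = 0) \<longrightarrow> f \<in> range \<iota>)"

abbreviation const_scale :: "('k \<Rightarrow> 'a::times) \<Rightarrow> 'k \<Rightarrow> 'a \<Rightarrow> 'a" where
  "const_scale \<iota> \<equiv> (\<lambda>c f. \<iota> c * f)"

text \<open>
  The value \<open>v 0 = 0\<close> is a dummy that makes the valuation of a point unique; \<open>val_ge\<close> treats
  \<open>0\<close> as having infinite valuation.
\<close>

definition places :: "('k \<Rightarrow> 'a::field) \<Rightarrow> ('a \<Rightarrow> int) set" where
  "places \<iota> = {v. v 0 = 0 \<and>
     (\<forall>f g. f \<noteq> 0 \<longrightarrow> g \<noteq> 0 \<longrightarrow> v (f * g) = v f + v g) \<and>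
     (\<forall>f g. f \<noteq> 0 \<longrightarrow> g \<noteq> 0 \<longrightarrow> f + g \<noteq> 0 \<longrightarrow> min (v f) (v g) \<le> v (f + g)) \<and>
     (\<forall>c. v (\<iota> c) = 0) \<and> (\<exists>t. v t = 1)}"

definition val_ge :: "('a::zero \<Rightarrow> int) \<Rightarrow> int \<Rightarrow> 'a set" where
  "val_ge P n = {f. f = 0 \<or> n \<le> P f}"

text \<open>The degree of the residue field \<open>val_ge P 0 / val_ge P 1\<close> over the constants.\<close>

definition place_degree :: "('k::field \<Rightarrow> 'a::field) \<Rightarrow> ('a \<Rightarrow> int) \<Rightarrow> nat" where
  "place_degree \<iota> P = quotient_dim (const_scale \<iota>) (val_ge P 0) (val_ge P 1)"

definition rational_places :: "('k::field \<Rightarrow> 'a::field) \<Rightarrow> ('a \<Rightarrow> int) set" where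
  "rational_places \<iota> = {P \<in> places \<iota>. place_degree \<iota> P = 1}"

definition value_at :: "('k \<Rightarrow> 'a::field) \<Rightarrow> ('a \<Rightarrow> int) \<Rightarrow> 'a \<Rightarrow> 'k" where
  "value_at \<iota> P h = (THE c. h - \<iota> c \<in> val_ge P 1)"


section \<open>Divisors and Riemann-Roch spaces\<close>

type_synonym 'a dvsr = "('a \<Rightarrow> int) \<Rightarrow> int"

definition Supp :: "'a dvsr \<Rightarrow> ('a \<Rightarrow> int) set" where
  "Supp G = {P. G P \<noteq> 0}"

definition divisors :: "('k \<Rightarrow> 'a::field) \<Rightarrow> 'a dvsr set" where
  "divisors \<iota> = {G. finite (Supp G) \<and> Supp G \<subseteq> places \<iota>}"

definition point_divisor :: "('a \<Rightarrow> int) \<Rightarrow> 'a dvsr" where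
  "point_divisor P = (\<lambda>Q. if Q = P then 1 else 0)"

definition divisor_degree :: "('k::field \<Rightarrow> 'a::field) \<Rightarrow> 'a dvsr \<Rightarrow> int" where
  "divisor_degree \<iota> G = (\<Sum>P\<in>Supp G. G P * int (place_degree \<iota> P))"

definition principal_divisor :: "('k \<Rightarrow> 'a::field) \<Rightarrow> 'a \<Rightarrow> 'a dvsr" where
  "principal_divisor \<iota> h = (\<lambda>P. if P \<in> places \<iota> then P h else 0)"

definition RR_space :: "('k \<Rightarrow> 'a::field) \<Rightarrow> 'a dvsr \<Rightarrow> 'a set" where
  "RR_space \<iota> G = {h. h \<noteq> 0 \<and> principal_divisor \<iota> h + G \<ge> 0} \<union> {0}"

definition ell :: "('k::field \<Rightarrow> 'a::field) \<Rightarrow> 'a dvsr \<Rightarrow> nat" where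
  "ell \<iota> G = vector_space.dim (const_scale \<iota>) (RR_space \<iota> G)"


section \<open>First cohomology and genus\<close>

text \<open>
  The flasque resolution \<open>0 \<rightarrow> O(B) \<rightarrow> F \<rightarrow> F/O(B) \<rightarrow> 0\<close> by the constant sheaf \<open>F\<close> and a direct sum
  of skyscraper sheaves presents \<open>H\<^sup>1(X, O(B))\<close> as the cokernel of \<open>F \<rightarrow> (\<Oplus>P. F / O(B)\<^sub>P)\<close>.
  Written with adeles (repartitions), this is \<open>adeles / (adeles_at B + F)\<close>.
\<close>

definition adeles :: "('k \<Rightarrow> 'a::field) \<Rightarrow> (('a \<Rightarrow> int) \<Rightarrow> 'a) set" where
  "adeles \<iota> = {\<alpha>. (\<forall>P. P \<notin> places \<iota> \<longrightarrow> \<alpha> P = 0) \<and>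
                   finite {P \<in> places \<iota>. \<alpha> P \<notin> val_ge P 0}}"

definition adeles_at :: "('k \<Rightarrow> 'a::field) \<Rightarrow> 'a dvsr \<Rightarrow> (('a \<Rightarrow> int) \<Rightarrow> 'a) set" where
  "adeles_at \<iota> B = {\<alpha> \<in> adeles \<iota>. \<forall>P\<in>places \<iota>. \<alpha> P \<in> val_ge P (- B P)}"

definition principal_adeles :: "('k \<Rightarrow> 'a::field) \<Rightarrow> (('a \<Rightarrow> int) \<Rightarrow> 'a) set" where
  "principal_adeles \<iota> = range (\<lambda>f P. if P \<in> places \<iota> then f else 0)"

abbreviation adele_scale :: "('k \<Rightarrow> 'a::field) \<Rightarrow> 'k \<Rightarrow> ('p \<Rightarrow> 'a) \<Rightarrow> ('p \<Rightarrow> 'a)" where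
  "adele_scale \<iota> \<equiv> (\<lambda>c \<alpha> P. \<iota> c * \<alpha> P)"

definition finite_h1 :: "('k::field \<Rightarrow> 'a::field) \<Rightarrow> 'a dvsr \<Rightarrow> bool" where
  "finite_h1 \<iota> B \<longleftrightarrow>
     finite_dim_quotient (adele_scale \<iota>) (adeles \<iota>) (adeles_at \<iota> B + principal_adeles \<iota>)"

definition h1 :: "('k::field \<Rightarrow> 'a::field) \<Rightarrow> 'a dvsr \<Rightarrow> nat" where
  "h1 \<iota> B = quotient_dim (adele_scale \<iota>) (adeles \<iota>) (adeles_at \<iota> B + principal_adeles \<iota>)"

text \<open>
  The dual of \<open>H\<^sup>1(X, O(B))\<close>: linear functionals on the adeles that factor through the quotient,
  extended by \<open>0\<close> outside the adeles.
\<close>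

definition H1_dual ::
  "('k::field \<Rightarrow> 'a::field) \<Rightarrow> 'a dvsr \<Rightarrow> ((('a \<Rightarrow> int) \<Rightarrow> 'a) \<Rightarrow> 'k) set" where
  "H1_dual \<iota> B = {\<phi>.
     (\<forall>\<alpha>. \<alpha> \<notin> adeles \<iota> \<longrightarrow> \<phi> \<alpha> = 0) \<and>
     (\<forall>\<alpha>\<in>adeles \<iota>. \<forall>\<beta>\<in>adeles \<iota>. \<phi> (\<alpha> + \<beta>) = \<phi> \<alpha> + \<phi> \<beta>) \<and>
     (\<forall>c. \<forall>\<alpha>\<in>adeles \<iota>. \<phi> (adele_scale \<iota> c \<alpha>) = c * \<phi> \<alpha>) \<and>
     (\<forall>\<alpha>\<in>adeles_at \<iota> B + principal_adeles \<iota>. \<phi> \<alpha> = 0)}"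

definition genus :: "('k::field \<Rightarrow> 'a::field) \<Rightarrow> nat" where
  "genus \<iota> = h1 \<iota> 0"


section \<open>Differentials\<close>

definition derivations :: "('k \<Rightarrow> 'a::field) \<Rightarrow> ('a \<Rightarrow> 'a) set" where
  "derivations \<iota> = {\<delta>. (\<forall>f g. \<delta> (f + g) = \<delta> f + \<delta> g) \<and>
     (\<forall>f g. \<delta> (f * g) = f * \<delta> g + g * \<delta> f) \<and> (\<forall>c. \<delta> (\<iota> c) = 0)}"

text \<open>
  Derivations of the function field \<open>F\<close> are the \<open>F\<close>-linear forms on its module of Kaehler
  differentials, and a vector space over a field embeds into its bidual.  So the Kaehler
  differentials are the \<open>F\<close>-span of the evaluations \<open>df\<close> on derivations.
\<close>

type_synonym 'a differential = "('a \<Rightarrow> 'a) \<Rightarrow> 'a"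

definition dform :: "('k \<Rightarrow> 'a::field) \<Rightarrow> 'a \<Rightarrow> 'a differential" where
  "dform \<iota> f = (\<lambda>\<delta>. if \<delta> \<in> derivations \<iota> then \<delta> f else 0)"

abbreviation form_scale :: "'a::field \<Rightarrow> 'a differential \<Rightarrow> 'a differential" where
  "form_scale \<equiv> (\<lambda>u \<eta> \<delta>. u * \<eta> \<delta>)"

definition differentials :: "('k \<Rightarrow> 'a::field) \<Rightarrow> 'a differential set" where
  "differentials \<iota> = module.span form_scale (range (dform \<iota>))"

text \<open>
  As the constant field is perfect, \<open>dt\<close> generates the differentials, also integrally at \<open>P\<close>,
  for every uniformizer \<open>t\<close> at \<open>P\<close>.
\<close>

definition diff_val ::
  "('k \<Rightarrow> 'a::field) \<Rightarrow> ('a \<Rightarrow> int) \<Rightarrow> 'a differential \<Rightarrow> int" where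
  "diff_val \<iota> P \<eta> = (THE n. \<exists>t u. P t = 1 \<and> \<eta> = form_scale u (dform \<iota> t) \<and> n = P u)"

definition diff_divisor :: "('k \<Rightarrow> 'a::field) \<Rightarrow> 'a differential \<Rightarrow> 'a dvsr" where
  "diff_divisor \<iota> \<eta> = (\<lambda>P. if P \<in> places \<iota> then diff_val \<iota> P \<eta> else 0)"

text \<open>
  The residue at \<open>P\<close>, followed by the trace from the residue field \<open>k(P)\<close> to the constants; at a
  rational point it is the residue itself.  Let \<open>d\<close> be the degree of \<open>P\<close> and \<open>Q = q\<^sup>d\<close> the size of
  \<open>k(P)\<close>.  In the completed local ring \<open>k(P)[[t]]\<close> the constants \<open>k(P)\<close> are the roots of
  \<open>X\<^sup>Q - X\<close>, so \<open>b i\<close> below agrees with a constant up to valuation \<open>n\<close>, and for \<open>\<eta> = u dt\<close> the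
  principal part of \<open>u\<close> at \<open>P\<close> is the sum of the \<open>b i / t\<^sup>i\<close> up to regular functions.  The trace of
  the coefficient of \<open>1 / t\<close> is the sum of its conjugates \<open>(b 1)^(q^j)\<close> with \<open>j < d\<close>.
  At a rational point, one may take \<open>b i\<close> in the constants themselves.
\<close>

definition residue_trace ::
  "('k::{field,finite} \<Rightarrow> 'a::field) \<Rightarrow> ('a \<Rightarrow> int) \<Rightarrow> 'a differential \<Rightarrow> 'k" where
  "residue_trace \<iota> P \<eta> = (THE c. \<exists>t u. \<exists>n\<ge>1. \<exists>b.
     P t = 1 \<and> \<eta> = form_scale u (dform \<iota> t) \<and>
     (\<forall>i\<in>{1..n}. b i \<in> val_ge P 0 \<and>
        b i ^ (CARD('k) ^ place_degree \<iota> P) - b i \<in> val_ge P (int n)) \<and>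
     u - (\<Sum>i=1..n. b i / t ^ i) \<in> val_ge P 0 \<and>
     (\<Sum>j<place_degree \<iota> P. b 1 ^ (CARD('k) ^ j)) - \<iota> c \<in> val_ge P 1)"

text \<open>The Serre pairing of a function \<open>f\<close> (the differential \<open>f\<eta>\<close>) with an adele.\<close>

definition serre_map ::
  "('k::{field,finite} \<Rightarrow> 'a::field) \<Rightarrow> 'a differential \<Rightarrow> 'a \<Rightarrow> (('a \<Rightarrow> int) \<Rightarrow> 'a) \<Rightarrow> 'k" where
  "serre_map \<iota> \<eta> f \<alpha> =
     (if \<alpha> \<in> adeles \<iota>
      then \<Sum>P | P \<in> places \<iota> \<and> residue_trace \<iota> P (form_scale (f * \<alpha> P) \<eta>) \<noteq> 0.
             residue_trace \<iota> P (form_scale (f * \<alpha> P) \<eta>)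
      else 0)"

definition index_of_speciality :: "('k::field \<Rightarrow> 'a::field) \<Rightarrow> 'a dvsr \<Rightarrow> 'a dvsr \<Rightarrow> nat" where
  "index_of_speciality \<iota> K B = ell \<iota> (K - B)"

definition nonspecial :: "('k::field \<Rightarrow> 'a::field) \<Rightarrow> 'a dvsr \<Rightarrow> 'a dvsr \<Rightarrow> bool" where
  "nonspecial \<iota> K B \<longleftrightarrow> index_of_speciality \<iota> K B = 0"


section \<open>Codes\<close>

text \<open>
  The evaluation points are a family \<open>Ps\<close> and not the divisor \<open>D\<close>, as \<open>D\<close> does not order them.
  The definition is meant for \<open>G\<close> with support disjoint from the points.
\<close>

definition code_L ::
  "('k \<Rightarrow> 'a::field) \<Rightarrow> ('n::finite \<Rightarrow> ('a \<Rightarrow> int)) \<Rightarrow> 'a dvsr \<Rightarrow> ('k ^ 'n) set" where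
  "code_L \<iota> Ps G = (\<lambda>h. \<chi> i. value_at \<iota> (Ps i) h) ` RR_space \<iota> G"

definition dual_code :: "('k::field ^ 'n::finite) set \<Rightarrow> ('k ^ 'n) set" where
  "dual_code C = {y. \<forall>x\<in>C. scalar_product x y = 0}"

definition hull_code :: "('k::field ^ 'n::finite) set \<Rightarrow> ('k ^ 'n) set" where
  "hull_code C = C \<inter> dual_code C"

definition R_space :: "('k \<Rightarrow> 'a::field) \<Rightarrow> 'a dvsr \<Rightarrow> 'a dvsr \<Rightarrow> 'a dvsr \<Rightarrow> 'a set" where
  "R_space \<iota> D G A = (RR_space \<iota> G + RR_space \<iota> A) \<inter> RR_space \<iota> (sup G A - D)"

definition R0_space :: "('k \<Rightarrow> 'a::field) \<Rightarrow> 'a dvsr \<Rightarrow> 'a dvsr \<Rightarrow> 'a dvsr \<Rightarrow> 'a set" where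
  "R0_space \<iota> D G A = RR_space \<iota> (G - D) + RR_space \<iota> (A - D)"

definition excess :: "('k::field \<Rightarrow> 'a::field) \<Rightarrow> 'a dvsr \<Rightarrow> 'a dvsr \<Rightarrow> 'a dvsr \<Rightarrow> nat" where
  "excess \<iota> D G A = quotient_dim (const_scale \<iota>) (R_space \<iota> D G A) (R0_space \<iota> D G A)"

end

theory Submission
  imports Defs
begin

text \<open>
  The divisors \<open>G\<close> and \<open>A = D - G + K\<close> are exchanged by \<open>B \<mapsto> D + K - B\<close>, so their join and meet satisfy
  \<open>(G \<or> A) + (G \<and> A) = D + K\<close>.  A word of the hull is the vector of values of some
  \<open>f \<in> L(G)\<close> and of some \<open>a \<in> L(A)\<close>.  The difference \<open>f - a\<close> vanishes at the points, so it lies in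
  \<open>R(G, A)\<close>; it is determined by the word up to \<open>L(G - D) + L(A - D)\<close>, and it lies in that space exactly
  if the word comes from \<open>L(G) \<inter> L(A) = L(G \<and> A)\<close>.  This correspondence is the isomorphism of the
  quotients, and both are zero for a non-special meet because \<open>R(G, A) \<subseteq> L(K - G \<and> A)\<close> is then zero.

  What carries the theorem is Serre duality with explicit residues: the pairing of \<open>L(K - B)\<close> with the
  adeles identifies it with the dual of \<open>H\<^sup>1(X, O(B))\<close> (\<open>serre_duality\<close>).  Besides the dimensions, it yields
  that the code of \<open>A\<close> is all of the dual of the code of \<open>G\<close>: a vector orthogonal to \<open>C\<^sub>L(D, G)\<close> is a
  functional on \<open>H\<^sup>1(X, O(G - D))\<close>, hence represented by a section of \<open>O(A)\<close> (\<open>dual_code_represented\<close>).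

  Riemann's part of the theory rests on counting over the finite field.  Every function that is not
  constant has a pole (\<open>exists_pole\<close>), zeros are finite in number (\<open>finite_zeros\<close>), and the defect
  \<open>deg B - \<ell>(B)\<close> is bounded (\<open>defect_bounded\<close>), so \<open>H\<^sup>1\<close> is finite and \<open>riemann_roch_h1\<close> holds.

  Residues follow Tate.  For a projection \<open>e\<close> onto the local ring, the residue of \<open>f dg\<close> is the trace of the
  commutator of the compressions \<open>e f e\<close> and \<open>e g e\<close>, which has finite rank.  This agrees with the trace of
  the coefficient of \<open>1 / t\<close> (\<open>residue_trace_eq_symbol\<close>).  The same construction on the space of
  adeles gives the sum of the residues, and the finiteness of \<open>H\<^sup>0\<close> and \<open>H\<^sup>1\<close> makes it vanish
  (\<open>residue_theorem\<close>).  So \<open>L(K - B)\<close> maps to the dual of \<open>H\<^sup>1(X, O(B))\<close>, injectively because the trace forms of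
  the residue fields are nondegenerate, and surjectively by a comparison of growth rates
  (\<open>serre_surjective\<close>).

  Let \<open>q\<close> be the number of constants.  Differentials are handled through the expansion \<open>f = \<Sum> a\<^sub>i\<^sup>q t\<^sup>i\<close> with \<open>i < q\<close> (\<open>q_expansion\<close>), which exists
  for every uniformizer \<open>t\<close>.  As \<open>q\<close>-th powers have derivative zero, it computes \<open>df/dt\<close> for all derivations
  and for Tate's symbol at once, and shows that \<open>df/dt\<close> is regular where \<open>f\<close> is.
\<close>

section \<open>Cosets and relative dimension\<close>

definition add_subgroup :: "'v::ab_group_add set \<Rightarrow> bool" where
  "add_subgroup W \<longleftrightarrow> 0 \<in> W \<and> (\<forall>x\<in>W. \<forall>y\<in>W. x - y \<in> W)"

lemma add_subgroupD:
  assumes "add_subgroup W"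
  shows "0 \<in> W" "x \<in> W \<Longrightarrow> y \<in> W \<Longrightarrow> x - y \<in> W" "x \<in> W \<Longrightarrow> - x \<in> W"
    "x \<in> W \<Longrightarrow> y \<in> W \<Longrightarrow> x + y \<in> W"
proof -
  show 0: "0 \<in> W" using assms by (simp add: add_subgroup_def)
  have d: "x - y \<in> W" if "x \<in> W" "y \<in> W" for x y using assms that by (simp add: add_subgroup_def)
  have m: "- x \<in> W" if "x \<in> W" for x using d[OF 0 that] by simp
  show "x \<in> W \<Longrightarrow> y \<in> W \<Longrightarrow> x - y \<in> W" "x \<in> W \<Longrightarrow> - x \<in> W" using d m by auto
  show "x \<in> W \<Longrightarrow> y \<in> W \<Longrightarrow> x + y \<in> W" using d[OF _ m, of x y] by simp
qed

lemma set_plus_iff: "x \<in> A + B \<longleftrightarrow> (\<exists>a\<in>A. \<exists>b\<in>B. x = a + b)"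
  by (auto simp: set_plus_def)

lemma set_plusI: "x = a + b \<Longrightarrow> a \<in> A \<Longrightarrow> b \<in> B \<Longrightarrow> x \<in> A + B"
  by auto

lemma add_subgroup_Int: "add_subgroup V \<Longrightarrow> add_subgroup W \<Longrightarrow> add_subgroup (V \<inter> W)"
  by (auto simp: add_subgroup_def)

lemma add_subgroup_plus:
  assumes "add_subgroup V" "add_subgroup W"
  shows "add_subgroup (V + W)"
  unfolding add_subgroup_def
proof (intro conjI ballI)
  show "0 \<in> V + W"
    using set_plus_intro[OF add_subgroupD(1)[OF assms(1)] add_subgroupD(1)[OF assms(2)]] by simp
  fix x y assume "x \<in> V + W" "y \<in> V + W"
  then obtain a b c d where *: "x = a + b" "y = c + d" "a \<in> V" "b \<in> W" "c \<in> V" "d \<in> W"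
    by (auto simp: set_plus_iff)
  have "x - y = (a - c) + (b - d)" using * by simp
  moreover have "a - c \<in> V" "b - d \<in> W" using * assms by (auto intro: add_subgroupD(2))
  ultimately show "x - y \<in> V + W" by (rule set_plusI)
qed

lemma subset_plus_right: "add_subgroup W \<Longrightarrow> V \<subseteq> V + W"
  using set_plus_intro add_subgroupD(1) by (metis add.right_neutral subsetI)

lemma subset_plus_left: "add_subgroup V \<Longrightarrow> W \<subseteq> V + W"
  using set_plus_intro add_subgroupD(1) by (metis add.left_neutral subsetI)

lemma coset_eq_iff:
  assumes "add_subgroup W"
  shows "x +o W = y +o W \<longleftrightarrow> x - y \<in> W"
proof
  assume "x +o W = y +o W"
  moreover have "x + 0 \<in> x +o W" using add_subgroupD(1)[OF assms] by blast
  ultimately show "x - y \<in> W" using set_plus_imp_minus by fastforce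
next
  assume *: "x - y \<in> W"
  have "z - x \<in> W \<longleftrightarrow> z - y \<in> W" for z
    using add_subgroupD(4)[OF assms _ *, of "z - x"] add_subgroupD(2)[OF assms _ *, of "z - y"]
    by auto
  then show "x +o W = y +o W" by (auto simp: set_minus_plus[symmetric])
qed

lemma bij_betw_images:
  assumes "\<And>x y. x \<in> V \<Longrightarrow> y \<in> V \<Longrightarrow> A x = A y \<longleftrightarrow> B x = B y"
  shows "\<exists>h. bij_betw h (A ` V) (B ` V)"
proof -
  define h where "h S = B (SOME x. x \<in> V \<and> A x = S)" for S
  have h: "h (A x) = B x" if "x \<in> V" for x
  proof -
    have "(SOME y. y \<in> V \<and> A y = A x) \<in> V \<and> A (SOME y. y \<in> V \<and> A y = A x) = A x"
      by (rule someI[of "\<lambda>y. y \<in> V \<and> A y = A x" x]) (use that in auto)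
    then show ?thesis using assms that unfolding h_def by blast
  qed
  have "inj_on h (A ` V)" by (auto simp: inj_on_def h assms)
  moreover have "h ` (A ` V) = B ` V" using h by (force simp: image_iff)
  ultimately show ?thesis by (auto simp: bij_betw_def)
qed

text \<open>
  Dimensions are compared by counting cosets.  The second isomorphism theorem, multiplication by a
  function and passage to the component at a place are instances of this comparison.
\<close>

lemma quotient_space_cong:
  assumes V: "add_subgroup V" and W: "add_subgroup W" "add_subgroup W'"
    and f: "\<And>x y. x \<in> V \<Longrightarrow> y \<in> V \<Longrightarrow> f (x - y) = f x - f y" "\<And>x. x \<in> V \<Longrightarrow> f x \<in> V'"
    and onto: "\<And>y. y \<in> V' \<Longrightarrow> \<exists>x\<in>V. y - f x \<in> W'"
    and ker: "\<And>x. x \<in> V \<Longrightarrow> f x \<in> W' \<longleftrightarrow> x \<in> W"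
  shows "card (quotient_space V W) = card (quotient_space V' W')"
    and "finite (quotient_space V W) \<longleftrightarrow> finite (quotient_space V' W')"
proof -
  have eq: "x +o W = y +o W \<longleftrightarrow> f x +o W' = f y +o W'" if "x \<in> V" "y \<in> V" for x y
    using that ker[of "x - y"] f(1)[of x y] add_subgroupD(2)[OF V that] W
    by (simp add: coset_eq_iff)
  have "quotient_space V' W' = (\<lambda>x. f x +o W') ` V"
  proof
    show "(\<lambda>x. f x +o W') ` V \<subseteq> quotient_space V' W'" using f(2) by (auto simp: quotient_space_def)
    show "quotient_space V' W' \<subseteq> (\<lambda>x. f x +o W') ` V"
    proof
      fix S assume "S \<in> quotient_space V' W'"
      then obtain y where y: "y \<in> V'" "S = y +o W'" by (auto simp: quotient_space_def)
      obtain x where "x \<in> V" "y - f x \<in> W'" using onto[OF y(1)] by blast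
      then show "S \<in> (\<lambda>x. f x +o W') ` V" using y coset_eq_iff[OF W(2), of y "f x"] by blast
    qed
  qed
  moreover obtain h where "bij_betw h ((\<lambda>x. x +o W) ` V) ((\<lambda>x. f x +o W') ` V)"
    using bij_betw_images[of V "\<lambda>x. x +o W" "\<lambda>x. f x +o W'"] eq by blast
  ultimately show "card (quotient_space V W) = card (quotient_space V' W')"
    and "finite (quotient_space V W) \<longleftrightarrow> finite (quotient_space V' W')"
    unfolding quotient_space_def by (auto dest: bij_betw_same_card bij_betw_finite)
qed

lemma quotient_space_nonempty: "V \<noteq> {} \<Longrightarrow> quotient_space V W \<noteq> {}"
  by (simp add: quotient_space_def)

text \<open>
  \<open>(S, T) \<mapsto> r S + T\<close> with fixed representatives \<open>r\<close> is a bijection.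
\<close>

lemma quotient_space_tower:
  assumes "add_subgroup V" "add_subgroup U" "add_subgroup W" "W \<subseteq> U" "U \<subseteq> V"
  shows "card (quotient_space V W) = card (quotient_space V U) * card (quotient_space U W)"
    and "finite (quotient_space V W) \<longleftrightarrow>
      finite (quotient_space V U) \<and> finite (quotient_space U W)"
proof -
  define r where "r S = (SOME x. x \<in> V \<and> S = x +o U)" for S
  have r: "r S \<in> V" "S = r S +o U" if "S \<in> quotient_space V U" for S
    using that someI_ex[of "\<lambda>x. x \<in> V \<and> S = x +o U"] unfolding quotient_space_def r_def by blast+
  define h where "h = (\<lambda>(S, T). r S +o T)"
  have "bij_betw h (quotient_space V U \<times> quotient_space U W) (quotient_space V W)"
    unfolding bij_betw_def
  proof
    show "inj_on h (quotient_space V U \<times> quotient_space U W)"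
    proof (rule inj_onI, clarify)
      fix S T S' T'
      assume S: "S \<in> quotient_space V U" "S' \<in> quotient_space V U"
        and T: "T \<in> quotient_space U W" "T' \<in> quotient_space U W" and eq: "h (S, T) = h (S', T')"
      obtain t t' where t: "t \<in> U" "T = t +o W" "t' \<in> U" "T' = t' +o W"
        using T by (auto simp: quotient_space_def)
      have *: "(r S + t) - (r S' + t') \<in> W"
        using eq t coset_eq_iff[OF assms(3)] by (simp add: h_def set_plus_rearranges)
      then have "((r S + t) - (r S' + t')) - (t - t') \<in> U"
        using t assms by (blast intro: add_subgroupD(2))
      then have "r S - r S' \<in> U" by simp
      then have "S = S'" using r(2)[OF S(1)] r(2)[OF S(2)] coset_eq_iff[OF assms(2)] by blast
      then show "S = S' \<and> T = T'" using * t coset_eq_iff[OF assms(3), of t t'] by simp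
    qed
    show "h ` (quotient_space V U \<times> quotient_space U W) = quotient_space V W"
    proof
      show "h ` (quotient_space V U \<times> quotient_space U W) \<subseteq> quotient_space V W"
      proof clarify
        fix S T assume S: "S \<in> quotient_space V U" and T: "T \<in> quotient_space U W"
        obtain t where t: "t \<in> U" "T = t +o W" using T by (auto simp: quotient_space_def)
        have "r S + t \<in> V" using r(1)[OF S] t assms by (blast intro: add_subgroupD(4))
        then show "h (S, T) \<in> quotient_space V W"
          using t by (auto simp: h_def quotient_space_def set_plus_rearranges)
      qed
      show "quotient_space V W \<subseteq> h ` (quotient_space V U \<times> quotient_space U W)"
      proof
        fix R assume "R \<in> quotient_space V W"
        then obtain x where x: "x \<in> V" "R = x +o W" by (auto simp: quotient_space_def)
        let ?S = "x +o U"
        have S: "?S \<in> quotient_space V U" using x by (auto simp: quotient_space_def)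
        have "x - r ?S \<in> U" using r(2)[OF S] coset_eq_iff[OF assms(2)] by blast
        then have "(x - r ?S) +o W \<in> quotient_space U W" by (auto simp: quotient_space_def)
        moreover have "R = h (?S, (x - r ?S) +o W)" using x by (simp add: h_def set_plus_rearranges)
        ultimately show "R \<in> h ` (quotient_space V U \<times> quotient_space U W)" using S by blast
      qed
    qed
  qed
  moreover have "quotient_space V U \<noteq> {}" "quotient_space U W \<noteq> {}"
    using assms add_subgroupD(1) by (auto intro!: quotient_space_nonempty)
  ultimately show "card (quotient_space V W) = card (quotient_space V U) * card (quotient_space U W)"
    and "finite (quotient_space V W) \<longleftrightarrow>
      finite (quotient_space V U) \<and> finite (quotient_space U W)"
    using bij_betw_same_card bij_betw_finite card_cartesian_product finite_cartesian_product
      finite_cartesian_productD1 finite_cartesian_productD2 by metis+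
qed

text \<open>
  With \<open>V\<close> and \<open>W\<close> the adeles bounded by two divisors and \<open>F\<close> the function field, this compares
  the spaces \<open>V \<inter> F\<close> of global sections and the cokernels of \<open>V + F\<close>.
\<close>

lemma quotient_space_exact:
  assumes V: "add_subgroup V" and W: "add_subgroup W" and F: "add_subgroup F" and "W \<subseteq> V"
  shows "card (quotient_space V W) =
      card (quotient_space (V \<inter> F) (W \<inter> F)) * card (quotient_space (V + F) (W + F))"
    and "finite (quotient_space V W) \<longleftrightarrow>
      finite (quotient_space (V \<inter> F) (W \<inter> F)) \<and> finite (quotient_space (V + F) (W + F))"
proof -
  let ?U = "W + (V \<inter> F)"
  have VF: "add_subgroup (V \<inter> F)" and WF: "add_subgroup (W \<inter> F)" and U: "add_subgroup ?U"
    and W_F: "add_subgroup (W + F)" by (intro add_subgroup_plus add_subgroup_Int assms)+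
  have WU: "W \<subseteq> ?U" by (rule subset_plus_right[OF VF])
  have UV: "?U \<subseteq> V" using \<open>W \<subseteq> V\<close> by (auto simp: set_plus_iff intro!: add_subgroupD(4)[OF V])
  note tower = quotient_space_tower[OF V U W WU UV]
  have 1: "\<exists>x\<in>V \<inter> F. y - x \<in> W" if y: "y \<in> ?U" for y
  proof -
    obtain w x where "w \<in> W" "x \<in> V \<inter> F" "y = w + x" using y unfolding set_plus_iff by blast
    then show ?thesis by (intro bexI[of _ x]) auto
  qed
  have 2: "\<exists>x\<in>V. y - x \<in> W + F" if y: "y \<in> V + F" for y
  proof -
    obtain x f where "x \<in> V" "f \<in> F" "y = x + f" using y unfolding set_plus_iff by blast
    then show ?thesis using subset_plus_left[OF W] by (intro bexI[of _ x]) auto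
  qed
  have 3: "x \<in> W + F \<longleftrightarrow> x \<in> ?U" if "x \<in> V" for x
  proof
    assume "x \<in> W + F"
    then obtain w f where w: "w \<in> W" "f \<in> F" "x = w + f" by (auto simp: set_plus_iff)
    have "f = x - w" using w by simp
    then have "f \<in> V" using w(1) add_subgroupD(2)[OF V that, of w] \<open>W \<subseteq> V\<close> by auto
    then show "x \<in> ?U" using w by blast
  qed (auto simp: set_plus_iff)
  have U1: "x \<in> ?U" if "x \<in> V \<inter> F" for x using that subset_plus_left[OF W] by blast
  have V1: "x \<in> V + F" if "x \<in> V" for x using that subset_plus_right[OF F] by blast
  note a = quotient_space_cong[OF VF WF W, of "\<lambda>x. x" ?U, OF _ U1 1, simplified]
  note b = quotient_space_cong[OF V U W_F, of "\<lambda>x. x" "V + F", OF _ V1 2 3, simplified]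
  show "card (quotient_space V W) =
      card (quotient_space (V \<inter> F) (W \<inter> F)) * card (quotient_space (V + F) (W + F))"
    and "finite (quotient_space V W) \<longleftrightarrow>
      finite (quotient_space (V \<inter> F) (W \<inter> F)) \<and> finite (quotient_space (V + F) (W + F))"
    using tower a b by (auto simp: mult.commute)
qed

subsection \<open>Bases of quotients over a finite field\<close>

definition quotient_independent ::
  "('k::field \<Rightarrow> 'v \<Rightarrow> 'v) \<Rightarrow> 'v::ab_group_add set \<Rightarrow> 'v set \<Rightarrow> bool" where
  "quotient_independent s W S \<longleftrightarrow>
     finite S \<and> (\<forall>c. (\<Sum>b\<in>S. s (c b) b) \<in> W \<longrightarrow> (\<forall>b\<in>S. c b = 0))"

lemma quotient_independentD:
  "quotient_independent s W S \<Longrightarrow> (\<Sum>b\<in>S. s (c b) b) \<in> W \<Longrightarrow> b \<in> S \<Longrightarrow> c b = 0"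
  by (simp add: quotient_independent_def)

context vector_space
begin

abbreviation endo :: "('b \<Rightarrow> 'b) \<Rightarrow> bool" where
  "endo \<equiv> Vector_Spaces.linear scale scale"

abbreviation functional :: "('b \<Rightarrow> 'a) \<Rightarrow> bool" where
  "functional \<equiv> Vector_Spaces.linear scale (*)"

lemma add_subgroup_subspace: "subspace V \<Longrightarrow> add_subgroup V"
  by (simp add: add_subgroup_def subspace_0 subspace_diff)

lemma subspace_plus: "subspace V \<Longrightarrow> subspace W \<Longrightarrow> subspace (V + W)"
proof -
  have "V + W = {x + y |x y. x \<in> V \<and> y \<in> W}" unfolding set_plus_def by blast
  then show "subspace V \<Longrightarrow> subspace W \<Longrightarrow> subspace (V + W)" using subspace_sums[of V W] by simp
qed

text \<open>
  An independent family of maximal size spans.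
\<close>

lemma quotient_basis_of_bounded:
  assumes W: "subspace W"
    and bound: "\<And>S. S \<subseteq> V \<Longrightarrow> quotient_independent scale W S \<Longrightarrow> card S \<le> N"
  shows "\<exists>B. quotient_basis scale V W B \<and> card B \<le> N"
proof -
  let ?P = "\<lambda>n. \<exists>S. S \<subseteq> V \<and> quotient_independent scale W S \<and> card S = n"
  have "?P 0" by (rule exI[of _ "{}"]) (simp add: quotient_independent_def)
  moreover have "n \<le> N" if "?P n" for n using that bound by blast
  ultimately have "?P (Greatest ?P)" and max: "\<And>n. ?P n \<Longrightarrow> n \<le> Greatest ?P"
    using GreatestI_nat[of ?P 0 N] Greatest_le_nat[of ?P _ N] by blast+
  then obtain S where S: "S \<subseteq> V" "quotient_independent scale W S" "card S = Greatest ?P" by blast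
  have fin: "finite S" using S(2) by (simp add: quotient_independent_def)
  have "v \<in> span S + W" if v: "v \<in> V" for v
  proof (cases "v \<in> S")
    case True
    then show ?thesis using set_plus_intro[OF span_base[OF True] subspace_0[OF W]] by simp
  next
    case False
    have "\<not> quotient_independent scale W (insert v S)"
    proof
      assume "quotient_independent scale W (insert v S)"
      then have "card (insert v S) \<le> Greatest ?P"
        using S(1) v by (intro max exI[of _ "insert v S"]) auto
      then show False using S(3) False fin by simp
    qed
    then obtain c b where c: "(\<Sum>b\<in>insert v S. scale (c b) b) \<in> W" "b \<in> insert v S" "c b \<noteq> 0"
      using fin by (auto simp: quotient_independent_def)
    have sum: "scale (c v) v + (\<Sum>b\<in>S. scale (c b) b) \<in> W" using c(1) fin False by simp
    have cv: "c v \<noteq> 0"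
    proof
      assume "c v = 0"
      then have "\<forall>b\<in>S. c b = 0" using S(2) sum by (simp add: quotient_independent_def)
      then show False using c \<open>c v = 0\<close> by auto
    qed
    let ?w = "scale (inverse (c v)) (scale (c v) v + (\<Sum>b\<in>S. scale (c b) b))"
    let ?s = "scale (- inverse (c v)) (\<Sum>b\<in>S. scale (c b) b)"
    have "v = ?s + ?w" using cv by (simp add: scale_right_distrib)
    moreover have "?s \<in> span S" by (intro span_scale span_sum span_base)
    moreover have "?w \<in> W" using sum by (rule subspace_scale[OF W])
    ultimately show ?thesis by (rule set_plusI)
  qed
  then have "quotient_basis scale V W S"
    using S fin by (auto simp: quotient_basis_def quotient_independent_def)
  then show ?thesis using bound S by blast
qed

end

locale finite_scalars = vector_space scale
  for scale :: "'k::{field,finite} \<Rightarrow> 'v::ab_group_add \<Rightarrow> 'v"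
begin

lemma coset_map_inj:
  assumes W: "subspace W" and S: "quotient_independent scale W S"
  shows "inj_on (\<lambda>c. (\<Sum>b\<in>S. scale (c b) b) +o W) (S \<rightarrow>\<^sub>E (UNIV :: 'k set))"
proof (rule inj_onI)
  fix c d :: "'v \<Rightarrow> 'k"
  assume c: "c \<in> S \<rightarrow>\<^sub>E UNIV" and d: "d \<in> S \<rightarrow>\<^sub>E UNIV"
    and eq: "(\<Sum>b\<in>S. scale (c b) b) +o W = (\<Sum>b\<in>S. scale (d b) b) +o W"
  have "(\<Sum>b\<in>S. scale (c b - d b) b) \<in> W" using eq coset_eq_iff[OF add_subgroup_subspace[OF W]]
    by (simp add: scale_left_diff_distrib sum_subtractf)
  then have "\<forall>b\<in>S. c b - d b = 0" using quotient_independentD[OF S, of "\<lambda>b. c b - d b"] by blast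
  then show "c = d" using c d by (auto intro: PiE_ext)
qed

lemma coset_map_range:
  assumes "subspace V" "S \<subseteq> V"
  shows "(\<lambda>c. (\<Sum>b\<in>S. scale (c b) b) +o W) ` (S \<rightarrow>\<^sub>E (UNIV :: 'k set)) \<subseteq> quotient_space V W"
  using assms by (auto simp: quotient_space_def intro!: imageI subspace_sum subspace_scale)

lemma card_quotient_basis:
  assumes V: "subspace V" and W: "subspace W" and B: "quotient_basis scale V W B"
  shows "card (quotient_space V W) = CARD('k) ^ card B" and "finite (quotient_space V W)"
proof -
  let ?h = "\<lambda>c. (\<Sum>b\<in>B. scale (c b) b) +o W"
  have B': "finite B" "B \<subseteq> V" "V \<subseteq> span B + W" "quotient_independent scale W B"
    using B by (auto simp: quotient_basis_def quotient_independent_def)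
  have "quotient_space V W \<subseteq> ?h ` (B \<rightarrow>\<^sub>E UNIV)"
  proof
    fix S assume "S \<in> quotient_space V W"
    then obtain v where v: "v \<in> V" "S = v +o W" by (auto simp: quotient_space_def)
    have "v \<in> span B + W" using v B'(3) by blast
    then obtain x w where x: "x \<in> span B" "w \<in> W" "v = x + w" by (elim set_plus_elim)
    obtain c where c: "x = (\<Sum>b\<in>B. scale (c b) b)" using x(1) span_finite[OF B'(1)] by auto
    have "S = ?h (restrict c B)"
      using v x c coset_eq_iff[OF add_subgroup_subspace[OF W], of v x] by simp
    then show "S \<in> ?h ` (B \<rightarrow>\<^sub>E UNIV)" by (intro image_eqI[of _ _ "restrict c B"]) auto
  qed
  then have eq: "quotient_space V W = ?h ` (B \<rightarrow>\<^sub>E UNIV)"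
    using coset_map_range[OF V B'(2), of W] by blast
  show "card (quotient_space V W) = CARD('k) ^ card B"
    unfolding eq using card_image[OF coset_map_inj[OF W B'(4)]] B'(1) by (simp add: card_PiE)
  show "finite (quotient_space V W)"
    unfolding eq using B'(1) by (intro finite_imageI finite_PiE) auto
qed

lemma CARD_ge_2: "2 \<le> CARD('k)"
proof -
  have "card {0, 1 :: 'k} \<le> CARD('k)" by (rule card_mono) auto
  then show ?thesis by simp
qed

lemma quotient_basis_exists:
  assumes V: "subspace V" and W: "subspace W" and fin: "finite (quotient_space V W)"
  shows "\<exists>B. quotient_basis scale V W B"
proof -
  have "card S \<le> card (quotient_space V W)" if S: "S \<subseteq> V" "quotient_independent scale W S" for S
  proof -
    have "CARD('k) ^ card S = card (S \<rightarrow>\<^sub>E (UNIV :: 'k set))"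
      using S(2) by (simp add: card_PiE quotient_independent_def)
    also have "\<dots> \<le> card (quotient_space V W)"
      using card_inj_on_le[OF coset_map_inj[OF W S(2)] coset_map_range[OF V S(1)] fin] .
    finally have "CARD('k) ^ card S \<le> card (quotient_space V W)" .
    moreover have "card S \<le> CARD('k) ^ card S"
      using less_exp[of "card S"] power_mono[OF CARD_ge_2, of "card S"] by linarith
    ultimately show ?thesis by linarith
  qed
  then show ?thesis using quotient_basis_of_bounded[OF W] by blast
qed

lemma finite_dim_quotient_iff:
  assumes "subspace V" "subspace W"
  shows "finite_dim_quotient scale V W \<longleftrightarrow> finite (quotient_space V W)"
  using assms quotient_basis_exists card_quotient_basis(2) by (auto simp: finite_dim_quotient_def)

lemma card_quotient_space:
  assumes "subspace V" "subspace W" "finite (quotient_space V W)"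
  shows "card (quotient_space V W) = CARD('k) ^ quotient_dim scale V W"
proof -
  have "finite_dim_quotient scale V W" using assms finite_dim_quotient_iff by blast
  moreover from this have "quotient_basis scale V W (SOME B. quotient_basis scale V W B)"
    unfolding finite_dim_quotient_def by (rule someI_ex)
  ultimately show ?thesis
    using card_quotient_basis(1)[OF assms(1,2)] by (simp add: quotient_dim_def)
qed

lemma quotient_dim_eqI:
  assumes "subspace V" "subspace W" "card (quotient_space V W) = CARD('k) ^ n"
  shows "quotient_dim scale V W = n"
proof -
  have "finite (quotient_space V W)" using assms(3) CARD_ge_2 by (intro card_ge_0_finite) simp
  then have "CARD('k) ^ quotient_dim scale V W = CARD('k) ^ n"
    using card_quotient_space assms by metis
  then show ?thesis using CARD_ge_2 by (simp add: power_inject_exp)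
qed

lemma quotient_space_zero: "bij_betw (\<lambda>v. {v}) V (quotient_space V {0 :: 'v})"
  by (auto simp: bij_betw_def quotient_space_def elt_set_plus_def)

lemma card_subspace:
  assumes "subspace V" "finite V"
  shows "card V = CARD('k) ^ dim V"
proof -
  obtain B where B: "B \<subseteq> V" "independent B" "V \<subseteq> span B" "card B = dim V"
    by (rule basis_exists[of V])
  have fin: "finite B" using B(1) assms(2) finite_subset by blast
  have 0: "subspace {0}" by (rule subspace_single_0)
  have "quotient_basis scale V {0} B"
    using B fin independentD[OF B(2) fin order_refl] by (auto simp: quotient_basis_def)
  then have "card (quotient_space V {0}) = CARD('k) ^ dim V"
    using card_quotient_basis(1)[OF assms(1) 0] B(4) by metis
  then show ?thesis using bij_betw_same_card[OF quotient_space_zero] by metis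
qed

end

subsection \<open>Extending linear maps\<close>

context vector_space_pair
begin

lemma extend_partial_linear:
  assumes V: "vs1.subspace V"
    and f: "\<And>x y. x \<in> V \<Longrightarrow> y \<in> V \<Longrightarrow> f (x + y) = f x + f y"
      "\<And>c x. x \<in> V \<Longrightarrow> f (s1 c x) = s2 c (f x)"
  shows "\<exists>g. Vector_Spaces.linear s1 s2 g \<and> (\<forall>x\<in>V. g x = f x)"
proof -
  obtain B where B: "B \<subseteq> V" "vs1.independent B" "V \<subseteq> vs1.span B" by (rule vs1.basis_exists[of V])
  obtain g where g: "Vector_Spaces.linear s1 s2 g" "\<forall>x\<in>B. g x = f x"
    using linear_independent_extend[OF B(2), of f] by blast
  interpret g: Vector_Spaces.linear s1 s2 g by (fact g(1))
  have f0: "f 0 = 0" using f(2)[OF vs1.subspace_0[OF V], of 0] by simp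
  have "x \<in> V \<and> g x = f x" if "x \<in> vs1.span B" for x using that
  proof (induction rule: vs1.span_induct_alt)
    case base
    then show ?case using f0 vs1.subspace_0[OF V] by simp
  next
    case (step c x y)
    have x: "x \<in> V" using step B(1) by blast
    then have cx: "s1 c x \<in> V" by (rule vs1.subspace_scale[OF V])
    show ?case using step x cx f g(2) vs1.subspace_add[OF V cx] by (simp add: g.add g.scale)
  qed
  then show ?thesis using B(3) g(1) by blast
qed

end

context vector_space
begin

lemma linearI:
  "(\<And>x y. f (x + y) = f x + f y) \<Longrightarrow> (\<And>c x. f (scale c x) = scale c (f x)) \<Longrightarrow>
    endo f"
  by (simp add: Vector_Spaces.linear_iff vector_space_axioms)

lemma vector_space_scalars: "vector_space ((*) :: 'a \<Rightarrow> 'a \<Rightarrow> 'a)"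
  by standard (simp_all add: algebra_simps)

lemma exists_projection:
  assumes A: "subspace A" and A': "subspace A'" and disj: "A \<inter> A' = {0}"
  shows "\<exists>e. endo e \<and> (\<forall>x. e x \<in> A) \<and>
    (\<forall>x\<in>A. e x = x) \<and> (\<forall>x\<in>A'. e x = 0)"
proof -
  interpret vector_space_pair scale scale ..
  define f where "f v = (THE a. a \<in> A \<and> v - a \<in> A')" for v
  have f: "f v = a" if "a \<in> A" "v - a \<in> A'" for a v unfolding f_def
  proof (rule the_equality)
    fix b assume b: "b \<in> A \<and> v - b \<in> A'"
    have "b - a \<in> A" "(v - a) - (v - b) \<in> A'"
      using that b subspace_diff[OF A] subspace_diff[OF A'] by blast+
    then show "b = a" using disj Int_iff[of "b - a" A A'] by simp
  qed (use that in blast)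
  have ex: "\<exists>a\<in>A. v - a \<in> A'" if "v \<in> A + A'" for v using that by (force simp: set_plus_iff)
  have "\<exists>g. endo g \<and> (\<forall>x\<in>A + A'. g x = f x)"
  proof (rule extend_partial_linear)
    show "subspace (A + A')" by (rule subspace_plus[OF A A'])
    fix x y assume "x \<in> A + A'" "y \<in> A + A'"
    then obtain a b where "a \<in> A" "x - a \<in> A'" "b \<in> A" "y - b \<in> A'" using ex by meson
    moreover from this have "(x + y) - (a + b) \<in> A'"
      using subspace_add[OF A', of "x - a" "y - b"] by (simp add: algebra_simps)
    ultimately show "f (x + y) = f x + f y" using f subspace_add[OF A] by metis
  next
    fix c x assume "x \<in> A + A'"
    then obtain a where "a \<in> A" "x - a \<in> A'" using ex by meson
    moreover from this have "scale c x - scale c a \<in> A'"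
      using subspace_scale[OF A', of "x - a" c] by (simp add: scale_right_diff_distrib)
    ultimately show "f (scale c x) = scale c (f x)" using f subspace_scale[OF A] by metis
  qed
  then obtain g where g: "endo g" "\<forall>x\<in>A + A'. g x = f x" by blast
  have "g x = x" if "x \<in> A" for x
    using g(2) f[of x x] that subspace_0[OF A'] set_plus_intro[OF that subspace_0[OF A']] by simp
  moreover have "g x = 0" if "x \<in> A'" for x
    using g(2) f[of 0 x] that subspace_0[OF A] set_plus_intro[OF subspace_0[OF A] that] by simp
  moreover obtain p where p: "endo p" "\<forall>x. p x \<in> A" "\<forall>x\<in>A. p x = x"
  proof -
    obtain B where B: "B \<subseteq> A" "independent B" "A \<subseteq> span B" by (rule basis_exists[of A])
    obtain p where p: "endo p" "\<forall>x\<in>B. p x = x" "range p = span B"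
      using linear_independent_extend_subspace[OF B(2), of "\<lambda>x. x"] by auto
    have "p x = x" if "x \<in> A" for x
      using linear_eq_on[OF p(1) linearI[of "\<lambda>x. x"], of x B] p(2) B(3) that by auto
    moreover have "p x \<in> A" for x using p(3) span_minimal[OF B(1) A] by blast
    ultimately show ?thesis using that p(1) by blast
  qed
  moreover have "endo (\<lambda>x. p (g x))"
    using Vector_Spaces.linear_compose[OF g(1) p(1)] by (simp add: o_def)
  moreover have "p 0 = 0" using p(3) subspace_0[OF A] by blast
  ultimately show ?thesis by (intro exI[of _ "\<lambda>x. p (g x)"]) auto
qed

lemma family_inj:
  assumes I: "finite I" and U: "subspace U"
    and indep: "\<And>\<kappa>. (\<Sum>i\<in>I. scale (\<kappa> i) (w i)) \<in> U \<Longrightarrow> \<forall>i\<in>I. \<kappa> i = 0"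
  shows "inj_on w I"
proof (rule inj_onI, rule ccontr)
  fix i j assume ij: "i \<in> I" "j \<in> I" "w i = w j" "i \<noteq> j"
  let ?\<kappa> = "\<lambda>l. if l = i then 1 :: 'a else if l = j then -1 else 0"
  have "(\<Sum>l\<in>I. scale (?\<kappa> l) (w l)) = (\<Sum>l\<in>{i, j}. scale (?\<kappa> l) (w l))"
    using ij I by (intro sum.mono_neutral_right) auto
  also have "\<dots> = 0" using ij by simp
  also have "0 \<in> U" by (rule subspace_0[OF U])
  finally have "?\<kappa> i = 0" using indep[of ?\<kappa>] ij(1) by blast
  then show False by simp
qed

lemma family_quotient_independent:
  assumes I: "finite I" and U: "subspace U"
    and indep: "\<And>\<kappa>. (\<Sum>i\<in>I. scale (\<kappa> i) (w i)) \<in> U \<Longrightarrow> \<forall>i\<in>I. \<kappa> i = 0"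
  shows "quotient_independent scale U (w ` I)"
  unfolding quotient_independent_def
proof (intro conjI allI impI ballI)
  fix c b assume sum: "(\<Sum>b\<in>w ` I. scale (c b) b) \<in> U" and "b \<in> w ` I"
  then obtain i where i: "i \<in> I" "b = w i" by blast
  have "(\<Sum>i\<in>I. scale (c (w i)) (w i)) \<in> U"
    using sum by (simp add: sum.reindex[OF family_inj[OF assms]])
  then show "c b = 0" using indep[of "\<lambda>i. c (w i)"] i by blast
qed (use I in simp)


text \<open>A projection along \<open>W\<close> onto a complement of \<open>U \<inter> W\<close> in \<open>U\<close>.\<close>

lemma relative_projection:
  assumes U: "subspace U" and W: "subspace W"
  shows "\<exists>e. endo e \<and> (\<forall>x. e x \<in> U) \<and> (\<forall>x\<in>W. e x = 0) \<and> (\<forall>x\<in>U. x - e x \<in> U \<inter> W)"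
proof -
  have N: "subspace (U \<inter> W)" by (rule subspace_inter[OF U W])
  then have disj: "(U \<inter> W) \<inter> {0} = {0}" using subspace_0 by blast
  obtain p where p: "endo p" "\<And>x. p x \<in> U \<inter> W" "\<And>x. x \<in> U \<inter> W \<Longrightarrow> p x = x"
    using exists_projection[OF N subspace_single_0 disj] by blast
  interpret p: Vector_Spaces.linear scale scale p
    by (rule p(1))
  have pp: "p (p x) = p x" for x using p(2,3) by blast
  define C where "C = {x \<in> U. p x = 0}"
  have C: "subspace C"
    by (rule subspaceI) (auto simp: C_def p.add p.scale subspace_0[OF U] subspace_add[OF U] subspace_scale[OF U])
  have disj: "C \<inter> W = {0}" using p(3) subspace_0[OF C] subspace_0[OF W] by (force simp: C_def)
  obtain e where e: "endo e" "\<And>x. e x \<in> C" "\<And>x. x \<in> C \<Longrightarrow> e x = x" "\<And>x. x \<in> W \<Longrightarrow> e x = 0"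
    using exists_projection[OF C W disj] by blast
  interpret e: Vector_Spaces.linear scale scale e
    by (rule e(1))
  have "x - e x \<in> U \<inter> W" if x: "x \<in> U" for x
  proof -
    have "x - p x \<in> C" using subspace_diff[OF U x] p(2) by (simp add: C_def p.diff pp)
    then have "e x = x - p x" using e(3)[of "x - p x"] e(4)[of "p x"] p(2) by (simp add: e.diff)
    then show ?thesis using p(2) by simp
  qed
  then show ?thesis using e(1,2,4) by (intro exI[of _ e]) (simp add: C_def)
qed

lemma quotient_functional:
  assumes W: "subspace W" and B: "quotient_basis scale V W B"
  shows "\<exists>\<phi>. functional \<phi> \<and> (\<forall>w\<in>W. \<phi> w = 0) \<and> (\<forall>b\<in>B. \<phi> b = c b)"
proof -
  interpret k: vector_space "(*) :: 'a \<Rightarrow> 'a \<Rightarrow> 'a"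
    by (rule vector_space_scalars)
  interpret vector_space_pair scale "(*) :: 'a \<Rightarrow> 'a \<Rightarrow> 'a" ..
  have B': "finite B" "\<And>c. (\<Sum>b\<in>B. scale (c b) b) \<in> W \<Longrightarrow> \<forall>b\<in>B. c b = 0"
    using B by (auto simp: quotient_basis_def)
  have "x = 0" if x: "x \<in> span B" "x \<in> W" for x
  proof -
    obtain d where "x = (\<Sum>b\<in>B. scale (d b) b)" using x(1) span_finite[OF B'(1)] by auto
    then show ?thesis using B'(2)[of d] x(2) by simp
  qed
  then have disj: "span B \<inter> W = {0}" using span_zero subspace_0[OF W] by blast
  obtain e where e: "endo e" "\<And>x. x \<in> span B \<Longrightarrow> e x = x" "\<And>x. x \<in> W \<Longrightarrow> e x = 0"
    using exists_projection[OF subspace_span W disj] by blast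
  have "independent B" using B' subspace_0[OF W] by (auto simp: dependent_finite)
  then obtain \<phi> where \<phi>: "functional \<phi>" "\<forall>b\<in>B. \<phi> b = c b" using linear_independent_extend by blast
  interpret \<phi>: Vector_Spaces.linear scale "(*)" \<phi>
    by (rule \<phi>(1))
  have "functional (\<lambda>x. \<phi> (e x))"
    using Vector_Spaces.linear_compose[OF e(1) \<phi>(1)] by (simp add: o_def)
  then show ?thesis
    using e(2,3) \<phi>(2) \<phi>.zero by (intro exI[of _ "\<lambda>x. \<phi> (e x)"]) (simp add: span_base)
qed

lemma family_dual_functional:
  assumes I: "finite I" and U: "subspace U" and i: "i \<in> I"
    and indep: "\<And>\<kappa>. (\<Sum>i\<in>I. scale (\<kappa> i) (w i)) \<in> U \<Longrightarrow> \<forall>i\<in>I. \<kappa> i = 0"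
  shows "\<exists>\<phi>. functional \<phi> \<and> (\<forall>u\<in>U. \<phi> u = 0) \<and>
    (\<forall>j\<in>I. \<phi> (w j) = (if j = i then 1 else 0))"
proof -
  have "quotient_basis scale (span (w ` I) + U) U (w ` I)" unfolding quotient_basis_def
  proof (intro conjI)
    show "w ` I \<subseteq> span (w ` I) + U"
      using subset_plus_right[OF add_subgroup_subspace[OF U]] span_superset by blast
  qed (use family_quotient_independent[OF I U indep] in \<open>auto simp: quotient_independent_def\<close>)
  then obtain \<phi> where \<phi>: "functional \<phi>" "\<forall>u\<in>U. \<phi> u = 0"
    "\<forall>b\<in>w ` I. \<phi> b = (if b = w i then 1 else 0)"
    using quotient_functional[OF U, of _ "w ` I" "\<lambda>b. if b = w i then 1 else 0"] by blast
  have "\<phi> (w j) = (if j = i then 1 else 0)" if "j \<in> I" for j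
    using \<phi>(3) that i inj_onD[OF family_inj[OF I U indep] _ that i] by auto
  then show ?thesis using \<phi> by blast
qed

end

section \<open>Traces of operators of finite rank\<close>

definition finite_rank ::
  "('k::field \<Rightarrow> 'v \<Rightarrow> 'v) \<Rightarrow> ('v::ab_group_add \<Rightarrow> 'v) \<Rightarrow> bool" where
  "finite_rank s T \<longleftrightarrow>
     Vector_Spaces.linear s s T \<and> (\<exists>S. finite S \<and> range T \<subseteq> module.span s S)"

text \<open>
  The sum of the diagonal entries in a basis of the whole space.  Only finitely many of them are
  nonzero if the range of \<open>T\<close> has finite dimension.
\<close>

definition op_trace ::
  "('k::field \<Rightarrow> 'v \<Rightarrow> 'v) \<Rightarrow> ('v::ab_group_add \<Rightarrow> 'v) \<Rightarrow> 'k" where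
  "op_trace s T =
     (\<Sum>b | module.representation s (vector_space.extend_basis s {}) (T b) b \<noteq> 0.
        module.representation s (vector_space.extend_basis s {}) (T b) b)"

definition commutator :: "('v \<Rightarrow> 'v) \<Rightarrow> ('v \<Rightarrow> 'v) \<Rightarrow> 'v \<Rightarrow> 'v::ab_group_add" where
  "commutator X Y = (\<lambda>v. X (Y v) - Y (X v))"

context vector_space
begin

lemma functionalI:
  "(\<And>x y. f (x + y) = f x + f y) \<Longrightarrow> (\<And>c x. f (scale c x) = c * f x) \<Longrightarrow>
    functional f"
  by (simp add: Vector_Spaces.linear_iff vector_space_axioms vector_space_scalars)

lemma linear_rules:
  assumes "Vector_Spaces.linear scale s2 T"
  shows "T (x + y) = T x + T y" "T (x - y) = T x - T y" "T (scale c x) = s2 c (T x)"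
    "T (- x) = - T x" "T 0 = 0" "T (sum f A) = (\<Sum>a\<in>A. T (f a))"
proof -
  interpret Vector_Spaces.linear scale s2 T by fact
  show "T (x + y) = T x + T y" "T (x - y) = T x - T y" "T (scale c x) = s2 c (T x)"
    "T (- x) = - T x" "T 0 = 0" "T (sum f A) = (\<Sum>a\<in>A. T (f a))"
    by (simp_all add: add diff scale neg sum)
qed

lemma linear_comp:
  "endo X \<Longrightarrow> endo Y \<Longrightarrow>
    endo (\<lambda>v. X (Y v))"
  by (rule linearI) (simp_all add: linear_rules)

lemma linear_minus:
  "endo X \<Longrightarrow> endo Y \<Longrightarrow>
    endo (\<lambda>v. X v - Y v)"
  by (rule linearI) (simp_all add: linear_rules scale_right_diff_distrib)

lemma finite_rankI:
  "endo T \<Longrightarrow> finite S \<Longrightarrow> (\<And>v. T v \<in> span S) \<Longrightarrow> finite_rank scale T"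
  by (auto simp: finite_rank_def)

lemma finite_rank_sum:
  assumes "finite I" "\<And>i. i \<in> I \<Longrightarrow> functional (\<phi> i)"
    and T: "\<And>v. T v = (\<Sum>i\<in>I. scale (\<phi> i v) (w i))"
  shows "finite_rank scale T"
proof (rule finite_rankI[of _ "w ` I"])
  show "endo T"
  proof (rule linearI)
    show "T (x + y) = T x + T y" for x y unfolding T sum.distrib[symmetric]
      by (rule sum.cong) (simp_all add: linear_rules[OF assms(2)] scale_left_distrib)
    show "T (scale c x) = scale c (T x)" for c x unfolding T scale_sum_right
      by (rule sum.cong) (simp_all add: linear_rules[OF assms(2)])
  qed
  show "T v \<in> span (w ` I)" for v unfolding T by (intro span_sum span_scale span_base) auto
qed (use assms in auto)

lemma finite_rank_decomp:
  assumes "finite_rank scale T"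
  obtains B \<phi> where "finite B" "\<And>b. b \<in> B \<Longrightarrow> functional (\<phi> b)"
    "\<And>v. T v = (\<Sum>b\<in>B. scale (\<phi> b v) b)"
proof -
  obtain S where S: "finite S" "range T \<subseteq> span S" and T: "endo T"
    using assms by (auto simp: finite_rank_def)
  obtain B where B: "B \<subseteq> S" "independent B" "S \<subseteq> span B" by (rule maximal_independent_subset)
  have fin: "finite B" using B(1) S(1) by (rule finite_subset)
  have TB: "T v \<in> span B" for v using S(2) span_minimal[OF B(3) subspace_span] by auto
  show ?thesis
  proof (rule that[OF fin])
    show "functional (\<lambda>v. representation B (T v) b)" for b by (rule functionalI)
        (simp_all add: linear_rules[OF T] representation_add[OF B(2)] representation_scale[OF B(2)] TB)
    show "T v = (\<Sum>b\<in>B. scale (representation B (T v) b) b)" for v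
      by (rule sum_representation_eq[OF B(2) TB fin order_refl, symmetric])
  qed
qed

text \<open>
  The right hand side does not refer to a basis, so this is why the trace is invariant.
\<close>

lemma op_trace_sum:
  assumes I: "finite I" and \<phi>: "\<And>i. i \<in> I \<Longrightarrow> functional (\<phi> i)"
    and T: "\<And>v. T v = (\<Sum>i\<in>I. scale (\<phi> i v) (w i))"
  shows "op_trace scale T = (\<Sum>i\<in>I. \<phi> i (w i))"
proof -
  define E where "E = extend_basis {}"
  have E: "independent E" "\<And>v. v \<in> span E"
    using independent_extend_basis[OF independent_empty] span_extend_basis[OF independent_empty]
    by (auto simp: E_def)
  let ?r = "representation E"
  define Z where "Z = (\<Union>i\<in>I. {b. ?r (w i) b \<noteq> 0})"
  have Z: "finite Z" using I finite_representation by (auto simp: Z_def)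
  have r: "?r (T v) b = (\<Sum>i\<in>I. \<phi> i v * ?r (w i) b)" for v b
    unfolding T by (simp add: representation_sum[OF E(1)] representation_scale[OF E(1)] E(2))
  have "op_trace scale T = (\<Sum>b\<in>Z. ?r (T b) b)" unfolding op_trace_def E_def[symmetric]
  proof (rule sum.mono_neutral_left[OF Z])
    show "{b. ?r (T b) b \<noteq> 0} \<subseteq> Z"
    proof
      fix b assume "b \<in> {b. ?r (T b) b \<noteq> 0}"
      then have "(\<Sum>i\<in>I. \<phi> i b * ?r (w i) b) \<noteq> 0" by (simp add: r)
      then obtain i where "i \<in> I" "\<phi> i b * ?r (w i) b \<noteq> 0"
        by (rule sum.not_neutral_contains_not_neutral)
      then show "b \<in> Z" by (auto simp: Z_def)
    qed
  qed auto
  also have "\<dots> = (\<Sum>i\<in>I. \<Sum>b\<in>Z. \<phi> i b * ?r (w i) b)" unfolding r by (rule sum.swap)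
  also have "\<dots> = (\<Sum>i\<in>I. \<phi> i (w i))"
  proof (rule sum.cong[OF refl])
    fix i assume i: "i \<in> I"
    have "(\<Sum>b\<in>Z. scale (?r (w i) b) b) = (\<Sum>b | ?r (w i) b \<noteq> 0. scale (?r (w i) b) b)"
      using i by (intro sum.mono_neutral_right[OF Z]) (auto simp: Z_def)
    also have "\<dots> = w i" by (rule sum_nonzero_representation_eq[OF E])
    finally have "\<phi> i (w i) = \<phi> i (\<Sum>b\<in>Z. scale (?r (w i) b) b)" by simp
    then show "(\<Sum>b\<in>Z. \<phi> i b * ?r (w i) b) = \<phi> i (w i)"
      unfolding linear_rules[OF \<phi>[OF i]] by (simp only: mult.commute)
  qed
  finally show ?thesis .
qed

lemma
  assumes X: "finite_rank scale X" and Y: "endo Y"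
  shows finite_rank_comp_left: "finite_rank scale (\<lambda>v. Y (X v))"
    and finite_rank_comp_right: "finite_rank scale (\<lambda>v. X (Y v))"
    and op_trace_comp: "op_trace scale (\<lambda>v. X (Y v)) = op_trace scale (\<lambda>v. Y (X v))"
proof -
  obtain B \<phi> where B: "finite B" "\<And>b. b \<in> B \<Longrightarrow> functional (\<phi> b)"
    "\<And>v. X v = (\<Sum>b\<in>B. scale (\<phi> b v) b)" using finite_rank_decomp[OF X] by metis
  have \<phi>Y: "functional (\<lambda>v. \<phi> b (Y v))" if "b \<in> B" for b
    by (rule functionalI) (simp_all add: linear_rules[OF Y] linear_rules[OF B(2)[OF that]])
  have YX: "Y (X v) = (\<Sum>b\<in>B. scale (\<phi> b v) (Y b))" for v
    unfolding B(3) by (simp add: linear_rules[OF Y])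
  show "finite_rank scale (\<lambda>v. Y (X v))" by (rule finite_rank_sum[OF B(1,2) YX])
  show "finite_rank scale (\<lambda>v. X (Y v))" by (rule finite_rank_sum[OF B(1) \<phi>Y B(3)])
  show "op_trace scale (\<lambda>v. X (Y v)) = op_trace scale (\<lambda>v. Y (X v))"
    using op_trace_sum[OF B(1) \<phi>Y B(3)] op_trace_sum[OF B(1,2) YX] by simp
qed

lemma
  assumes X: "finite_rank scale X" and Y: "finite_rank scale Y"
  shows finite_rank_combine: "finite_rank scale (\<lambda>v. X v + scale c (Y v))"
    and op_trace_combine:
      "op_trace scale (\<lambda>v. X v + scale c (Y v)) = op_trace scale X + c * op_trace scale Y"
proof -
  obtain B \<phi> where B: "finite B" "\<And>b. b \<in> B \<Longrightarrow> functional (\<phi> b)"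
    "\<And>v. X v = (\<Sum>b\<in>B. scale (\<phi> b v) b)" using finite_rank_decomp[OF X] by metis
  obtain C \<psi> where C: "finite C" "\<And>b. b \<in> C \<Longrightarrow> functional (\<psi> b)"
    "\<And>v. Y v = (\<Sum>b\<in>C. scale (\<psi> b v) b)" using finite_rank_decomp[OF Y] by metis
  let ?I = "B <+> C"
  let ?\<phi> = "case_sum \<phi> (\<lambda>b v. c * \<psi> b v)"
  let ?w = "case_sum (\<lambda>b. b) (\<lambda>b. b)"
  have I: "finite ?I" using B(1) C(1) by simp
  have \<phi>: "functional (?\<phi> i)" if "i \<in> ?I" for i using that
  proof (cases i)
    case (Inl b)
    then show ?thesis using B(2) that by auto
  next
    case (Inr b)
    then have "functional (\<psi> b)" using C(2) that by auto
    then show ?thesis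
      using Inr by (auto intro!: functionalI simp: linear_rules[of "(*)" "\<psi> b"] algebra_simps)
  qed
  have sum: "X v + scale c (Y v) = (\<Sum>i\<in>?I. scale (?\<phi> i v) (?w i))" for v
    using B(1) C(1) by (simp add: sum.Plus B(3) C(3) scale_sum_right o_def)
  show "finite_rank scale (\<lambda>v. X v + scale c (Y v))" by (rule finite_rank_sum[OF I \<phi> sum])
  show "op_trace scale (\<lambda>v. X v + scale c (Y v)) = op_trace scale X + c * op_trace scale Y"
    using op_trace_sum[OF I \<phi> sum] op_trace_sum[OF B] op_trace_sum[OF C] B(1) C(1)
    by (simp add: sum.Plus sum_distrib_left o_def)
qed

lemma
  assumes X: "finite_rank scale X" and Y: "finite_rank scale Y"
  shows finite_rank_add: "finite_rank scale (\<lambda>v. X v + Y v)"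
    and op_trace_add: "op_trace scale (\<lambda>v. X v + Y v) = op_trace scale X + op_trace scale Y"
    and finite_rank_diff: "finite_rank scale (\<lambda>v. X v - Y v)"
    and op_trace_diff: "op_trace scale (\<lambda>v. X v - Y v) = op_trace scale X - op_trace scale Y"
  using finite_rank_combine[OF assms, of 1] op_trace_combine[OF assms, of 1]
    finite_rank_combine[OF assms, of "-1"] op_trace_combine[OF assms, of "-1"] by simp_all

lemma finite_rank_zero: "finite_rank scale (\<lambda>v. 0)"
  by (rule finite_rank_sum[of "{}"]) auto

lemma op_trace_zero: "op_trace scale (\<lambda>v. 0) = 0"
  by (subst op_trace_sum[of "{}"]) auto

lemma op_trace_scale:
  assumes "finite_rank scale X"
  shows "op_trace scale (\<lambda>v. scale c (X v)) = c * op_trace scale X"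
  using op_trace_combine[OF finite_rank_zero assms, of c] by (simp add: op_trace_zero)

lemma
  assumes X: "finite_rank scale X" and Y: "endo Y"
  shows finite_rank_commutator: "finite_rank scale (commutator X Y)"
    and op_trace_commutator_finite_rank: "op_trace scale (commutator X Y) = 0"
  unfolding commutator_def
  using finite_rank_diff[OF finite_rank_comp_right[OF assms] finite_rank_comp_left[OF assms]]
    op_trace_diff[OF finite_rank_comp_right[OF assms] finite_rank_comp_left[OF assms]]
    op_trace_comp[OF assms] by simp_all

lemma
  assumes lin: "endo X" "endo X'"
      "endo Y" "endo Y'"
    and near: "finite_rank scale (\<lambda>v. X v - X' v)" "finite_rank scale (\<lambda>v. Y v - Y' v)"
    and fin: "finite_rank scale (commutator X Y)"
  shows finite_rank_commutator_cong: "finite_rank scale (commutator X' Y')"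
    and op_trace_commutator_cong:
      "op_trace scale (commutator X Y) = op_trace scale (commutator X' Y')"
proof -
  let ?A = "commutator (\<lambda>v. X v - X' v) Y" and ?B = "commutator (\<lambda>v. Y v - Y' v) X'"
  note A = finite_rank_commutator[OF near(1) lin(3)] op_trace_commutator_finite_rank[OF near(1) lin(3)]
  note B = finite_rank_commutator[OF near(2) lin(2)] op_trace_commutator_finite_rank[OF near(2) lin(2)]
  have eq: "commutator X' Y' = (\<lambda>v. (commutator X Y v - ?A v) + ?B v)"
    by (rule ext) (simp add: commutator_def linear_rules[OF lin(1)] linear_rules[OF lin(2)]
        linear_rules[OF lin(3)] linear_rules[OF lin(4)])
  note d = finite_rank_diff[OF fin A(1)]
  show "finite_rank scale (commutator X' Y')" unfolding eq by (rule finite_rank_add[OF d B(1)])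
  show "op_trace scale (commutator X Y) = op_trace scale (commutator X' Y')"
    unfolding eq op_trace_add[OF d B(1)] op_trace_diff[OF fin A(1)] using A B by simp
qed

end

section \<open>Tate's symbol\<close>

text \<open>
  Let \<open>e\<close> project onto a subspace \<open>A\<close> that every multiplication \<open>m f\<close> maps into \<open>A\<close> up to finite
  dimension.  The compressions \<open>toeplitz f = e (m f) e\<close> then multiply like the functions up to operators of
  finite rank, so they commute up to finite rank, and the trace of their commutator is the
  residue of \<open>f dg\<close>.  The product rule in \<open>g\<close> is the identity
  \<open>[X, YZ] + [Y, ZX] + [Z, XY] = 0\<close>.
\<close>

locale tate = vector_space scale
  for scale :: "'k::field \<Rightarrow> 'v::ab_group_add \<Rightarrow> 'v" +
  fixes \<iota> :: "'k \<Rightarrow> 'r::comm_ring_1" and m :: "'r \<Rightarrow> 'v \<Rightarrow> 'v" and e :: "'v \<Rightarrow> 'v"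
  assumes m_linear: "endo (m f)"
    and m_mult: "m (f * g) v = m f (m g v)"
    and m_add: "m (f + g) v = m f v + m g v"
    and m_scale: "m (\<iota> c * f) v = scale c (m f v)"
    and e_linear: "endo e"
    and e_idem: "e (e v) = e v"
    and e_near: "finite_rank scale (\<lambda>v. m f (e v) - e (m f (e v)))"
begin

definition toeplitz :: "'r \<Rightarrow> 'v \<Rightarrow> 'v" where
  "toeplitz f v = e (m f (e v))"

definition symbol :: "'r \<Rightarrow> 'r \<Rightarrow> 'k" where
  "symbol f g = op_trace scale (commutator (toeplitz f) (toeplitz g))"

lemma toeplitz_linear: "endo (toeplitz f)"
  unfolding toeplitz_def[abs_def] by (rule linear_comp[OF e_linear linear_comp[OF m_linear e_linear]])

lemma toeplitz_mult_near:
  "finite_rank scale (\<lambda>v. toeplitz (f * g) v - toeplitz f (toeplitz g v))"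
proof -
  have "(\<lambda>v. toeplitz (f * g) v - toeplitz f (toeplitz g v)) =
      (\<lambda>v. e (m f (m g (e v) - e (m g (e v)))))" by (rule ext)
      (simp add: toeplitz_def m_mult e_idem linear_rules[OF e_linear] linear_rules[OF m_linear])
  then show ?thesis using finite_rank_comp_left[OF e_near linear_comp[OF e_linear m_linear]] by simp
qed

lemma finite_rank_toeplitz_commutator: "finite_rank scale (commutator (toeplitz f) (toeplitz g))"
  using finite_rank_diff[OF toeplitz_mult_near[of g f] toeplitz_mult_near[of f g]]
  by (simp add: commutator_def mult.commute algebra_simps)

lemma symbol_add_left: "symbol (f + f') g = symbol f g + symbol f' g"
proof -
  have "commutator (toeplitz (f + f')) (toeplitz g) =
      (\<lambda>v. commutator (toeplitz f) (toeplitz g) v + commutator (toeplitz f') (toeplitz g) v)"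
    by (rule ext)
      (simp add: commutator_def toeplitz_def m_add linear_rules[OF e_linear] linear_rules[OF m_linear])
  then show ?thesis by (simp add: symbol_def op_trace_add finite_rank_toeplitz_commutator)
qed

lemma symbol_scale_left: "symbol (\<iota> c * f) g = c * symbol f g"
proof -
  have "commutator (toeplitz (\<iota> c * f)) (toeplitz g) =
      (\<lambda>v. scale c (commutator (toeplitz f) (toeplitz g) v))"
    by (rule ext) (simp add: commutator_def toeplitz_def m_scale scale_right_diff_distrib
        linear_rules[OF e_linear] linear_rules[OF m_linear])
  then show ?thesis by (simp add: symbol_def op_trace_scale finite_rank_toeplitz_commutator)
qed

lemma symbol_antisym: "symbol f g = - symbol g f"
proof -
  have "commutator (toeplitz f) (toeplitz g) =
      (\<lambda>v. 0 - commutator (toeplitz g) (toeplitz f) v)" by (rule ext) (simp add: commutator_def)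
  then have "symbol f g = op_trace scale (\<lambda>v. 0 - commutator (toeplitz g) (toeplitz f) v)"
    by (simp only: symbol_def)
  also have "\<dots> = 0 - symbol g f"
    using op_trace_diff[OF finite_rank_zero finite_rank_toeplitz_commutator[of g f]]
    by (simp only: symbol_def op_trace_zero)
  finally show ?thesis by simp
qed

lemma symbol_add_right: "symbol f (g + g') = symbol f g + symbol f g'"
  using symbol_add_left[of g g' f] symbol_antisym[of f "g + g'"] symbol_antisym[of f g]
    symbol_antisym[of f g'] by simp

lemma symbol_mult:
  "finite_rank scale (commutator (toeplitz f) (\<lambda>v. toeplitz g (toeplitz h v)))"
  "op_trace scale (commutator (toeplitz f) (\<lambda>v. toeplitz g (toeplitz h v))) = symbol f (g * h)"
proof -
  have z: "finite_rank scale (\<lambda>v. toeplitz f v - toeplitz f v)" by (simp add: finite_rank_zero)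
  note * = toeplitz_linear toeplitz_linear toeplitz_linear
    linear_comp[OF toeplitz_linear toeplitz_linear] z
    toeplitz_mult_near finite_rank_toeplitz_commutator
  show "finite_rank scale (commutator (toeplitz f) (\<lambda>v. toeplitz g (toeplitz h v)))"
    by (rule finite_rank_commutator_cong[OF *])
  show "op_trace scale (commutator (toeplitz f) (\<lambda>v. toeplitz g (toeplitz h v))) = symbol f (g * h)"
    unfolding symbol_def by (rule op_trace_commutator_cong[OF *, symmetric])
qed

lemma symbol_derivation: "symbol f (g * h) = symbol (f * g) h + symbol (f * h) g"
proof -
  let ?c = "\<lambda>f g h. commutator (toeplitz f) (\<lambda>v. toeplitz g (toeplitz h v))"
  have "(\<lambda>v. (?c f g h v + ?c g h f v) + ?c h f g v) = (\<lambda>v. 0)"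
    by (rule ext) (simp only: commutator_def, simp)
  moreover have "op_trace scale (\<lambda>v. (?c f g h v + ?c g h f v) + ?c h f g v) =
      symbol f (g * h) + symbol g (h * f) + symbol h (f * g)"
    by (simp only: op_trace_add symbol_mult finite_rank_add)
  ultimately have "symbol f (g * h) + symbol g (h * f) + symbol h (f * g) = 0"
    by (simp only: op_trace_zero)
  then have "symbol f (g * h) = - symbol g (h * f) - symbol h (f * g)"
    by (simp only: eq_neg_iff_add_eq_0 diff_conv_add_uminus minus_add_distrib[symmetric] add.assoc)
  then show ?thesis
    using symbol_antisym[of g "h * f"] symbol_antisym[of h "f * g"] by (simp add: mult.commute)
qed

lemma symbol_eq_0_of_stable:
  assumes "\<And>v. e (m f (e v)) = m f (e v)" "\<And>v. e (m g (e v)) = m g (e v)"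
  shows "symbol f g = 0"
proof -
  have "commutator (toeplitz f) (toeplitz g) = (\<lambda>v. 0)"
  proof
    fix v
    have "e (m f (m g (e v))) = m f (m g (e v))"
      using assms(1)[of "m g (e v)"] by (simp add: assms(2))
    moreover have "e (m g (m f (e v))) = m g (m f (e v))"
      using assms(2)[of "m f (e v)"] by (simp add: assms(1))
    ultimately show "commutator (toeplitz f) (toeplitz g) v = 0"
      using m_mult[of f g "e v"] m_mult[of g f "e v"]
      by (simp add: commutator_def toeplitz_def assms mult.commute)
  qed
  then show ?thesis by (simp add: symbol_def op_trace_zero)
qed

text \<open>
  If the compressions can be changed by operators of finite rank into a commuting family, then the
  commutators have trace \<open>0\<close>: a commutator with an operator of finite rank has trace \<open>0\<close>.
\<close>

lemma symbol_eq_0_of_near: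
  assumes e': "endo e'" "finite_rank scale (\<lambda>v. e v - e' v)"
    and idem: "\<And>v. e' (e' v) = e' v"
    and hom: "\<And>f g v. e' (m f (e' (m g (e' v)))) = e' (m (f * g) (e' v))"
  shows "symbol f g = 0"
proof -
  let ?T = "\<lambda>f v. e' (m f (e' v))"
  have lin: "endo (?T f)" for f by (rule linear_comp[OF e'(1) linear_comp[OF m_linear e'(1)]])
  have near: "finite_rank scale (\<lambda>v. toeplitz f v - ?T f v)" for f
  proof -
    have "(\<lambda>v. toeplitz f v - ?T f v) = (\<lambda>v. (e (m f (e v)) - e' (m f (e v))) + e' (m f (e v - e' v)))"
      by (rule ext) (simp add: toeplitz_def linear_rules[OF m_linear] linear_rules[OF e'(1)])
    moreover have "finite_rank scale (\<lambda>v. e (m f (e v)) - e' (m f (e v)))"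
      using finite_rank_comp_right[OF e'(2) linear_comp[OF m_linear e_linear]] by simp
    moreover have "finite_rank scale (\<lambda>v. e' (m f (e v - e' v)))"
      using finite_rank_comp_left[OF e'(2) linear_comp[OF e'(1) m_linear]] by simp
    ultimately show ?thesis using finite_rank_add by simp
  qed
  have "symbol f g = op_trace scale (commutator (?T f) (?T g))" unfolding symbol_def
    by (rule op_trace_commutator_cong[OF toeplitz_linear lin toeplitz_linear lin near near
          finite_rank_toeplitz_commutator])
  also have "commutator (?T f) (?T g) = (\<lambda>v. 0)"
  proof
    fix v
    show "commutator (?T f) (?T g) v = 0"
      using hom[of f g v] hom[of g f v] by (simp add: commutator_def idem mult.commute)
  qed
  finally show ?thesis by (simp add: op_trace_zero)
qed

text \<open>
  The symbol depends only on the range of the projection: up to finite rank, both compressions agree with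
  \<open>e' (m f) e\<close>, and the trace is invariant under \<open>XY \<mapsto> YX\<close>.
\<close>

lemma symbol_projection_cong:
  assumes e': "endo e'" "\<And>v. e (e' v) = e' v" "\<And>v. e' (e v) = e v"
  shows "symbol f g = op_trace scale (commutator (\<lambda>v. e' (m f (e' v))) (\<lambda>v. e' (m g (e' v))))"
proof -
  let ?X = "\<lambda>f v. e' (m f (e v))"
  have linX: "endo (?X f)" for f by (rule linear_comp[OF e'(1) linear_comp[OF m_linear e_linear]])
  have near: "finite_rank scale (\<lambda>v. toeplitz f v - ?X f v)" for f
  proof -
    have "(\<lambda>v. toeplitz f v - ?X f v) =
        (\<lambda>v. (\<lambda>w. e w - e' w) (m f (e v) - e (m f (e v))))" by (rule ext)
        (simp add: toeplitz_def e'(3) e_idem linear_rules[OF e_linear] linear_rules[OF e'(1)])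
    then show ?thesis using finite_rank_comp_left[OF e_near linear_minus[OF e_linear e'(1)]] by simp
  qed
  note c = toeplitz_linear linX toeplitz_linear linX near near finite_rank_toeplitz_commutator
  have fin: "finite_rank scale (commutator (?X f) (?X g))"
    by (rule finite_rank_commutator_cong[OF c])
  let ?C = "commutator (\<lambda>v. e' (m f (e' v))) (\<lambda>v. e' (m g (e' v)))"
  have e'_idem: "e' (e' v) = e' v" for v using e'(2,3) by metis
  have C: "?C = (\<lambda>v. commutator (?X f) (?X g) (e' v))"
    by (rule ext) (simp add: commutator_def e'(2) e'_idem)
  have C': "commutator (?X f) (?X g) = (\<lambda>v. e' (commutator (?X f) (?X g) v))"
    by (rule ext) (simp add: commutator_def linear_rules[OF e'(1)] e'_idem)
  have "symbol f g = op_trace scale (commutator (?X f) (?X g))"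
    unfolding symbol_def by (rule op_trace_commutator_cong[OF c])
  also have "\<dots> = op_trace scale (\<lambda>v. e' (commutator (?X f) (?X g) v))" using C' by simp
  also have "\<dots> = op_trace scale ?C" unfolding C by (rule op_trace_comp[OF fin e'(1), symmetric])
  finally show ?thesis .
qed

end

section \<open>Function fields over a finite field\<close>

lemma (in vector_space) card_family_le:
  assumes I: "finite I" and T: "finite T" and sub: "\<And>i. i \<in> I \<Longrightarrow> w i \<in> span T"
    and indep: "\<And>\<kappa>. (\<Sum>i\<in>I. scale (\<kappa> i) (w i)) = 0 \<Longrightarrow> \<forall>i\<in>I. \<kappa> i = 0"
  shows "card I \<le> card T"
proof -
  have indep': "\<forall>i\<in>I. \<kappa> i = 0" if "(\<Sum>i\<in>I. scale (\<kappa> i) (w i)) \<in> {0}" for \<kappa> using indep that by simp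
  note fam = I subspace_single_0 indep'
  have "quotient_independent scale {0} (w ` I)" by (rule family_quotient_independent[OF fam])
  then have "independent (w ` I)" by (auto simp: quotient_independent_def dependent_finite)
  moreover have "w ` I \<subseteq> span T" using sub by auto
  ultimately have "card (w ` I) \<le> card T" using independent_span_bound[OF T, of "w ` I"] by auto
  moreover have "inj_on w I" by (rule family_inj[OF fam])
  ultimately show ?thesis by (simp add: card_image)
qed

subsection \<open>The Frobenius map\<close>

lemma finite_field_power_card:
  fixes c :: "'k::{field,finite}"
  shows "c ^ CARD('k) = c"
proof (cases "c = 0")
  case True
  then show ?thesis using zero_less_card_finite[where 'a='k] by (simp add: power_0_left)
next
  case False
  let ?N = "UNIV - {0::'k}"
  have bij: "bij_betw (\<lambda>x. c * x) ?N ?N" using False by (intro bij_betwI[of _ _ _ "\<lambda>x. x / c"]) auto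
  have "(\<Prod>x\<in>?N. x) = (\<Prod>x\<in>?N. c * x)" using prod.reindex_bij_betw[OF bij, of "\<lambda>x. x"] by simp
  also have "\<dots> = c ^ card ?N * (\<Prod>x\<in>?N. x)" by (simp add: prod.distrib)
  finally have "c ^ card ?N = 1" by simp
  moreover have "CARD('k) = Suc (card ?N)"
    using zero_less_card_finite[where 'a='k] by (simp add: card_Diff_singleton)
  ultimately show ?thesis by (simp only: power_Suc mult_1_right)
qed

locale curve =
  fixes \<iota> :: "'k::{field,finite} \<Rightarrow> 'a::field"
  assumes function_field: "function_field \<iota>"
begin

abbreviation \<X> :: "('a \<Rightarrow> int) set" where
  "\<X> \<equiv> places \<iota>"

abbreviation \<O> :: "('a \<Rightarrow> int) \<Rightarrow> 'a set" where
  "\<O> P \<equiv> val_ge P 0"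

abbreviation \<m> :: "('a \<Rightarrow> int) \<Rightarrow> 'a set" where
  "\<m> P \<equiv> val_ge P 1"

abbreviation \<A> :: "(('a \<Rightarrow> int) \<Rightarrow> 'a) set" where
  "\<A> \<equiv> adeles \<iota>"

abbreviation \<F> :: "(('a \<Rightarrow> int) \<Rightarrow> 'a) set" where
  "\<F> \<equiv> principal_adeles \<iota>"

abbreviation Div :: "'a dvsr set" where
  "Div \<equiv> divisors \<iota>"

abbreviation deg :: "'a dvsr \<Rightarrow> int" where
  "deg \<equiv> divisor_degree \<iota>"

abbreviation L :: "'a dvsr \<Rightarrow> 'a set" where
  "L \<equiv> RR_space \<iota>"

lemma \<iota>_1 [simp]: "\<iota> 1 = 1"
  and \<iota>_add [simp]: "\<iota> (a + b) = \<iota> a + \<iota> b"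
  and \<iota>_mult [simp]: "\<iota> (a * b) = \<iota> a * \<iota> b"
  using function_field by (auto simp: function_field_def)

lemma \<iota>_0 [simp]: "\<iota> 0 = 0"
  using \<iota>_add[of 0 0] add_left_cancel[of "\<iota> 0" "\<iota> 0" 0] by (simp del: \<iota>_add)

lemma \<iota>_minus [simp]: "\<iota> (- a) = - \<iota> a"
  using \<iota>_add[of a "- a"] by (simp add: eq_neg_iff_add_eq_0 add.commute)

lemma \<iota>_diff [simp]: "\<iota> (a - b) = \<iota> a - \<iota> b"
  using \<iota>_add[of a "- b"] by simp

lemma \<iota>_eq_0_iff [simp]: "\<iota> a = 0 \<longleftrightarrow> a = 0"
proof
  assume "\<iota> a = 0"
  then have "\<iota> (a * inverse a) = 0" by simp
  then show "a = 0" by (cases "a = 0") auto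
qed simp

lemma \<iota>_eq_iff [simp]: "\<iota> a = \<iota> b \<longleftrightarrow> a = b"
  using \<iota>_eq_0_iff[of "a - b"] by (simp del: \<iota>_eq_0_iff)

lemma \<iota>_power [simp]: "\<iota> (a ^ n) = \<iota> a ^ n"
  by (induction n) simp_all

lemma \<iota>_of_nat [simp]: "\<iota> (of_nat n) = of_nat n"
  by (induction n) simp_all

lemma \<iota>_inverse [simp]: "\<iota> (inverse a) = inverse (\<iota> a)"
proof (cases "a = 0")
  case False
  then have "\<iota> a * \<iota> (inverse a) = 1" by (simp flip: \<iota>_mult)
  then show ?thesis by (simp add: inverse_unique)
qed simp

lemma inj_\<iota>: "inj \<iota>"
  by (rule injI) simp

sublocale F: finite_scalars "const_scale \<iota>"
  by unfold_locales (simp_all add: algebra_simps)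

sublocale A: finite_scalars "adele_scale \<iota> :: 'k \<Rightarrow> (('a \<Rightarrow> int) \<Rightarrow> 'a) \<Rightarrow> _"
  by unfold_locales (auto simp: fun_eq_iff algebra_simps)

lemma q_ge_2: "2 \<le> CARD('k)"
  by (rule F.CARD_ge_2)

lemma \<iota>_power_q: "\<iota> c ^ CARD('k) = \<iota> c"
  using arg_cong[OF finite_field_power_card[of c], of \<iota>] by simp

lemma of_nat_q: "of_nat CARD('k) = (0::'a)"
proof -
  have "bij_betw (\<lambda>c::'k. c + 1) UNIV UNIV" by (intro bij_betwI[of _ _ _ "\<lambda>c. c - 1"]) auto
  then have "(\<Sum>c\<in>UNIV. c) = (\<Sum>c\<in>(UNIV::'k set). c + 1)"
    using sum.reindex_bij_betw[of _ UNIV UNIV "\<lambda>c. c"] by metis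
  then have "of_nat CARD('k) = (0::'k)" by (simp add: sum.distrib)
  then show ?thesis by (metis \<iota>_of_nat \<iota>_0)
qed

text \<open>
  Both sides are monic polynomials of degree \<open>q = CARD('k)\<close> in \<open>y\<close>, and they agree at the \<open>q\<close> constants.
\<close>

lemma prod_linear_factors: "(\<Prod>c\<in>UNIV. y - \<iota> c) = y ^ CARD('k) - y"
proof -
  let ?P = "\<Prod>c\<in>UNIV. [:- \<iota> c, 1:]" and ?Q = "monom 1 CARD('k) - [:0, 1:] :: 'a poly"
  have deg: "degree ?P = CARD('k)" by (subst degree_prod_eq_sum_degree) auto
  have lead: "coeff ?P CARD('k) = 1"
    using lead_coeff_prod[of "\<lambda>c. [:- \<iota> c, 1:]" UNIV] by (simp add: deg)
  have lt: "degree (?P - ?Q) < CARD('k)"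
  proof (rule degree_lessI)
    show "?P - ?Q \<noteq> 0 \<or> CARD('k) > 0" using q_ge_2 by simp
    show "\<forall>k\<ge>CARD('k). coeff (?P - ?Q) k = 0"
    proof (intro allI impI)
      fix k assume k: "k \<ge> CARD('k)"
      then have "coeff [:0, 1 :: 'a:] k = 0" using q_ge_2 by (intro coeff_eq_0) simp
      moreover have "coeff ?P k = (if k = CARD('k) then 1 else 0)"
        using k lead deg by (auto intro: coeff_eq_0)
      ultimately show "coeff (?P - ?Q) k = 0" by simp
    qed
  qed
  have "?P - ?Q = 0"
  proof (rule ccontr)
    assume *: "?P - ?Q \<noteq> 0"
    have "range \<iota> \<subseteq> {z. poly (?P - ?Q) z = 0}"
    proof
      fix z assume "z \<in> range \<iota>"
      then obtain c where z: "z = \<iota> c" by blast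
      have "(\<Prod>c\<in>UNIV. z - \<iota> c) = 0" using z by (subst prod_zero_iff) auto
      then show "z \<in> {z. poly (?P - ?Q) z = 0}"
        using \<iota>_power_q[of c] z by (simp add: poly_prod poly_monom)
    qed
    then have "CARD('k) \<le> card {z. poly (?P - ?Q) z = 0}"
      using card_mono[OF poly_roots_finite[OF *]] card_image[OF inj_\<iota>] by metis
    then show False using card_poly_roots_bound[OF *] lt by linarith
  qed
  then have "poly ?P y = poly ?Q y" by simp
  then show ?thesis by (simp add: poly_prod poly_monom)
qed

lemma power_q_add_const: "(y + \<iota> c) ^ CARD('k) = y ^ CARD('k) + \<iota> c"
proof -
  have "bij_betw (\<lambda>d::'k. d - c) UNIV UNIV" by (intro bij_betwI[of _ _ _ "\<lambda>d. d + c"]) auto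
  then have "(\<Prod>d\<in>UNIV. y - \<iota> (d - c)) = (\<Prod>d\<in>UNIV. y - \<iota> d)"
    using prod.reindex_bij_betw[of "\<lambda>d. d - c" UNIV UNIV "\<lambda>d. y - \<iota> d"] by simp
  then have "(y + \<iota> c) ^ CARD('k) - (y + \<iota> c) = y ^ CARD('k) - y"
    using prod_linear_factors[of y] prod_linear_factors[of "y + \<iota> c"] by (simp add: algebra_simps)
  then show ?thesis by (simp add: algebra_simps)
qed

text \<open>
  In \<open>(X + y)\<^sup>q - X\<^sup>q - y\<^sup>q\<close> with \<open>q = CARD('k)\<close> the leading terms cancel, and all \<open>q\<close> constants
  are roots, so this polynomial of degree less than \<open>q\<close> is zero.
\<close>

lemma power_q_add: "(x + y) ^ CARD('k) = x ^ CARD('k) + (y :: 'a) ^ CARD('k)"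
proof -
  let ?P = "[:y, 1:] ^ CARD('k)" and ?Q = "monom 1 CARD('k) + [:y ^ CARD('k):]"
  have deg: "degree ?P = CARD('k)" by (simp add: degree_power_eq)
  have lead: "coeff ?P CARD('k) = 1"
    using lead_coeff_power[of "[:y, 1:]" "CARD('k)"] by (simp add: deg)
  have lt: "degree (?P - ?Q) < CARD('k)"
  proof (rule degree_lessI)
    show "?P - ?Q \<noteq> 0 \<or> CARD('k) > 0" using q_ge_2 by simp
    show "\<forall>k\<ge>CARD('k). coeff (?P - ?Q) k = 0"
    proof (intro allI impI)
      fix k assume k: "k \<ge> CARD('k)"
      then have "coeff [:y ^ CARD('k):] k = 0" using q_ge_2 by (intro coeff_eq_0) simp
      moreover have "coeff ?P k = (if k = CARD('k) then 1 else 0)"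
        using k lead deg by (auto intro: coeff_eq_0)
      ultimately show "coeff (?P - ?Q) k = 0" by simp
    qed
  qed
  have "?P - ?Q = 0"
  proof (rule ccontr)
    assume *: "?P - ?Q \<noteq> 0"
    have "range \<iota> \<subseteq> {z. poly (?P - ?Q) z = 0}"
      using \<iota>_power_q power_q_add_const[of y] by (auto simp: poly_monom)
    then have "CARD('k) \<le> card {z. poly (?P - ?Q) z = 0}"
      using card_mono[OF poly_roots_finite[OF *]] card_image[OF inj_\<iota>] by metis
    then show False using card_poly_roots_bound[OF *] lt by linarith
  qed
  then have "poly ?P x = poly ?Q x" by simp
  then show ?thesis by (simp add: poly_monom add.commute)
qed

lemma frob_add: "(x + y) ^ (CARD('k) ^ j) = x ^ (CARD('k) ^ j) + (y :: 'a) ^ (CARD('k) ^ j)"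
proof (induction j arbitrary: x y)
  case (Suc j)
  then show ?case using power_q_add by (simp add: power_mult)
qed simp

lemma frob_0: "(0::'a) ^ (CARD('k) ^ j) = 0"
  by (simp add: power_0_left)

lemma frob_minus: "(- x) ^ (CARD('k) ^ j) = - ((x :: 'a) ^ (CARD('k) ^ j))"
  using frob_add[of x "- x" j] by (simp add: frob_0 eq_neg_iff_add_eq_0 add.commute)

lemma frob_diff: "(x - y) ^ (CARD('k) ^ j) = x ^ (CARD('k) ^ j) - (y :: 'a) ^ (CARD('k) ^ j)"
  using frob_add[of x "- y" j] by (simp add: frob_minus)

lemma frob_sum: "(sum f I) ^ (CARD('k) ^ j) = (\<Sum>i\<in>I. (f i :: 'a) ^ (CARD('k) ^ j))"
  by (induction I rule: infinite_finite_induct) (simp_all add: frob_add frob_0)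

lemma frob_\<iota>: "\<iota> c ^ (CARD('k) ^ j) = \<iota> c"
  by (induction j) (simp_all add: power_mult \<iota>_power_q)

lemmas frob1 = frob_add[of _ _ 1, simplified] frob_0[of 1, simplified] frob_minus[of _ 1, simplified]
  frob_diff[of _ _ 1, simplified] frob_sum[of _ _ 1, simplified]

subsection \<open>Polynomials in a function\<close>

definition pev :: "'k poly \<Rightarrow> 'a \<Rightarrow> 'a" where
  "pev p x = poly (map_poly \<iota> p) x"

lemma pev_0 [simp]: "pev 0 x = 0"
  by (simp add: pev_def)

lemma pev_pCons [simp]: "pev (pCons a p) x = \<iota> a + x * pev p x"
  by (simp add: pev_def map_poly_pCons)

lemma pev_1 [simp]: "pev 1 x = 1"
  by (simp add: one_pCons)

lemma pev_add [simp]: "pev (p + r) x = pev p x + pev r x"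
proof (induction p arbitrary: r)
  case (pCons a p)
  then show ?case by (cases r) (simp add: algebra_simps)
qed simp

lemma pev_smult [simp]: "pev (smult a p) x = \<iota> a * pev p x"
  by (induction p) (simp_all add: algebra_simps)

lemma pev_mult [simp]: "pev (p * r) x = pev p x * pev r x"
  by (induction p) (simp_all add: algebra_simps)

lemma pev_minus [simp]: "pev (- p) x = - pev p x"
  using pev_smult[of "-1" p x] by simp

lemma pev_diff [simp]: "pev (p - r) x = pev p x - pev r x"
  using pev_add[of p "- r" x] by simp

lemma pev_power [simp]: "pev (p ^ n) x = pev p x ^ n"
  by (induction n) simp_all

lemma pev_sum: "pev (sum f I) x = (\<Sum>i\<in>I. pev (f i) x)"
  by (induction I rule: infinite_finite_induct) simp_all

lemma pev_monom [simp]: "pev (monom a n) x = \<iota> a * x ^ n"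
  by (simp add: pev_def map_poly_monom poly_monom)

lemma pev_altdef: "pev p x = (\<Sum>i\<le>degree p. \<iota> (coeff p i) * x ^ i)"
  unfolding pev_def poly_altdef by (simp add: degree_map_poly coeff_map_poly)

definition transcendental :: "'a \<Rightarrow> bool" where
  "transcendental x \<longleftrightarrow> (\<forall>p. p \<noteq> 0 \<longrightarrow> pev p x \<noteq> 0)"

lemma transcendentalD: "transcendental x \<Longrightarrow> p \<noteq> 0 \<Longrightarrow> pev p x \<noteq> 0"
  by (simp add: transcendental_def)

text \<open>
  This is where the constants are algebraically closed in the function field.
\<close>

lemma transcendental_iff: "transcendental f \<longleftrightarrow> f \<notin> range \<iota>"
proof
  assume *: "transcendental f"
  show "f \<notin> range \<iota>"
  proof
    assume "f \<in> range \<iota>"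
    then obtain c where "f = \<iota> c" by blast
    then have "pev [:- c, 1:] f = 0" by simp
    moreover have "[:- c, 1:] \<noteq> (0 :: 'k poly)" by simp
    ultimately show False using transcendentalD[OF *] by blast
  qed
next
  assume "f \<notin> range \<iota>"
  then show "transcendental f"
    using function_field unfolding function_field_def transcendental_def pev_def by blast
qed

lemma common_denominator:
  assumes "finite B" "\<And>b. b \<in> B \<Longrightarrow> \<exists>s. s \<noteq> 0 \<and> P s b" "\<And>s s' b. s' \<noteq> 0 \<Longrightarrow> P s b \<Longrightarrow> P (s * s') b"
  shows "\<exists>s::'k poly. s \<noteq> 0 \<and> (\<forall>b\<in>B. P s b)"
  using assms(1,2)
proof (induction B rule: finite_induct)
  case empty
  show ?case by (intro exI[of _ 1]) simp
next
  case (insert b B)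
  obtain s where s: "s \<noteq> 0" "\<forall>b\<in>B. P s b" using insert by auto
  obtain s' where s': "s' \<noteq> 0" "P s' b" using insert.prems by auto
  have "P (s * s') b'" if "b' \<in> insert b B" for b'
    using that s s' assms(3)[of s s' b] assms(3)[of s s' b'] assms(3)[of s' s b'] assms(3)[of s s' b']
    by (auto simp: mult.commute)
  then show ?case using s s' by (intro exI[of _ "s * s'"]) auto
qed

end

text \<open>
  \<open>B\<close> is a basis of the function field over the rational functions in \<open>x\<close>, with the denominators
  of rational functions cleared.
\<close>

locale curve_coord = curve \<iota> for \<iota> :: "'k::{field,finite} \<Rightarrow> 'a::field" +
  fixes x :: 'a and B :: "'a set"
  assumes x: "transcendental x"
    and finite_B: "finite B"
    and B_span: "\<exists>s c. s \<noteq> 0 \<and> pev s x * f = (\<Sum>b\<in>B. pev (c b) x * b)"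
    and B_indep: "(\<Sum>b\<in>B. pev (c b) x * b) = 0 \<Longrightarrow> b \<in> B \<Longrightarrow> c b = 0"

lemma (in curve) coordinates_exist: "\<exists>x B. curve_coord \<iota> x B"
proof -
  define span where "span x B \<longleftrightarrow> finite B \<and>
    (\<forall>f. \<exists>s c. s \<noteq> 0 \<and> pev s x * f = (\<Sum>b\<in>B. pev (c b) x * b))" for x B
  obtain x B where x: "transcendental x" and B: "finite B" "\<And>f. \<exists>c.
      (\<forall>b\<in>B. c b \<in> {pev p x / pev r x | p r. r \<noteq> 0}) \<and> f = (\<Sum>b\<in>B. c b * b)"
    using function_field unfolding function_field_def transcendental_def pev_def by auto
  have "span x B" unfolding span_def
  proof (intro conjI allI B(1))
    fix f
    obtain c where c: "\<forall>b\<in>B. c b \<in> {pev p x / pev r x | p r. r \<noteq> 0}" "f = (\<Sum>b\<in>B. c b * b)"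
      using B(2) by blast
    have "\<exists>s. s \<noteq> 0 \<and> (\<forall>b\<in>B. \<exists>p. pev s x * c b = pev p x)"
    proof (rule common_denominator[OF B(1)])
      fix b assume "b \<in> B"
      then obtain p r where "c b = pev p x / pev r x" "r \<noteq> 0" using c by blast
      then show "\<exists>s. s \<noteq> 0 \<and> (\<exists>p. pev s x * c b = pev p x)"
        using transcendentalD[OF x] by (intro exI[of _ r]) auto
    next
      fix s s' b assume "\<exists>p. pev s x * c b = pev p x"
      then obtain p where "pev s x * c b = pev p x" by blast
      then show "\<exists>p. pev (s * s') x * c b = pev p x"
        by (intro exI[of _ "p * s'"]) (simp add: mult.commute mult.left_commute)
    qed
    then obtain s p where s: "s \<noteq> 0" "\<forall>b\<in>B. pev s x * c b = pev (p b) x" by metis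
    have "pev s x * f = (\<Sum>b\<in>B. (pev s x * c b) * b)" by (simp add: c(2) sum_distrib_left mult.assoc)
    also have "\<dots> = (\<Sum>b\<in>B. pev (p b) x * b)" using s(2) by (intro sum.cong) auto
    finally show "\<exists>s c. s \<noteq> 0 \<and> pev s x * f = (\<Sum>b\<in>B. pev (c b) x * b)" using s(1) by blast
  qed
  then have "\<exists>n B. span x B \<and> card B = n" by blast
  define n where "n = (LEAST n. \<exists>B. span x B \<and> card B = n)"
  have "\<exists>B. span x B \<and> card B = n" unfolding n_def by (rule LeastI_ex) fact
  then obtain C where C: "span x C" "card C = n" by blast
  have min: "n \<le> card B'" if "span x B'" for B' unfolding n_def using that by (intro Least_le) blast
  have "curve_coord \<iota> x C"
  proof
    show "transcendental x" "finite C" "\<exists>s c. s \<noteq> 0 \<and> pev s x * f = (\<Sum>b\<in>C. pev (c b) x * b)" for f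
      using x C(1) by (auto simp: span_def)
    fix c b assume sum: "(\<Sum>b\<in>C. pev (c b) x * b) = 0" and b: "b \<in> C"
    show "c b = 0"
    proof (rule ccontr)
      assume nz: "c b \<noteq> 0"
      have fin: "finite C" using C(1) by (simp add: span_def)
      have cb: "pev (c b) x * b = - (\<Sum>b'\<in>C - {b}. pev (c b') x * b')"
        using sum sum.remove[OF fin b, of "\<lambda>b. pev (c b) x * b"] by (simp add: eq_neg_iff_add_eq_0)
      have "span x (C - {b})" unfolding span_def
      proof (intro conjI allI)
        fix f
        obtain s d where s: "s \<noteq> 0" "pev s x * f = (\<Sum>b\<in>C. pev (d b) x * b)"
          using C(1) unfolding span_def by meson
        have "pev (c b * s) x * f = pev (c b) x * (\<Sum>b'\<in>C. pev (d b') x * b')"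
          by (simp add: s(2)[symmetric] mult.assoc)
        also have "\<dots> = pev (d b) x * (pev (c b) x * b) + (\<Sum>b'\<in>C - {b}. pev (c b * d b') x * b')"
          by (simp add: sum.remove[OF fin b] distrib_left sum_distrib_left mult_ac)
        also have "\<dots> = (\<Sum>b'\<in>C - {b}. pev (c b * d b' - d b * c b') x * b')"
          by (simp add: cb sum_distrib_left sum_subtractf left_diff_distrib mult.assoc)
        finally show "\<exists>s e. s \<noteq> 0 \<and> pev s x * f = (\<Sum>b\<in>C - {b}. pev (e b) x * b)"
          using s(1) nz by (intro exI[of _ "c b * s"] exI[of _ "\<lambda>b'. c b * d b' - d b * c b'"]) simp
      qed (use fin in simp)
      then have "n \<le> card (C - {b})" by (rule min)
      then show False using C(2) fin b by (metis card_Diff1_less not_le)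
    qed
  qed
  then show ?thesis by blast
qed

subsection \<open>Counting in coordinates\<close>

context curve_coord
begin

definition monomials :: "nat \<Rightarrow> 'a set" where
  "monomials m = (\<lambda>(j, b). x ^ j * b) ` ({..m} \<times> B)"

lemma finite_monomials: "finite (monomials m)"
  using finite_B by (simp add: monomials_def)

lemma card_monomials: "card (monomials m) \<le> card B * Suc m"
proof -
  have "card (monomials m) \<le> card ({..m} \<times> B)"
    unfolding monomials_def using finite_B by (intro card_image_le) simp
  then show ?thesis by (simp add: card_cartesian_product algebra_simps)
qed

abbreviation bounded :: "nat \<Rightarrow> 'a set" where
  "bounded m \<equiv> F.span (monomials m)"

lemma bounded_mono: "m \<le> m' \<Longrightarrow> bounded m \<subseteq> bounded m'"
  by (intro F.span_mono) (auto simp: monomials_def)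

lemma bounded_mult:
  assumes y: "\<And>b. b \<in> B \<Longrightarrow> y * b \<in> bounded e" and a: "a \<in> bounded m"
  shows "y * a \<in> bounded (m + e)"
  using a
proof (induction rule: F.span_induct_alt)
  case base
  show ?case by (simp add: F.span_zero)
next
  case (step c u v)
  obtain j b where u: "u = x ^ j * b" "j \<le> m" "b \<in> B" using step(1) by (auto simp: monomials_def)
  have shift: "x ^ j * w \<in> bounded (m + e)" if "w \<in> bounded e" for w using that
  proof (induction rule: F.span_induct_alt)
    case base
    show ?case by (simp add: F.span_zero)
  next
    case (step c u v)
    obtain i b where "u = x ^ i * b" "i \<le> e" "b \<in> B" using step(1) by (auto simp: monomials_def)
    then have "x ^ j * u \<in> monomials (m + e)" using u(2) unfolding monomials_def
      by (intro image_eqI[of _ _ "(j + i, b)"]) (auto simp: power_add)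
    then have "\<iota> c * (x ^ j * u) + x ^ j * v \<in> bounded (m + e)"
      by (rule F.span_add[OF F.span_scale[OF F.span_base] step(2)])
    then show ?case by (simp add: algebra_simps)
  qed
  have "y * u \<in> bounded (m + e)" using shift[OF y[OF u(3)]] by (simp add: u(1) mult.left_commute)
  then have "\<iota> c * (y * u) + y * v \<in> bounded (m + e)" by (rule F.span_add[OF F.span_scale step(2)])
  then show ?case by (simp add: algebra_simps)
qed

lemma pev_basis_bounded:
  assumes "b \<in> B" "degree p \<le> e"
  shows "pev p x * b \<in> bounded e"
proof -
  have "pev p x * b = (\<Sum>i\<le>degree p. \<iota> (coeff p i) * (x ^ i * b))"
    by (simp add: pev_altdef sum_distrib_right mult.assoc)
  also have "\<dots> \<in> bounded e"
  proof (intro F.span_sum F.span_scale F.span_base)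
    fix i assume "i \<in> {..degree p}"
    then show "x ^ i * b \<in> monomials e"
      using assms unfolding monomials_def by (intro image_eqI[of _ _ "(i, b)"]) auto
  qed
  finally show ?thesis .
qed

lemma pev_mult_bounded: "degree p \<le> e \<Longrightarrow> a \<in> bounded m \<Longrightarrow> pev p x * a \<in> bounded (m + e)"
  using bounded_mult[of "pev p x" e] pev_basis_bounded by blast

lemma bounded_denominator:
  assumes "finite Y"
  shows "\<exists>s C. s \<noteq> 0 \<and> (\<forall>y\<in>Y. pev s x * y \<in> bounded C)"
proof -
  have "\<exists>s. s \<noteq> 0 \<and> (\<forall>y\<in>Y. \<exists>C. pev s x * y \<in> bounded C)"
  proof (rule common_denominator[OF assms])
    fix y
    obtain s c where s: "s \<noteq> 0" "pev s x * y = (\<Sum>b\<in>B. pev (c b) x * b)" using B_span[of y] by blast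
    have "pev (c b) x * b \<in> bounded (\<Sum>b\<in>B. degree (c b))" if "b \<in> B" for b
      using that finite_B by (intro pev_basis_bounded member_le_sum) auto
    then have "pev s x * y \<in> bounded (\<Sum>b\<in>B. degree (c b))" unfolding s(2) by (rule F.span_sum)
    then show "\<exists>s. s \<noteq> 0 \<and> (\<exists>C. pev s x * y \<in> bounded C)" using s(1) by blast
  next
    fix s s' y assume "\<exists>C. pev s x * y \<in> bounded C"
    then obtain C where "pev s x * y \<in> bounded C" by blast
    then have "pev s' x * (pev s x * y) \<in> bounded (C + degree s')" by (intro pev_mult_bounded) auto
    then show "\<exists>C. pev (s * s') x * y \<in> bounded C" by (auto simp: mult_ac)
  qed
  then obtain s C where s: "s \<noteq> 0" "\<forall>y\<in>Y. pev s x * y \<in> bounded (C y)" by metis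
  have "pev s x * y \<in> bounded (\<Sum>y\<in>Y. C y)" if "y \<in> Y" for y
    using s(2) that bounded_mono[OF member_le_sum[of y Y C]] assms by auto
  then show ?thesis using s(1) by blast
qed

text \<open>
  Multiplying the representatives of a basis of \<open>V / yV\<close> by the powers \<open>1, \<dots>, y\<^sup>M\<^sup>-\<^sup>1\<close> gives
  independent functions, which lie, up to a common denominator, in a space of dimension
  \<open>card B * (e * M + const)\<close>.
\<close>

lemma card_quotient_independent_le:
  assumes V: "F.subspace V" and y: "y \<noteq> 0" "\<And>v. v \<in> V \<Longrightarrow> y * v \<in> V"
    and c: "c \<noteq> 0" "degree c \<le> e" "\<And>b. b \<in> B \<Longrightarrow> pev c x * y * b \<in> bounded e"
    and S: "S \<subseteq> V" "quotient_independent (const_scale \<iota>) ((\<lambda>v. y * v) ` V) S"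
  shows "card S \<le> card B * e"
proof -
  have fin: "finite S" using S(2) by (simp add: quotient_independent_def)
  obtain s C where s: "s \<noteq> 0" "\<forall>u\<in>S. pev s x * u \<in> bounded C"
    using bounded_denominator[OF fin] by blast
  have step: "\<forall>a<M. \<forall>u\<in>S. \<kappa> u a = 0"
    if "(\<Sum>a<M. y ^ a * (\<Sum>u\<in>S. \<iota> (\<kappa> u a) * u)) = 0" for M and \<kappa> :: "'a \<Rightarrow> nat \<Rightarrow> 'k" using that
  proof (induction M arbitrary: \<kappa>)
    case (Suc M)
    let ?v = "\<lambda>a. \<Sum>u\<in>S. \<iota> (\<kappa> u a) * u"
    let ?w = "\<Sum>a<M. y ^ a * ?v (Suc a)"
    have v: "?v a \<in> V" for a using S(1) by (intro F.subspace_sum[OF V] F.subspace_scale[OF V]) auto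
    have pow: "y ^ a * w \<in> V" if "w \<in> V" for a w
      using that y(2) by (induction a) (simp_all add: mult.assoc)
    have w: "?w \<in> V" using pow v by (intro F.subspace_sum[OF V]) auto
    have 0: "?v 0 + y * ?w = 0"
      using Suc.prems by (simp only: sum.lessThan_Suc_shift) (simp add: sum_distrib_left mult.assoc)
    then have "?v 0 = y * (- ?w)" by (simp add: eq_neg_iff_add_eq_0)
    then have "?v 0 \<in> (\<lambda>v. y * v) ` V" using F.subspace_neg[OF V w] by blast
    then have \<kappa>0: "\<kappa> u 0 = 0" if "u \<in> S" for u
      using quotient_independentD[OF S(2), of "\<lambda>u. \<kappa> u 0"] that by blast
    then have "?w = 0" using 0 y(1) by simp
    then have "\<forall>a<M. \<forall>u\<in>S. \<kappa> u (Suc a) = 0" by (rule Suc.IH)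
    then show ?case using \<kappa>0 less_Suc_eq_0_disj by auto
  qed simp
  have le: "card S * M \<le> card B * Suc (C + M * e)" for M
  proof -
    let ?g = "pev (s * c ^ M) x"
    have g: "?g \<noteq> 0" using s(1) c(1) by (intro transcendentalD[OF x]) simp
    have "card (S \<times> {..<M}) \<le> card (monomials (C + M * e))"
    proof (rule F.card_family_le[of _ _ "\<lambda>(u, a). ?g * (y ^ a * u)"])
      fix i assume "i \<in> S \<times> {..<M}"
      then obtain u a where i: "i = (u, a)" "u \<in> S" "a < M" by auto
      have cy: "(pev c x * y) ^ a * w \<in> bounded (m + a * e)" if "w \<in> bounded m" for w m using that
      proof (induction a)
        case (Suc a)
        then have "(pev c x * y) * ((pev c x * y) ^ a * w) \<in> bounded ((m + a * e) + e)"
          using bounded_mult[of "pev c x * y" e] c(3) by blast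
        then show ?case by (simp add: algebra_simps)
      qed simp
      have "pev (c ^ (M - a)) x * ((pev c x * y) ^ a * (pev s x * u))
          \<in> bounded (C + a * e + (M - a) * e)"
      proof (rule pev_mult_bounded)
        have "degree (c ^ (M - a)) \<le> degree c * (M - a)" by (rule degree_power_le)
        also have "\<dots> \<le> (M - a) * e" using c(2) by (simp add: mult.commute)
        finally show "degree (c ^ (M - a)) \<le> (M - a) * e" .
      qed (use cy s i in blast)
      moreover have "C + a * e + (M - a) * e = C + M * e"
        using i(3) by (metis add.assoc add_mult_distrib le_add_diff_inverse less_imp_le)
      moreover have "pev c x ^ M = pev c x ^ (M - a) * pev c x ^ a"
        using i(3) by (simp flip: power_add)
      then have "?g * (y ^ a * u) = pev (c ^ (M - a)) x * ((pev c x * y) ^ a * (pev s x * u))"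
        by (simp add: power_mult_distrib)
      ultimately show "(case i of (u, a) \<Rightarrow> ?g * (y ^ a * u)) \<in> bounded (C + M * e)"
        by (simp only: i(1) prod.case)
    next
      fix \<kappa> :: "'a \<times> nat \<Rightarrow> 'k"
      assume "(\<Sum>i\<in>S \<times> {..<M}. \<iota> (\<kappa> i) * (case i of (u, a) \<Rightarrow> ?g * (y ^ a * u))) = 0"
      then have "(\<Sum>u\<in>S. \<Sum>a<M. ?g * (y ^ a * (\<iota> (\<kappa> (u, a)) * u))) = 0"
        by (simp add: sum.cartesian_product' mult_ac)
      then have "(\<Sum>a<M. \<Sum>u\<in>S. ?g * (y ^ a * (\<iota> (\<kappa> (u, a)) * u))) = 0" by (subst sum.swap)
      then have "?g * (\<Sum>a<M. y ^ a * (\<Sum>u\<in>S. \<iota> (\<kappa> (u, a)) * u)) = 0" by (simp only: sum_distrib_left)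
      then have "(\<Sum>a<M. y ^ a * (\<Sum>u\<in>S. \<iota> (\<kappa> (u, a)) * u)) = 0"
        using g unfolding mult_eq_0_iff by blast
      then show "\<forall>i\<in>S \<times> {..<M}. \<kappa> i = 0" using step[of "\<lambda>u a. \<kappa> (u, a)" M] by auto
    qed (use fin finite_monomials in auto)
    also have "\<dots> \<le> card B * Suc (C + M * e)" by (rule card_monomials)
    finally show ?thesis by (simp add: card_cartesian_product)
  qed
  show ?thesis
  proof (rule ccontr)
    assume "\<not> ?thesis"
    then have "card B * e + 1 \<le> card S" by simp
    let ?M = "card B * Suc C + 1"
    have "(card B * e + 1) * ?M \<le> card S * ?M"
      using \<open>card B * e + 1 \<le> card S\<close> by (rule mult_le_mono1)
    also have "\<dots> \<le> card B * Suc (C + ?M * e)" by (rule le)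
    finally show False by (simp add: algebra_simps)
  qed
qed

lemma monomials_independent:
  assumes sum: "(\<Sum>(j, b)\<in>{..m} \<times> B. \<iota> (\<kappa> (j, b)) * (x ^ j * b)) = 0" and j: "j \<le> m" and b: "b \<in> B"
  shows "\<kappa> (j, b) = 0"
proof -
  let ?c = "\<lambda>b. \<Sum>j\<le>m. monom (\<kappa> (j, b)) j"
  have "(\<Sum>b\<in>B. pev (?c b) x * b) = (\<Sum>b\<in>B. \<Sum>j\<le>m. \<iota> (\<kappa> (j, b)) * (x ^ j * b))"
    by (simp add: pev_sum sum_distrib_right mult.assoc)
  also have "\<dots> = 0" using sum by (subst sum.swap) (simp add: sum.cartesian_product)
  finally have "?c b = 0" by (rule B_indep[OF _ b, of ?c])
  then have "coeff (?c b) j = 0" by simp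
  then show ?thesis using j by (simp add: coeff_sum)
qed

text \<open>
  The \<open>q\<close>-th powers of functions with \<open>degree \<le> m\<close> have degree \<open>\<le> q * m\<close>, so there is room for
  only \<open>q\<close> times as many independent functions.
\<close>

lemma power_q_dependent:
  fixes w :: "nat \<Rightarrow> 'a"
  shows "\<exists>h. (\<Sum>i\<le>CARD('k). h i ^ CARD('k) * w i) = 0 \<and> (\<exists>i\<le>CARD('k). h i \<noteq> 0)"
proof (rule ccontr)
  let ?q = "CARD('k)"
  assume neg: "\<not> ?thesis"
  have indep: "h i = 0" if "(\<Sum>i\<le>?q. h i ^ ?q * w i) = 0" "i \<le> ?q" for h i using neg that by blast
  obtain s C where s: "s \<noteq> 0" "\<forall>y\<in>(\<lambda>(i, b). b ^ ?q * w i) ` ({..?q} \<times> B). pev s x * y \<in> bounded C"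
    using bounded_denominator[of "(\<lambda>(i, b). b ^ ?q * w i) ` ({..?q} \<times> B)"] finite_B by auto
  have g: "pev s x \<noteq> 0" using s(1) by (rule transcendentalD[OF x])
  let ?I = "\<lambda>m. {..?q} \<times> ({..m} \<times> B)"
  have le: "Suc ?q * (Suc m * card B) \<le> card B * Suc (C + ?q * m)" for m
  proof -
    have "card (?I m) \<le> card (monomials (C + ?q * m))"
    proof (rule F.card_family_le[of _ _ "\<lambda>(i, j, b). pev s x * (w i * (x ^ j * b) ^ ?q)"])
      fix l assume "l \<in> ?I m"
      then obtain i j b where l: "l = (i, j, b)" "i \<le> ?q" "j \<le> m" "b \<in> B" by auto
      have "pev s x * (b ^ ?q * w i) \<in> bounded C" using s(2) l by force
      then have "pev (monom 1 (?q * j)) x * (pev s x * (b ^ ?q * w i)) \<in> bounded (C + ?q * m)"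
        using l(3) by (intro pev_mult_bounded) (auto simp: degree_monom_eq)
      moreover have "pev (monom 1 (?q * j)) x = (x ^ j) ^ ?q"
        by (simp add: mult.commute flip: power_mult)
      then have "pev s x * (w i * (x ^ j * b) ^ ?q) =
          pev (monom 1 (?q * j)) x * (pev s x * (b ^ ?q * w i))" by (simp add: power_mult_distrib)
      ultimately show "(case l of (i, j, b) \<Rightarrow> pev s x * (w i * (x ^ j * b) ^ ?q))
          \<in> bounded (C + ?q * m)" by (simp only: l(1) prod.case)
    next
      fix \<kappa> :: "nat \<times> nat \<times> 'a \<Rightarrow> 'k"
      assume *: "(\<Sum>l\<in>?I m. \<iota> (\<kappa> l) * (case l of (i, j, b) \<Rightarrow> pev s x * (w i * (x ^ j * b) ^ ?q))) = 0"
      define h where "h i = (\<Sum>(j, b)\<in>{..m} \<times> B. \<iota> (\<kappa> (i, j, b)) * (x ^ j * b))" for i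
      have h: "h i ^ ?q = (\<Sum>(j, b)\<in>{..m} \<times> B. \<iota> (\<kappa> (i, j, b)) * (x ^ j * b) ^ ?q)" for i
        unfolding h_def frob1 by (intro sum.cong) (auto simp: power_mult_distrib \<iota>_power_q)
      have "pev s x * (\<Sum>i\<le>?q. h i ^ ?q * w i) =
          (\<Sum>i\<le>?q. \<Sum>(j, b)\<in>{..m} \<times> B. \<iota> (\<kappa> (i, j, b)) * (pev s x * (w i * (x ^ j * b) ^ ?q)))"
        unfolding h sum_distrib_left sum_distrib_right by (intro sum.cong refl) (auto simp: mult_ac)
      also have "\<dots> = (\<Sum>l\<in>?I m. \<iota> (\<kappa> l) * (case l of (i, j, b) \<Rightarrow> pev s x * (w i * (x ^ j * b) ^ ?q)))"
        unfolding sum.cartesian_product by (intro sum.cong) auto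
      finally have sum_h: "(\<Sum>i\<le>?q. h i ^ ?q * w i) = 0" using * g by simp
      show "\<forall>l\<in>?I m. \<kappa> l = 0"
      proof clarify
        fix i j b assume i: "i \<le> ?q" "j \<le> m" "b \<in> B"
        have "h i = 0" using indep[OF sum_h i(1)] .
        then show "\<kappa> (i, j, b) = 0"
          using monomials_independent[of "\<lambda>(j, b). \<kappa> (i, j, b)" m j b] i by (simp add: h_def)
      qed
    qed (use finite_B finite_monomials in auto)
    also have "\<dots> \<le> card B * Suc (C + ?q * m)" by (rule card_monomials)
    finally show ?thesis by (simp add: card_cartesian_product del: mult_Suc mult_Suc_right)
  qed
  have "B \<noteq> {}"
  proof
    assume "B = {}"
    then obtain s where "s \<noteq> 0" "pev s x * 1 = 0" using B_span[of 1] by auto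
    then show False using transcendentalD[OF x] by simp
  qed
  then have "0 < card B" using finite_B by (simp add: card_gt_0_iff)
  moreover have "card B * (Suc ?q * Suc C) \<le> card B * Suc (C + ?q * C)"
    using le[of C] by (simp add: mult_ac del: mult_Suc mult_Suc_right)
  ultimately have "Suc ?q * Suc C \<le> Suc (C + ?q * C)" by (simp del: mult_Suc mult_Suc_right)
  then show False using q_ge_2 by simp
qed

end

context curve
begin

text \<open>
  The bound depends on \<open>y\<close> alone and not on \<open>V\<close>.  With \<open>V\<close> a ring, this is the finiteness of the
  residue ring \<open>V / yV\<close>.
\<close>

lemma finite_mult_quotient:
  assumes y: "y \<noteq> 0"
  shows "\<exists>N. \<forall>V S. F.subspace V \<longrightarrow> (\<forall>v\<in>V. y * v \<in> V) \<longrightarrow> S \<subseteq> V \<longrightarrow>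
    quotient_independent (const_scale \<iota>) ((\<lambda>v. y * v) ` V) S \<longrightarrow> card S \<le> N"
proof -
  obtain x B where "curve_coord \<iota> x B" using coordinates_exist by blast
  then interpret curve_coord \<iota> x B .
  obtain s C where s: "s \<noteq> 0" "\<forall>a\<in>(\<lambda>b. y * b) ` B. pev s x * a \<in> bounded C"
    using bounded_denominator[of "(\<lambda>b. y * b) ` B"] finite_B by auto
  have "pev s x * y * b \<in> bounded (max (degree s) C)" if "b \<in> B" for b
    using s(2) that bounded_mono[of C "max (degree s) C"] by (auto simp: mult.assoc)
  then have "\<forall>V S. F.subspace V \<longrightarrow> (\<forall>v\<in>V. y * v \<in> V) \<longrightarrow> S \<subseteq> V \<longrightarrow>
    quotient_independent (const_scale \<iota>) ((\<lambda>v. y * v) ` V) S \<longrightarrow>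
      card S \<le> card B * max (degree s) C"
    using y s(1) by (intro allI impI card_quotient_independent_le[of _ y s]) auto
  then show ?thesis by blast
qed

lemma subspace_mult: "F.subspace V \<Longrightarrow> F.subspace ((\<lambda>v. y * v) ` V)"
proof (rule F.subspaceI)
  assume V: "F.subspace V"
  show "0 \<in> (\<lambda>v. y * v) ` V" using F.subspace_0[OF V] by force
  fix a b assume "a \<in> (\<lambda>v. y * v) ` V" "b \<in> (\<lambda>v. y * v) ` V"
  then obtain v w where "a = y * v" "b = y * w" "v \<in> V" "w \<in> V" by blast
  then show "a + b \<in> (\<lambda>v. y * v) ` V"
    using F.subspace_add[OF V] by (intro image_eqI[of _ _ "v + w"]) (auto simp: algebra_simps)
next
  fix c a assume V: "F.subspace V" and "a \<in> (\<lambda>v. y * v) ` V"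
  then obtain v where "a = y * v" "v \<in> V" by blast
  then show "\<iota> c * a \<in> (\<lambda>v. y * v) ` V"
    using F.subspace_scale[OF V] by (intro image_eqI[of _ _ "\<iota> c * v"]) auto
qed

lemma finite_quotient_mult:
  assumes "y \<noteq> 0" and V: "F.subspace V" "\<And>v. v \<in> V \<Longrightarrow> y * v \<in> V"
  shows "finite (quotient_space V ((\<lambda>v. y * v) ` V))"
proof -
  obtain N where "\<And>S. S \<subseteq> V \<Longrightarrow>
    quotient_independent (const_scale \<iota>) ((\<lambda>v. y * v) ` V) S \<Longrightarrow> card S \<le> N"
    using finite_mult_quotient[OF assms(1)] V by meson
  then obtain S where "quotient_basis (const_scale \<iota>) V ((\<lambda>v. y * v) ` V) S"
    using F.quotient_basis_of_bounded[OF subspace_mult[OF V(1)]] by meson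
  then show ?thesis by (rule F.card_quotient_basis(2)[OF V(1) subspace_mult[OF V(1)]])
qed

section \<open>Places\<close>

lemma place_0: "P \<in> \<X> \<Longrightarrow> P 0 = 0"
  and place_mult: "P \<in> \<X> \<Longrightarrow> f \<noteq> 0 \<Longrightarrow> g \<noteq> 0 \<Longrightarrow> P (f * g) = P f + P g"
  and place_add: "P \<in> \<X> \<Longrightarrow> f \<noteq> 0 \<Longrightarrow> g \<noteq> 0 \<Longrightarrow> f + g \<noteq> 0 \<Longrightarrow> min (P f) (P g) \<le> P (f + g)"
  and place_\<iota>: "P \<in> \<X> \<Longrightarrow> P (\<iota> c) = 0"
  by (auto simp: places_def)

lemma place_1: "P \<in> \<X> \<Longrightarrow> P 1 = 0"
  using place_\<iota>[of P 1] by simp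

lemma uniformizer_exists:
  assumes "P \<in> \<X>"
  obtains t where "P t = 1" "t \<noteq> 0"
  using assms place_0[OF assms] by (force simp: places_def)

lemma place_inverse: "P \<in> \<X> \<Longrightarrow> P (inverse f) = - P f"
proof (cases "f = 0")
  case False
  assume P: "P \<in> \<X>"
  have "P (f * inverse f) = P f + P (inverse f)" using False by (intro place_mult[OF P]) auto
  then show ?thesis using False place_1[OF P] by simp
qed (simp add: place_0)

lemma place_divide: "P \<in> \<X> \<Longrightarrow> f \<noteq> 0 \<Longrightarrow> g \<noteq> 0 \<Longrightarrow> P (f / g) = P f - P g"
  using place_mult[of P f "inverse g"] place_inverse[of P g] by (simp add: divide_inverse)

lemma place_power: "P \<in> \<X> \<Longrightarrow> P (f ^ n) = int n * P f"
proof (cases "f = 0")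
  case False
  assume P: "P \<in> \<X>"
  then show ?thesis using False by (induction n) (simp_all add: place_1 place_mult algebra_simps)
qed (cases n; simp add: place_0 place_1)

lemma place_power_int: "P \<in> \<X> \<Longrightarrow> P (f powi n) = n * P f"
  by (simp add: power_int_def place_power place_inverse)

lemma place_minus: "P \<in> \<X> \<Longrightarrow> P (- f) = P f"
  using place_mult[of P "-1" f] place_\<iota>[of P "-1"] by (cases "f = 0") auto

lemma zero_val_ge [simp]: "0 \<in> val_ge P n"
  by (simp add: val_ge_def)

lemma val_ge_iff: "f \<noteq> 0 \<Longrightarrow> f \<in> val_ge P n \<longleftrightarrow> n \<le> P f"
  by (simp add: val_ge_def)

lemma val_ge_mono: "m \<le> n \<Longrightarrow> f \<in> val_ge P n \<Longrightarrow> f \<in> val_ge P m"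
  by (auto simp: val_ge_def)

lemma val_ge_mult:
  "P \<in> \<X> \<Longrightarrow> f \<in> val_ge P m \<Longrightarrow> g \<in> val_ge P n \<Longrightarrow> f * g \<in> val_ge P (m + n)"
  by (cases "f = 0"; cases "g = 0") (auto simp: val_ge_iff place_mult)

lemma val_ge_mult_iff:
  "P \<in> \<X> \<Longrightarrow> z \<noteq> 0 \<Longrightarrow> z * f \<in> val_ge P n \<longleftrightarrow> f \<in> val_ge P (n - P z)"
  by (cases "f = 0") (auto simp: val_ge_iff place_mult)

lemma \<iota>_val_ge: "P \<in> \<X> \<Longrightarrow> \<iota> c \<in> \<O> P"
  by (simp add: val_ge_def place_\<iota>)

lemma one_val_ge: "P \<in> \<X> \<Longrightarrow> 1 \<in> \<O> P"
  using \<iota>_val_ge[of P 1] by simp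

lemma val_ge_subspace:
  assumes P: "P \<in> \<X>"
  shows "F.subspace (val_ge P n)"
proof (rule F.subspaceI)
  fix f g assume "f \<in> val_ge P n" "g \<in> val_ge P n"
  then show "f + g \<in> val_ge P n"
    using place_add[OF P, of f g] by (cases "f = 0"; cases "g = 0"; cases "f + g = 0")
      (auto simp: val_ge_def)
next
  fix c f assume "f \<in> val_ge P n"
  then show "\<iota> c * f \<in> val_ge P n" using val_ge_mult[OF P \<iota>_val_ge[OF P, of c]] by simp
qed simp

lemmas val_ge_add = F.subspace_add[OF val_ge_subspace]
  and val_ge_diff = F.subspace_diff[OF val_ge_subspace]
  and val_ge_neg = F.subspace_neg[OF val_ge_subspace]
  and val_ge_sum = F.subspace_sum[OF val_ge_subspace]
  and val_ge_scale = F.subspace_scale[OF val_ge_subspace]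

lemma val_ge_power: "P \<in> \<X> \<Longrightarrow> f \<in> \<O> P \<Longrightarrow> f ^ n \<in> \<O> P"
  by (induction n) (auto simp: one_val_ge dest: val_ge_mult[where m = 0 and n = 0])

lemma val_ge_mult0: "P \<in> \<X> \<Longrightarrow> f \<in> \<O> P \<Longrightarrow> g \<in> val_ge P n \<Longrightarrow> f * g \<in> val_ge P n"
  using val_ge_mult[of P f 0 g n] by simp

lemma of_nat_val_ge: "P \<in> \<X> \<Longrightarrow> of_nat n \<in> \<O> P"
  using \<iota>_val_ge[of P "of_nat n"] by simp

lemma place_add_eq:
  assumes P: "P \<in> \<X>" and f: "f \<noteq> 0" and g: "g \<in> val_ge P (P f + 1)"
  shows "f + g \<noteq> 0" "P (f + g) = P f"
proof -
  show nz: "f + g \<noteq> 0"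
  proof
    assume "f + g = 0"
    then have "g = - f" by (simp add: eq_neg_iff_add_eq_0 add.commute)
    then show False using g f place_minus[OF P, of f] by (simp add: val_ge_def)
  qed
  show "P (f + g) = P f"
  proof (cases "g = 0")
    case False
    then have lt: "P f < P g" using g by (simp add: val_ge_def)
    have "P f \<le> P (f + g)" using place_add[OF P f False nz] lt by simp
    moreover have "min (P (f + g)) (P (- g)) \<le> P ((f + g) + - g)"
      using nz f False by (intro place_add[OF P]) auto
    ultimately show ?thesis using lt by (simp add: place_minus[OF P])
  qed simp
qed

text \<open>No two terms of least valuation can cancel.\<close>

lemma place_sum_distinct:
  assumes P: "P \<in> \<X>" and "finite I" "I \<noteq> {}" "\<And>i. i \<in> I \<Longrightarrow> f i \<noteq> 0" "inj_on (\<lambda>i. P (f i)) I"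
  shows "sum f I \<noteq> 0 \<and> (\<exists>i\<in>I. P (sum f I) = P (f i)) \<and> (\<forall>i\<in>I. P (sum f I) \<le> P (f i))"
  using assms(2-)
proof (induction I rule: finite_ne_induct)
  case (insert i I)
  have IH: "sum f I \<noteq> 0" "\<exists>j\<in>I. P (sum f I) = P (f j)" "\<forall>j\<in>I. P (sum f I) \<le> P (f j)"
    using insert by auto
  have ne: "P (f i) \<noteq> P (sum f I)" using IH(2) insert.prems(2) insert.hyps by auto
  have sum: "sum f (insert i I) = f i + sum f I" using insert.hyps by simp
  have fi: "f i \<noteq> 0" using insert.prems(1) by simp
  show ?case
  proof (cases "P (f i) < P (sum f I)")
    case True
    then have "sum f I \<in> val_ge P (P (f i) + 1)" by (simp add: val_ge_def)
    then show ?thesis using place_add_eq[OF P fi] True IH(3) by (force simp: sum)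
  next
    case False
    then have "f i \<in> val_ge P (P (sum f I) + 1)" using ne by (simp add: val_ge_def)
    then show ?thesis
      using place_add_eq[OF P IH(1), of "f i"] False IH ne by (auto simp: sum add.commute)
  qed
qed simp

subsection \<open>Expansions in \<open>q\<close>-th powers\<close>

lemma place_q_terms_inj:
  assumes P: "P \<in> \<X>" and t: "P t = 1" "t \<noteq> 0"
    and a: "\<And>i. i \<in> I \<Longrightarrow> a i \<noteq> 0" "I \<subseteq> {..<CARD('k)}"
  shows "inj_on (\<lambda>i. P (a i ^ CARD('k) * t ^ i)) I"
proof (rule inj_onI)
  fix i j assume ij: "i \<in> I" "j \<in> I" and eq: "P (a i ^ CARD('k) * t ^ i) = P (a j ^ CARD('k) * t ^ j)"
  have "P (a i ^ CARD('k) * t ^ i) = int CARD('k) * P (a i) + int i" if "i \<in> I" for i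
    using a(1)[OF that] t by (simp add: place_mult[OF P] place_power[OF P])
  then have "(int CARD('k) * P (a i) + int i) mod int CARD('k) = (int CARD('k) * P (a j) + int j) mod int CARD('k)"
    using eq ij by simp
  then have "int i mod int CARD('k) = int j mod int CARD('k)" by simp
  moreover have "i < CARD('k)" "j < CARD('k)" using ij a(2) by auto
  ultimately show "i = j" by simp
qed

text \<open>
  The terms of the expansion have distinct valuations modulo \<open>q\<close>, so none of them has a smaller valuation
  than \<open>f\<close>.
\<close>

lemma q_expansion:
  assumes P: "P \<in> \<X>" and t: "P t = 1"
  shows "\<exists>a. f = (\<Sum>i<CARD('k). a i ^ CARD('k) * t ^ i) \<and>
    (\<forall>n. f \<in> val_ge P n \<longrightarrow> (\<forall>i<CARD('k). a i ^ CARD('k) * t ^ i \<in> val_ge P n))"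
proof -
  let ?q = "CARD('k)"
  have t0: "t \<noteq> 0" using t place_0[OF P] by auto
  have terms: "sum (\<lambda>i. a i ^ ?q * t ^ i) {i. i < ?q \<and> a i \<noteq> 0} = (\<Sum>i<?q. a i ^ ?q * t ^ i)" for a
    using q_ge_2 by (intro sum.mono_neutral_left) (auto simp: power_0_left)
  have nonzero: "(\<Sum>i<?q. a i ^ ?q * t ^ i) \<noteq> 0 \<and>
      (\<forall>j<?q. a j \<noteq> 0 \<longrightarrow> P (\<Sum>i<?q. a i ^ ?q * t ^ i) \<le> P (a j ^ ?q * t ^ j))"
    if "\<exists>i<?q. a i \<noteq> 0" for a
  proof -
    have "inj_on (\<lambda>i. P (a i ^ ?q * t ^ i)) {i. i < ?q \<and> a i \<noteq> 0}"
      by (rule place_q_terms_inj[OF P t t0]) auto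
    then show ?thesis
      using place_sum_distinct[OF P, of "{i. i < ?q \<and> a i \<noteq> 0}" "\<lambda>i. a i ^ ?q * t ^ i"] t0 that terms[of a]
      by auto
  qed
  have "\<exists>a. f = (\<Sum>i<?q. a i ^ ?q * t ^ i)"
  proof -
    obtain x B where "curve_coord \<iota> x B" using coordinates_exist by blast
    then interpret curve_coord \<iota> x B .
    let ?w = "\<lambda>i. if i < ?q then t ^ i else f"
    obtain h where h: "(\<Sum>i\<le>?q. h i ^ ?q * ?w i) = 0" "\<exists>i\<le>?q. h i \<noteq> 0"
      using power_q_dependent[of ?w] by blast
    have sum: "(\<Sum>i<?q. h i ^ ?q * t ^ i) + h ?q ^ ?q * f = 0"
      using h(1) by (simp add: lessThan_Suc_atMost[symmetric])
    have nz: "h ?q \<noteq> 0"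
    proof
      assume 0: "h ?q = 0"
      then have "(\<Sum>i<?q. h i ^ ?q * t ^ i) = 0" using sum q_ge_2 by (simp add: power_0_left)
      moreover have "\<exists>i<?q. h i \<noteq> 0" using h(2) 0 by (metis le_neq_implies_less)
      ultimately show False using nonzero by blast
    qed
    have "f = - (\<Sum>i<?q. h i ^ ?q * t ^ i) / h ?q ^ ?q"
      using sum nz by (simp add: field_simps add_eq_0_iff)
    also have "\<dots> = (\<Sum>i<?q. (- h i / h ?q) ^ ?q * t ^ i)"
      by (simp add: sum_divide_distrib sum_negf[symmetric] power_divide frob1)
    finally show ?thesis by (rule exI[of _ "\<lambda>i. - h i / h ?q"])
  qed
  then obtain a where a: "f = (\<Sum>i<?q. a i ^ ?q * t ^ i)" by blast
  have "a i ^ ?q * t ^ i \<in> val_ge P n" if "f \<in> val_ge P n" "i < ?q" for i n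
  proof (cases "a i = 0")
    case False
    then have "f \<noteq> 0" "P f \<le> P (a i ^ ?q * t ^ i)" using nonzero[of a] that(2) a by auto
    then show ?thesis using that(1) False t0 by (auto simp: val_ge_def)
  qed (use q_ge_2 in \<open>simp add: power_0_left\<close>)
  then show ?thesis using a by blast
qed

text \<open>
  \<open>S f g\<close> stands for \<open>f dg\<close>: it is either \<open>f * \<delta> g\<close> for a derivation \<open>\<delta>\<close> or Tate's symbol.  As
  \<open>q = 0\<close> in the function field, \<open>q\<close>-th powers have differential \<open>0\<close>.
\<close>

lemma differential_rule:
  fixes S :: "'a \<Rightarrow> 'a \<Rightarrow> 'b::ab_group_add"
  assumes add: "\<And>f f' g. S (f + f') g = S f g + S f' g" "\<And>f g g'. S f (g + g') = S f g + S f g'"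
    and mult: "\<And>f g h. S f (g * h) = S (f * g) h + S (f * h) g"
  shows "S f (\<Sum>i<CARD('k). a i ^ CARD('k) * t ^ i) =
    S (f * (\<Sum>i<CARD('k). of_nat i * a i ^ CARD('k) * t ^ (i - 1))) t"
proof -
  let ?q = "CARD('k)"
  have z: "S 0 g = 0" "S f 0 = 0" for f g using add(1)[of 0 0 g] add(2)[of f 0 0] by simp_all
  have sum_r: "S f (\<Sum>i\<in>I. g i) = (\<Sum>i\<in>I. S f (g i))" for f I and g :: "nat \<Rightarrow> 'a"
    by (induction I rule: infinite_finite_induct) (simp_all add: z add)
  have sum_l: "S (\<Sum>i\<in>I. g i) f = (\<Sum>i\<in>I. S (g i) f)" for f I and g :: "nat \<Rightarrow> 'a"
    by (induction I rule: infinite_finite_induct) (simp_all add: z add)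
  have one: "S f 1 = 0" for f using mult[of f 1 1] by simp
  have pow: "S f (g ^ n) = S (f * (of_nat n * g ^ (n - 1))) g" for f g n
  proof (induction n arbitrary: f)
    case (Suc n)
    have "S f (g ^ Suc n) = S (f * g) (g ^ n) + S (f * g ^ n) g" using mult[of f g "g ^ n"] by simp
    also have "\<dots> = S (f * g * (of_nat n * g ^ (n - 1)) + f * g ^ n) g" by (simp add: Suc add)
    also have "f * g * (of_nat n * g ^ (n - 1)) + f * g ^ n = f * (of_nat (Suc n) * g ^ (Suc n - 1))"
      by (cases n) (simp_all add: algebra_simps)
    finally show ?case .
  qed (simp add: one z)
  have "S f (a i ^ ?q * t ^ i) = S (f * (of_nat i * a i ^ ?q * t ^ (i - 1))) t" for i
    using mult[of f "a i ^ ?q" "t ^ i"] pow[of "f * t ^ i" "a i" ?q] pow[of "f * a i ^ ?q" t i]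
    by (simp add: of_nat_q z mult_ac)
  then show ?thesis by (simp add: sum_r sum_l sum_distrib_left)
qed

definition dcoeff :: "'a \<Rightarrow> (nat \<Rightarrow> 'a) \<Rightarrow> 'a" where
  "dcoeff t a = (\<Sum>i<CARD('k). of_nat i * a i ^ CARD('k) * t ^ (i - 1))"

lemma dcoeff_val_ge:
  assumes P: "P \<in> \<X>" and t: "P t = 1"
    and a: "\<And>i. i < CARD('k) \<Longrightarrow> a i ^ CARD('k) * t ^ i \<in> \<O> P"
  shows "dcoeff t a \<in> \<O> P"
  unfolding dcoeff_def
proof (rule val_ge_sum[OF P])
  fix i assume i: "i \<in> {..<CARD('k)}"
  have t0: "t \<noteq> 0" using t place_0[OF P] by auto
  have "a i ^ CARD('k) * t ^ (i - 1) \<in> \<O> P" if ai: "a i \<noteq> 0" and pos: "i > 0"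
  proof -
    have "0 \<le> int CARD('k) * P (a i) + int i"
      using a[of i] i ai t0 t by (simp add: val_ge_def place_mult[OF P] place_power[OF P])
    moreover have "int CARD('k) * P (a i) \<le> int CARD('k) * (- 1)" if "P (a i) < 0"
      using that by (intro mult_left_mono) auto
    ultimately have "0 \<le> P (a i)" using i by force
    then show ?thesis using pos t0 t ai by (simp add: val_ge_def place_mult[OF P] place_power[OF P])
  qed
  then have "a i ^ CARD('k) * t ^ (i - 1) \<in> \<O> P \<or> of_nat i = (0 :: 'a)"
    by (cases "a i = 0"; cases "i = 0") (auto simp: power_0_left)
  then show "of_nat i * a i ^ CARD('k) * t ^ (i - 1) \<in> \<O> P"
    using val_ge_mult0[OF P of_nat_val_ge[OF P]] by (auto simp: mult.assoc)
qed

text \<open>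
  For a uniformizer \<open>t\<close>, the derivative \<open>df/dt\<close> exists, is the same for derivations and for Tate's
  symbol, and is regular if \<open>f\<close> is.
\<close>

lemma derivative_exists:
  assumes P: "P \<in> \<X>" and t: "P t = 1"
  obtains u where "f \<in> \<O> P \<Longrightarrow> u \<in> \<O> P"
    "\<And>\<delta>. \<delta> \<in> derivations \<iota> \<Longrightarrow> \<delta> f = u * \<delta> t"
    "\<And>S :: 'a \<Rightarrow> 'a \<Rightarrow> 'k. (\<And>f f' g. S (f + f') g = S f g + S f' g) \<Longrightarrow>
      (\<And>f g g'. S f (g + g') = S f g + S f g') \<Longrightarrow>
      (\<And>f g h. S f (g * h) = S (f * g) h + S (f * h) g) \<Longrightarrow> (\<And>g. S g f = S (g * u) t)"
proof -
  obtain a where a: "f = (\<Sum>i<CARD('k). a i ^ CARD('k) * t ^ i)"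
    "\<forall>n. f \<in> val_ge P n \<longrightarrow> (\<forall>i<CARD('k). a i ^ CARD('k) * t ^ i \<in> val_ge P n)"
    using q_expansion[OF P t] by blast
  show ?thesis
  proof (rule that[of "dcoeff t a"])
    show "f \<in> \<O> P \<Longrightarrow> dcoeff t a \<in> \<O> P" using a(2) by (intro dcoeff_val_ge[OF P t]) blast
    show "\<delta> f = dcoeff t a * \<delta> t" if "\<delta> \<in> derivations \<iota>" for \<delta>
      using that differential_rule[of "\<lambda>f g. f * \<delta> g" 1 a t] a(1)
      by (simp add: derivations_def algebra_simps dcoeff_def)
    show "S g f = S (g * dcoeff t a) t"
      if "\<And>f f' g. S (f + f') g = S f g + S f' g" "\<And>f g g'. S f (g + g') = S f g + S f g'"
        "\<And>f g h. S f (g * h) = S (f * g) h + S (f * h) g" for S :: "'a \<Rightarrow> 'a \<Rightarrow> 'k" and g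
      using differential_rule[of S g a t, OF that] a(1) by (simp add: dcoeff_def)
  qed
qed

end

subsection \<open>Existence of places\<close>

text \<open>Subrings over the constants in which \<open>y\<close> is not invertible.\<close>

definition (in curve) nonunit_subrings :: "'a \<Rightarrow> 'a set set" where
  "nonunit_subrings y = {R. range \<iota> \<subseteq> R \<and> y \<in> R \<and> (\<forall>a\<in>R. \<forall>b\<in>R. a + b \<in> R \<and> a * b \<in> R) \<and> inverse y \<notin> R}"

text \<open>
  By Zorn's lemma there is a maximal ring \<open>R\<close> that contains \<open>y\<close> but not \<open>1 / y\<close>.  By maximality every
  \<open>1 + y r\<close> is a unit and, as in Chevalley's extension theorem, \<open>R\<close> is a valuation ring; it is
  discrete because \<open>R / yR\<close> is finite.
\<close>

locale maximal_nonunit = curve \<iota> for \<iota> :: "'k::{field,finite} \<Rightarrow> 'a::field" +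
  fixes y :: 'a and R :: "'a set"
  assumes y0: "y \<noteq> 0" and R: "R \<in> nonunit_subrings y"
    and maximal: "\<And>R'. R' \<in> nonunit_subrings y \<Longrightarrow> R \<subseteq> R' \<Longrightarrow> R' = R"
begin

lemma R_const: "\<iota> c \<in> R" and R_y: "y \<in> R" and R_add: "a \<in> R \<Longrightarrow> b \<in> R \<Longrightarrow> a + b \<in> R"
  and R_mult: "a \<in> R \<Longrightarrow> b \<in> R \<Longrightarrow> a * b \<in> R" and R_inverse_y: "inverse y \<notin> R"
  using R by (auto simp: nonunit_subrings_def)

lemma R_0: "0 \<in> R" and R_1: "1 \<in> R"
  using R_const[of 0] R_const[of 1] by simp_all

lemma R_neg: "a \<in> R \<Longrightarrow> - a \<in> R"
  using R_mult[OF R_const[of "-1"]] by simp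

lemma R_diff: "a \<in> R \<Longrightarrow> b \<in> R \<Longrightarrow> a - b \<in> R"
  using R_add[OF _ R_neg] by fastforce

lemma R_power: "a \<in> R \<Longrightarrow> a ^ n \<in> R"
  by (induction n) (auto simp: R_1 R_mult)

lemma R_sum: "(\<And>i. i \<in> I \<Longrightarrow> f i \<in> R) \<Longrightarrow> sum f I \<in> R"
  by (induction I rule: infinite_finite_induct) (auto simp: R_0 R_add)

lemma R_subspace: "F.subspace R"
  by (intro F.subspaceI R_0 R_add R_mult R_const)

lemma y_mult_ne: "a \<in> R \<Longrightarrow> y * a \<noteq> 1"
  using R_inverse_y inverse_unique by metis

lemma unit_one_plus:
  assumes r: "r \<in> R"
  shows "1 + y * r \<noteq> 0" "inverse (1 + y * r) \<in> R"
proof -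
  have nz: "1 + y * s \<noteq> 0" if "s \<in> R" for s
    using y_mult_ne[OF R_neg[OF that]] by (auto simp: add_eq_0_iff)
  show "1 + y * r \<noteq> 0" by (rule nz[OF r])
  define R' where "R' = {a / (1 + y * s) | a s. a \<in> R \<and> s \<in> R}"
  have sub: "R \<subseteq> R'"
  proof
    fix a assume "a \<in> R"
    then show "a \<in> R'" unfolding R'_def using R_0 by (intro CollectI exI[of _ a] exI[of _ 0]) auto
  qed
  have "R' \<in> nonunit_subrings y" unfolding nonunit_subrings_def
  proof (intro CollectI conjI ballI)
    show "range \<iota> \<subseteq> R'" "y \<in> R'" using sub R_const R_y by auto
    fix u v assume "u \<in> R'" "v \<in> R'"
    then obtain a s b w where uv: "u = a / (1 + y * s)" "v = b / (1 + y * w)"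
      "a \<in> R" "s \<in> R" "b \<in> R" "w \<in> R" unfolding R'_def by blast
    have den: "(1 + y * s) * (1 + y * w) = 1 + y * (s + w + y * (s * w))"
      by (simp add: algebra_simps)
    have den_R: "s + w + y * (s * w) \<in> R" by (intro R_add R_mult R_y uv)
    have "u * v = (a * b) / (1 + y * (s + w + y * (s * w)))"
      unfolding den[symmetric] using uv by simp
    then show "u * v \<in> R'" unfolding R'_def using den_R uv R_mult by blast
    have "u + v = (a * (1 + y * w) + b * (1 + y * s)) / (1 + y * (s + w + y * (s * w)))"
      unfolding den[symmetric] using uv nz by (simp add: add_frac_eq)
    moreover have "a * (1 + y * w) + b * (1 + y * s) \<in> R" by (intro R_add R_mult R_y R_1 uv)
    ultimately show "u + v \<in> R'" unfolding R'_def using den_R by blast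
  next
    show "inverse y \<notin> R'"
    proof
      assume "inverse y \<in> R'"
      then obtain a s where a: "inverse y = a / (1 + y * s)" "a \<in> R" "s \<in> R"
        unfolding R'_def by blast
      then have "1 + y * s = y * a" using nz[of s] y0 by (simp add: field_simps)
      then have "y * (a - s) = 1" by (simp add: algebra_simps)
      then show False using y_mult_ne[OF R_diff[OF a(2,3)]] by blast
    qed
  qed
  then have "R' = R" using maximal sub by blast
  moreover have "inverse (1 + y * r) \<in> R'"
    unfolding R'_def using r R_1 by (intro CollectI exI[of _ 1] exI[of _ r]) (simp add: divide_inverse)
  ultimately show "inverse (1 + y * r) \<in> R" by simp
qed

text \<open>
  \<open>1 / y\<close> is a polynomial of degree at most \<open>m\<close> in \<open>z\<close> over \<open>R\<close>.
\<close>

definition inverts :: "'a \<Rightarrow> nat \<Rightarrow> bool" where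
  "inverts z m \<longleftrightarrow> (\<exists>a. (\<forall>i. a i \<in> R) \<and> y * (\<Sum>i\<le>m. a i * z ^ i) = 1)"

lemma inverts_exists:
  assumes z: "z \<notin> R"
  shows "\<exists>m. inverts z m"
proof -
  define R' where "R' = {poly p z | p. \<forall>i. coeff p i \<in> R}"
  have sub: "R \<subseteq> R'"
  proof
    fix a assume "a \<in> R"
    then show "a \<in> R'"
      unfolding R'_def using R_0 by (intro CollectI exI[of _ "[:a:]"]) (auto simp: coeff_pCons split: nat.splits)
  qed
  have "z \<in> R'" unfolding R'_def using R_0 R_1
    by (intro CollectI exI[of _ "[:0, 1:]"]) (auto simp: coeff_pCons split: nat.splits)
  then have "R' \<noteq> R" using z by blast
  then have "R' \<notin> nonunit_subrings y" using maximal sub by blast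
  moreover have "u + v \<in> R'" "u * v \<in> R'" if uv: "u \<in> R'" "v \<in> R'" for u v
  proof -
    obtain p r where p: "u = poly p z" "v = poly r z" "\<forall>i. coeff p i \<in> R" "\<forall>i. coeff r i \<in> R"
      using uv unfolding R'_def by blast
    show "u + v \<in> R'" unfolding R'_def using p R_add by (intro CollectI exI[of _ "p + r"]) auto
    show "u * v \<in> R'" unfolding R'_def using p
      by (intro CollectI exI[of _ "p * r"]) (auto simp: coeff_mult intro!: R_sum R_mult)
  qed
  ultimately have "inverse y \<in> R'" using sub R_const R_y unfolding nonunit_subrings_def by auto
  then obtain p where p: "inverse y = poly p z" "\<forall>i. coeff p i \<in> R" unfolding R'_def by blast
  have "y * (\<Sum>i\<le>degree p. coeff p i * z ^ i) = 1"
    using p(1) y0 by (simp add: poly_altdef[symmetric] p(1)[symmetric])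
  then have "inverts z (degree p)" unfolding inverts_def using p(2) by blast
  then show ?thesis by blast
qed

text \<open>
  The relation for \<open>1 / z\<close> expresses \<open>z\<^sup>m\<^sup>+\<^sup>1\<close> by lower powers of \<open>z\<close> with coefficients in \<open>yR\<close>.
\<close>

lemma inverts_reduce:
  assumes z0: "z \<noteq> 0" and m: "inverts z (Suc m)" and l: "inverts (inverse z) l" and lm: "l \<le> Suc m"
  shows "inverts z m"
proof -
  obtain a where a: "\<And>i. a i \<in> R" "y * (\<Sum>i\<le>Suc m. a i * z ^ i) = 1"
    using m unfolding inverts_def by blast
  obtain b where b: "\<And>i. b i \<in> R" "y * (\<Sum>j\<le>l. b j * inverse z ^ j) = 1"
    using l unfolding inverts_def by blast
  define w where "w = inverse (1 + y * - b 0)"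
  have w: "w \<in> R" "1 + y * - b 0 \<noteq> 0"
    unfolding w_def using unit_one_plus[OF R_neg[OF b(1)[of 0]]] by auto
  let ?k = "Suc m"
  have "y * (\<Sum>j\<le>l. b j * inverse z ^ j) = y * b 0 + y * (\<Sum>j=1..l. b j * inverse z ^ j)"
  proof -
    have "{..l} - {0} = {1..l}" by auto
    then show ?thesis
      using sum.remove[of "{..l}" 0 "\<lambda>j. b j * inverse z ^ j"] by (simp add: distrib_left)
  qed
  then have "y * (\<Sum>j=1..l. b j * inverse z ^ j) = 1 + y * - b 0"
    using b(2) by (simp add: algebra_simps)
  then have "w * y * (\<Sum>j=1..l. b j * inverse z ^ j) = 1" using w(2) by (simp add: w_def mult.assoc)
  then have "z ^ ?k = (w * y * (\<Sum>j=1..l. b j * inverse z ^ j)) * z ^ ?k" by simp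
  also have "\<dots> = (\<Sum>j=1..l. w * y * b j * z ^ (?k - j))" unfolding sum_distrib_left sum_distrib_right
  proof (rule sum.cong[OF refl])
    fix j assume j: "j \<in> {1..l}"
    have "inverse z ^ j * z ^ ?k = z ^ (?k - j)" using j lm z0 by (simp add: power_diff field_simps)
    then show "w * y * (b j * inverse z ^ j) * z ^ ?k = w * y * b j * z ^ (?k - j)"
      by (simp add: mult.assoc)
  qed
  also have "\<dots> = (\<Sum>i\<le>m. (if ?k - i \<le> l then w * y * b (?k - i) else 0) * z ^ i)"
  proof -
    have "(\<Sum>j=1..l. w * y * b j * z ^ (?k - j)) =
        (\<Sum>j=1..?k. if j \<le> l then w * y * b j * z ^ (?k - j) else 0)"
      using lm by (intro sum.mono_neutral_cong_left) auto
    also have "\<dots> = (\<Sum>i\<le>m. if ?k - i \<le> l then w * y * b (?k - i) * z ^ i else 0)"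
      by (rule sum.reindex_bij_witness[of _ "\<lambda>i. ?k - i" "\<lambda>j. ?k - j"]) auto
    also have "\<dots> = (\<Sum>i\<le>m. (if ?k - i \<le> l then w * y * b (?k - i) else 0) * z ^ i)"
      by (intro sum.cong) auto
    finally show ?thesis .
  qed
  finally have zk: "z ^ ?k = (\<Sum>i\<le>m. (if ?k - i \<le> l then w * y * b (?k - i) else 0) * z ^ i)" .
  let ?c = "\<lambda>i. a i + a ?k * (if ?k - i \<le> l then w * y * b (?k - i) else 0)"
  have "(\<Sum>i\<le>?k. a i * z ^ i) = (\<Sum>i\<le>m. a i * z ^ i) + a ?k * z ^ ?k" by simp
  also have "\<dots> = (\<Sum>i\<le>m. ?c i * z ^ i)"
    unfolding zk by (simp add: sum_distrib_left sum.distrib distrib_right mult.assoc)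
  finally have "y * (\<Sum>i\<le>m. ?c i * z ^ i) = 1" using a(2) by simp
  moreover have "?c i \<in> R" for i using a b w R_y by (auto intro!: R_add R_mult R_0)
  ultimately show ?thesis unfolding inverts_def by (intro exI[of _ ?c]) blast
qed

lemma not_inverts_0: "\<not> inverts z 0"
  using y_mult_ne by (auto simp: inverts_def)

text \<open>
  If neither \<open>z\<close> nor \<open>1 / z\<close> were in \<open>R\<close>, then both relations would exist, and the larger of the two
  degrees could be lowered without end.
\<close>

lemma valuation_ring:
  assumes z0: "z \<noteq> 0"
  shows "z \<in> R \<or> inverse z \<in> R"
proof (rule ccontr)
  assume "\<not> ?thesis"
  then have ex: "\<exists>m. inverts z m" "\<exists>m. inverts (inverse z) m" using inverts_exists by auto
  define m where "m = (LEAST m. inverts z m)"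
  define l where "l = (LEAST m. inverts (inverse z) m)"
  have m: "inverts z m" and l: "inverts (inverse z) l"
    unfolding m_def l_def using ex by (auto intro: LeastI_ex)
  have min: "\<not> inverts z m'" if "m' < m" for m' using that unfolding m_def by (rule not_less_Least)
  have min': "\<not> inverts (inverse z) m'" if "m' < l" for m'
    using that unfolding l_def by (rule not_less_Least)
  obtain m' l' where m': "m = Suc m'" "l = Suc l'"
    using m l not_inverts_0 by (metis not0_implies_Suc)
  show False
  proof (cases "l \<le> m")
    case True
    then show False using inverts_reduce[OF z0, of m' l] m l min m'(1) by auto
  next
    case False
    then show False using inverts_reduce[of "inverse z" l' m] m l min' m'(2) z0 by auto
  qed
qed

definition nonunits :: "'a set" where
  "nonunits = {a \<in> R. a = 0 \<or> inverse a \<notin> R}"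

lemma finite_chain: "f \<in> R \<Longrightarrow> f \<noteq> 0 \<Longrightarrow> finite (quotient_space R ((\<lambda>v. f * v) ` R))"
  by (rule finite_quotient_mult[OF _ R_subspace]) (auto intro: R_mult)

lemma multiples_subgroup: "add_subgroup ((\<lambda>v. f * v) ` R)"
  by (rule F.add_subgroup_subspace[OF subspace_mult[OF R_subspace]])

text \<open>
  Only finitely many multiples of an element lie between \<open>yR\<close> and \<open>R\<close>, because \<open>R / yR\<close> is finite.
\<close>

lemma nonunits_principal: "\<exists>t\<in>nonunits. t \<noteq> 0 \<and> (\<forall>b\<in>nonunits. b / t \<in> R)"
proof -
  let ?I = "\<lambda>a. (\<lambda>v. a * v) ` R"
  let ?Q = "\<lambda>a. quotient_space (?I a) (?I y)"
  let ?P = "\<lambda>a. a \<in> nonunits \<and> a \<noteq> 0 \<and> y / a \<in> R"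
  have fin: "finite (quotient_space R (?I y))" by (rule finite_chain[OF R_y y0])
  have sub: "?Q a \<subseteq> quotient_space R (?I y)" if "a \<in> R" for a
    using that R_mult by (auto simp: quotient_space_def)
  have "?P y" using R_y R_inverse_y y0 R_1 by (simp add: nonunits_def)
  moreover have "card (?Q a) < Suc (card (quotient_space R (?I y)))" if "?P a" for a
    using card_mono[OF fin sub[of a]] that by (auto simp: nonunits_def)
  ultimately obtain t where t: "?P t" and max: "\<And>a. ?P a \<Longrightarrow> card (?Q a) \<le> card (?Q t)"
    using ex_has_greatest_nat[of ?P y "\<lambda>a. card (?Q a)" "Suc (card (quotient_space R (?I y)))"]
    by blast
  have "b / t \<in> R" if b: "b \<in> nonunits" for b
  proof (rule ccontr)
    assume nb: "b / t \<notin> R"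
    then have b0: "b \<noteq> 0" using R_0 by auto
    have tb: "t / b \<in> R" using valuation_ring[of "b / t"] nb b0 t by auto
    then have "(t / b) * (y / t) \<in> R" using t by (intro R_mult) auto
    then have "y / b \<in> R" using t by simp
    then have le: "card (?Q b) \<le> card (?Q t)" using max b b0 by blast
    have "?Q t \<subseteq> ?Q b"
    proof -
      have "?I t \<subseteq> ?I b"
      proof
        fix a assume "a \<in> ?I t"
        then obtain v where "a = t * v" "v \<in> R" by blast
        then show "a \<in> ?I b" using R_mult[OF tb] b0 by (intro image_eqI[of _ _ "t / b * v"]) auto
      qed
      then show ?thesis by (auto simp: quotient_space_def)
    qed
    moreover have "b +o ?I y \<in> ?Q b" unfolding quotient_space_def using R_1
      by (intro imageI image_eqI[of b "\<lambda>v. b * v" 1]) auto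
    moreover have "b +o ?I y \<notin> ?Q t"
    proof
      assume "b +o ?I y \<in> ?Q t"
      then obtain v where v: "v \<in> R" "b +o ?I y = (t * v) +o ?I y"
        by (auto simp: quotient_space_def)
      then obtain w where w: "w \<in> R" "b - t * v = y * w"
        using coset_eq_iff[OF multiples_subgroup] by blast
      have "b / t = v + (y / t) * w" using w(2) t by (simp add: field_simps)
      moreover have "v + (y / t) * w \<in> R" using v(1) w(1) t by (intro R_add R_mult) auto
      ultimately show False using nb by simp
    qed
    ultimately have "?Q t \<subset> ?Q b" by blast
    moreover have "finite (?Q b)" using finite_subset[OF sub fin] b by (auto simp: nonunits_def)
    ultimately have "card (?Q t) < card (?Q b)" by (intro psubset_card_mono)
    then show False using le by simp
  qed
  then show ?thesis using t by blast
qed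

lemma unit_decomposition:
  assumes t: "t \<in> nonunits" "t \<noteq> 0" "\<And>b. b \<in> nonunits \<Longrightarrow> b / t \<in> R" and f: "f \<in> R" "f \<noteq> 0"
  shows "\<exists>n u. f = t ^ n * u \<and> u \<in> R \<and> inverse u \<in> R \<and> u \<noteq> 0"
proof (rule ccontr)
  assume neg: "\<not> ?thesis"
  have tR: "t \<in> R" "inverse t \<notin> R" using t by (auto simp: nonunits_def)
  have div: "f / t ^ n \<in> R" for n
  proof (induction n)
    case (Suc n)
    have "inverse (f / t ^ n) \<notin> R"
      using neg f t(2) Suc by (auto dest!: spec[of _ n] spec[of _ "f / t ^ n"])
    then have "f / t ^ n / t \<in> R" using Suc by (intro t(3)) (auto simp: nonunits_def)
    then show ?case by (simp add: mult.commute)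
  qed (use f in simp)
  let ?I = "(\<lambda>v. f * v) ` R"
  have inj: "inj (\<lambda>n. t ^ n +o ?I)"
  proof (rule injI, rule ccontr)
    have no: False if nm: "n < m" "t ^ n - t ^ m \<in> ?I" for n m
    proof -
      obtain v where v: "v \<in> R" "t ^ n - t ^ m = f * v" using nm(2) by blast
      have "t ^ m = t ^ n * t ^ (m - n)" using nm(1) by (simp flip: power_add)
      moreover have "m - n = Suc (m - Suc n)" using nm(1) by simp
      ultimately have a: "t ^ n - t ^ m = t ^ n * (1 - t * t ^ (m - Suc n))"
        by (simp add: algebra_simps)
      have b: "f * v = t ^ n * (t * (f / t ^ Suc n * v))" using t(2) by (simp add: field_simps)
      have "t ^ n * (1 - t * t ^ (m - Suc n)) = t ^ n * (t * (f / t ^ Suc n * v))"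
        by (rule trans[OF trans[OF a[symmetric] v(2)] b])
      then have "1 - t * t ^ (m - Suc n) = t * (f / t ^ Suc n * v)"
        using mult_left_cancel[THEN iffD1, of "t ^ n"] power_not_zero[OF t(2)] by blast
      then have "t * (f / t ^ Suc n * v + t ^ (m - Suc n)) = 1" by (simp add: algebra_simps)
      then have "inverse t = f / t ^ Suc n * v + t ^ (m - Suc n)" by (rule inverse_unique)
      moreover have "f / t ^ Suc n * v + t ^ (m - Suc n) \<in> R"
        by (intro R_add R_mult div v R_power tR)
      ultimately show False using tR by simp
    qed
    fix n m assume nm: "t ^ n +o ?I = t ^ m +o ?I" "n \<noteq> m"
    then have "t ^ n - t ^ m \<in> ?I" "t ^ m - t ^ n \<in> ?I"
      using coset_eq_iff[OF multiples_subgroup] by metis+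
    then show False using no nm(2) by (metis linorder_neqE_nat)
  qed
  have "range (\<lambda>n. t ^ n +o ?I) \<subseteq> quotient_space R ?I"
    using R_power[OF tR(1)] by (auto simp: quotient_space_def)
  then have "finite (range (\<lambda>n. t ^ n +o ?I))" using finite_chain[OF f] finite_subset by blast
  then show False using inj finite_imageD infinite_UNIV_nat by blast
qed

lemma place_exists: "\<exists>P\<in>\<X>. P y > 0"
proof -
  obtain t where t: "t \<in> nonunits" "t \<noteq> 0" "\<And>b. b \<in> nonunits \<Longrightarrow> b / t \<in> R"
    using nonunits_principal by blast
  have tR: "t \<in> R" "inverse t \<notin> R" using t by (auto simp: nonunits_def)
  let ?U = "\<lambda>u. u \<in> R \<and> inverse u \<in> R \<and> u \<noteq> 0"
  have U_mult: "?U (u * v)" if "?U u" "?U v" for u v using that R_mult by simp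
  have U_div: "?U (u / v)" if "?U u" "?U v" for u v using that R_mult by (simp add: divide_inverse)
  have decomp: "\<exists>n u. f = t powi n * u \<and> ?U u" if f: "f \<noteq> 0" for f
  proof (cases "f \<in> R")
    case True
    then obtain n u where "f = t ^ n * u" "?U u" using unit_decomposition[OF t True f] by blast
    then show ?thesis by (intro exI[of _ "int n"] exI[of _ u]) simp
  next
    case False
    then have "inverse f \<in> R" "inverse f \<noteq> 0" using valuation_ring[OF f] f by auto
    then obtain n u where u: "inverse f = t ^ n * u" "?U u" using unit_decomposition[OF t] by blast
    then have "f = inverse (t ^ n * u)" by (metis inverse_inverse_eq)
    also have "\<dots> = t powi (- int n) * inverse u" by (simp add: power_int_minus)
    finally show ?thesis using u(2) by (intro exI[of _ "- int n"] exI[of _ "inverse u"]) simp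
  qed
  have R_iff: "t powi n * u \<in> R \<longleftrightarrow> 0 \<le> n" if "?U u" for n u
  proof
    assume "0 \<le> n"
    then show "t powi n * u \<in> R" using that R_power[OF tR(1)] R_mult by (simp add: power_int_def)
  next
    assume *: "t powi n * u \<in> R"
    show "0 \<le> n"
    proof (rule ccontr)
      assume n: "\<not> 0 \<le> n"
      then have "t powi n * t ^ nat (- n - 1) = t powi n * t powi (- n - 1)"
        by (simp add: power_int_def)
      also have "\<dots> = inverse t"
        using t(2) power_int_add[of t n "- n - 1"] by (simp add: power_int_minus)
      finally have "t powi n * t ^ nat (- n - 1) = inverse t" .
      moreover have "(t powi n * u) * (inverse u * t ^ nat (- n - 1)) \<in> R"
        by (rule R_mult[OF * R_mult[OF _ R_power[OF tR(1)]]]) (use that in blast)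
      moreover have "(t powi n * u) * (inverse u * t ^ nat (- n - 1)) = t powi n * t ^ nat (- n - 1)"
        using that by simp
      ultimately show False using tR(2) by simp
    qed
  qed
  define v where "v f = (if f = 0 then 0 else THE n. \<exists>u. f = t powi n * u \<and> ?U u)" for f
  have v: "v f = n" if f: "f = t powi n * u" "?U u" for f n u
  proof -
    have "f \<noteq> 0" using f t(2) by simp
    moreover have "(THE n. \<exists>u. f = t powi n * u \<and> ?U u) = n"
    proof (rule the_equality)
      fix n' assume "\<exists>u. f = t powi n' * u \<and> ?U u"
      then obtain u' where u': "f = t powi n' * u'" "?U u'" by blast
      have "t powi (n - n') * (u / u') = 1" "t powi (n' - n) * (u' / u) = 1"
        using f u' t(2) by (simp_all add: power_int_diff field_simps)
      then have "0 \<le> n - n'" "0 \<le> n' - n"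
        using R_iff[OF U_div[OF f(2) u'(2)], of "n - n'"] R_iff[OF U_div[OF u'(2) f(2)], of "n' - n"] R_1
        by simp_all
      then show "n' = n" by simp
    qed (use f in blast)
    ultimately show ?thesis by (simp add: v_def)
  qed
  have v_R: "n \<le> v f \<longleftrightarrow> t powi (- n) * f \<in> R" if f: "f \<noteq> 0" for n f
  proof -
    obtain k u where k: "f = t powi k * u" "?U u" using decomp[OF f] by blast
    then have "t powi (- n) * f = t powi (k - n) * u"
      using t(2) by (simp add: power_int_diff power_int_minus field_simps)
    then show ?thesis using R_iff[OF k(2), of "k - n"] v[OF k] by simp
  qed
  have "v \<in> \<X>" unfolding places_def
  proof (intro CollectI conjI allI impI)
    show "v 0 = 0" by (simp add: v_def)
    fix f g :: 'a assume f: "f \<noteq> 0" and g: "g \<noteq> 0"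
    obtain k u where k: "f = t powi k * u" "?U u" using decomp[OF f] by blast
    obtain l w where l: "g = t powi l * w" "?U w" using decomp[OF g] by blast
    have "f * g = t powi (k + l) * (u * w)" using t(2) k l by (simp add: power_int_add)
    then show "v (f * g) = v f + v g" using v[OF _ U_mult[OF k(2) l(2)]] v[OF k] v[OF l] by simp
  next
    fix f g :: 'a assume f: "f \<noteq> 0" and g: "g \<noteq> 0" and fg: "f + g \<noteq> 0"
    let ?n = "min (v f) (v g)"
    have "t powi (- ?n) * f \<in> R" "t powi (- ?n) * g \<in> R"
      using v_R[OF f, of ?n] v_R[OF g, of ?n] by auto
    then have "t powi (- ?n) * (f + g) \<in> R" by (simp add: distrib_left R_add)
    then show "?n \<le> v (f + g)" using v_R[OF fg] by blast
  next
    fix c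
    have "?U (\<iota> c)" if "c \<noteq> 0" using that R_const[of c] R_const[of "inverse c"] by simp
    then show "v (\<iota> c) = 0" using v[of "\<iota> c" 0 "\<iota> c"] by (cases "c = 0") (auto simp: v_def)
  next
    show "\<exists>t. v t = 1" using v[of t 1 1] R_1 by auto
  qed
  moreover have "v y > 0"
  proof -
    have "y / t \<in> R" using t(3)[of y] R_y R_inverse_y by (simp add: nonunits_def)
    then show ?thesis using v_R[OF y0, of 1] by (simp add: power_int_minus field_simps)
  qed
  ultimately show ?thesis by blast
qed

end

context curve
begin

lemma exists_zero:
  assumes y: "y \<notin> range \<iota>"
  shows "\<exists>P\<in>\<X>. P y > 0"
proof -
  have y0: "y \<noteq> 0" using y \<iota>_0 by (metis rangeI)
  have tr: "transcendental y" using y transcendental_iff by blast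
  let ?R = "range (\<lambda>p. pev p y)"
  have "?R \<in> nonunit_subrings y" unfolding nonunit_subrings_def
  proof (intro CollectI conjI ballI)
    show "range \<iota> \<subseteq> ?R"
    proof clarify
      fix c show "\<iota> c \<in> ?R"
        by (rule image_eqI[of _ _ "[:c:]"]) auto
    qed
    show "y \<in> ?R" by (rule image_eqI[of _ _ "[:0, 1:]"]) auto
    fix a b assume "a \<in> ?R" "b \<in> ?R"
    then obtain p r where pr: "a = pev p y" "b = pev r y" by blast
    show "a + b \<in> ?R" by (rule image_eqI[of _ _ "p + r"]) (auto simp: pr)
    show "a * b \<in> ?R" by (rule image_eqI[of _ _ "p * r"]) (auto simp: pr)
  next
    show "inverse y \<notin> ?R"
    proof
      assume "inverse y \<in> ?R"
      then obtain p where "inverse y = pev p y" by blast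
      then have "pev (pCons (-1) p) y = 0" using y0 by (simp add: field_simps)
      then show False using transcendentalD[OF tr, of "pCons (-1) p"] by simp
    qed
  qed
  moreover have "\<Union>\<C> \<in> nonunit_subrings y"
    if C: "\<C> \<noteq> {}" "subset.chain (nonunit_subrings y) \<C>" for \<C>
  proof -
    have sub: "\<C> \<subseteq> nonunit_subrings y" and lin: "\<And>X Y. X \<in> \<C> \<Longrightarrow> Y \<in> \<C> \<Longrightarrow> X \<subseteq> Y \<or> Y \<subseteq> X"
      using C(2) by (auto simp: subset_chain_def)
    obtain X where X: "X \<in> \<C>" using C(1) by blast
    have ring: "range \<iota> \<subseteq> X \<and> y \<in> X \<and> (\<forall>a\<in>X. \<forall>b\<in>X. a + b \<in> X \<and> a * b \<in> X) \<and> inverse y \<notin> X"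
      if "X \<in> \<C>" for X using subsetD[OF sub that] by (simp add: nonunit_subrings_def)
    have "a + b \<in> \<Union>\<C> \<and> a * b \<in> \<Union>\<C>" if ab: "a \<in> \<Union>\<C>" "b \<in> \<Union>\<C>" for a b
    proof -
      obtain X Y where XY: "X \<in> \<C>" "a \<in> X" "Y \<in> \<C>" "b \<in> Y" using ab by blast
      then obtain Z where "Z \<in> \<C>" "a \<in> Z" "b \<in> Z" using lin[of X Y] by blast
      then show ?thesis using ring[of Z] by blast
    qed
    moreover have "range \<iota> \<subseteq> \<Union>\<C>" "y \<in> \<Union>\<C>" using ring[OF X] X by blast+
    moreover have "inverse y \<notin> \<Union>\<C>" using ring by blast
    ultimately show ?thesis by (simp add: nonunit_subrings_def)
  qed
  ultimately have "\<exists>R\<in>nonunit_subrings y. \<forall>R'\<in>nonunit_subrings y. R \<subseteq> R' \<longrightarrow> R' = R"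
    by (intro subset_Zorn_nonempty) blast+
  then obtain R where R: "R \<in> nonunit_subrings y"
    "\<And>R'. R' \<in> nonunit_subrings y \<Longrightarrow> R \<subseteq> R' \<Longrightarrow> R' = R" by blast
  interpret maximal_nonunit \<iota> y R
    by unfold_locales (use y0 R in auto)
  show ?thesis by (rule place_exists)
qed

lemma exists_pole:
  assumes "f \<notin> range \<iota>"
  shows "\<exists>P\<in>\<X>. P f < 0"
proof -
  have "inverse f \<notin> range \<iota>"
  proof
    assume "inverse f \<in> range \<iota>"
    then obtain c where "inverse f = \<iota> c" by blast
    then have "f = \<iota> (inverse c)" by (metis \<iota>_inverse inverse_inverse_eq)
    then show False using assms by blast
  qed
  then obtain P where "P \<in> \<X>" "P (inverse f) > 0" using exists_zero by blast
  then show ?thesis using place_inverse[of P f] by (intro bexI[of _ P]) auto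
qed

end

context curve
begin

subsection \<open>Weak approximation\<close>

text \<open>
  Units at \<open>P\<close> are units at \<open>Q\<close>, so the two valuations are proportional, and both are normalized.
\<close>

lemma places_eqI:
  assumes P: "P \<in> \<X>" and Q: "Q \<in> \<X>"
    and sub: "\<And>f. f \<noteq> 0 \<Longrightarrow> 0 \<le> P f \<Longrightarrow> 0 \<le> Q f"
  shows "P = Q"
proof -
  obtain t where t: "P t = 1" "t \<noteq> 0" using uniformizer_exists[OF P] .
  have unit: "Q f = 0" if "f \<noteq> 0" "P f = 0" for f
    using sub[of f] sub[of "inverse f"] that by (simp add: place_inverse[OF P] place_inverse[OF Q])
  have Q_eq: "Q f = P f * Q t" if f: "f \<noteq> 0" for f
  proof -
    have "Q (f * t powi (- P f)) = 0"
      using f t by (intro unit) (simp_all add: place_mult[OF P] place_power_int[OF P])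
    then show ?thesis using f t by (simp add: place_mult[OF Q] place_power_int[OF Q])
  qed
  obtain s where s: "Q s = 1" "s \<noteq> 0" using uniformizer_exists[OF Q] .
  have "P s * Q t = 1" "0 \<le> Q t" using Q_eq[OF s(2)] s sub[OF t(2)] t by auto
  then have "Q t = 1" by (metis dvd_triv_right zdvd1_eq abs_of_nonneg)
  then show ?thesis using Q_eq place_0[OF P] place_0[OF Q] by (intro ext) (metis mult.right_neutral)
qed

lemma separate_two_places:
  assumes P: "P \<in> \<X>" and Q: "Q \<in> \<X>" and "P \<noteq> Q"
  obtains z where "z \<noteq> 0" "P z < 0" "0 < Q z"
proof -
  obtain a where a: "a \<noteq> 0" "0 \<le> P a" "Q a < 0" using places_eqI[OF P Q] \<open>P \<noteq> Q\<close> by force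
  obtain b where b: "b \<noteq> 0" "0 \<le> Q b" "P b < 0" using places_eqI[OF Q P] \<open>P \<noteq> Q\<close> by force
  show ?thesis
    using a b by (intro that[of "b / a"]) (simp_all add: place_divide[OF P] place_divide[OF Q])
qed

lemma place_near_one:
  assumes P: "P \<in> \<X>" and z: "z \<noteq> 0" and m: "m > 0"
  shows "P z < 0 \<Longrightarrow> 1 + z ^ m \<noteq> 0 \<and> P (1 + z ^ m) = int m * P z"
    and "0 < P z \<Longrightarrow> 1 + z ^ m \<noteq> 0 \<and> P (1 + z ^ m) = 0"
proof -
  assume "P z < 0"
  then have "P (z ^ m) < 0" using m by (simp add: place_power[OF P] mult_pos_neg)
  then have "1 \<in> val_ge P (P (z ^ m) + 1)" by (simp add: val_ge_def place_1[OF P])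
  then show "1 + z ^ m \<noteq> 0 \<and> P (1 + z ^ m) = int m * P z"
    using place_add_eq[OF P, of "z ^ m" 1] z by (simp add: add.commute place_power[OF P])
next
  assume "0 < P z"
  then have "z ^ m \<in> val_ge P (P 1 + 1)"
    using m by (simp add: val_ge_def place_1[OF P] place_power[OF P] int_one_le_iff_zero_less)
  then show "1 + z ^ m \<noteq> 0 \<and> P (1 + z ^ m) = 0"
    using place_add_eq[OF P, of 1 "z ^ m"] by (simp add: place_1[OF P])
qed

lemma separate_places:
  assumes "finite S" "S \<subseteq> \<X>" and P: "P \<in> \<X>" "P \<notin> S"
  shows "\<exists>z. z \<noteq> 0 \<and> P z < 0 \<and> (\<forall>Q\<in>S. 0 < Q z)"
  using assms(1,2) P(2)
proof (induction S rule: finite_induct)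
  case empty
  obtain t where "P t = 1" "t \<noteq> 0" using uniformizer_exists[OF P(1)] .
  then show ?case using P(1) by (intro exI[of _ "inverse t"]) (simp add: place_inverse)
next
  case (insert Q' S)
  then obtain z where z: "z \<noteq> 0" "P z < 0" "\<And>Q. Q \<in> S \<Longrightarrow> 0 < Q z" by auto
  have S: "\<And>Q. Q \<in> S \<Longrightarrow> Q \<in> \<X>" and Q': "Q' \<in> \<X>" using insert.prems by auto
  obtain w where w: "w \<noteq> 0" "P w < 0" "0 < Q' w"
    using separate_two_places[OF P(1) Q'] insert.prems by blast
  define m where "m = Suc (nat (\<Sum>Q\<in>S. \<bar>Q w\<bar>))"
  have m: "m > 0" by (simp add: m_def)
  have big: "0 < int m * Q z + Q w" if "Q \<in> S" for Q
  proof -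
    have "\<bar>Q w\<bar> \<le> (\<Sum>Q\<in>S. \<bar>Q w\<bar>)" using that insert.hyps(1) by (intro member_le_sum) auto
    then have "\<bar>Q w\<bar> < int m" by (simp add: m_def)
    moreover have "int m * 1 \<le> int m * Q z" using z(3)[OF that] by (intro mult_left_mono) auto
    ultimately show ?thesis by linarith
  qed
  show ?case
  proof (cases "0 \<le> Q' z")
    case True
    have "P (z ^ m * w) < 0"
      using z w m by (simp add: place_mult[OF P(1)] place_power[OF P(1)] add_neg_neg mult_pos_neg)
    moreover have "0 < Q' (z ^ m * w)"
      using z(1) w True by (simp add: place_mult[OF Q'] place_power[OF Q'] add_nonneg_pos)
    moreover have "0 < Q (z ^ m * w)" if "Q \<in> S" for Q
      using big[OF that] z(1) w(1) by (simp add: place_mult[OF S[OF that]] place_power[OF S[OF that]])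
    ultimately show ?thesis using z(1) w(1) by (intro exI[of _ "z ^ m * w"]) auto
  next
    case False
    let ?u = "z ^ m / (1 + z ^ m) * w"
    have P1: "1 + z ^ m \<noteq> 0" "P (1 + z ^ m) = int m * P z"
      using place_near_one(1)[OF P(1) z(1) m] z(2) by auto
    then have "P ?u < 0"
      using z(1) w by (simp add: place_mult[OF P(1)] place_divide[OF P(1)] place_power[OF P(1)])
    moreover have "Q' (1 + z ^ m) = int m * Q' z"
      using place_near_one(1)[OF Q' z(1) m] False by auto
    then have "0 < Q' ?u"
      using P1 z(1) w by (simp add: place_mult[OF Q'] place_divide[OF Q'] place_power[OF Q'])
    moreover have "0 < Q ?u" if "Q \<in> S" for Q
    proof -
      have "Q (1 + z ^ m) = 0" using place_near_one(2)[OF S[OF that] z(1) m] z(3)[OF that] by auto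
      then show ?thesis using big[OF that] P1 z(1) w(1)
        by (simp add: place_mult[OF S[OF that]] place_divide[OF S[OF that]] place_power[OF S[OF that]])
    qed
    ultimately show ?thesis using z(1) w(1) P1(1) by (intro exI[of _ ?u]) auto
  qed
qed

text \<open>
  With \<open>z\<close> of negative value at \<open>P\<close> and positive values on \<open>S\<close>, take \<open>z^m / (1 + z^m)\<close> for large \<open>m\<close>.
\<close>

lemma approximate_idempotent:
  assumes S: "finite S" "S \<subseteq> \<X>" and P: "P \<in> \<X>" "P \<notin> S"
  shows "\<exists>u. u - 1 \<in> val_ge P n \<and> (\<forall>Q\<in>S. u \<in> val_ge Q n)"
proof -
  obtain z where z: "z \<noteq> 0" "P z < 0" "\<And>Q. Q \<in> S \<Longrightarrow> 0 < Q z" using separate_places[OF S P] by blast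
  define m where "m = Suc (nat n)"
  have m: "m > 0" "n \<le> int m" by (simp_all add: m_def)
  let ?u = "z ^ m / (1 + z ^ m)"
  have P1: "1 + z ^ m \<noteq> 0" "P (1 + z ^ m) = int m * P z"
    using place_near_one(1)[OF P(1) z(1) m(1)] z(2) by auto
  have "?u - 1 = - inverse (1 + z ^ m)" using P1(1) by (simp add: field_simps)
  then have "P (?u - 1) = - (int m * P z)"
    using P1(2) by (simp add: place_minus[OF P(1)] place_inverse[OF P(1)])
  moreover have "int m * 1 \<le> int m * - P z" using z(2) by (intro mult_left_mono) auto
  ultimately have "?u - 1 \<in> val_ge P n" using m(2) by (simp add: val_ge_def)
  moreover have "?u \<in> val_ge Q n" if Q: "Q \<in> S" for Q
  proof -
    have Q': "Q \<in> \<X>" using Q S(2) by blast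
    have "Q (1 + z ^ m) = 0" using place_near_one(2)[OF Q' z(1) m(1)] z(3)[OF Q] by auto
    then have "Q ?u = int m * Q z"
      using P1(1) z(1) by (simp add: place_divide[OF Q'] place_power[OF Q'])
    moreover have "int m * 1 \<le> int m * Q z" using z(3)[OF Q] by (intro mult_left_mono) auto
    ultimately show ?thesis using m(2) by (simp add: val_ge_def)
  qed
  ultimately show ?thesis by blast
qed

lemma weak_approximation:
  assumes S: "finite S" "S \<subseteq> \<X>"
  shows "\<exists>f. \<forall>P\<in>S. f - \<alpha> P \<in> val_ge P n"
proof -
  define N where "N = n + (\<Sum>P\<in>S. \<Sum>Q\<in>S. \<bar>P (\<alpha> Q)\<bar>)"
  have N: "n \<le> P (\<alpha> Q) + N" if "P \<in> S" "Q \<in> S" for P Q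
  proof -
    have "\<bar>P (\<alpha> Q)\<bar> \<le> (\<Sum>Q\<in>S. \<bar>P (\<alpha> Q)\<bar>)" using that S(1) by (intro member_le_sum) auto
    also have "\<dots> \<le> (\<Sum>P\<in>S. \<Sum>Q\<in>S. \<bar>P (\<alpha> Q)\<bar>)"
      using that S(1) by (intro member_le_sum[of P S "\<lambda>P. \<Sum>Q\<in>S. \<bar>P (\<alpha> Q)\<bar>"]) (auto intro: sum_nonneg)
    finally show ?thesis by (simp add: N_def)
  qed
  have "\<exists>u. u - 1 \<in> val_ge P N \<and> (\<forall>Q\<in>S - {P}. u \<in> val_ge Q N)" if "P \<in> S" for P
    using S that by (intro approximate_idempotent) auto
  then obtain u where u: "\<And>P. P \<in> S \<Longrightarrow> u P - 1 \<in> val_ge P N"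
    "\<And>P Q. P \<in> S \<Longrightarrow> Q \<in> S \<Longrightarrow> P \<noteq> Q \<Longrightarrow> u Q \<in> val_ge P N" by (metis Diff_iff singletonD)
  have mult: "\<alpha> Q * f \<in> val_ge P n" if "P \<in> S" "Q \<in> S" "f \<in> val_ge P N" for P Q f
  proof -
    have P: "P \<in> \<X>" using that S by blast
    have "\<alpha> Q \<in> val_ge P (P (\<alpha> Q))" by (simp add: val_ge_def)
    then show ?thesis using val_ge_mono[OF N[OF that(1,2)]] val_ge_mult[OF P _ that(3)] by blast
  qed
  show ?thesis
  proof (intro exI[of _ "\<Sum>Q\<in>S. \<alpha> Q * u Q"] ballI)
    fix P assume P: "P \<in> S"
    have P': "P \<in> \<X>" using P S by blast
    have "(\<Sum>Q\<in>S. \<alpha> Q * u Q) - \<alpha> P = \<alpha> P * (u P - 1) + (\<Sum>Q\<in>S - {P}. \<alpha> Q * u Q)"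
      using sum.remove[OF S(1) P, of "\<lambda>Q. \<alpha> Q * u Q"] by (simp add: algebra_simps)
    also have "\<dots> \<in> val_ge P n" using P u by (intro val_ge_add[OF P'] val_ge_sum[OF P'] mult) auto
    finally show "(\<Sum>Q\<in>S. \<alpha> Q * u Q) - \<alpha> P \<in> val_ge P n" .
  qed
qed

lemma one_notin_val_ge_1: "P \<in> \<X> \<Longrightarrow> 1 \<notin> \<m> P"
  by (simp add: val_ge_def place_1)

lemma \<iota>_val_ge_1_iff: "P \<in> \<X> \<Longrightarrow> \<iota> c \<in> \<m> P \<longleftrightarrow> c = 0"
  by (simp add: val_ge_def place_\<iota>)

definition semilocal :: "('a \<Rightarrow> int) set \<Rightarrow> 'a set" where
  "semilocal S = {f. \<forall>P\<in>S. f \<in> \<O> P}"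

lemma semilocal_subspace: "S \<subseteq> \<X> \<Longrightarrow> F.subspace (semilocal S)"
  by (intro F.subspaceI)
    (auto simp: semilocal_def subset_iff intro: val_ge_add val_ge_scale)

lemma semilocal_mult:
  "S \<subseteq> \<X> \<Longrightarrow> y \<in> semilocal S \<Longrightarrow> f \<in> semilocal S \<Longrightarrow> y * f \<in> semilocal S"
  by (auto simp: semilocal_def intro: val_ge_mult0)

text \<open>
  The functions that are \<open>1\<close> at one zero of \<open>y\<close> and \<open>0\<close> at the others are independent modulo \<open>y\<close> in the
  semilocal ring of the zeros, so their number is bounded by a bound independent of this ring.
\<close>

lemma finite_zeros:
  assumes y: "y \<noteq> 0"
  shows "finite {P \<in> \<X>. 0 < P y}"
proof (rule ccontr)
  assume inf: "infinite {P \<in> \<X>. 0 < P y}"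
  obtain N where N: "\<And>V S. F.subspace V \<Longrightarrow> (\<forall>v\<in>V. y * v \<in> V) \<Longrightarrow> S \<subseteq> V \<Longrightarrow>
    quotient_independent (const_scale \<iota>) ((\<lambda>v. y * v) ` V) S \<Longrightarrow> card S \<le> N"
    using finite_mult_quotient[OF y] by blast
  obtain S where S: "finite S" "card S = Suc N" "S \<subseteq> {P \<in> \<X>. 0 < P y}"
    using infinite_arbitrarily_large[OF inf] by blast
  have Sp: "S \<subseteq> \<X>" and pos: "\<And>P. P \<in> S \<Longrightarrow> 0 < P y" using S(3) by auto
  have "\<exists>u. \<forall>Q\<in>S. u - (if Q = P then 1 else 0) \<in> \<m> Q" for P by (rule weak_approximation[OF S(1) Sp])
  then obtain u where u: "\<And>P Q. Q \<in> S \<Longrightarrow> u P - (if Q = P then 1 else 0) \<in> \<m> Q" by metis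
  have u_other: "u P \<in> \<m> Q" if "Q \<in> S" "P \<noteq> Q" for P Q using u[OF that(1), of P] that(2) by auto
  have u_self: "u P - 1 \<in> \<m> P" if "P \<in> S" for P using u[OF that, of P] by simp
  let ?V = "semilocal S"
  have V: "F.subspace ?V" by (rule semilocal_subspace[OF Sp])
  have W: "F.subspace ((\<lambda>v. y * v) ` ?V)" by (rule subspace_mult[OF V])
  have indep: "\<forall>P\<in>S. \<kappa> P = 0" if sum: "(\<Sum>P\<in>S. \<iota> (\<kappa> P) * u P) \<in> (\<lambda>v. y * v) ` ?V" for \<kappa>
  proof
    fix P assume P: "P \<in> S"
    have P': "P \<in> \<X>" using P Sp by blast
    have "y * v \<in> \<m> P" if "v \<in> ?V" for v
    proof -
      have "y \<in> \<m> P" using pos[OF P] by (simp add: val_ge_def)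
      moreover have "v \<in> \<O> P" using that P by (simp add: semilocal_def)
      ultimately show ?thesis using val_ge_mult[OF P', of y 1 v 0] by simp
    qed
    then have 1: "(\<Sum>Q\<in>S. \<iota> (\<kappa> Q) * u Q) \<in> \<m> P" using sum by auto
    have 2: "(\<Sum>Q\<in>S - {P}. \<iota> (\<kappa> Q) * u Q) \<in> \<m> P"
      using P u_other by (intro val_ge_sum[OF P'] val_ge_scale[OF P']) auto
    have 3: "\<iota> (\<kappa> P) * (u P - 1) \<in> \<m> P" by (rule val_ge_scale[OF P' u_self[OF P]])
    have "\<iota> (\<kappa> P) = (\<Sum>Q\<in>S. \<iota> (\<kappa> Q) * u Q) - (\<Sum>Q\<in>S - {P}. \<iota> (\<kappa> Q) * u Q) - \<iota> (\<kappa> P) * (u P - 1)"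
      using sum.remove[OF S(1) P, of "\<lambda>Q. \<iota> (\<kappa> Q) * u Q"] by (simp add: algebra_simps)
    then have "\<iota> (\<kappa> P) \<in> \<m> P" using val_ge_diff[OF P' val_ge_diff[OF P' 1 2] 3] by simp
    then show "\<kappa> P = 0" using \<iota>_val_ge_1_iff[OF P'] by simp
  qed
  have "card (u ` S) \<le> N"
  proof (rule N[OF V])
    have "y \<in> ?V" using pos y by (force simp: semilocal_def val_ge_def)
    then show "\<forall>v\<in>?V. y * v \<in> ?V" using semilocal_mult[OF Sp] by blast
    show "u ` S \<subseteq> ?V"
    proof clarify
      fix P assume "P \<in> S"
      have "u P \<in> \<O> Q" if Q: "Q \<in> S" for Q
      proof (cases "Q = P")
        case True
        have Q': "Q \<in> \<X>" using Q Sp by blast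
        have "(u P - 1) + 1 \<in> \<O> Q" using u_self[OF Q] True
          by (intro val_ge_add[OF Q'] one_val_ge[OF Q']) (auto intro: val_ge_mono[of 0 1])
        then show ?thesis by simp
      next
        case False
        then show ?thesis using u_other[OF Q, of P] by (intro val_ge_mono[of 0 1]) auto
      qed
      then show "u P \<in> ?V" by (simp add: semilocal_def)
    qed
    show "quotient_independent (const_scale \<iota>) ((\<lambda>v. y * v) ` ?V) (u ` S)"
      by (rule F.family_quotient_independent[OF S(1) W indep])
  qed
  moreover have "inj_on u S" by (rule F.family_inj[OF S(1) W indep])
  ultimately show False using S(2) by (simp add: card_image)
qed

lemma finite_poles: "finite {P \<in> \<X>. P f < 0}"
proof (cases "f = 0")
  case True
  then have "{P \<in> \<X>. P f < 0} = {}" by (auto simp: place_0)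
  then show ?thesis by (simp only: finite.emptyI)
next
  case False
  have "{P \<in> \<X>. P f < 0} = {P \<in> \<X>. 0 < P (inverse f)}" by (auto simp: place_inverse)
  then show ?thesis using finite_zeros[of "inverse f"] False by simp
qed

section \<open>Divisors and adeles\<close>

lemma divisors_finite: "B \<in> Div \<Longrightarrow> finite (Supp B)"
  and divisors_places: "B \<in> Div \<Longrightarrow> P \<notin> \<X> \<Longrightarrow> B P = 0"
  by (auto simp: divisors_def Supp_def)

lemma divisorsI: "finite S \<Longrightarrow> S \<subseteq> \<X> \<Longrightarrow> (\<And>P. P \<notin> S \<Longrightarrow> B P = 0) \<Longrightarrow> B \<in> Div"
proof -
  assume S: "finite S" "S \<subseteq> \<X>" "\<And>P. P \<notin> S \<Longrightarrow> B P = 0"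
  have "Supp B \<subseteq> S" using S(3) by (auto simp: Supp_def)
  then show ?thesis using S finite_subset by (auto simp: divisors_def)
qed

lemma divisors_combine:
  assumes B: "B \<in> Div" and C: "C \<in> Div" and f: "f 0 0 = 0"
  shows "(\<lambda>P. f (B P) (C P)) \<in> Div"
  by (rule divisorsI[of "Supp B \<union> Supp C"]) (use assms in \<open>auto simp: divisors_def Supp_def\<close>)

lemma divisors_add: "B \<in> Div \<Longrightarrow> C \<in> Div \<Longrightarrow> B + C \<in> Div"
  and divisors_diff: "B \<in> Div \<Longrightarrow> C \<in> Div \<Longrightarrow> B - C \<in> Div"
  and divisors_sup: "B \<in> Div \<Longrightarrow> C \<in> Div \<Longrightarrow> sup B C \<in> Div"
  and divisors_inf: "B \<in> Div \<Longrightarrow> C \<in> Div \<Longrightarrow> inf B C \<in> Div"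
  using divisors_combine[of B C "(+)"] divisors_combine[of B C "(-)"] divisors_combine[of B C sup]
    divisors_combine[of B C inf]
  by (simp_all add: plus_fun_def fun_diff_def sup_fun_def inf_fun_def)

lemma divisors_0: "0 \<in> Div"
  by (rule divisorsI[of "{}"]) auto

lemma divisors_minus: "B \<in> Div \<Longrightarrow> - B \<in> Div"
  using divisors_diff[OF divisors_0, of B] by simp

lemma point_divisor_in_divisors: "P \<in> \<X> \<Longrightarrow> point_divisor P \<in> Div"
  by (rule divisorsI[of "{P}"]) (auto simp: point_divisor_def)

lemma principal_divisor_in_divisors: "principal_divisor \<iota> h \<in> Div"
proof (cases "h = 0")
  case True
  then have "principal_divisor \<iota> h = 0" by (auto simp: principal_divisor_def place_0 fun_eq_iff)
  then show ?thesis by (simp add: divisors_0)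
next
  case False
  show ?thesis by (rule divisorsI[of "{P \<in> \<X>. 0 < P h} \<union> {P \<in> \<X>. P h < 0}"])
      (use finite_zeros[OF False] finite_poles in \<open>auto simp: principal_divisor_def\<close>)
qed

lemma divisor_degree_superset:
  assumes "finite S" "Supp B \<subseteq> S"
  shows "deg B = (\<Sum>P\<in>S. B P * int (place_degree \<iota> P))"
  unfolding divisor_degree_def by (rule sum.mono_neutral_left) (use assms in \<open>auto simp: Supp_def\<close>)

lemma divisor_degree_add:
  assumes B: "B \<in> Div" and C: "C \<in> Div"
  shows "deg (B + C) = deg B + deg C"
proof -
  let ?S = "Supp B \<union> Supp C"
  have S: "finite ?S" using assms by (simp add: divisors_finite)
  have "Supp (B + C) \<subseteq> ?S" by (auto simp: Supp_def)
  then show ?thesis using S by (simp add: divisor_degree_superset[of ?S] sum.distrib algebra_simps)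
qed

lemma divisor_degree_0: "deg 0 = 0"
  by (simp add: divisor_degree_def Supp_def)

lemma divisor_degree_minus: "deg (- B) = - deg B"
  by (simp add: divisor_degree_def Supp_def sum_negf)

lemma divisor_degree_diff:
  "B \<in> Div \<Longrightarrow> C \<in> Div \<Longrightarrow>
    deg (B - C) = deg B - deg C"
  using divisor_degree_add[of B "- C"] divisors_minus[of C] divisor_degree_minus[of C] by simp

lemma divisor_degree_point: "P \<in> \<X> \<Longrightarrow> deg (point_divisor P) = int (place_degree \<iota> P)"
  by (subst divisor_degree_superset[of "{P}"]) (auto simp: Supp_def point_divisor_def)

subsection \<open>Degrees as dimensions\<close>

lemma card_residue_field:
  assumes P: "P \<in> \<X>"
  shows "finite (quotient_space (\<O> P) (\<m> P))"
    and "card (quotient_space (\<O> P) (\<m> P)) = CARD('k) ^ place_degree \<iota> P"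
proof -
  obtain t where t: "P t = 1" "t \<noteq> 0" using uniformizer_exists[OF P] .
  have "\<m> P = (\<lambda>v. t * v) ` \<O> P"
  proof
    show "\<m> P \<subseteq> (\<lambda>v. t * v) ` \<O> P"
    proof
      fix f assume "f \<in> \<m> P"
      then have "f / t \<in> \<O> P" using val_ge_mult_iff[OF P t(2), of "f / t" 1] t by simp
      then show "f \<in> (\<lambda>v. t * v) ` \<O> P" using t(2) by (intro image_eqI[of _ _ "f / t"]) auto
    qed
    show "(\<lambda>v. t * v) ` \<O> P \<subseteq> \<m> P" using val_ge_mult_iff[OF P t(2), of _ 1] t(1) by auto
  qed
  moreover have "t * v \<in> \<O> P" if "v \<in> \<O> P" for v
    using val_ge_mult_iff[OF P t(2), of v 0] t(1) val_ge_mono[of "-1" 0] that by simp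
  ultimately show fin: "finite (quotient_space (\<O> P) (\<m> P))"
    using finite_quotient_mult[OF t(2) val_ge_subspace[OF P]] by simp
  show "card (quotient_space (\<O> P) (\<m> P)) = CARD('k) ^ place_degree \<iota> P"
    unfolding place_degree_def by (rule F.card_quotient_space) (intro val_ge_subspace P fin)+
qed

lemma place_degree_pos:
  assumes P: "P \<in> \<X>"
  shows "0 < place_degree \<iota> P"
proof (rule ccontr)
  assume "\<not> ?thesis"
  then have "card (quotient_space (\<O> P) (\<m> P)) = 1" using card_residue_field(2)[OF P] by simp
  then obtain S where "quotient_space (\<O> P) (\<m> P) = {S}" by (rule card_1_singletonE)
  then have "1 +o \<m> P = 0 +o \<m> P"
    using one_val_ge[OF P] zero_val_ge[of P 0] unfolding quotient_space_def by blast
  then show False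
    using coset_eq_iff[OF F.add_subgroup_subspace[OF val_ge_subspace[OF P, of 1]], of 1 0]
      one_notin_val_ge_1[OF P] by simp
qed

lemma card_val_ge_step:
  assumes P: "P \<in> \<X>"
  shows "card (quotient_space (val_ge P n) (val_ge P (n + 1))) = CARD('k) ^ place_degree \<iota> P"
    and "finite (quotient_space (val_ge P n) (val_ge P (n + 1)))"
proof -
  obtain t where t: "P t = 1" "t \<noteq> 0" using uniformizer_exists[OF P] .
  define z where "z = t powi n"
  have z: "P z = n" "z \<noteq> 0" using t by (simp_all add: z_def place_power_int[OF P])
  note sub = F.add_subgroup_subspace[OF val_ge_subspace[OF P]]
  have onto: "\<exists>x\<in>\<O> P. y - z * x \<in> val_ge P (n + 1)" if "y \<in> val_ge P n" for y
  proof (rule bexI[of _ "y / z"])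
    show "y / z \<in> \<O> P" using val_ge_mult_iff[OF P z(2), of "y / z" n] that z by simp
  qed (use z(2) in simp)
  have minus: "z * (x - y) = z * x - z * y" if "x \<in> \<O> P" "y \<in> \<O> P" for x y
    by (rule right_diff_distrib)
  note cong = quotient_space_cong[OF sub sub sub, of 0 "\<lambda>f. z * f" "val_ge P n" "n + 1" 1]
  have map: "z * x \<in> val_ge P n" if "x \<in> \<O> P" for x
    using val_ge_mult_iff[OF P z(2), of x n] that z by simp
  have ker: "z * x \<in> val_ge P (n + 1) \<longleftrightarrow> x \<in> \<m> P" if "x \<in> \<O> P" for x
    using val_ge_mult_iff[OF P z(2), of x "n + 1"] z by simp
  show "card (quotient_space (val_ge P n) (val_ge P (n + 1))) = CARD('k) ^ place_degree \<iota> P"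
    using cong(1)[OF minus map onto ker] card_residue_field(2)[OF P] by simp
  show "finite (quotient_space (val_ge P n) (val_ge P (n + 1)))"
    using cong(2)[OF minus map onto ker] card_residue_field(1)[OF P] by simp
qed

lemma adeles_subspace: "A.subspace (\<A>)"
proof (rule A.subspaceI)
  show "0 \<in> \<A>" by (simp add: adeles_def)
  fix \<alpha> \<beta> :: "('a \<Rightarrow> int) \<Rightarrow> 'a" assume ab: "\<alpha> \<in> \<A>" "\<beta> \<in> \<A>"
  have "{P \<in> \<X>. (\<alpha> + \<beta>) P \<notin> \<O> P} \<subseteq>
      {P \<in> \<X>. \<alpha> P \<notin> \<O> P} \<union> {P \<in> \<X>. \<beta> P \<notin> \<O> P}" by (auto dest: val_ge_add)
  then show "\<alpha> + \<beta> \<in> \<A>" using ab by (auto simp: adeles_def intro: finite_subset)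
next
  fix c and \<alpha> :: "('a \<Rightarrow> int) \<Rightarrow> 'a" assume a: "\<alpha> \<in> \<A>"
  have "{P \<in> \<X>. \<iota> c * \<alpha> P \<notin> \<O> P} \<subseteq> {P \<in> \<X>. \<alpha> P \<notin> \<O> P}" by (auto dest: val_ge_scale)
  then show "(\<lambda>P. \<iota> c * \<alpha> P) \<in> \<A>" using a by (auto simp: adeles_def intro: finite_subset)
qed

lemma adeles_at_subspace: "A.subspace (adeles_at \<iota> B)"
  by (rule A.subspaceI)
    (auto simp: adeles_at_def intro: A.subspace_0[OF adeles_subspace] A.subspace_add[OF adeles_subspace]
      A.subspace_scale[OF adeles_subspace] val_ge_add val_ge_scale)

abbreviation diagonal :: "'a \<Rightarrow> ('a \<Rightarrow> int) \<Rightarrow> 'a" where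
  "diagonal f \<equiv> (\<lambda>P. if P \<in> \<X> then f else 0)"

lemma diagonal_adele: "diagonal f \<in> \<A>"
proof -
  have "{P \<in> \<X>. diagonal f P \<notin> \<O> P} \<subseteq> {P \<in> \<X>. P f < 0}" by (auto simp: val_ge_def)
  then show ?thesis using finite_subset[OF _ finite_poles[of f]] by (auto simp: adeles_def)
qed

lemma principal_adeles_subspace: "A.subspace (\<F>)"
proof (rule A.subspaceI)
  show "0 \<in> \<F>" unfolding principal_adeles_def by (rule image_eqI[of _ _ 0]) auto
  fix \<alpha> \<beta> :: "('a \<Rightarrow> int) \<Rightarrow> 'a" assume "\<alpha> \<in> \<F>" "\<beta> \<in> \<F>"
  then obtain f g where "\<alpha> = diagonal f" "\<beta> = diagonal g" by (auto simp: principal_adeles_def)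
  then show "\<alpha> + \<beta> \<in> \<F>" unfolding principal_adeles_def by (intro image_eqI[of _ _ "f + g"]) auto
next
  fix c and \<alpha> :: "('a \<Rightarrow> int) \<Rightarrow> 'a" assume "\<alpha> \<in> \<F>"
  then obtain f where "\<alpha> = diagonal f" by (auto simp: principal_adeles_def)
  then show "(\<lambda>P. \<iota> c * \<alpha> P) \<in> \<F>"
    unfolding principal_adeles_def by (intro image_eqI[of _ _ "\<iota> c * f"]) auto
qed

lemma principal_adeles_adeles: "\<F> \<subseteq> \<A>"
  using diagonal_adele by (auto simp: principal_adeles_def)

definition local_adele :: "('a \<Rightarrow> int) \<Rightarrow> 'a \<Rightarrow> ('a \<Rightarrow> int) \<Rightarrow> 'a" where
  "local_adele P f = (\<lambda>Q. if Q = P then f else 0)"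

lemma local_adele_adele: "P \<in> \<X> \<Longrightarrow> local_adele P f \<in> \<A>"
  by (auto simp: adeles_def local_adele_def intro: finite_subset[of _ "{P}"])

lemma local_adele_at: "P \<in> \<X> \<Longrightarrow> local_adele P f \<in> adeles_at \<iota> B \<longleftrightarrow> f \<in> val_ge P (- B P)"
  by (auto simp: adeles_at_def local_adele_adele) (auto simp: local_adele_def)

lemma card_adeles_step:
  assumes P: "P \<in> \<X>"
  shows "card (quotient_space (adeles_at \<iota> (B + point_divisor P)) (adeles_at \<iota> B)) =
      CARD('k) ^ place_degree \<iota> P"
    and "finite (quotient_space (adeles_at \<iota> (B + point_divisor P)) (adeles_at \<iota> B))"
proof -
  let ?C = "B + point_divisor P"
  have C: "?C P = B P + 1" "?C Q = B Q" if "Q \<noteq> P" for Q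
    using that by (auto simp: point_divisor_def)
  note subA = A.add_subgroup_subspace[OF adeles_at_subspace]
  note sub = F.add_subgroup_subspace[OF val_ge_subspace[OF P]]
  have CP: "- ?C P = - B P - 1" by (simp add: point_divisor_def)
  have map: "\<alpha> P \<in> val_ge P (- B P - 1)" if "\<alpha> \<in> adeles_at \<iota> ?C" for \<alpha>
    using that P CP by (auto simp: adeles_at_def)
  have onto: "\<exists>\<alpha>\<in>adeles_at \<iota> ?C. y - \<alpha> P \<in> val_ge P (- B P)" if "y \<in> val_ge P (- B P - 1)" for y
  proof (rule bexI[of _ "local_adele P y"])
    show "local_adele P y \<in> adeles_at \<iota> ?C" using that CP by (simp only: local_adele_at[OF P])
  qed (simp add: local_adele_def)
  have ker: "\<alpha> P \<in> val_ge P (- B P) \<longleftrightarrow> \<alpha> \<in> adeles_at \<iota> B" if "\<alpha> \<in> adeles_at \<iota> ?C" for \<alpha>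
  proof
    assume *: "\<alpha> P \<in> val_ge P (- B P)"
    have "\<alpha> Q \<in> val_ge Q (- B Q)" if Q: "Q \<in> \<X>" for Q
      using * \<open>\<alpha> \<in> adeles_at \<iota> ?C\<close> Q C(2)[of Q] by (cases "Q = P") (auto simp: adeles_at_def)
    then show "\<alpha> \<in> adeles_at \<iota> B" using that by (auto simp: adeles_at_def)
  qed (use P in \<open>auto simp: adeles_at_def\<close>)
  have minus: "(\<alpha> - \<beta>) P = \<alpha> P - \<beta> P" if "\<alpha> \<in> adeles_at \<iota> ?C" "\<beta> \<in> adeles_at \<iota> ?C" for \<alpha> \<beta> by simp
  note cong = quotient_space_cong[OF subA subA sub, of ?C "\<lambda>\<alpha>. \<alpha> P" "val_ge P (- B P - 1)" "- B P" B]
  show "card (quotient_space (adeles_at \<iota> ?C) (adeles_at \<iota> B)) = CARD('k) ^ place_degree \<iota> P"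
  proof -
    have "card (quotient_space (adeles_at \<iota> ?C) (adeles_at \<iota> B)) =
        card (quotient_space (val_ge P (- B P - 1)) (val_ge P (- B P)))"
      using minus map onto ker by (rule cong(1))
    then show ?thesis using card_val_ge_step(1)[OF P, of "- B P - 1"] by simp
  qed
  show "finite (quotient_space (adeles_at \<iota> ?C) (adeles_at \<iota> B))"
  proof -
    have "finite (quotient_space (adeles_at \<iota> ?C) (adeles_at \<iota> B)) \<longleftrightarrow>
        finite (quotient_space (val_ge P (- B P - 1)) (val_ge P (- B P)))"
      using minus map onto ker by (rule cong(2))
    then show ?thesis using card_val_ge_step(2)[OF P, of "- B P - 1"] by simp
  qed
qed

lemma adeles_at_mono: "B \<le> C \<Longrightarrow> adeles_at \<iota> B \<subseteq> adeles_at \<iota> C"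
  by (auto simp: adeles_at_def le_fun_def elim!: val_ge_mono[rotated])

text \<open>
  Adding one point to the divisor enlarges the adeles by one residue field.
\<close>

lemma card_adeles_quotient:
  assumes "B \<in> Div" "C \<in> Div" "B \<le> C"
  shows "finite (quotient_space (adeles_at \<iota> C) (adeles_at \<iota> B)) \<and>
    deg B \<le> deg C \<and>
    card (quotient_space (adeles_at \<iota> C) (adeles_at \<iota> B)) =
      CARD('k) ^ nat (deg C - deg B)"
  using assms(2,3)
proof (induction "nat (\<Sum>P\<in>Supp B \<union> Supp C. C P - B P)" arbitrary: C rule: less_induct)
  case less
  note subA = A.add_subgroup_subspace[OF adeles_at_subspace]
  show ?case
  proof (cases "C = B")
    case True
    have "quotient_space (adeles_at \<iota> B) (adeles_at \<iota> B) = {adeles_at \<iota> B}"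
    proof -
      have "\<alpha> +o adeles_at \<iota> B = 0 +o adeles_at \<iota> B" if "\<alpha> \<in> adeles_at \<iota> B" for \<alpha>
        using that coset_eq_iff[OF subA, of \<alpha> B 0] by simp
      then show ?thesis using A.subspace_0[OF adeles_at_subspace] by (auto simp: quotient_space_def)
    qed
    then show ?thesis using True by simp
  next
    case False
    then obtain P where P: "B P < C P" using less.prems(2) by (metis ext le_fun_def order_less_le)
    have pl: "P \<in> \<X>" using P divisors_places[OF assms(1)] divisors_places[OF less.prems(1)] by force
    define C' where "C' = C - point_divisor P"
    have C': "C' \<in> Div" "C = C' + point_divisor P"
      using divisors_diff[OF less.prems(1) point_divisor_in_divisors[OF pl]] by (simp_all add: C'_def)
    have le: "B \<le> C'" using less.prems(2) P by (auto simp: le_fun_def C'_def point_divisor_def)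
    have fin: "finite (Supp B \<union> Supp C)" using assms(1) less.prems(1) by (simp add: divisors_finite)
    have "Supp C' \<subseteq> Supp B \<union> Supp C" using P by (auto simp: Supp_def C'_def point_divisor_def)
    then have "(\<Sum>P\<in>Supp B \<union> Supp C'. C' P - B P) = (\<Sum>P\<in>Supp B \<union> Supp C. C' P - B P)"
      using fin by (intro sum.mono_neutral_left) (auto simp: Supp_def)
    also have "\<dots> = (\<Sum>Q\<in>Supp B \<union> Supp C. (C Q - B Q) - (if Q = P then 1 else 0))"
      by (rule sum.cong) (auto simp: C'_def point_divisor_def)
    also have "\<dots> = (\<Sum>Q\<in>Supp B \<union> Supp C. C Q - B Q) - 1"
      using fin P by (auto simp: sum_subtractf Supp_def)
    finally have sum: "(\<Sum>P\<in>Supp B \<union> Supp C'. C' P - B P) = (\<Sum>Q\<in>Supp B \<union> Supp C. C Q - B Q) - 1" .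
    have nonneg: "0 \<le> (\<Sum>P\<in>Supp B \<union> Supp C'. C' P - B P)"
      using le by (intro sum_nonneg) (simp add: le_fun_def)
    have IH: "finite (quotient_space (adeles_at \<iota> C') (adeles_at \<iota> B))"
      "deg B \<le> deg C'"
      "card (quotient_space (adeles_at \<iota> C') (adeles_at \<iota> B)) =
        CARD('k) ^ nat (deg C' - deg B)" using less.hyps[of C'] C' le sum nonneg by auto
    have CC: "C' \<le> C" by (auto simp: C'_def le_fun_def point_divisor_def)
    note tower = quotient_space_tower[OF subA subA subA adeles_at_mono[OF le] adeles_at_mono[OF CC]]
    have deg: "deg C = deg C' + int (place_degree \<iota> P)"
      unfolding C'(2) divisor_degree_add[OF C'(1) point_divisor_in_divisors[OF pl]]
      by (simp add: divisor_degree_point[OF pl])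
    have "nat (deg C - deg B) =
        place_degree \<iota> P + nat (deg C' - deg B)" using deg IH(2) by simp
    then show ?thesis
      using tower card_adeles_step[OF pl, of C', folded C'(2)] IH deg by (simp add: power_add)
  qed
qed

subsection \<open>Riemann-Roch spaces\<close>

lemma RR_space_iff:
  assumes B: "B \<in> Div"
  shows "h \<in> L B \<longleftrightarrow> (\<forall>P\<in>\<X>. h \<in> val_ge P (- B P))"
proof (cases "h = 0")
  case False
  have "h \<in> L B \<longleftrightarrow> (\<forall>P. 0 \<le> principal_divisor \<iota> h P + B P)"
    using False by (auto simp: RR_space_def le_fun_def)
  also have "\<dots> \<longleftrightarrow> (\<forall>P\<in>\<X>. 0 \<le> P h + B P)"
    using divisors_places[OF B] by (auto simp: principal_divisor_def)
  also have "\<dots> \<longleftrightarrow> (\<forall>P\<in>\<X>. h \<in> val_ge P (- B P))" using False by (auto simp: val_ge_def algebra_simps)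
  finally show ?thesis .
qed (simp add: RR_space_def)

lemma RR_space_subspace: "B \<in> Div \<Longrightarrow> F.subspace (L B)"
  by (rule F.subspaceI) (auto simp: RR_space_iff val_ge_add val_ge_scale)

lemma diagonal_at_iff:
  "B \<in> Div \<Longrightarrow> diagonal h \<in> adeles_at \<iota> B \<longleftrightarrow> h \<in> L B"
  by (auto simp: RR_space_iff adeles_at_def diagonal_adele)

lemma RR_space_mono: "B \<in> Div \<Longrightarrow> C \<in> Div \<Longrightarrow> B \<le> C \<Longrightarrow> L B \<subseteq> L C"
  using adeles_at_mono[of B C] diagonal_at_iff by blast

lemma RR_space_0: "L 0 = range \<iota>"
proof
  show "L 0 \<subseteq> range \<iota>"
  proof
    fix h assume h: "h \<in> L 0"
    show "h \<in> range \<iota>"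
    proof (rule ccontr)
      assume "h \<notin> range \<iota>"
      then obtain P where "P \<in> \<X>" "P h < 0" using exists_pole by blast
      then show False using h RR_space_iff[OF divisors_0] place_0 by (force simp: val_ge_def)
    qed
  qed
  show "range \<iota> \<subseteq> L 0" using RR_space_iff[OF divisors_0] \<iota>_val_ge by auto
qed

lemma global_sections_quotient:
  assumes B: "B \<in> Div" and C: "C \<in> Div"
  shows "card (quotient_space (L C) (L B)) =
      card (quotient_space (adeles_at \<iota> C \<inter> \<F>) (adeles_at \<iota> B \<inter> \<F>))"
    and "finite (quotient_space (L C) (L B)) \<longleftrightarrow>
      finite (quotient_space (adeles_at \<iota> C \<inter> \<F>) (adeles_at \<iota> B \<inter> \<F>))"
proof -
  note sub = F.add_subgroup_subspace[OF RR_space_subspace]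
  have subA: "add_subgroup (adeles_at \<iota> E \<inter> \<F>)" for E
    by (intro add_subgroup_Int A.add_subgroup_subspace adeles_at_subspace principal_adeles_subspace)
  have onto: "\<exists>h\<in>L C. \<alpha> - diagonal h \<in> adeles_at \<iota> B \<inter> \<F>"
    if "\<alpha> \<in> adeles_at \<iota> C \<inter> \<F>" for \<alpha>
  proof -
    obtain h where h: "\<alpha> = diagonal h"
      using \<open>\<alpha> \<in> adeles_at \<iota> C \<inter> \<F>\<close> by (auto simp: principal_adeles_def)
    have "h \<in> L C" using that diagonal_at_iff[OF C] by (simp add: h)
    moreover have "\<alpha> - diagonal h \<in> adeles_at \<iota> B \<inter> \<F>"
      unfolding h using add_subgroupD(1)[OF subA] by simp
    ultimately show ?thesis by blast
  qed
  have minus: "diagonal (x - y) = diagonal x - diagonal y" for x y by (rule ext) simp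
  have pr: "diagonal h \<in> \<F>" for h by (simp add: principal_adeles_def)
  note cong = quotient_space_cong[OF sub[OF C] sub[OF B] subA, of diagonal
      "adeles_at \<iota> C \<inter> \<F>", OF minus _ onto]
  show "card (quotient_space (L C) (L B)) =
      card (quotient_space (adeles_at \<iota> C \<inter> \<F>) (adeles_at \<iota> B \<inter> \<F>))"
    by (rule cong(1)) (simp_all only: Int_iff diagonal_at_iff[OF B] diagonal_at_iff[OF C] pr simp_thms)
  show "finite (quotient_space (L C) (L B)) \<longleftrightarrow>
      finite (quotient_space (adeles_at \<iota> C \<inter> \<F>) (adeles_at \<iota> B \<inter> \<F>))"
    by (rule cong(2)) (simp_all only: Int_iff diagonal_at_iff[OF B] diagonal_at_iff[OF C] pr simp_thms)
qed

lemma finite_quotient_RR: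
  assumes B: "B \<in> Div" and C: "C \<in> Div" and le: "B \<le> C"
  shows "finite (quotient_space (L C) (L B))"
  using quotient_space_exact(2)[OF A.add_subgroup_subspace[OF adeles_at_subspace]
      A.add_subgroup_subspace[OF adeles_at_subspace] A.add_subgroup_subspace[OF principal_adeles_subspace]
      adeles_at_mono[OF le]]
    card_adeles_quotient[OF B C le] global_sections_quotient(2)[OF B C] by simp

lemma finite_iff_quotient_zero: "finite V \<longleftrightarrow> finite (quotient_space V {0 :: 'a})"
  using bij_betw_finite[OF F.quotient_space_zero] by blast

text \<open>
  Compare with \<open>L(0)\<close>, the finite set of constants: the difference is bounded by the degree.
\<close>

lemma RR_space_finite:
  assumes B: "B \<in> Div"
  shows "finite (L B)"
proof -
  let ?C = "sup B 0"
  have C: "?C \<in> Div" "0 \<le> ?C" "B \<le> ?C" using divisors_sup[OF B divisors_0] by auto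
  have "finite (quotient_space (L 0) {0})"
    using finite_iff_quotient_zero[of "L 0"] by (simp add: RR_space_0)
  moreover have "{0} \<subseteq> L 0" by (simp add: RR_space_def)
  ultimately have "finite (quotient_space (L ?C) {0})"
    using quotient_space_tower(2)[OF F.add_subgroup_subspace[OF RR_space_subspace[OF C(1)]]
        F.add_subgroup_subspace[OF RR_space_subspace[OF divisors_0]]
        F.add_subgroup_subspace[OF F.subspace_single_0] _ RR_space_mono[OF divisors_0 C(1,2)]]
      finite_quotient_RR[OF divisors_0 C(1,2)] by blast
  then have "finite (L ?C)" by (simp add: finite_iff_quotient_zero)
  then show ?thesis using finite_subset[OF RR_space_mono[OF B C(1,3)]] by blast
qed

lemma card_RR_space: "B \<in> Div \<Longrightarrow> card (L B) = CARD('k) ^ ell \<iota> B"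
  unfolding ell_def by (rule F.card_subspace[OF RR_space_subspace RR_space_finite])

lemma ell_0: "ell \<iota> 0 = 1"
proof -
  have "CARD('k) ^ ell \<iota> 0 = CARD('k) ^ 1"
    using card_RR_space[OF divisors_0] card_image[OF inj_\<iota>] by (simp add: RR_space_0)
  then show ?thesis using q_ge_2 power_inject_exp[of "CARD('k)" "ell \<iota> 0" 1] by simp
qed

text \<open>
  The Euler characteristics of \<open>O(B) \<subseteq> O(C)\<close> differ by the degree; cardinalities take the place of dimensions.
\<close>

lemma cokernel_quotient:
  assumes B: "B \<in> Div" and C: "C \<in> Div" and le: "B \<le> C"
  defines "Q \<equiv> quotient_space (adeles_at \<iota> C + \<F>) (adeles_at \<iota> B + \<F>)"
  shows "finite Q"
    and "CARD('k) ^ ell \<iota> C * card Q =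
      CARD('k) ^ ell \<iota> B * CARD('k) ^ nat (deg C - deg B)"
proof -
  note exact = quotient_space_exact[OF A.add_subgroup_subspace[OF adeles_at_subspace]
      A.add_subgroup_subspace[OF adeles_at_subspace] A.add_subgroup_subspace[OF principal_adeles_subspace]
      adeles_at_mono[OF le]]
  note deg = card_adeles_quotient[OF B C le]
  show "finite Q" using exact(2) deg by (simp add: Q_def)
  have Z: "F.subspace {0}" by (rule F.subspace_single_0)
  have "card (L C) = card (quotient_space (L C) (L B)) * card (L B)"
    using quotient_space_tower(1)[OF F.add_subgroup_subspace[OF RR_space_subspace[OF C]]
        F.add_subgroup_subspace[OF RR_space_subspace[OF B]] F.add_subgroup_subspace[OF Z]
        _ RR_space_mono[OF B C le]] bij_betw_same_card[OF F.quotient_space_zero]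
    by (simp add: RR_space_def)
  then have "CARD('k) ^ ell \<iota> C =
      card (quotient_space (adeles_at \<iota> C \<inter> \<F>) (adeles_at \<iota> B \<inter> \<F>)) *
      CARD('k) ^ ell \<iota> B" by (simp add: card_RR_space B C global_sections_quotient(1))
  then show "CARD('k) ^ ell \<iota> C * card Q =
      CARD('k) ^ ell \<iota> B * CARD('k) ^ nat (deg C - deg B)" using exact(1) deg by (simp add: Q_def)
qed

end

section \<open>The theorem of Riemann\<close>

context curve
begin

definition zero_divisor :: "'a \<Rightarrow> 'a dvsr" where
  "zero_divisor y = sup (principal_divisor \<iota> y) 0"

lemma zero_divisor_in_divisors: "zero_divisor y \<in> Div"
  unfolding zero_divisor_def by (intro divisors_sup principal_divisor_in_divisors divisors_0)

lemma zero_divisor_apply: "P \<in> \<X> \<Longrightarrow> zero_divisor y P = max (P y) 0"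
  by (simp add: zero_divisor_def principal_divisor_def sup_max)

lemma zero_divisor_nonneg: "0 \<le> zero_divisor y P"
  by (simp add: zero_divisor_def)

lemma divisors_scale: "B \<in> Div \<Longrightarrow> (\<lambda>P. c * B P) \<in> Div"
  using divisors_combine[of B 0 "\<lambda>a b. c * a"] divisors_0 by simp

lemma divisor_degree_scale: "B \<in> Div \<Longrightarrow> deg (\<lambda>P. c * B P) = c * deg B"
  by (subst divisor_degree_superset[of "Supp B"])
    (auto simp: Supp_def divisors_def divisor_degree_def sum_distrib_left mult.assoc)

definition defect :: "'a dvsr \<Rightarrow> int" where
  "defect B = deg B - int (ell \<iota> B)"

lemma card_cokernel:
  assumes B: "B \<in> Div" and C: "C \<in> Div" and le: "B \<le> C"
  shows "defect B \<le> defect C"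
    and "card (quotient_space (adeles_at \<iota> C + \<F>) (adeles_at \<iota> B + \<F>)) =
      CARD('k) ^ nat (defect C - defect B)"
proof -
  define Q where
    "Q = quotient_space (adeles_at \<iota> C + \<F>) (adeles_at \<iota> B + \<F>)"
  have deg: "deg B \<le> deg C" using card_adeles_quotient[OF B C le] by blast
  have eq: "CARD('k) ^ ell \<iota> C * card Q =
      CARD('k) ^ (ell \<iota> B + nat (deg C - deg B))"
    using cokernel_quotient(2)[OF B C le] by (simp add: Q_def power_add)
  have "A.subspace (adeles_at \<iota> C + \<F>)"
    by (intro A.subspace_plus adeles_at_subspace principal_adeles_subspace)
  then have "Q \<noteq> {}" unfolding Q_def by (intro quotient_space_nonempty) (auto dest: A.subspace_0)
  then have "0 < card Q" using cokernel_quotient(1)[OF B C le] by (simp add: Q_def card_gt_0_iff)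
  then have "CARD('k) ^ ell \<iota> C \<le> CARD('k) ^ (ell \<iota> B + nat (deg C - deg B))"
    unfolding eq[symmetric] by simp
  then have le': "ell \<iota> C \<le> ell \<iota> B + nat (deg C - deg B)"
    using q_ge_2 by (simp add: power_le_imp_le_exp)
  then show "defect B \<le> defect C" using deg by (simp add: defect_def)
  have "ell \<iota> B + nat (deg C - deg B) = ell \<iota> C + nat (defect C - defect B)"
    using le' deg by (simp add: defect_def)
  then have "CARD('k) ^ ell \<iota> C * card Q = CARD('k) ^ ell \<iota> C * CARD('k) ^ nat (defect C - defect B)"
    by (simp add: eq power_add)
  then show "card Q = CARD('k) ^ nat (defect C - defect B)" using q_ge_2 by simp
qed

end

context curve_coord
begin

lemma pev_val_ge: "P \<in> \<X> \<Longrightarrow> x \<in> \<O> P \<Longrightarrow> pev p x \<in> \<O> P"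
  by (induction p) (auto intro: val_ge_add \<iota>_val_ge val_ge_mult0)

text \<open>If two polynomials agree at \<open>P\<close>, then their difference vanishes at \<open>P\<close>.\<close>

lemma polynomial_vanishing_at:
  assumes P: "P \<in> \<X>" "x \<in> \<O> P"
  shows "\<exists>p. p \<noteq> 0 \<and> pev p x \<in> \<m> P"
proof -
  let ?h = "\<lambda>n. x ^ n +o \<m> P"
  have "range ?h \<subseteq> quotient_space (\<O> P) (\<m> P)"
    using val_ge_power[OF P] by (auto simp: quotient_space_def)
  then have "finite (range ?h)" using card_residue_field(1)[OF P(1)] finite_subset by blast
  then have "\<not> inj ?h" using finite_imageD infinite_UNIV_nat by blast
  then obtain n m where nm: "n \<noteq> m" "?h n = ?h m" by (auto simp: inj_def)
  have "x ^ n - x ^ m \<in> \<m> P"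
    using nm(2) coset_eq_iff[OF F.add_subgroup_subspace[OF val_ge_subspace[OF P(1), of 1]]] by blast
  moreover have "monom 1 n - monom 1 m \<noteq> (0 :: 'k poly)"
    using nm(1) by (metis coeff_diff coeff_monom diff_0_right coeff_0 one_neq_zero)
  ultimately show ?thesis by (intro exI[of _ "monom 1 n - monom 1 m"]) simp
qed

lemma polynomial_vanishing_order:
  assumes S: "finite S" "S \<subseteq> \<X>" "\<And>P. P \<in> S \<Longrightarrow> x \<in> \<O> P"
  shows "\<exists>p. p \<noteq> 0 \<and> (\<forall>P\<in>S. pev p x \<in> val_ge P (int (n P)))"
proof -
  have "\<forall>P\<in>S. \<exists>p. p \<noteq> 0 \<and> pev p x \<in> \<m> P" using S polynomial_vanishing_at by blast
  then obtain p where p: "\<And>P. P \<in> S \<Longrightarrow> p P \<noteq> 0" "\<And>P. P \<in> S \<Longrightarrow> pev (p P) x \<in> \<m> P" by metis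
  let ?p = "\<Prod>P\<in>S. p P ^ n P"
  have "pev ?p x \<in> val_ge P (int (n P))" if P: "P \<in> S" for P
  proof -
    have P': "P \<in> \<X>" using P S by blast
    have pow: "f ^ m \<in> val_ge P (int m)" if "f \<in> \<m> P" for f m
      using that by (induction m) (auto simp: one_val_ge[OF P'] dest: val_ge_mult[OF P', of f 1])
    have "pev (\<Prod>Q\<in>S - {P}. p Q ^ n Q) x \<in> \<O> P" by (rule pev_val_ge[OF P' S(3)[OF P]])
    moreover have "pev ?p x = pev (\<Prod>Q\<in>S - {P}. p Q ^ n Q) x * pev (p P) x ^ n P"
      using prod.remove[OF S(1) P, of "\<lambda>Q. p Q ^ n Q"] by (simp add: mult.commute)
    ultimately show ?thesis using val_ge_mult0[OF P' _ pow[OF p(2)[OF P]]] by simp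
  qed
  moreover have "?p \<noteq> 0" using p(1) S(1) by simp
  ultimately show ?thesis by blast
qed

text \<open>
  The quotient \<open>V / yV\<close> for the functions \<open>V\<close> that are regular at all zeros of \<open>y\<close> is the product
  of the quotients at the single zeros, by weak approximation.
\<close>

lemma degree_zero_divisor_le:
  assumes y: "y \<noteq> 0" and c: "c \<noteq> 0" "degree c \<le> e" "\<And>b. b \<in> B \<Longrightarrow> pev c x * y * b \<in> bounded e"
  shows "deg (zero_divisor y) \<le> int (card B * e)"
proof -
  let ?Z = "zero_divisor y"
  have Z: "?Z \<in> Div" "- ?Z \<in> Div" "- ?Z \<le> 0"
    using zero_divisor_in_divisors divisors_minus[OF zero_divisor_in_divisors] zero_divisor_nonneg
    by (auto simp: le_fun_def)
  define S where "S = Supp ?Z"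
  have S: "finite S" "S \<subseteq> \<X>" using Z(1) by (auto simp: S_def divisors_def)
  have Sy: "?Z P = P y" "0 < P y" if "P \<in> S" for P
    using that S(2) zero_divisor_apply[of P y] by (auto simp: S_def Supp_def)
  let ?V = "semilocal S"
  let ?W = "(\<lambda>v. y * v) ` ?V"
  have V: "F.subspace ?V" and W: "F.subspace ?W"
    using semilocal_subspace[OF S(2)] subspace_mult by auto
  have "y \<in> ?V" using Sy(2) by (force simp: semilocal_def val_ge_def)
  then have yV: "y * v \<in> ?V" if "v \<in> ?V" for v using semilocal_mult[OF S(2)] that by blast
  have fin: "finite (quotient_space ?V ?W)" by (rule finite_quotient_mult[OF y V yV])
  let ?f = "\<lambda>(f :: 'a) P. if P \<in> S then f else 0"
  have minus: "?f (u - v) = ?f u - ?f v" for u v by (rule ext) simp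
  have map: "?f v \<in> adeles_at \<iota> 0" if "v \<in> ?V" for v
    using that S by (auto simp: adeles_at_def adeles_def semilocal_def intro: finite_subset[of _ S])
  have onto: "\<exists>v\<in>?V. \<alpha> - ?f v \<in> adeles_at \<iota> (- ?Z)" if a: "\<alpha> \<in> adeles_at \<iota> 0" for \<alpha>
  proof -
    define n where "n = (\<Sum>P\<in>S. ?Z P)"
    have n: "?Z P \<le> n" if "P \<in> S" for P
      unfolding n_def using that S(1) zero_divisor_nonneg by (intro member_le_sum) auto
    have n0: "0 \<le> n" unfolding n_def by (intro sum_nonneg zero_divisor_nonneg)
    obtain v where v: "\<And>P. P \<in> S \<Longrightarrow> v - \<alpha> P \<in> val_ge P n"
      using weak_approximation[OF S, of \<alpha> n] by blast
    have a0: "\<alpha> P \<in> \<O> P" if "P \<in> \<X>" for P using a that by (auto simp: adeles_at_def)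
    have "v \<in> \<O> P" if P: "P \<in> S" for P
    proof -
      have P': "P \<in> \<X>" using P S by blast
      have "(v - \<alpha> P) + \<alpha> P \<in> \<O> P" by (rule val_ge_add[OF P' val_ge_mono[OF n0 v[OF P]] a0[OF P']])
      then show ?thesis by simp
    qed
    then have "v \<in> ?V" by (simp add: semilocal_def)
    moreover have "\<alpha> - ?f v \<in> adeles_at \<iota> (- ?Z)" unfolding adeles_at_def mem_Collect_eq
    proof (intro conjI ballI)
      show "\<alpha> - ?f v \<in> \<A>"
        using A.subspace_diff[OF adeles_subspace] a map[OF \<open>v \<in> ?V\<close>] by (auto simp: adeles_at_def)
      fix P assume P: "P \<in> \<X>"
      show "(\<alpha> - ?f v) P \<in> val_ge P (- (- ?Z) P)"
      proof (cases "P \<in> S")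
        case True
        have "- (v - \<alpha> P) \<in> val_ge P (?Z P)"
          by (rule val_ge_neg[OF P val_ge_mono[OF n[OF True] v[OF True]]])
        then show ?thesis using True by simp
      next
        case False
        then have "?Z P = 0" by (simp add: S_def Supp_def)
        then show ?thesis using False a0[OF P] by simp
      qed
    qed
    ultimately show ?thesis by blast
  qed
  have ker: "?f v \<in> adeles_at \<iota> (- ?Z) \<longleftrightarrow> v \<in> ?W" if v: "v \<in> ?V" for v
  proof
    assume *: "?f v \<in> adeles_at \<iota> (- ?Z)"
    have "v / y \<in> \<O> P" if P: "P \<in> S" for P
    proof -
      have P': "P \<in> \<X>" using P S by blast
      have "?f v P \<in> val_ge P (?Z P)" using * P' by (auto simp: adeles_at_def)
      then show ?thesis using val_ge_mult_iff[OF P' y, of "v / y" "P y"] y P Sy(1)[OF P] by simp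
    qed
    then have "v / y \<in> ?V" by (simp add: semilocal_def)
    then show "v \<in> ?W" using y by (intro image_eqI[of _ _ "v / y"]) auto
  next
    assume "v \<in> ?W"
    then obtain w where w: "v = y * w" "w \<in> ?V" by blast
    have "?f v P \<in> val_ge P (?Z P)" if P: "P \<in> \<X>" for P
    proof (cases "P \<in> S")
      case True
      then show ?thesis
        using val_ge_mult_iff[OF P y, of w "P y"] w Sy(1)[OF True] by (simp add: semilocal_def)
    qed simp
    then show "?f v \<in> adeles_at \<iota> (- ?Z)" using map[OF v] by (auto simp: adeles_at_def)
  qed
  have "card (quotient_space ?V ?W) = card (quotient_space (adeles_at \<iota> 0) (adeles_at \<iota> (- ?Z)))"
    using minus map onto ker
    by (rule quotient_space_cong(1)[OF F.add_subgroup_subspace[OF V] F.add_subgroup_subspace[OF W]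
          A.add_subgroup_subspace[OF adeles_at_subspace]])
  also have "\<dots> = CARD('k) ^ nat (deg ?Z)" using card_adeles_quotient[OF Z(2) divisors_0 Z(3)]
    by (simp add: divisor_degree_minus divisor_degree_0)
  finally have card: "card (quotient_space ?V ?W) = CARD('k) ^ nat (deg ?Z)" .
  obtain T where T: "quotient_basis (const_scale \<iota>) ?V ?W T"
    using F.quotient_basis_exists[OF V W fin] by blast
  have "CARD('k) ^ card T = CARD('k) ^ nat (deg ?Z)"
    using F.card_quotient_basis(1)[OF V W T] card by simp
  then have "card T = nat (deg ?Z)" using q_ge_2 by (simp add: power_inject_exp)
  moreover have "card T \<le> card B * e"
  proof (rule card_quotient_independent_le[OF V y yV c])
    show "T \<subseteq> ?V" "quotient_independent (const_scale \<iota>) ?W T"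
      using T by (auto simp: quotient_basis_def quotient_independent_def)
  qed
  ultimately show ?thesis by linarith
qed

definition poles_x :: "'a dvsr" where
  "poles_x = zero_divisor (inverse x)"

lemma x_nonzero: "x \<noteq> 0"
  using transcendentalD[OF x, of "[:0, 1:]"] by auto

lemma degree_poles_x: "deg poles_x \<le> int (card B)"
proof -
  have "pev [:0, 1:] x * inverse x * b \<in> bounded 1" if "b \<in> B" for b
    using pev_basis_bounded[OF that, of 1 1] x_nonzero by simp
  then show ?thesis
    using degree_zero_divisor_le[of "inverse x" "[:0, 1:]" 1] x_nonzero by (simp add: poles_x_def)
qed

lemma degree_zeros_polynomial:
  "p \<noteq> 0 \<Longrightarrow> deg (zero_divisor (pev p x)) \<le> int (card B * degree p)"
  using degree_zero_divisor_le[of "pev p x" 1 "degree p"] transcendentalD[OF x] pev_basis_bounded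
  by simp

lemma place_pev:
  assumes P: "P \<in> \<X>" "P x < 0" and p: "p \<noteq> 0"
  shows "P (pev p x) \<le> int (degree p) * P x"
proof -
  let ?I = "{i. i \<le> degree p \<and> coeff p i \<noteq> 0}"
  have val: "P (\<iota> (coeff p i) * x ^ i) = int i * P x" if "i \<in> ?I" for i
    using that x_nonzero by (simp add: place_mult[OF P(1)] place_power[OF P(1)] place_\<iota>[OF P(1)])
  have sum: "pev p x = (\<Sum>i\<in>?I. \<iota> (coeff p i) * x ^ i)"
    unfolding pev_altdef by (rule sum.mono_neutral_right) auto
  have inj: "inj_on (\<lambda>i. P (\<iota> (coeff p i) * x ^ i)) ?I"
    using P(2) by (intro inj_onI) (simp add: val del: mem_Collect_eq)
  have deg: "degree p \<in> ?I" using p by simp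
  have "finite ?I" "?I \<noteq> {}" using deg by auto
  moreover have "\<iota> (coeff p i) * x ^ i \<noteq> 0" if "i \<in> ?I" for i using that x_nonzero by simp
  ultimately have "P (pev p x) \<le> P (\<iota> (coeff p (degree p)) * x ^ degree p)"
    unfolding sum using place_sum_distinct[OF P(1) _ _ _ inj] deg by blast
  then show ?thesis using val[OF deg] by simp
qed

lemma x_val_ge: "P \<in> \<X> \<Longrightarrow> 0 \<le> P x \<Longrightarrow> x \<in> \<O> P"
  by (simp add: val_ge_def)

lemma poles_x_apply: "P \<in> \<X> \<Longrightarrow> poles_x P = max (- P x) 0"
  by (simp add: poles_x_def zero_divisor_apply place_inverse)

lemma common_denominator_poles:
  assumes Y: "finite Y"
  shows "\<exists>s c. s \<noteq> 0 \<and> (\<forall>y\<in>Y. pev s x * y \<in> L (\<lambda>P. int c * poles_x P))"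
proof -
  have X: "poles_x \<in> Div" by (simp add: poles_x_def zero_divisor_in_divisors)
  have "\<exists>s. s \<noteq> 0 \<and> (\<forall>y\<in>Y. \<forall>P\<in>\<X>. 0 \<le> P x \<longrightarrow> pev s x * y \<in> \<O> P)"
  proof (rule common_denominator[OF Y])
    fix y
    let ?S = "{P \<in> \<X>. P y < 0 \<and> 0 \<le> P x}"
    have "finite ?S" by (rule finite_subset[OF _ finite_poles[of y]]) auto
    then obtain p where p: "p \<noteq> 0" "\<forall>P\<in>?S. pev p x \<in> val_ge P (int (nat (- P y)))"
      using polynomial_vanishing_order[of ?S "\<lambda>P. nat (- P y)"] x_val_ge by auto
    have "pev p x * y \<in> \<O> P" if P: "P \<in> \<X>" "0 \<le> P x" for P
    proof (cases "P y < 0")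
      case True
      then have "pev p x \<in> val_ge P (- P y)" using p(2) P by auto
      moreover have "y \<in> val_ge P (P y)" by (simp add: val_ge_def)
      ultimately show ?thesis using val_ge_mult[OF P(1)] by fastforce
    next
      case False
      then have "y \<in> \<O> P" by (simp add: val_ge_def)
      then show ?thesis by (rule val_ge_mult0[OF P(1) pev_val_ge[OF P(1) x_val_ge[OF P]]])
    qed
    then show "\<exists>s. s \<noteq> 0 \<and> (\<forall>P\<in>\<X>. 0 \<le> P x \<longrightarrow> pev s x * y \<in> \<O> P)" using p(1) by blast
  next
    fix s s' y assume *: "\<forall>P\<in>\<X>. 0 \<le> P x \<longrightarrow> pev s x * y \<in> \<O> P"
    have "pev s' x * (pev s x * y) \<in> \<O> P" if P: "P \<in> \<X>" "0 \<le> P x" for P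
      by (rule val_ge_mult0[OF P(1) pev_val_ge[OF P(1) x_val_ge[OF P]]]) (use * P in blast)
    then show "\<forall>P\<in>\<X>. 0 \<le> P x \<longrightarrow> pev (s * s') x * y \<in> \<O> P" by (simp add: mult_ac)
  qed
  then obtain s where s: "s \<noteq> 0" "\<And>y P. y \<in> Y \<Longrightarrow> P \<in> \<X> \<Longrightarrow> 0 \<le> P x \<Longrightarrow> pev s x * y \<in> \<O> P" by blast
  define c where "c = (\<Sum>y\<in>Y. \<Sum>P\<in>Supp poles_x. nat \<bar>P (pev s x * y)\<bar>)"
  have "pev s x * y \<in> L (\<lambda>P. int c * poles_x P)" if y: "y \<in> Y" for y
    unfolding RR_space_iff[OF divisors_scale[OF X]]
  proof
    fix P assume P: "P \<in> \<X>"
    show "pev s x * y \<in> val_ge P (- (int c * poles_x P))"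
    proof (cases "0 \<le> P x")
      case True
      then show ?thesis using s(2)[OF y P] by (simp add: poles_x_apply[OF P])
    next
      case False
      then have PS: "P \<in> Supp poles_x" and 1: "1 \<le> poles_x P"
        by (auto simp: Supp_def poles_x_apply[OF P])
      have "nat \<bar>P (pev s x * y)\<bar> \<le> (\<Sum>P\<in>Supp poles_x. nat \<bar>P (pev s x * y)\<bar>)"
        using PS divisors_finite[OF X] by (intro member_le_sum) auto
      also have "\<dots> \<le> c" unfolding c_def using y Y
        by (intro member_le_sum[of y Y "\<lambda>y. \<Sum>P\<in>Supp poles_x. nat \<bar>P (pev s x * y)\<bar>"]) auto
      finally have "\<bar>P (pev s x * y)\<bar> \<le> int c" by linarith
      moreover have "int c * 1 \<le> int c * poles_x P" using 1 by (intro mult_left_mono) auto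
      ultimately have "- (int c * poles_x P) \<le> P (pev s x * y)" by linarith
      then show ?thesis unfolding val_ge_def by blast
    qed
  qed
  then show ?thesis using s(1) by blast
qed

text \<open>
  The functions \<open>x^j * b\<close> with \<open>j \<le> m\<close> and \<open>b \<in> B\<close> have, up to a common factor, poles only at those of
  \<open>x\<close>, with orders multiplied by at most \<open>m + c\<close>.
\<close>

lemma ell_poles_x_ge: "\<exists>c. \<forall>m. card B * (m + 1) \<le> ell \<iota> (\<lambda>P. int (m + c) * poles_x P)"
proof -
  have X: "poles_x \<in> Div" by (simp add: poles_x_def zero_divisor_in_divisors)
  obtain s c where s: "s \<noteq> 0" "\<And>b. b \<in> B \<Longrightarrow> pev s x * b \<in> L (\<lambda>P. int c * poles_x P)"
    using common_denominator_poles[OF finite_B] by blast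
  have g: "pev s x \<noteq> 0" by (rule transcendentalD[OF x s(1)])
  have "card B * (m + 1) \<le> ell \<iota> (\<lambda>P. int (m + c) * poles_x P)" for m
  proof -
    let ?L = "L (\<lambda>P. int (m + c) * poles_x P)"
    have L: "F.subspace ?L" "finite ?L"
      by (intro RR_space_subspace RR_space_finite divisors_scale X)+
    obtain T where T: "T \<subseteq> ?L" "?L \<subseteq> F.span T" "card T = F.dim ?L" by (rule F.basis_exists)
    have "card ({..m} \<times> B) \<le> card T"
    proof (rule F.card_family_le[of _ _ "\<lambda>(j, b). pev s x * (x ^ j * b)"])
      show "finite T" using T(1) L(2) finite_subset by blast
      fix i assume "i \<in> {..m} \<times> B"
      then obtain j b where i: "i = (j, b)" "j \<le> m" "b \<in> B" by auto
      have "pev s x * (x ^ j * b) \<in> ?L" unfolding RR_space_iff[OF divisors_scale[OF X]]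
      proof
        fix P assume P: "P \<in> \<X>"
        have "pev s x * b \<in> val_ge P (- (int c * poles_x P))"
          using s(2)[OF i(3)] RR_space_iff[OF divisors_scale[OF X]] P by blast
        moreover have "x ^ j \<in> val_ge P (- (int m * poles_x P))"
        proof (cases "0 \<le> P x")
          case False
          then have "int m * P x \<le> int j * P x" using i(2) by (intro mult_right_mono_neg) auto
          then show ?thesis
            using False by (simp add: val_ge_def place_power[OF P] poles_x_apply[OF P])
        qed (simp add: val_ge_def place_power[OF P] poles_x_apply[OF P])
        ultimately have "x ^ j * (pev s x * b) \<in> val_ge P (- (int m * poles_x P) + - (int c * poles_x P))"
          by (intro val_ge_mult[OF P])
        then show "pev s x * (x ^ j * b) \<in> val_ge P (- (int (m + c) * poles_x P))"
          by (simp add: algebra_simps)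
      qed
      then show "(case i of (j, b) \<Rightarrow> pev s x * (x ^ j * b)) \<in> F.span T" using T(2) i(1) by auto
    next
      fix \<kappa> :: "nat \<times> 'a \<Rightarrow> 'k"
      assume "(\<Sum>i\<in>{..m} \<times> B. \<iota> (\<kappa> i) * (case i of (j, b) \<Rightarrow> pev s x * (x ^ j * b))) = 0"
      moreover have "(\<Sum>i\<in>{..m} \<times> B. \<iota> (\<kappa> i) * (case i of (j, b) \<Rightarrow> pev s x * (x ^ j * b))) =
          pev s x * (\<Sum>(j, b)\<in>{..m} \<times> B. \<iota> (\<kappa> (j, b)) * (x ^ j * b))"
        unfolding sum_distrib_left by (intro sum.cong) auto
      ultimately have "(\<Sum>(j, b)\<in>{..m} \<times> B. \<iota> (\<kappa> (j, b)) * (x ^ j * b)) = 0" using g by simp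
      then show "\<forall>i\<in>{..m} \<times> B. \<kappa> i = 0" using monomials_independent by auto
    qed (use finite_B in simp)
    then show ?thesis using T(3) by (simp add: ell_def card_cartesian_product mult.commute)
  qed
  then show ?thesis by blast
qed

text \<open>
  Division by \<open>p(x)\<close> moves poles of \<open>x\<close> to zeros of \<open>p(x)\<close>.
\<close>

lemma ell_zeros_polynomial_ge:
  assumes p: "p \<noteq> 0"
  shows "ell \<iota> (\<lambda>P. int (m + degree p) * poles_x P) \<le>
    ell \<iota> ((\<lambda>P. int m * poles_x P) + zero_divisor (pev p x))"
proof -
  have X: "poles_x \<in> Div" by (simp add: poles_x_def zero_divisor_in_divisors)
  let ?C = "\<lambda>P. int (m + degree p) * poles_x P"
  let ?E = "(\<lambda>P. int m * poles_x P) + zero_divisor (pev p x)"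
  have C: "?C \<in> Div" and E: "?E \<in> Div"
    by (intro divisors_scale X divisors_add zero_divisor_in_divisors)+
  have g: "pev p x \<noteq> 0" by (rule transcendentalD[OF x p])
  have "(\<lambda>h. h / pev p x) ` L ?C \<subseteq> L ?E"
  proof clarify
    fix h assume h: "h \<in> L ?C"
    show "h / pev p x \<in> L ?E" unfolding RR_space_iff[OF E]
    proof
      fix P assume P: "P \<in> \<X>"
      have hP: "h \<in> val_ge P (- (int (m + degree p) * poles_x P))"
        using h RR_space_iff[OF C] P by blast
      have le: "P (pev p x) \<le> int (degree p) * (- poles_x P) + zero_divisor (pev p x) P"
      proof (cases "0 \<le> P x")
        case True
        then show ?thesis by (simp add: poles_x_apply[OF P] zero_divisor_apply[OF P])
      next
        case False
        then have "P (pev p x) \<le> int (degree p) * P x" using place_pev[OF P _ p] by auto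
        then show ?thesis using False by (simp add: poles_x_apply[OF P] zero_divisor_apply[OF P])
      qed
      show "h / pev p x \<in> val_ge P (- ?E P)"
      proof (cases "h = 0")
        case False
        then have "- (int (m + degree p) * poles_x P) \<le> P h" using hP by (simp add: val_ge_def)
        then show ?thesis
          using le False g by (simp add: val_ge_def place_divide[OF P] algebra_simps)
      qed simp
    qed
  qed
  moreover have "inj_on (\<lambda>h. h / pev p x) (L ?C)" using g by (auto simp: inj_on_def)
  ultimately have "card (L ?C) \<le> card (L ?E)"
    by (intro card_inj_on_le[OF _ _ RR_space_finite[OF E]])
  then have "CARD('k) ^ ell \<iota> ?C \<le> CARD('k) ^ ell \<iota> ?E"
    using card_RR_space[OF C] card_RR_space[OF E] by simp
  then show ?thesis using q_ge_2 by (simp add: power_le_imp_le_exp)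
qed

text \<open>
  Every divisor lies below the sum of a multiple of the poles of \<open>x\<close> and the zeros of some \<open>p(x)\<close>.  For
  such a sum, the degree is at most \<open>card B * (m + degree p)\<close>, and \<open>\<ell>\<close> is smaller by a constant at most.
\<close>

lemma defect_bounded: "\<exists>\<gamma>. \<forall>E\<in>Div. defect E \<le> \<gamma>"
proof -
  have X: "poles_x \<in> Div" by (simp add: poles_x_def zero_divisor_in_divisors)
  obtain c where c: "\<And>m. card B * (m + 1) \<le> ell \<iota> (\<lambda>P. int (m + c) * poles_x P)"
    using ell_poles_x_ge by blast
  have "defect E \<le> int (card B * c)" if E: "E \<in> Div" for E
  proof -
    let ?S = "{P \<in> Supp E. 0 \<le> P x}"
    have S: "finite ?S" "?S \<subseteq> \<X>" using E by (auto simp: divisors_def)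
    then obtain p where p: "p \<noteq> 0" "\<forall>P\<in>?S. pev p x \<in> val_ge P (int (nat (E P)))"
      using polynomial_vanishing_order[OF S, of "\<lambda>P. nat (E P)"] x_val_ge by blast
    define m where "m = c + (\<Sum>P\<in>Supp E. nat \<bar>E P\<bar>)"
    let ?C = "(\<lambda>P. int m * poles_x P) + zero_divisor (pev p x)"
    have C: "?C \<in> Div" by (intro divisors_scale X divisors_add zero_divisor_in_divisors)
    have "E \<le> ?C"
    proof (rule le_funI)
      fix P
      have nonneg: "0 \<le> int m * poles_x P" "0 \<le> zero_divisor (pev p x) P"
        by (simp_all add: poles_x_def zero_divisor_nonneg)
      show "E P \<le> ?C P"
      proof (cases "P \<in> Supp E")
        case False
        then show ?thesis using nonneg by (simp add: Supp_def)
      next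
        case True
        then have P: "P \<in> \<X>" using E by (auto simp: divisors_def)
        show ?thesis
        proof (cases "0 \<le> P x")
          case True': True
          then have "pev p x \<in> val_ge P (int (nat (E P)))" using p(2) True by auto
          then have "int (nat (E P)) \<le> P (pev p x)"
            unfolding val_ge_def using transcendentalD[OF x p(1)] by blast
          then have "E P \<le> zero_divisor (pev p x) P" unfolding zero_divisor_apply[OF P] by linarith
          then show ?thesis using nonneg by simp
        next
          case False
          have "nat \<bar>E P\<bar> \<le> (\<Sum>P\<in>Supp E. nat \<bar>E P\<bar>)"
            using True divisors_finite[OF E] by (intro member_le_sum) auto
          then have "nat \<bar>E P\<bar> \<le> m" unfolding m_def by linarith
          then have "E P \<le> int m * 1" by linarith
          also have "\<dots> \<le> int m * poles_x P"
            using False by (intro mult_left_mono) (auto simp: poles_x_apply[OF P])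
          finally show ?thesis using nonneg by simp
        qed
      qed
    qed
    then have "defect E \<le> defect ?C" by (rule card_cokernel(1)[OF E C])
    also have "deg ?C = int m * deg poles_x + deg (zero_divisor (pev p x))"
      by (simp only: divisor_degree_add[OF divisors_scale[OF X] zero_divisor_in_divisors] divisor_degree_scale[OF X])
    then have "deg ?C \<le> int m * int (card B) + int (card B * degree p)"
      using mult_left_mono[OF degree_poles_x, of "int m"] degree_zeros_polynomial[OF p(1)] by simp
    then have "defect ?C \<le> int m * int (card B) + int (card B * degree p) - int (ell \<iota> ?C)"
      by (simp add: defect_def)
    also have "int (card B * (m + degree p - c + 1)) \<le> int (ell \<iota> ?C)"
    proof -
      have "card B * (m + degree p - c + 1) \<le> ell \<iota> (\<lambda>P. int (m + degree p) * poles_x P)"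
      proof -
        have "m + degree p - c + c = m + degree p" by (simp add: m_def)
        then show ?thesis using c[of "m + degree p - c"] by (simp only:)
      qed
      also have "\<dots> \<le> ell \<iota> ?C" by (rule ell_zeros_polynomial_ge[OF p(1)])
      finally show ?thesis unfolding of_nat_le_iff .
    qed
    then have "int m * int (card B) + int (card B * degree p) - int (ell \<iota> ?C) \<le> int (card B * c)"
    proof -
      assume *: "int (card B * (m + degree p - c + 1)) \<le> int (ell \<iota> ?C)"
      obtain d where d: "m = c + d" by (simp add: m_def)
      have "m + degree p - c + 1 = d + degree p + 1" by (simp add: d)
      then have "int (card B) * (int d + int (degree p) + 1) \<le> int (ell \<iota> ?C)"
        using * by (simp only: of_nat_mult of_nat_add of_nat_1)
      then show ?thesis unfolding d by (simp add: algebra_simps)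
    qed
    finally show ?thesis .
  qed
  then show ?thesis by blast
qed

end

context curve
begin

lemma adele_bounded:
  assumes a: "\<alpha> \<in> \<A>" and B: "B \<in> Div"
  shows "\<exists>C\<in>Div. B \<le> C \<and> \<alpha> \<in> adeles_at \<iota> C"
proof -
  let ?S = "{P \<in> \<X>. \<alpha> P \<notin> \<O> P}"
  let ?E = "\<lambda>P. if P \<in> ?S then - P (\<alpha> P) else 0"
  have "?E \<in> Div" using a by (intro divisorsI[of ?S]) (auto simp: adeles_def)
  moreover have "\<alpha> P \<in> val_ge P (- sup B ?E P)" if "P \<in> \<X>" for P
  proof (cases "P \<in> ?S")
    case True
    then show ?thesis by (auto simp: val_ge_def sup_max)
  next
    case False
    then have "\<alpha> P \<in> \<O> P" using that by blast
    moreover have "- sup B ?E P \<le> 0" using False by (auto simp: sup_max)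
    ultimately show ?thesis using val_ge_mono by blast
  qed
  ultimately show ?thesis
    using a divisors_sup[OF B] by (intro bexI[of _ "sup B ?E"]) (auto simp: adeles_at_def)
qed

text \<open>
  The defect \<open>deg B - \<ell>(B)\<close> is monotone and bounded.  Once it is maximal the cokernel no longer
  shrinks, and as every adele is bounded by some divisor, the cokernel is then zero.
\<close>

lemma h1_dim:
  assumes B: "B \<in> Div"
  shows "finite_h1 \<iota> B"
    and "\<exists>C\<in>Div. B \<le> C \<and> int (h1 \<iota> B) = defect C - defect B \<and> (\<forall>E\<in>Div. C \<le> E \<longrightarrow> defect E = defect C)"
proof -
  obtain x Bs where "curve_coord \<iota> x Bs" using coordinates_exist by blast
  then interpret cc: curve_coord \<iota> x Bs .
  obtain \<gamma> where \<gamma>: "\<And>E. E \<in> Div \<Longrightarrow> defect E \<le> \<gamma>" using cc.defect_bounded by blast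
  let ?P = "\<lambda>C. C \<in> Div \<and> B \<le> C"
  have "\<exists>C. ?P C \<and> (\<forall>E. ?P E \<longrightarrow> nat (\<gamma> - defect C) \<le> nat (\<gamma> - defect E))"
    using ex_has_least_nat[of ?P B "\<lambda>C. nat (\<gamma> - defect C)"] B by blast
  then obtain C where C: "C \<in> Div" "B \<le> C"
    and least: "\<And>E. E \<in> Div \<Longrightarrow> B \<le> E \<Longrightarrow> nat (\<gamma> - defect C) \<le> nat (\<gamma> - defect E)" by blast
  have max: "defect E \<le> defect C" if E: "E \<in> Div" "B \<le> E" for E
    using least[OF E] \<gamma>[OF E(1)] \<gamma>[OF C(1)] by linarith
  have const: "defect E = defect C" if E: "E \<in> Div" "C \<le> E" for E
    by (rule antisym[OF max[OF E(1) order_trans[OF C(2) E(2)]] card_cokernel(1)[OF C(1) E]])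
  let ?W = "\<lambda>B. adeles_at \<iota> B + \<F>"
  have sub: "A.subspace (?W E)" for E
    by (intro A.subspace_plus adeles_at_subspace principal_adeles_subspace)
  have "\<A> \<subseteq> ?W C"
  proof
    fix \<alpha> :: "('a \<Rightarrow> int) \<Rightarrow> 'a" assume "\<alpha> \<in> \<A>"
    then obtain E where E: "E \<in> Div" "C \<le> E" "\<alpha> \<in> adeles_at \<iota> E" using adele_bounded C(1) by blast
    have "card (quotient_space (?W E) (?W C)) = 1"
      using card_cokernel(2)[OF C(1) E(1,2)] const[OF E(1,2)] by simp
    then obtain S where S: "quotient_space (?W E) (?W C) = {S}" by (rule card_1_singletonE)
    have "\<alpha> \<in> ?W E" "0 \<in> ?W E"
      using set_plus_intro[OF E(3) A.subspace_0[OF principal_adeles_subspace]] A.subspace_0[OF sub] by simp_all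
    then have "\<alpha> +o ?W C = 0 +o ?W C" using S unfolding quotient_space_def by blast
    then show "\<alpha> \<in> ?W C" using coset_eq_iff[OF A.add_subgroup_subspace[OF sub], of \<alpha> C 0] by simp
  qed
  moreover have "?W C \<subseteq> \<A>" using principal_adeles_adeles A.subspace_add[OF adeles_subspace]
    by (auto simp: set_plus_def adeles_at_def subset_iff)
  ultimately have WC: "?W C = \<A>" by blast
  have "finite (quotient_space (\<A>) (?W B))" using cokernel_quotient(1)[OF B C] WC by simp
  then show "finite_h1 \<iota> B"
    unfolding finite_h1_def using A.finite_dim_quotient_iff[OF adeles_subspace sub] by blast
  have "h1 \<iota> B = nat (defect C - defect B)" unfolding h1_def
    by (rule A.quotient_dim_eqI[OF adeles_subspace sub]) (use card_cokernel(2)[OF B C] WC in simp)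
  then have "int (h1 \<iota> B) = defect C - defect B" using card_cokernel(1)[OF B C] by simp
  then show "\<exists>C\<in>Div. B \<le> C \<and> int (h1 \<iota> B) = defect C - defect B \<and>
      (\<forall>E\<in>Div. C \<le> E \<longrightarrow> defect E = defect C)" using C const by blast
qed

theorem riemann_roch_h1:
  assumes B: "B \<in> Div"
  shows "int (ell \<iota> B) - int (h1 \<iota> B) = deg B + 1 - int (genus \<iota>)"
proof -
  obtain C where C: "C \<in> Div" "int (h1 \<iota> B) = defect C - defect B"
    "\<And>E. E \<in> Div \<Longrightarrow> C \<le> E \<Longrightarrow> defect E = defect C" using h1_dim(2)[OF B] by blast
  obtain C' where C': "C' \<in> Div" "int (h1 \<iota> 0) = defect C' - defect 0"
    "\<And>E. E \<in> Div \<Longrightarrow> C' \<le> E \<Longrightarrow> defect E = defect C'" using h1_dim(2)[OF divisors_0] by blast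
  have "defect C = defect C'"
    using C(3)[OF divisors_sup[OF C(1) C'(1)] sup_ge1] C'(3)[OF divisors_sup[OF C(1) C'(1)] sup_ge2]
    by (rule trans[OF sym])
  then show ?thesis using C(2) C'(2) by (simp add: genus_def defect_def divisor_degree_0 ell_0)
qed

end

section \<open>Residue fields\<close>

context curve
begin

lemma val_ge_prime:
  assumes P: "P \<in> \<X>" and f: "f \<in> \<O> P" and g: "g \<in> \<O> P" and fg: "f * g \<in> \<m> P"
  shows "f \<in> \<m> P \<or> g \<in> \<m> P"
  using assms by (cases "f = 0"; cases "g = 0") (auto simp: val_ge_def place_mult[OF P])

lemma val_ge_prod: "P \<in> \<X> \<Longrightarrow> (\<And>i. i \<in> I \<Longrightarrow> f i \<in> \<O> P) \<Longrightarrow> prod f I \<in> \<O> P"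
  by (induction I rule: infinite_finite_induct) (simp_all add: one_val_ge val_ge_mult0)

lemma val_ge_prime_prod:
  assumes P: "P \<in> \<X>" and "finite I" "\<And>i. i \<in> I \<Longrightarrow> f i \<in> \<O> P" "prod f I \<in> \<m> P"
  shows "\<exists>i\<in>I. f i \<in> \<m> P"
  using assms(2-)
proof (induction I rule: finite_induct)
  case empty
  then show ?case using one_notin_val_ge_1[OF P] by simp
next
  case (insert i I)
  have "prod f I \<in> \<O> P" using insert.prems(1) by (intro val_ge_prod[OF P]) auto
  then show ?case using val_ge_prime[OF P, of "f i" "prod f I"] insert by auto
qed

lemma val_ge_1_mult: "P \<in> \<X> \<Longrightarrow> f \<in> \<O> P \<Longrightarrow> g \<in> \<m> P \<Longrightarrow> f * g \<in> \<m> P"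
  by (rule val_ge_mult0)

lemma val_ge_1_0: "f \<in> \<m> P \<Longrightarrow> f \<in> \<O> P"
  by (rule val_ge_mono[of 0 1]) auto

lemma cong_mult:
  assumes P: "P \<in> \<X>" and "a \<in> \<O> P" "b' \<in> \<O> P" "a - a' \<in> \<m> P" "b - b' \<in> \<m> P"
  shows "a * b - a' * b' \<in> \<m> P"
proof -
  have "a * (b - b') + b' * (a - a') \<in> \<m> P"
    using assms by (intro val_ge_add[OF P] val_ge_mult0[OF P])
  then show ?thesis by (simp add: algebra_simps)
qed

lemma cong_prod:
  assumes P: "P \<in> \<X>" and "finite I" "\<And>i. i \<in> I \<Longrightarrow> f i \<in> \<O> P \<and> g i \<in> \<O> P \<and> f i - g i \<in> \<m> P"
  shows "prod g I \<in> \<O> P \<and> prod f I - prod g I \<in> \<m> P"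
  using assms(2,3)
proof (induction I rule: finite_induct)
  case (insert i I)
  then have "prod g I \<in> \<O> P" "prod f I - prod g I \<in> \<m> P"
    "f i \<in> \<O> P" "g i \<in> \<O> P" "f i - g i \<in> \<m> P" by auto
  then show ?case
    using insert.hyps cong_mult[OF P, of "f i" "prod g I" "g i" "prod f I"] val_ge_mult0[OF P]
    by auto
qed (simp add: one_val_ge[OF P])

definition residue_reps :: "('a \<Rightarrow> int) \<Rightarrow> 'a set \<Rightarrow> bool" where
  "residue_reps P R \<longleftrightarrow> finite R \<and> R \<subseteq> \<O> P \<and> card R = CARD('k) ^ place_degree \<iota> P \<and>
    (\<forall>f\<in>\<O> P. \<exists>!r. r \<in> R \<and> f - r \<in> \<m> P)"

lemma residue_reps_exist:
  assumes P: "P \<in> \<X>"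
  shows "\<exists>R. residue_reps P R"
proof -
  let ?Q = "quotient_space (\<O> P) (\<m> P)"
  note coset = coset_eq_iff[OF F.add_subgroup_subspace[OF val_ge_subspace[OF P, of 1]]]
  have "\<forall>S\<in>?Q. \<exists>r\<in>\<O> P. S = r +o \<m> P" by (auto simp: quotient_space_def)
  then obtain r where r: "\<And>S. S \<in> ?Q \<Longrightarrow> r S \<in> \<O> P" "\<And>S. S \<in> ?Q \<Longrightarrow> S = r S +o \<m> P" by metis
  have inj: "inj_on r ?Q" by (rule inj_onI) (metis r(2))
  have "\<exists>!s\<in>r ` ?Q. f - s \<in> \<m> P" if f: "f \<in> \<O> P" for f
  proof (rule ex1I[of _ "r (f +o \<m> P)"])
    have S: "f +o \<m> P \<in> ?Q" using f by (simp add: quotient_space_def)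
    then show "r (f +o \<m> P) \<in> r ` ?Q \<and> f - r (f +o \<m> P) \<in> \<m> P"
      using r(2)[OF S] coset[of f "r (f +o \<m> P)"] by blast
    fix s assume s: "s \<in> r ` ?Q \<and> f - s \<in> \<m> P"
    then obtain S where S: "S \<in> ?Q" "s = r S" by blast
    have "f +o \<m> P = s +o \<m> P" using s coset by blast
    then show "s = r (f +o \<m> P)" using r(2)[OF S(1)] S(2) by simp
  qed
  then have "residue_reps P (r ` ?Q)"
    unfolding residue_reps_def using card_residue_field[OF P] r(1) by (auto simp: card_image[OF inj])
  then show ?thesis by blast
qed

lemma residue_repsD:
  assumes "residue_reps P R"
  shows "finite R" "R \<subseteq> \<O> P" "card R = CARD('k) ^ place_degree \<iota> P"
    "\<And>f. f \<in> \<O> P \<Longrightarrow> \<exists>!r. r \<in> R \<and> f - r \<in> \<m> P"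
  using assms by (simp_all add: residue_reps_def)

lemma residue_reps_distinct:
  assumes P: "P \<in> \<X>" and R: "residue_reps P R" and "r \<in> R" "s \<in> R" "r - s \<in> \<m> P"
  shows "r = s"
proof -
  have "r \<in> \<O> P" "r - r \<in> \<m> P" using residue_repsD(2)[OF R] assms by auto
  then show ?thesis using residue_repsD(4)[OF R, of r] assms by blast
qed

text \<open>
  Multiplication by \<open>f\<close> permutes the nonzero residues, so multiplying all of them by \<open>f\<close> does not change their product.
\<close>

lemma residue_power_card:
  assumes P: "P \<in> \<X>" and f: "f \<in> \<O> P"
  shows "f ^ (CARD('k) ^ place_degree \<iota> P) - f \<in> \<m> P"
proof (cases "f \<in> \<m> P")
  case True
  have "f ^ Suc n \<in> \<m> P" for n
    using val_ge_mult0[OF P val_ge_power[OF P f] True] by (simp add: mult.commute)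
  moreover obtain n where "CARD('k) ^ place_degree \<iota> P = Suc n"
    using q_ge_2 by (metis not0_implies_Suc power_not_zero not_numeral_le_zero)
  ultimately show ?thesis using True by (simp only: val_ge_diff[OF P])
next
  case False
  obtain R where reps: "residue_reps P R" using residue_reps_exist[OF P] by blast
  note R = residue_repsD(1-3)[OF reps] and ex1 = residue_repsD(4)[OF reps]
    and same = residue_reps_distinct[OF P reps]
  define rep where "rep g = (THE r. r \<in> R \<and> g - r \<in> \<m> P)" for g
  have rep: "rep g \<in> R" "g - rep g \<in> \<m> P" if "g \<in> \<O> P" for g
    using theI'[OF ex1[OF that]] by (auto simp: rep_def)
  obtain r0 where r0: "r0 \<in> R" "0 - r0 \<in> \<m> P" using rep[of 0] by auto
  define N where "N = R - {r0}"
  have N: "finite N" "N \<subseteq> \<O> P" using R(1,2) by (auto simp: N_def)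
  have cardN: "Suc (card N) = CARD('k) ^ place_degree \<iota> P"
    using card.remove[OF R(1) r0(1)] R(3) by (simp only: N_def)
  have N_unit: "r \<notin> \<m> P" if "r \<in> N" for r
  proof
    assume "r \<in> \<m> P"
    then have "r + (0 - r0) \<in> \<m> P" using r0(2) by (rule val_ge_add[OF P])
    then show False using same[of r r0] that r0(1) by (auto simp: N_def)
  qed
  have fr: "f * r \<in> \<O> P" if "r \<in> N" for r using that N(2) f val_ge_mult0[OF P] by blast
  have map: "rep (f * r) \<in> N" if r: "r \<in> N" for r
  proof -
    have "rep (f * r) \<noteq> r0"
    proof
      assume "rep (f * r) = r0"
      then have "f * r - r0 \<in> \<m> P" using rep(2)[OF fr[OF r]] by simp
      then have "(f * r - r0) - (0 - r0) \<in> \<m> P" by (rule val_ge_diff[OF P _ r0(2)])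
      then show False using val_ge_prime[OF P f, of r] False N_unit[OF r] r N(2) by auto
    qed
    then show ?thesis using rep(1)[OF fr[OF r]] by (simp add: N_def)
  qed
  have inj: "inj_on (\<lambda>r. rep (f * r)) N"
  proof (rule inj_onI)
    fix r s assume rs: "r \<in> N" "s \<in> N" "rep (f * r) = rep (f * s)"
    have "(f * r - rep (f * r)) - (f * s - rep (f * s)) \<in> \<m> P"
      by (rule val_ge_diff[OF P rep(2)[OF fr[OF rs(1)]] rep(2)[OF fr[OF rs(2)]]])
    then have "f * (r - s) \<in> \<m> P" using rs(3) by (simp add: algebra_simps)
    moreover have "r - s \<in> \<O> P" using rs N(2) by (intro val_ge_diff[OF P]) auto
    ultimately have "r - s \<in> \<m> P" using val_ge_prime[OF P f] False by blast
    then show "r = s" using same rs by (simp add: N_def)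
  qed
  have "bij_betw (\<lambda>r. rep (f * r)) N N"
    using inj map N(1) by (simp add: bij_betw_def endo_inj_surj image_subsetI)
  then have prod: "(\<Prod>r\<in>N. rep (f * r)) = (\<Prod>r\<in>N. r)" by (rule prod.reindex_bij_betw)
  have pr: "f * r \<in> \<O> P \<and> rep (f * r) \<in> \<O> P \<and> f * r - rep (f * r) \<in> \<m> P"
    if "r \<in> N" for r using fr[OF that] rep[OF fr[OF that]] R(2) by blast
  have cong: "(\<Prod>r\<in>N. rep (f * r)) \<in> \<O> P \<and>
      (\<Prod>r\<in>N. f * r) - (\<Prod>r\<in>N. rep (f * r)) \<in> \<m> P" by (rule cong_prod[OF P N(1)]) (rule pr)
  then have PN: "(\<Prod>r\<in>N. r) \<in> \<O> P" by (simp only: prod)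
  have "(\<Prod>r\<in>N. f * r) - (\<Prod>r\<in>N. r) \<in> \<m> P" using cong by (simp only: prod)
  then have "(\<Prod>r\<in>N. r) * (f ^ card N - 1) \<in> \<m> P" by (simp add: prod.distrib algebra_simps)
  moreover have "f ^ card N - 1 \<in> \<O> P"
    by (intro val_ge_diff[OF P] val_ge_power[OF P f] one_val_ge[OF P])
  moreover have "(\<Prod>r\<in>N. r) \<notin> \<m> P"
    using val_ge_prime_prod[OF P N(1), of "\<lambda>r. r"] N(2) N_unit by blast
  ultimately have "f ^ card N - 1 \<in> \<m> P" using val_ge_prime[OF P PN] by blast
  then have "f * (f ^ card N - 1) \<in> \<m> P" by (rule val_ge_1_mult[OF P f])
  moreover have "f * (f ^ card N - 1) = f ^ (CARD('k) ^ place_degree \<iota> P) - f"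
    by (simp add: cardN[symmetric] right_diff_distrib)
  ultimately show ?thesis by simp
qed

text \<open>
  The polynomial \<open>X\<^sup>q - X\<close> is the product of the \<open>X - c\<close> over the constants \<open>c\<close>.
\<close>

lemma residue_constant:
  assumes P: "P \<in> \<X>" and f: "f \<in> \<O> P" and fixed: "f ^ CARD('k) - f \<in> \<m> P"
  shows "\<exists>c. f - \<iota> c \<in> \<m> P"
proof -
  have "(\<Prod>c\<in>UNIV. f - \<iota> c) \<in> \<m> P" using fixed by (simp add: prod_linear_factors)
  then show ?thesis
    using val_ge_prime_prod[OF P, of UNIV "\<lambda>c. f - \<iota> c"] val_ge_diff[OF P f \<iota>_val_ge[OF P]] by auto
qed

subsection \<open>The trace of a residue field\<close>

definition residue_frob_sum :: "('a \<Rightarrow> int) \<Rightarrow> 'a \<Rightarrow> 'a" where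
  "residue_frob_sum P f = (\<Sum>j<place_degree \<iota> P. f ^ (CARD('k) ^ j))"

definition tr :: "('a \<Rightarrow> int) \<Rightarrow> 'a \<Rightarrow> 'k" where
  "tr P f = (THE c. residue_frob_sum P f - \<iota> c \<in> \<m> P)"

lemma \<iota>_cong_unique:
  assumes P: "P \<in> \<X>" and "f - \<iota> c \<in> \<m> P" "f - \<iota> c' \<in> \<m> P"
  shows "c = c'"
proof -
  have "(f - \<iota> c') - (f - \<iota> c) \<in> \<m> P" by (rule val_ge_diff[OF P assms(3,2)])
  then have "\<iota> (c - c') \<in> \<m> P" by (simp add: algebra_simps)
  then show ?thesis using \<iota>_val_ge_1_iff[OF P, of "c - c'"] by simp
qed

lemma residue_frob_sum_val_ge: "P \<in> \<X> \<Longrightarrow> f \<in> \<O> P \<Longrightarrow> residue_frob_sum P f \<in> \<O> P"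
  unfolding residue_frob_sum_def by (intro val_ge_sum val_ge_power) auto

lemma residue_frob_sum_constant:
  assumes P: "P \<in> \<X>" and f: "f \<in> \<O> P"
  shows "\<exists>c. residue_frob_sum P f - \<iota> c \<in> \<m> P"
proof (rule residue_constant[OF P residue_frob_sum_val_ge[OF P f]])
  let ?d = "place_degree \<iota> P"
  have "residue_frob_sum P f ^ CARD('k) = (\<Sum>j<?d. f ^ (CARD('k) ^ Suc j))"
    unfolding residue_frob_sum_def frob1 by (simp add: mult.commute flip: power_mult)
  also have "\<dots> = (\<Sum>j<Suc ?d. f ^ (CARD('k) ^ j)) - f" by (simp only: sum.lessThan_Suc_shift) simp
  also have "\<dots> = residue_frob_sum P f + (f ^ (CARD('k) ^ ?d) - f)"
    by (simp add: residue_frob_sum_def)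
  finally show "residue_frob_sum P f ^ CARD('k) - residue_frob_sum P f \<in> \<m> P"
    using residue_power_card[OF P f] by simp
qed

lemma tr_cong:
  assumes P: "P \<in> \<X>" and f: "f \<in> \<O> P"
  shows "residue_frob_sum P f - \<iota> (tr P f) \<in> \<m> P"
  unfolding tr_def
  by (rule theI') (use residue_frob_sum_constant[OF P f] \<iota>_cong_unique[OF P] in blast)

lemma tr_eqI: "P \<in> \<X> \<Longrightarrow> f \<in> \<O> P \<Longrightarrow> residue_frob_sum P f - \<iota> c \<in> \<m> P \<Longrightarrow> tr P f = c"
  using tr_cong \<iota>_cong_unique by blast

lemma tr_add:
  assumes P: "P \<in> \<X>" and "f \<in> \<O> P" "g \<in> \<O> P"
  shows "tr P (f + g) = tr P f + tr P g"
proof (rule tr_eqI[OF P val_ge_add[OF P assms(2,3)]])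
  have "(residue_frob_sum P f - \<iota> (tr P f)) + (residue_frob_sum P g - \<iota> (tr P g)) \<in> \<m> P"
    by (rule val_ge_add[OF P tr_cong[OF P assms(2)] tr_cong[OF P assms(3)]])
  then show "residue_frob_sum P (f + g) - \<iota> (tr P f + tr P g) \<in> \<m> P"
    by (simp add: residue_frob_sum_def frob_add sum.distrib algebra_simps)
qed

lemma tr_scale:
  assumes P: "P \<in> \<X>" and "f \<in> \<O> P"
  shows "tr P (\<iota> c * f) = c * tr P f"
proof (rule tr_eqI[OF P val_ge_scale[OF P assms(2)]])
  have "\<iota> c * (residue_frob_sum P f - \<iota> (tr P f)) \<in> \<m> P" by (intro val_ge_scale[OF P] tr_cong assms)
  then show "residue_frob_sum P (\<iota> c * f) - \<iota> (c * tr P f) \<in> \<m> P"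
    by (simp add: residue_frob_sum_def power_mult_distrib frob_\<iota> sum_distrib_left algebra_simps)
qed

lemma tr_sum:
  assumes P: "P \<in> \<X>" and "\<And>i. i \<in> I \<Longrightarrow> f i \<in> \<O> P"
  shows "tr P (\<Sum>i\<in>I. \<iota> (c i) * f i) = (\<Sum>i\<in>I. c i * tr P (f i))"
  using assms(2)
proof (induction I rule: infinite_finite_induct)
  case (insert i I)
  then have "(\<Sum>i\<in>I. \<iota> (c i) * f i) \<in> \<O> P" by (intro val_ge_sum[OF P] val_ge_scale[OF P]) auto
  then show ?case using insert by (simp add: tr_add[OF P] tr_scale[OF P] val_ge_scale[OF P])
qed (use tr_scale[OF P, of 0 0] in simp_all)

lemma tr_residue:
  assumes P: "P \<in> \<X>" and "f \<in> \<m> P"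
  shows "tr P f = 0"
proof (rule tr_eqI[OF P val_ge_1_0[OF assms(2)]])
  have "f ^ (CARD('k) ^ j) \<in> \<m> P" for j
  proof -
    obtain n where "CARD('k) ^ j = Suc n"
      using q_ge_2 by (metis not0_implies_Suc power_not_zero not_numeral_le_zero)
    then show ?thesis
      using val_ge_mult0[OF P val_ge_power[OF P val_ge_1_0[OF assms(2)]] assms(2), of n]
      by (simp add: mult.commute)
  qed
  then show "residue_frob_sum P f - \<iota> 0 \<in> \<m> P" by (simp add: residue_frob_sum_def val_ge_sum[OF P])
qed

lemma tr_diff_residue:
  "P \<in> \<X> \<Longrightarrow> f \<in> \<O> P \<Longrightarrow> g \<in> \<O> P \<Longrightarrow> f - g \<in> \<m> P \<Longrightarrow> tr P f = tr P g"
  using tr_add[of P g "f - g"] tr_residue[of P "f - g"] val_ge_1_0[of "f - g" P] by simp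

text \<open>
  A polynomial over the residue field that vanishes at more points than its degree is zero.
\<close>

lemma residue_poly_zero:
  assumes P: "P \<in> \<X>" and "finite R" "R \<subseteq> \<O> P" "degree p < card R"
    and "\<And>r s. r \<in> R \<Longrightarrow> s \<in> R \<Longrightarrow> r \<noteq> s \<Longrightarrow> r - s \<notin> \<m> P"
    and "\<And>i. coeff p i \<in> \<O> P" "\<And>r. r \<in> R \<Longrightarrow> poly p r \<in> \<m> P"
  shows "coeff p i \<in> \<m> P"
  using assms(2-)
proof (induction "degree p" arbitrary: p R i)
  case 0
  then obtain c where p: "p = [:c:]" by (metis degree_eq_zeroE)
  obtain r where "r \<in> R" using 0 by (metis card_gt_0_iff ex_in_conv)
  then have "c \<in> \<m> P" using 0(7)[of r] by (simp add: p)
  then show ?case by (simp add: p coeff_pCons split: nat.splits)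
next
  case (Suc n)
  obtain r where r: "r \<in> R"
    using Suc.prems by (metis card_gt_0_iff ex_in_conv not_less_zero card.empty)
  let ?s = "synthetic_div p r"
  have ps: "p + smult r ?s = pCons (poly p r) ?s" by (rule synthetic_div_correct)
  have p_eq: "poly p z = poly p r + (z - r) * poly ?s z" for z
    using arg_cong[OF ps, of "\<lambda>p. poly p z"] by (simp add: algebra_simps)
  have r0: "r \<in> \<O> P" using r Suc.prems by blast
  have step: "coeff ?s i = coeff p (Suc i) + r * coeff ?s (Suc i)" for i
    using arg_cong[OF ps, of "\<lambda>p. coeff p (Suc i)"] by simp
  have deg: "degree ?s = n" using Suc.hyps(2) by (simp add: degree_synthetic_div)
  have s0: "coeff ?s i \<in> \<O> P" for i
  proof (induction "Suc n - i" arbitrary: i)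
    case 0
    then have "coeff ?s i = 0" using deg by (intro coeff_eq_0) simp
    then show ?case by simp
  next
    case (Suc k)
    then have "coeff ?s (Suc i) \<in> \<O> P" by simp
    then show ?case
      unfolding step[of i] by (intro val_ge_add[OF P] val_ge_mult0[OF P] r0 Suc.prems assms) (use \<open>\<And>i. coeff p i \<in> \<O> P\<close> in auto)
  qed
  have "coeff ?s i \<in> \<m> P" for i
  proof (rule Suc.hyps(1)[of ?s "R - {r}"])
    show "degree ?s < card (R - {r})" using Suc.hyps(2) Suc.prems(1,3) r deg by simp
    fix z assume z: "z \<in> R - {r}"
    have z0: "z \<in> \<O> P" using z Suc.prems by blast
    have "poly p z - poly p r \<in> \<m> P" using z r Suc.prems(6) by (intro val_ge_diff[OF P]) auto
    then have "(z - r) * poly ?s z \<in> \<m> P" by (simp add: p_eq[of z])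
    moreover have "poly ?s z \<in> \<O> P"
      unfolding poly_altdef by (intro val_ge_sum[OF P] val_ge_mult0[OF P s0] val_ge_power[OF P z0])
    ultimately show "poly ?s z \<in> \<m> P"
      using val_ge_prime[OF P val_ge_diff[OF P z0 r0]] Suc.prems(4)[of z r] z r by blast
  qed (use deg Suc.prems s0 in auto)
  note s1 = this
  show ?case
  proof (cases i)
    case 0
    have "coeff p 0 = poly p r - r * coeff ?s 0"
      using arg_cong[OF ps, of "\<lambda>p. coeff p 0"] by (simp add: algebra_simps)
    then show ?thesis
      using 0 Suc.prems(6)[OF r] s1[of 0] by (simp add: val_ge_diff[OF P] val_ge_mult0[OF P r0])
  next
    case (Suc j)
    have "coeff p (Suc j) = coeff ?s j - r * coeff ?s (Suc j)" using step[of j] by simp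
    then show ?thesis using Suc s1 by (simp add: val_ge_diff[OF P] val_ge_mult0[OF P r0])
  qed
qed

lemma frob_poly_zero:
  assumes P: "P \<in> \<X>" and a: "\<And>j. a j \<in> \<O> P"
    and zero: "\<And>f. f \<in> \<O> P \<Longrightarrow> (\<Sum>j<place_degree \<iota> P. a j * f ^ (CARD('k) ^ j)) \<in> \<m> P"
    and j: "j < place_degree \<iota> P"
  shows "a j \<in> \<m> P"
proof -
  let ?d = "place_degree \<iota> P"
  let ?p = "\<Sum>j<?d. monom (a j) (CARD('k) ^ j)"
  obtain R where reps: "residue_reps P R" using residue_reps_exist[OF P] by blast
  note R = residue_repsD(1-3)[OF reps]
  have inj: "CARD('k) ^ i = CARD('k) ^ j \<longleftrightarrow> i = j" for i j
    using q_ge_2 by (simp add: power_inject_exp)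
  have coeff: "coeff ?p i = (\<Sum>j<?d. if CARD('k) ^ j = i then a j else 0)" for i
    by (simp add: coeff_sum)
  have "degree ?p \<le> CARD('k) ^ (?d - 1)"
  proof (intro degree_sum_le)
    fix j assume "j \<in> {..<?d}"
    then have "CARD('k) ^ j \<le> CARD('k) ^ (?d - 1)" using q_ge_2 by (intro power_increasing) auto
    then show "degree (monom (a j) (CARD('k) ^ j)) \<le> CARD('k) ^ (?d - 1)"
      using degree_monom_le[of "a j" "CARD('k) ^ j"] by linarith
  qed simp
  also have "\<dots> < card R" unfolding R(3) using q_ge_2 j by (intro power_strict_increasing) auto
  finally have deg: "degree ?p < card R" .
  have "coeff ?p (CARD('k) ^ j) \<in> \<m> P"
  proof (rule residue_poly_zero[OF P R(1,2) deg])
    show "r - s \<notin> \<m> P" if "r \<in> R" "s \<in> R" "r \<noteq> s" for r s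
      using residue_reps_distinct[OF P reps] that by blast
    show "coeff ?p i \<in> \<O> P" for i unfolding coeff using a by (intro val_ge_sum[OF P]) auto
    show "poly ?p r \<in> \<m> P" if "r \<in> R" for r
      using zero[of r] that R(2) by (auto simp: poly_sum poly_monom)
  qed
  moreover have "coeff ?p (CARD('k) ^ j) = a j" unfolding coeff inj using j by simp
  ultimately show ?thesis by simp
qed

text \<open>
  A trace that vanishes identically would be a nonzero polynomial with more roots than its degree.
\<close>

lemma tr_nondegenerate:
  assumes P: "P \<in> \<X>" and f: "f \<in> \<O> P" "f \<notin> \<m> P"
  shows "\<exists>a\<in>\<O> P. tr P (a * f) \<noteq> 0"
proof -
  have "\<exists>g\<in>\<O> P. tr P g \<noteq> 0"
  proof (rule ccontr)
    assume "\<not> ?thesis"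
    then have "(\<Sum>j<place_degree \<iota> P. 1 * g ^ (CARD('k) ^ j)) \<in> \<m> P" if "g \<in> \<O> P" for g
      using tr_cong[OF P that] that by (auto simp: residue_frob_sum_def)
    then have "1 \<in> \<m> P"
      using frob_poly_zero[OF P, of "\<lambda>j. 1" 0] one_val_ge[OF P] place_degree_pos[OF P] by blast
    then show False using one_notin_val_ge_1[OF P] by blast
  qed
  then obtain g where g: "g \<in> \<O> P" "tr P g \<noteq> 0" by blast
  have f': "f \<noteq> 0" "P f = 0" using f by (auto simp: val_ge_def)
  then have "inverse f \<in> \<O> P" by (simp add: val_ge_def place_inverse[OF P])
  then have "g * inverse f \<in> \<O> P" using g(1) val_ge_mult0[OF P] by blast
  moreover have "g * inverse f * f = g" using f'(1) by simp
  ultimately show ?thesis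
    using g(2) by (intro bexI[of _ "g * inverse f"]) (simp_all only: simp_thms)
qed

definition residue_basis :: "('a \<Rightarrow> int) \<Rightarrow> 'a set \<Rightarrow> bool" where
  "residue_basis P W \<longleftrightarrow> quotient_basis (const_scale \<iota>) (\<O> P) (\<m> P) W"

lemma residue_basisD:
  assumes P: "P \<in> \<X>" and W: "residue_basis P W"
  shows "finite W" "W \<subseteq> \<O> P" "card W = place_degree \<iota> P"
    "\<And>f. f \<in> \<O> P \<Longrightarrow> \<exists>c. f - (\<Sum>w\<in>W. \<iota> (c w) * w) \<in> \<m> P"
    "\<And>c w. (\<Sum>w\<in>W. \<iota> (c w) * w) \<in> \<m> P \<Longrightarrow> w \<in> W \<Longrightarrow> c w = 0"
proof -
  show 1: "finite W" "W \<subseteq> \<O> P"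
    and 2: "\<And>c w. (\<Sum>w\<in>W. \<iota> (c w) * w) \<in> \<m> P \<Longrightarrow> w \<in> W \<Longrightarrow> c w = 0"
    using W by (auto simp: residue_basis_def quotient_basis_def)
  show "card W = place_degree \<iota> P"
    using F.card_quotient_basis(1)[OF val_ge_subspace[OF P] val_ge_subspace[OF P] W[unfolded residue_basis_def]]
      card_residue_field(2)[OF P] q_ge_2 by (simp add: power_inject_exp)
  fix f assume "f \<in> \<O> P"
  then have "f \<in> F.span W + \<m> P" using W by (auto simp: residue_basis_def quotient_basis_def)
  then obtain v w where v: "f = v + w" "v \<in> F.span W" "w \<in> \<m> P" by (elim set_plus_elim)
  then obtain c where "v = (\<Sum>w\<in>W. \<iota> (c w) * w)" using F.span_finite[OF 1(1)] by auto
  then show "\<exists>c. f - (\<Sum>w\<in>W. \<iota> (c w) * w) \<in> \<m> P" using v by (intro exI[of _ c]) simp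
qed

lemma residue_basis_exists:
  assumes P: "P \<in> \<X>"
  shows "\<exists>W. residue_basis P W"
  unfolding residue_basis_def
  by (rule F.quotient_basis_exists[OF val_ge_subspace[OF P] val_ge_subspace[OF P] card_residue_field(1)[OF P]])

text \<open>
  The map \<open>a \<mapsto> (tr (a * v))\<close> for \<open>v \<in> W\<close> is injective on the residue field, and its source and target have the
  same number of elements.
\<close>

lemma dual_residue_basis:
  assumes P: "P \<in> \<X>" and W: "residue_basis P W"
  shows "\<exists>d. \<forall>w\<in>W. d w \<in> \<O> P \<and> (\<forall>v\<in>W. tr P (d w * v) = (if v = w then 1 else 0))"
proof -
  note W' = residue_basisD[OF P W]
  let ?h = "\<lambda>a. \<lambda>v\<in>W. tr P (a * v)"
  have prod: "a * v \<in> \<O> P" if "a \<in> \<O> P" "v \<in> W" for a v using that W'(2) val_ge_mult0[OF P] by blast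
  have inj: "a +o \<m> P = b +o \<m> P \<longleftrightarrow> ?h a = ?h b"
    if ab: "a \<in> \<O> P" "b \<in> \<O> P" for a b
  proof
    assume "a +o \<m> P = b +o \<m> P"
    then have d: "a - b \<in> \<m> P"
      using coset_eq_iff[OF F.add_subgroup_subspace[OF val_ge_subspace[OF P, of 1]]] by blast
    have "a * v - b * v \<in> \<m> P" if "v \<in> W" for v
      using val_ge_mult0[OF P _ d, of v] that W'(2) by (auto simp: algebra_simps)
    then show "?h a = ?h b" using prod ab tr_diff_residue[OF P] by (intro restrict_ext) blast
  next
    assume eq: "?h a = ?h b"
    have d0: "a - b \<in> \<O> P" using ab by (rule val_ge_diff[OF P])
    have 0: "tr P ((a - b) * v) = 0" if "v \<in> W" for v
    proof -
      have "tr P (a * v) = tr P (b * v)" using fun_cong[OF eq, of v] that by simp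
      moreover have "tr P (a * v) = tr P (b * v) + tr P ((a - b) * v)"
        using tr_add[OF P prod[OF ab(2) that] prod[OF d0 that]] by (simp add: algebra_simps)
      ultimately show ?thesis by simp
    qed
    have "tr P (y * (a - b)) = 0" if y: "y \<in> \<O> P" for y
    proof -
      obtain c where c: "y - (\<Sum>w\<in>W. \<iota> (c w) * w) \<in> \<m> P" using W'(4)[OF y] by blast
      let ?s = "\<Sum>w\<in>W. \<iota> (c w) * w"
      have s0: "?s \<in> \<O> P" using W'(2) by (intro val_ge_sum[OF P] val_ge_scale[OF P]) auto
      have "(a - b) * (y - ?s) \<in> \<m> P" by (rule val_ge_mult0[OF P d0 c])
      then have "tr P (y * (a - b)) = tr P (?s * (a - b))"
        using s0 y d0 by (intro tr_diff_residue[OF P] val_ge_mult0[OF P]) (auto simp: algebra_simps)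
      also have "?s * (a - b) = (\<Sum>w\<in>W. \<iota> (c w) * ((a - b) * w))"
        by (simp add: sum_distrib_right sum_distrib_left mult_ac)
      also have "tr P \<dots> = (\<Sum>w\<in>W. c w * tr P ((a - b) * w))"
        using prod[OF d0] by (intro tr_sum[OF P]) auto
      also have "\<dots> = 0" using 0 by simp
      finally show ?thesis .
    qed
    then have "a - b \<in> \<m> P" using tr_nondegenerate[OF P d0] by blast
    then show "a +o \<m> P = b +o \<m> P"
      using coset_eq_iff[OF F.add_subgroup_subspace[OF val_ge_subspace[OF P, of 1]]] by blast
  qed
  obtain g where g: "bij_betw g (quotient_space (\<O> P) (\<m> P)) (?h ` \<O> P)"
    using bij_betw_images[of "\<O> P" "\<lambda>a. a +o \<m> P" ?h] inj unfolding quotient_space_def by blast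
  have "card (?h ` \<O> P) = card (W \<rightarrow>\<^sub>E (UNIV :: 'k set))"
    using bij_betw_same_card[OF g] card_residue_field(2)[OF P] W'(1,3) by (simp add: card_PiE)
  moreover have "?h ` \<O> P \<subseteq> W \<rightarrow>\<^sub>E UNIV" by auto
  moreover have "finite (W \<rightarrow>\<^sub>E (UNIV :: 'k set))" using W'(1) by (intro finite_PiE) auto
  ultimately have onto: "?h ` \<O> P = W \<rightarrow>\<^sub>E UNIV" by (metis card_subset_eq)
  have "\<exists>a\<in>\<O> P. \<forall>v\<in>W. tr P (a * v) = (if v = w then 1 else 0)" if "w \<in> W" for w
  proof -
    have "(\<lambda>v\<in>W. if v = w then 1 else 0) \<in> ?h ` \<O> P" unfolding onto by auto
    then obtain a where a: "a \<in> \<O> P" "(\<lambda>v\<in>W. if v = w then 1 else 0) = ?h a" by blast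
    have "tr P (a * v) = (if v = w then 1 else 0)" if "v \<in> W" for v
      using fun_cong[OF a(2), of v] that by simp
    then show ?thesis using a(1) by blast
  qed
  then show ?thesis by (intro bchoice) blast
qed

text \<open>
  For the dual basis \<open>d\<close> of \<open>W\<close>, the expansion \<open>y = \<Sum> tr (d w * y) w\<close> is the polynomial identity
  \<open>X = \<Sum>\<^sub>j (\<Sum>\<^sub>w (d w)^(q^j) w) X^(q^j)\<close> on a field with more elements than the degree.
  So \<open>\<Sum> d w * w = 1\<close>, and this is why the sum of the conjugates is the trace of a matrix.
\<close>

lemma trace_multiplication_matrix:
  assumes P: "P \<in> \<X>" and W: "residue_basis P W" and b: "b \<in> \<O> P"
    and \<beta>: "\<And>w. w \<in> W \<Longrightarrow> b * w - (\<Sum>v\<in>W. \<iota> (\<beta> v w) * v) \<in> \<m> P"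
  shows "(\<Sum>w\<in>W. \<beta> w w) = tr P b"
proof -
  note W' = residue_basisD[OF P W]
  let ?d = "place_degree \<iota> P"
  obtain d where d: "\<And>w. w \<in> W \<Longrightarrow> d w \<in> \<O> P"
    "\<And>w v. w \<in> W \<Longrightarrow> v \<in> W \<Longrightarrow> tr P (d w * v) = (if v = w then 1 else 0)"
    using dual_residue_basis[OF P W] by blast
  have coord: "tr P (d w * y) = c w"
    if w: "w \<in> W" and y: "y \<in> \<O> P" and c: "y - (\<Sum>v\<in>W. \<iota> (c v) * v) \<in> \<m> P" for w y c
  proof -
    let ?s = "\<Sum>v\<in>W. \<iota> (c v) * v"
    have s0: "?s \<in> \<O> P" using W'(2) by (intro val_ge_sum[OF P] val_ge_scale[OF P]) auto
    have "d w * (y - ?s) \<in> \<m> P" by (rule val_ge_mult0[OF P d(1)[OF w] c])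
    then have "tr P (d w * y) = tr P (d w * ?s)"
      using s0 y d(1)[OF w] by (intro tr_diff_residue[OF P] val_ge_mult0[OF P]) (auto simp: algebra_simps)
    also have "d w * ?s = (\<Sum>v\<in>W. \<iota> (c v) * (d w * v))"
      by (simp add: sum_distrib_right sum_distrib_left mult_ac)
    also have "tr P \<dots> = (\<Sum>v\<in>W. c v * tr P (d w * v))"
      using W'(2) d(1)[OF w] by (intro tr_sum[OF P] val_ge_mult0[OF P]) auto
    also have "\<dots> = (\<Sum>v\<in>W. if v = w then c v else 0)" using d(2)[OF w] by (intro sum.cong) auto
    also have "\<dots> = c w" using w W'(1) by simp
    finally show ?thesis .
  qed
  define a where "a j = (\<Sum>w\<in>W. d w ^ (CARD('k) ^ j) * w)" for j
  have a0: "a j \<in> \<O> P" for j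
    unfolding a_def using d(1) W'(2) by (intro val_ge_sum[OF P] val_ge_mult0[OF P] val_ge_power[OF P]) auto
  have expand: "(\<Sum>j<?d. a j * y ^ (CARD('k) ^ j)) - y \<in> \<m> P" if y: "y \<in> \<O> P" for y
  proof -
    obtain c where c: "y - (\<Sum>w\<in>W. \<iota> (c w) * w) \<in> \<m> P" using W'(4)[OF y] by blast
    have "w * (residue_frob_sum P (d w * y) - \<iota> (c w)) \<in> \<m> P" if w: "w \<in> W" for w
      using tr_cong[OF P val_ge_mult0[OF P d(1)[OF w] y]] coord[OF w y c] w W'(2)
      by (intro val_ge_mult0[OF P]) auto
    then have "(\<Sum>w\<in>W. w * (residue_frob_sum P (d w * y) - \<iota> (c w))) \<in> \<m> P"
      by (rule val_ge_sum[OF P])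
    moreover have "(\<Sum>w\<in>W. w * residue_frob_sum P (d w * y)) = (\<Sum>j<?d. a j * y ^ (CARD('k) ^ j))"
      unfolding residue_frob_sum_def a_def sum_distrib_left sum_distrib_right
      by (subst sum.swap) (simp add: power_mult_distrib mult_ac)
    ultimately have "(\<Sum>j<?d. a j * y ^ (CARD('k) ^ j)) - (\<Sum>w\<in>W. \<iota> (c w) * w) \<in> \<m> P"
      by (simp add: right_diff_distrib sum_subtractf mult.commute)
    then have "((\<Sum>j<?d. a j * y ^ (CARD('k) ^ j)) - (\<Sum>w\<in>W. \<iota> (c w) * w)) - (y - (\<Sum>w\<in>W. \<iota> (c w) * w)) \<in> \<m> P"
      using c by (rule val_ge_diff[OF P])
    then show ?thesis by simp
  qed
  have d_pos: "0 < ?d" by (rule place_degree_pos[OF P])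
  let ?a = "\<lambda>j. if j = 0 then a 0 - 1 else a j"
  have split: "(\<Sum>j<?d. ?a j * y ^ (CARD('k) ^ j)) = (\<Sum>j<?d. a j * y ^ (CARD('k) ^ j)) - y" for y
  proof -
    have "(\<Sum>j<?d. ?a j * y ^ (CARD('k) ^ j)) = (\<Sum>j<?d. a j * y ^ (CARD('k) ^ j) - (if j = 0 then y else 0))"
      by (intro sum.cong) (auto simp: algebra_simps)
    then show ?thesis using d_pos by (simp add: sum_subtractf)
  qed
  have a_cong: "?a j \<in> \<m> P" if "j < ?d" for j
  proof (rule frob_poly_zero[OF P _ _ that, of ?a])
    show "?a j \<in> \<O> P" for j using a0 val_ge_diff[OF P a0 one_val_ge[OF P]] by simp
    show "(\<Sum>j<?d. ?a j * f ^ (CARD('k) ^ j)) \<in> \<m> P" if "f \<in> \<O> P" for f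
      unfolding split using expand[OF that] .
  qed
  have one: "(\<Sum>w\<in>W. d w * w) - 1 \<in> \<m> P" using a_cong[OF d_pos] by (simp add: a_def)
  have "(\<Sum>w\<in>W. \<beta> w w) = (\<Sum>w\<in>W. tr P (d w * (b * w)))"
  proof (rule sum.cong[OF refl])
    fix w assume w: "w \<in> W"
    have "b * w \<in> \<O> P" using w W'(2) val_ge_mult0[OF P b] by blast
    then show "\<beta> w w = tr P (d w * (b * w))" using coord[OF w _ \<beta>[OF w]] by simp
  qed
  also have "\<dots> = tr P (\<Sum>w\<in>W. \<iota> 1 * (d w * (b * w)))"
    using d(1) b W'(2) by (subst tr_sum[OF P]) (auto intro!: val_ge_mult0[OF P])
  also have "\<dots> = tr P b"
  proof (rule tr_diff_residue[OF P _ b])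
    have eq: "(\<Sum>w\<in>W. \<iota> 1 * (d w * (b * w))) = b * (\<Sum>w\<in>W. d w * w)"
      by (simp add: sum_distrib_right sum_distrib_left mult_ac)
    show "(\<Sum>w\<in>W. \<iota> 1 * (d w * (b * w))) - b \<in> \<m> P"
      unfolding eq using val_ge_mult0[OF P b one] by (simp add: right_diff_distrib)
    show "(\<Sum>w\<in>W. \<iota> 1 * (d w * (b * w))) \<in> \<O> P"
      unfolding eq using b d(1) W'(2) by (intro val_ge_mult0[OF P] val_ge_sum[OF P]) auto
  qed
  finally show ?thesis .
qed

end

section \<open>Local residues\<close>

context curve
begin

lemma val_ge_divide_iff:
  "P \<in> \<X> \<Longrightarrow> z \<noteq> 0 \<Longrightarrow> f / z \<in> val_ge P n \<longleftrightarrow> f \<in> val_ge P (n + P z)"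
  using val_ge_mult_iff[of P "inverse z" f n]
  by (simp add: divide_inverse mult.commute place_inverse)

text \<open>
  The symbol for a projection onto the local ring is a residue without completions: all such projections
  give the same symbol, and a convenient one is chosen for each calculation.
\<close>

definition integral_projection :: "('a \<Rightarrow> int) \<Rightarrow> ('a \<Rightarrow> 'a) \<Rightarrow> bool" where
  "integral_projection P e \<longleftrightarrow> F.endo e \<and>
     (\<forall>f. e f \<in> \<O> P) \<and> (\<forall>f\<in>\<O> P. e f = f)"

lemma integral_projection_exists:
  assumes P: "P \<in> \<X>" and A': "F.subspace A'" "\<O> P \<inter> A' = {0}"
  shows "\<exists>e. integral_projection P e \<and> (\<forall>f\<in>A'. e f = 0)"
  using F.exists_projection[OF val_ge_subspace[OF P] A'] unfolding integral_projection_def by blast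

lemma integral_projection_near:
  assumes P: "P \<in> \<X>" and e: "integral_projection P e"
  shows "finite_rank (const_scale \<iota>) (\<lambda>v. f * e v - e (f * e v))"
proof -
  have lin: "F.endo e"
    and range: "\<And>v. e v \<in> \<O> P" and id: "\<And>v. v \<in> \<O> P \<Longrightarrow> e v = v"
    using e by (auto simp: integral_projection_def)
  have mult_lin: "F.endo (\<lambda>v. f * v)" by (rule F.linearI) (simp_all add: algebra_simps)
  have T_lin: "F.endo (\<lambda>v. f * e v - e (f * e v))"
    by (rule F.linear_minus[OF F.linear_comp[OF mult_lin lin]
          F.linear_comp[OF lin F.linear_comp[OF mult_lin lin]]])
  obtain t where t: "P t = 1" "t \<noteq> 0" using uniformizer_exists[OF P] .
  define n where "n = nat (- P f)"
  let ?V = "val_ge P (- int n)"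
  have fV: "f * v \<in> ?V" if "v \<in> \<O> P" for v
  proof -
    have "f \<in> ?V" by (simp add: val_ge_def n_def)
    then show ?thesis using val_ge_mult[OF P _ that] by fastforce
  qed
  have tn: "P (t ^ n) = int n" "t ^ n \<noteq> 0" using t by (simp_all add: place_power[OF P])
  have "\<O> P = (\<lambda>v. t ^ n * v) ` ?V"
  proof
    show "\<O> P \<subseteq> (\<lambda>v. t ^ n * v) ` ?V"
    proof
      fix g assume "g \<in> \<O> P"
      then have "g / t ^ n \<in> ?V" using val_ge_divide_iff[OF P tn(2), of g "- int n"] tn(1) by simp
      then show "g \<in> (\<lambda>v. t ^ n * v) ` ?V" using tn(2) by (intro image_eqI[of _ _ "g / t ^ n"]) auto
    qed
    show "(\<lambda>v. t ^ n * v) ` ?V \<subseteq> \<O> P" using val_ge_mult_iff[OF P tn(2), of _ 0] tn(1) by auto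
  qed
  moreover have "t ^ n * v \<in> ?V" if "v \<in> ?V" for v
    using that val_ge_mult_iff[OF P tn(2), of v "- int n"] tn(1) by (auto elim: val_ge_mono[rotated])
  ultimately have "finite (quotient_space ?V (\<O> P))"
    using finite_quotient_mult[OF tn(2) val_ge_subspace[OF P]] by simp
  then obtain S where S: "quotient_basis (const_scale \<iota>) ?V (\<O> P) S"
    using F.quotient_basis_exists[OF val_ge_subspace[OF P] val_ge_subspace[OF P]] by blast
  then have S': "finite S" "?V \<subseteq> F.span S + \<O> P" by (auto simp: quotient_basis_def)
  show ?thesis
  proof (rule F.finite_rankI[OF T_lin])
    show "finite ((\<lambda>s. s - e s) ` S)" using S'(1) by simp
    fix v
    have "f * e v \<in> F.span S + \<O> P" using fV[OF range] S'(2) by blast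
    then obtain s w where sw: "f * e v = s + w" "s \<in> F.span S" "w \<in> \<O> P" by (elim set_plus_elim)
    obtain c where c: "s = (\<Sum>b\<in>S. \<iota> (c b) * b)" using sw(2) F.span_finite[OF S'(1)] by auto
    have "f * e v - e (f * e v) = s - e s"
      unfolding sw(1) using id[OF sw(3)] by (simp add: F.linear_rules[OF lin])
    also have "\<dots> = (\<Sum>b\<in>S. \<iota> (c b) * (b - e b))"
      unfolding c by (simp add: F.linear_rules[OF lin] sum_subtractf right_diff_distrib)
    also have "\<dots> \<in> F.span ((\<lambda>s. s - e s) ` S)" by (intro F.span_sum F.span_scale F.span_base) auto
    finally show "f * e v - e (f * e v) \<in> F.span ((\<lambda>s. s - e s) ` S)" .
  qed
qed

lemma tate_local:
  assumes P: "P \<in> \<X>" and e: "integral_projection P e"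
  shows "tate (const_scale \<iota>) \<iota> (*) e"
proof (rule tate.intro[OF F.vector_space_axioms], rule tate_axioms.intro)
  show "F.endo ((*) f)" for f by (rule F.linearI) (simp_all add: algebra_simps)
  show "finite_rank (const_scale \<iota>) (\<lambda>v. f * e v - e (f * e v))" for f
    by (rule integral_projection_near[OF P e])
qed (use e in \<open>auto simp: integral_projection_def algebra_simps\<close>)

definition place_projection :: "('a \<Rightarrow> int) \<Rightarrow> 'a \<Rightarrow> 'a" where
  "place_projection P = (SOME e. integral_projection P e)"

definition local_symbol :: "('a \<Rightarrow> int) \<Rightarrow> 'a \<Rightarrow> 'a \<Rightarrow> 'k" where
  "local_symbol P = tate.symbol (const_scale \<iota>) (*) (place_projection P)"

lemma place_projection:
  assumes P: "P \<in> \<X>"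
  shows "integral_projection P (place_projection P)"
  unfolding place_projection_def
  using integral_projection_exists[OF P F.subspace_single_0] someI_ex[of "integral_projection P"] by auto

lemma local_symbol_eq:
  assumes P: "P \<in> \<X>" and e: "integral_projection P e"
  shows "local_symbol P f g =
    op_trace (const_scale \<iota>) (commutator (\<lambda>v. e (f * e v)) (\<lambda>v. e (g * e v)))"
proof -
  interpret tate "const_scale \<iota>" \<iota> "(*)" "place_projection P"
    by (rule tate_local[OF P place_projection[OF P]])
  have "integral_projection P (place_projection P)" by (rule place_projection[OF P])
  then show ?thesis unfolding local_symbol_def using e
    by (intro symbol_projection_cong) (auto simp: integral_projection_def)
qed

lemma
  assumes P: "P \<in> \<X>"
  shows local_symbol_add_left: "local_symbol P (f + f') g = local_symbol P f g + local_symbol P f' g"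
    and local_symbol_add_right: "local_symbol P f (g + g') = local_symbol P f g + local_symbol P f g'"
    and local_symbol_scale: "local_symbol P (\<iota> c * f) g = c * local_symbol P f g"
    and local_symbol_derivation:
      "local_symbol P f (g * h) = local_symbol P (f * g) h + local_symbol P (f * h) g"
    and local_symbol_regular:
      "f \<in> \<O> P \<Longrightarrow> g \<in> \<O> P \<Longrightarrow> local_symbol P f g = 0"
proof -
  interpret tate "const_scale \<iota>" \<iota> "(*)" "place_projection P"
    by (rule tate_local[OF P place_projection[OF P]])
  show "local_symbol P (f + f') g = local_symbol P f g + local_symbol P f' g"
    "local_symbol P f (g + g') = local_symbol P f g + local_symbol P f g'"
    "local_symbol P (\<iota> c * f) g = c * local_symbol P f g"
    "local_symbol P f (g * h) = local_symbol P (f * g) h + local_symbol P (f * h) g"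
    unfolding local_symbol_def
    by (rule symbol_add_left symbol_add_right symbol_scale_left symbol_derivation)+
  have e: "place_projection P v \<in> \<O> P" "v \<in> \<O> P \<Longrightarrow> place_projection P v = v" for v
    using place_projection[OF P] by (auto simp: integral_projection_def)
  show "f \<in> \<O> P \<Longrightarrow> g \<in> \<O> P \<Longrightarrow> local_symbol P f g = 0"
    unfolding local_symbol_def using e val_ge_mult0[OF P] by (intro symbol_eq_0_of_stable) auto
qed

lemma local_symbol_zero: "P \<in> \<X> \<Longrightarrow> local_symbol P 0 g = 0"
  using local_symbol_scale[of P 0 0 g] by simp

lemma local_symbol_sum:
  "P \<in> \<X> \<Longrightarrow> local_symbol P (\<Sum>i\<in>I. f i) g = (\<Sum>i\<in>I. local_symbol P (f i) g)"
  by (induction I rule: infinite_finite_induct) (simp_all add: local_symbol_add_left local_symbol_zero)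

subsection \<open>Approximate Teichmueller representatives\<close>

text \<open>
  Up to valuation \<open>n\<close> the solutions of \<open>X\<^sup>Q = X\<close> form a copy of the residue field inside the
  completed local ring.  Iterating the Frobenius map moves every regular function into it.
\<close>

definition teichmueller :: "('a \<Rightarrow> int) \<Rightarrow> nat \<Rightarrow> 'a \<Rightarrow> bool" where
  "teichmueller P n b \<longleftrightarrow> b \<in> \<O> P \<and> b ^ (CARD('k) ^ place_degree \<iota> P) - b \<in> val_ge P (int n)"

lemma teichmueller_exists:
  assumes P: "P \<in> \<X>" and f: "f \<in> \<O> P"
  shows "\<exists>b. teichmueller P n b \<and> b - f \<in> \<m> P"
proof -
  let ?d = "place_degree \<iota> P"
  let ?Q = "CARD('k) ^ ?d"
  have cong: "f ^ (?Q ^ m) - f \<in> \<m> P" for m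
  proof (induction m)
    case (Suc m)
    have "f ^ (?Q ^ Suc m) = (f ^ (?Q ^ m)) ^ ?Q" by (simp add: mult.commute flip: power_mult)
    then have "f ^ (?Q ^ Suc m) - f ^ (?Q ^ m) \<in> \<m> P"
      using residue_power_card[OF P val_ge_power[OF P f, of "?Q ^ m"]] by simp
    then have "(f ^ (?Q ^ Suc m) - f ^ (?Q ^ m)) + (f ^ (?Q ^ m) - f) \<in> \<m> P"
      using Suc by (rule val_ge_add[OF P])
    then show ?case by simp
  qed simp
  let ?z = "f ^ ?Q - f"
  have z: "?z \<in> \<m> P" by (rule residue_power_card[OF P f])
  have zm: "?z ^ m \<in> val_ge P (int m)" for m
  proof (induction m)
    case (Suc m)
    then show ?case using val_ge_mult[OF P z Suc] by simp
  qed (simp add: one_val_ge[OF P])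
  have "2 \<le> ?Q" using place_degree_pos[OF P] q_ge_2 self_le_power[of "CARD('k)" ?d] by linarith
  then have "n \<le> ?Q ^ n" using less_exp[of n] power_mono[of 2 ?Q n] by linarith
  moreover have "(f ^ (?Q ^ n)) ^ ?Q - f ^ (?Q ^ n) = ?z ^ (?Q ^ n)"
    using frob_diff[of "f ^ ?Q" f "?d * n"] by (simp add: power_mult mult.commute flip: power_mult)
  ultimately have "(f ^ (?Q ^ n)) ^ ?Q - f ^ (?Q ^ n) \<in> val_ge P (int n)"
    using val_ge_mono[OF _ zm[of "?Q ^ n"], of "int n"] by (simp only: of_nat_le_iff)
  then show ?thesis using cong[of n] val_ge_power[OF P f] unfolding teichmueller_def by blast
qed

lemma residue_card_ge_2:
  assumes P: "P \<in> \<X>"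
  shows "2 \<le> CARD('k) ^ place_degree \<iota> P"
  using place_degree_pos[OF P] q_ge_2 self_le_power[of "CARD('k)" "place_degree \<iota> P"] by linarith

text \<open>
  For small \<open>z\<close> the power \<open>z\<^sup>Q\<close> is negligible against \<open>z\<close>.
\<close>

lemma teichmueller_small:
  assumes P: "P \<in> \<X>" and z: "z \<in> \<m> P"
    and fixed: "z ^ (CARD('k) ^ place_degree \<iota> P) - z \<in> val_ge P n"
  shows "z \<in> val_ge P n"
proof (cases "z = 0")
  case False
  obtain m where m: "CARD('k) ^ place_degree \<iota> P = Suc (Suc m)"
    using le_Suc_ex[OF residue_card_ge_2[OF P]] by auto
  have "z ^ Suc m \<in> \<m> P"
    using val_ge_mult0[OF P val_ge_power[OF P val_ge_1_0[OF z]] z, of m] by (simp add: mult.commute)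
  then have nz: "-1 + z ^ Suc m \<noteq> 0" and val: "P (-1 + z ^ Suc m) = 0"
    using place_add_eq[OF P, of "-1" "z ^ Suc m"] place_minus[OF P, of 1] by (simp_all add: place_1[OF P])
  have "z ^ (CARD('k) ^ place_degree \<iota> P) - z = z * (-1 + z ^ Suc m)" by (simp add: m algebra_simps)
  moreover have "z * (-1 + z ^ Suc m) \<noteq> 0" "P (z * (-1 + z ^ Suc m)) = P z"
    using False nz val place_mult[OF P False nz] by simp_all
  ultimately have "n \<le> P z" using fixed by (auto simp only: val_ge_def mem_Collect_eq)
  then show ?thesis using False by (simp add: val_ge_iff)
qed simp

definition residue_lift :: "('a \<Rightarrow> int) \<Rightarrow> 'a set \<Rightarrow> ('a \<Rightarrow> 'a) \<Rightarrow> bool" where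
  "residue_lift P W \<omega> \<longleftrightarrow> residue_basis P W \<and> (\<forall>w\<in>W. \<omega> w \<in> \<O> P \<and> \<omega> w - w \<in> \<m> P)"

lemma digits_independent:
  assumes P: "P \<in> \<X>" and t: "P t = 1" and W: "residue_lift P W \<omega>"
    and sum: "(\<Sum>j<N. \<Sum>w\<in>W. \<iota> (\<kappa> j w) * (\<omega> w * t ^ j)) \<in> val_ge P (int N)"
    and j: "j < N" and w: "w \<in> W"
  shows "\<kappa> j w = 0"
  using sum j
proof (induction N arbitrary: \<kappa> j)
  case (Suc N)
  have W': "residue_basis P W" "\<And>w. w \<in> W \<Longrightarrow> \<omega> w \<in> \<O> P" "\<And>w. w \<in> W \<Longrightarrow> \<omega> w - w \<in> \<m> P"
    using W by (auto simp: residue_lift_def)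
  have t0: "t \<noteq> 0" using t place_0[OF P] by auto
  let ?r = "\<Sum>j<N. \<Sum>w\<in>W. \<iota> (\<kappa> (Suc j) w) * (\<omega> w * t ^ j)"
  let ?s = "\<Sum>w\<in>W. \<iota> (\<kappa> 0 w) * \<omega> w"
  have tot: "?s + t * ?r \<in> val_ge P (int (Suc N))"
    using Suc.prems(1) by (simp only: sum.lessThan_Suc_shift) (simp add: sum_distrib_left mult_ac)
  have t1: "t \<in> \<m> P" using t by (simp add: val_ge_def)
  have r0: "?r \<in> \<O> P" using W'(2) val_ge_1_0[OF t1]
    by (intro val_ge_sum[OF P] val_ge_scale[OF P] val_ge_mult0[OF P] val_ge_power[OF P]) auto
  have "(?s + t * ?r) - ?r * t \<in> \<m> P"
    by (rule val_ge_diff[OF P val_ge_mono[OF _ tot] val_ge_mult0[OF P r0 t1]]) simp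
  then have "?s \<in> \<m> P" by (simp add: mult.commute)
  moreover have "(\<Sum>w\<in>W. \<iota> (\<kappa> 0 w) * (\<omega> w - w)) \<in> \<m> P"
    using W'(3) by (intro val_ge_sum[OF P] val_ge_scale[OF P])
  ultimately have "?s - (\<Sum>w\<in>W. \<iota> (\<kappa> 0 w) * (\<omega> w - w)) \<in> \<m> P" by (rule val_ge_diff[OF P])
  then have "(\<Sum>w\<in>W. \<iota> (\<kappa> 0 w) * w) \<in> \<m> P" by (simp add: right_diff_distrib sum_subtractf)
  then have 0: "\<kappa> 0 v = 0" if "v \<in> W" for v
    using residue_basisD(5)[OF P W'(1), of "\<kappa> 0"] that by blast
  then have "t * ?r \<in> val_ge P (int (Suc N))" using tot by simp
  then have "?r \<in> val_ge P (int N)" using val_ge_mult_iff[OF P t0, of ?r "int (Suc N)"] t by simp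
  then have "\<kappa> (Suc i) w = 0" if "i < N" for i using Suc.IH[of "\<lambda>j. \<kappa> (Suc j)"] that by blast
  then show ?case using 0 w Suc.prems(2) by (cases j) auto
qed simp

lemma digits_span:
  assumes P: "P \<in> \<X>" and t: "P t = 1" and W: "residue_lift P W \<omega>" and a: "a \<in> \<O> P"
  shows "\<exists>\<kappa>. a - (\<Sum>j<N. \<Sum>w\<in>W. \<iota> (\<kappa> j w) * (\<omega> w * t ^ j)) \<in> val_ge P (int N)"
  using a
proof (induction N arbitrary: a)
  case (Suc N)
  have W': "residue_basis P W" "\<And>w. w \<in> W \<Longrightarrow> \<omega> w - w \<in> \<m> P" using W by (auto simp: residue_lift_def)
  have t0: "t \<noteq> 0" using t place_0[OF P] by auto
  obtain c where c: "a - (\<Sum>w\<in>W. \<iota> (c w) * w) \<in> \<m> P"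
    using residue_basisD(4)[OF P W'(1) Suc.prems] by blast
  have "(\<Sum>w\<in>W. \<iota> (c w) * (\<omega> w - w)) \<in> \<m> P"
    using W'(2) by (intro val_ge_sum[OF P] val_ge_scale[OF P])
  then have "(a - (\<Sum>w\<in>W. \<iota> (c w) * w)) - (\<Sum>w\<in>W. \<iota> (c w) * (\<omega> w - w)) \<in> \<m> P"
    by (rule val_ge_diff[OF P c])
  then have a1: "a - (\<Sum>w\<in>W. \<iota> (c w) * \<omega> w) \<in> \<m> P" by (simp add: right_diff_distrib sum_subtractf)
  define a' where "a' = (a - (\<Sum>w\<in>W. \<iota> (c w) * \<omega> w)) / t"
  have a': "a - (\<Sum>w\<in>W. \<iota> (c w) * \<omega> w) = t * a'" using t0 by (simp add: a'_def)
  then have "a' \<in> \<O> P" using a1 val_ge_mult_iff[OF P t0, of a' 1] t by simp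
  then obtain \<kappa> where \<kappa>: "a' - (\<Sum>j<N. \<Sum>w\<in>W. \<iota> (\<kappa> j w) * (\<omega> w * t ^ j)) \<in> val_ge P (int N)"
    using Suc.IH by blast
  let ?r = "\<Sum>j<N. \<Sum>w\<in>W. \<iota> (\<kappa> j w) * (\<omega> w * t ^ j)"
  let ?\<kappa> = "\<lambda>j. case j of 0 \<Rightarrow> c | Suc j \<Rightarrow> \<kappa> j"
  have "t * (a' - ?r) \<in> val_ge P (int (Suc N))"
    using \<kappa> val_ge_mult_iff[OF P t0, of "a' - ?r" "int (Suc N)"] t by simp
  moreover have "(\<Sum>j<Suc N. \<Sum>w\<in>W. \<iota> (?\<kappa> j w) * (\<omega> w * t ^ j)) = (\<Sum>w\<in>W. \<iota> (c w) * \<omega> w) + t * ?r"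
    by (simp only: sum.lessThan_Suc_shift) (simp add: sum_distrib_left mult_ac)
  ultimately have "a - (\<Sum>j<Suc N. \<Sum>w\<in>W. \<iota> (?\<kappa> j w) * (\<omega> w * t ^ j)) \<in> val_ge P (int (Suc N))"
    using a' by (simp add: algebra_simps)
  then show ?case by blast
qed simp

subsection \<open>The symbol of a principal part\<close>

text \<open>
  For a projection that kills the functions \<open>\<omega> w / t^j\<close>, the commutator for \<open>b / t^i dt\<close> maps
  \<open>\<omega> w t^(i-1)\<close> to \<open>b \<omega> w\<close> and all other digits to \<open>0\<close>.  It is nilpotent unless \<open>i = 1\<close>, when it
  is multiplication by \<open>b\<close> on the residue field.
\<close>

lemma local_symbol_principal_part:
  assumes P: "P \<in> \<X>" and t: "P t = 1" and i: "1 \<le> i" "i \<le> n" and b: "teichmueller P n b"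
  shows "local_symbol P (b / t ^ i) t = (if i = 1 then tr P b else 0)"
proof -
  let ?Q = "CARD('k) ^ place_degree \<iota> P"
  have t0: "t \<noteq> 0" using t place_0[OF P] by auto
  have t_val: "t \<in> \<O> P" using t by (simp add: val_ge_def)
  have b0: "b \<in> \<O> P" and bQ: "b ^ ?Q - b \<in> val_ge P (int n)"
    using b by (auto simp: teichmueller_def)
  obtain W where W: "residue_basis P W" using residue_basis_exists[OF P] by blast
  note W' = residue_basisD[OF P W]
  have "\<forall>w\<in>W. \<exists>v. teichmueller P n v \<and> v - w \<in> \<m> P" using teichmueller_exists[OF P] W'(2) by blast
  then obtain \<omega> where \<omega>: "\<And>w. w \<in> W \<Longrightarrow> teichmueller P n (\<omega> w)" "\<And>w. w \<in> W \<Longrightarrow> \<omega> w - w \<in> \<m> P" by metis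
  have \<omega>0: "\<omega> w \<in> \<O> P" if "w \<in> W" for w using \<omega>(1)[OF that] by (simp add: teichmueller_def)
  have lift: "residue_lift P W \<omega>" using W \<omega>0 \<omega>(2) by (simp add: residue_lift_def)
  have "\<exists>c. b * w - (\<Sum>v\<in>W. \<iota> (c v) * v) \<in> \<m> P" if "w \<in> W" for w
    by (rule W'(4)) (use that W'(2) val_ge_mult0[OF P b0] in blast)
  then obtain \<beta>' where \<beta>': "\<And>w. w \<in> W \<Longrightarrow> b * w - (\<Sum>v\<in>W. \<iota> (\<beta>' w v) * v) \<in> \<m> P" by metis
  define Y where "Y w = (\<Sum>v\<in>W. \<iota> (\<beta>' w v) * \<omega> v)" for w
  define z where "z w = b * \<omega> w - Y w" for w
  have Y0: "Y w \<in> \<O> P" for w unfolding Y_def using \<omega>0 by (intro val_ge_sum[OF P] val_ge_scale[OF P])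
  have z: "z w \<in> val_ge P (int n)" if w: "w \<in> W" for w
  proof (rule teichmueller_small[OF P])
    have "b * (\<omega> w - w) + (b * w - (\<Sum>v\<in>W. \<iota> (\<beta>' w v) * v)) - (\<Sum>v\<in>W. \<iota> (\<beta>' w v) * (\<omega> v - v)) \<in> \<m> P"
      using \<omega>(2) w by (intro val_ge_diff[OF P val_ge_add[OF P val_ge_mult0[OF P b0 \<omega>(2)[OF w]] \<beta>'[OF w]]]
          val_ge_sum[OF P] val_ge_scale[OF P])
    then show "z w \<in> \<m> P" by (simp add: z_def Y_def algebra_simps sum_subtractf)
    have frobQ: "(f - g) ^ ?Q = f ^ ?Q - g ^ ?Q" for f g :: 'a by (rule frob_diff)
    have "z w ^ ?Q = b ^ ?Q * \<omega> w ^ ?Q - (\<Sum>v\<in>W. \<iota> (\<beta>' w v) * \<omega> v ^ ?Q)"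
      unfolding z_def Y_def by (simp add: frobQ frob_sum power_mult_distrib frob_\<iota>)
    then have eq: "z w ^ ?Q - z w = (b ^ ?Q * (\<omega> w ^ ?Q - \<omega> w) + \<omega> w * (b ^ ?Q - b))
        - (\<Sum>v\<in>W. \<iota> (\<beta>' w v) * (\<omega> v ^ ?Q - \<omega> v))"
      by (simp add: z_def Y_def algebra_simps sum_subtractf)
    have \<omega>Q: "\<omega> v ^ ?Q - \<omega> v \<in> val_ge P (int n)" if "v \<in> W" for v
      using \<omega>(1)[OF that] by (simp add: teichmueller_def)
    show "z w ^ ?Q - z w \<in> val_ge P (int n)" unfolding eq using \<omega>Q w
      by (intro val_ge_diff[OF P val_ge_add[OF P val_ge_mult0[OF P val_ge_power[OF P b0] \<omega>Q[OF w]]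
              val_ge_mult0[OF P \<omega>0[OF w] bQ]]] val_ge_sum[OF P] val_ge_scale[OF P])
  qed
  define A' where "A' = range (\<lambda>\<kappa>. \<Sum>j\<in>{1..n}. \<Sum>w\<in>W. \<iota> (\<kappa> j w) * (\<omega> w / t ^ j))"
  have A'_sub: "F.subspace A'"
  proof (rule F.subspaceI)
    show "0 \<in> A'" unfolding A'_def by (rule image_eqI[of _ _ "\<lambda>j w. 0"]) auto
    fix x y assume "x \<in> A'" "y \<in> A'"
    then obtain \<kappa> \<mu> where "x = (\<Sum>j\<in>{1..n}. \<Sum>w\<in>W. \<iota> (\<kappa> j w) * (\<omega> w / t ^ j))"
      "y = (\<Sum>j\<in>{1..n}. \<Sum>w\<in>W. \<iota> (\<mu> j w) * (\<omega> w / t ^ j))" unfolding A'_def by blast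
    then have "x + y = (\<Sum>j\<in>{1..n}. \<Sum>w\<in>W. \<iota> (\<kappa> j w + \<mu> j w) * (\<omega> w / t ^ j))"
      by (simp add: sum.distrib distrib_right add_divide_distrib)
    then show "x + y \<in> A'" unfolding A'_def by (rule image_eqI[of _ _ "\<lambda>j w. \<kappa> j w + \<mu> j w"]) simp
  next
    fix c x assume "x \<in> A'"
    then obtain \<kappa> where x: "x = (\<Sum>j\<in>{1..n}. \<Sum>w\<in>W. \<iota> (\<kappa> j w) * (\<omega> w / t ^ j))"
      unfolding A'_def by blast
    have "\<iota> c * x = (\<Sum>j\<in>{1..n}. \<Sum>w\<in>W. \<iota> (c * \<kappa> j w) * (\<omega> w / t ^ j))"
      unfolding x sum_distrib_left by (intro sum.cong refl) (simp only: \<iota>_mult mult.assoc)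
    then show "\<iota> c * x \<in> A'" unfolding A'_def by (rule image_eqI[of _ _ "\<lambda>j w. c * \<kappa> j w"]) simp
  qed
  have A'_disj: "\<O> P \<inter> A' = {0}"
  proof -
    have "x = 0" if x: "x \<in> \<O> P" "x \<in> A'" for x
    proof -
      obtain \<kappa> where \<kappa>: "x = (\<Sum>j\<in>{1..n}. \<Sum>w\<in>W. \<iota> (\<kappa> j w) * (\<omega> w / t ^ j))"
        using x(2) unfolding A'_def by blast
      have "t ^ n * x = (\<Sum>j\<in>{1..n}. \<Sum>w\<in>W. \<iota> (\<kappa> j w) * (\<omega> w * t ^ (n - j)))"
        unfolding \<kappa> sum_distrib_left using t0
        by (intro sum.cong refl) (simp add: power_diff field_simps)
      also have "\<dots> = (\<Sum>j<n. \<Sum>w\<in>W. \<iota> (\<kappa> (n - j) w) * (\<omega> w * t ^ j))"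
        by (rule sum.reindex_bij_witness[of _ "\<lambda>j. n - j" "\<lambda>j. n - j"]) auto
      finally have "(\<Sum>j<n. \<Sum>w\<in>W. \<iota> (\<kappa> (n - j) w) * (\<omega> w * t ^ j)) \<in> val_ge P (int n)"
        using x(1) t0 t val_ge_mult_iff[OF P, of "t ^ n" x "int n"] by (simp add: place_power[OF P])
      then have 0: "\<kappa> (n - j) w = 0" if "j < n" "w \<in> W" for j w
        using digits_independent[OF P t lift, of "\<lambda>j. \<kappa> (n - j)" n j w] that by blast
      have "\<kappa> j w = 0" if "j \<in> {1..n}" "w \<in> W" for j w using 0[of "n - j" w] that by simp
      then show "x = 0" unfolding \<kappa> by simp
    qed
    then show ?thesis using F.subspace_0[OF A'_sub] by auto
  qed
  obtain e where e: "integral_projection P e" "\<And>f. f \<in> A' \<Longrightarrow> e f = 0"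
    using integral_projection_exists[OF P A'_sub A'_disj] by blast
  have e_lin: "F.endo e"
    and e_range: "\<And>v. e v \<in> \<O> P" and e_id: "\<And>v. v \<in> \<O> P \<Longrightarrow> e v = v"
    using e(1) by (auto simp: integral_projection_def)
  have e_kill: "e (Y w / t ^ k) = 0" if k: "1 \<le> k" "k \<le> n" for w k
  proof (rule e(2))
    have "Y w / t ^ k = (\<Sum>j\<in>{1..n}. \<Sum>v\<in>W. \<iota> (if j = k then \<beta>' w v else 0) * (\<omega> v / t ^ j))"
    proof -
      have "(\<Sum>j\<in>{1..n}. \<Sum>v\<in>W. \<iota> (if j = k then \<beta>' w v else 0) * (\<omega> v / t ^ j)) =
          (\<Sum>j\<in>{1..n}. if j = k then Y w / t ^ k else 0)"
        by (intro sum.cong) (auto simp: Y_def sum_divide_distrib)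
      then show ?thesis using k by simp
    qed
    then show "Y w / t ^ k \<in> A'"
      unfolding A'_def by (rule image_eqI[of _ _ "\<lambda>j v. if j = k then \<beta>' w v else 0"]) simp
  qed
  let ?f = "b / t ^ i"
  have "\<exists>\<psi>. \<forall>w\<in>W. F.functional (\<psi> w) \<and> (\<forall>u\<in>val_ge P (int i). \<psi> w u = 0) \<and>
      (\<forall>l\<in>{..<i} \<times> W. \<psi> w (case l of (j, v) \<Rightarrow> \<omega> v * t ^ j) = (if l = (i - 1, w) then 1 else 0))"
  proof (intro bchoice ballI)
    fix w assume w: "w \<in> W"
    show "\<exists>\<psi>. F.functional \<psi> \<and> (\<forall>u\<in>val_ge P (int i). \<psi> u = 0) \<and>
      (\<forall>l\<in>{..<i} \<times> W. \<psi> (case l of (j, v) \<Rightarrow> \<omega> v * t ^ j) = (if l = (i - 1, w) then 1 else 0))"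
    proof (rule F.family_dual_functional)
      show "finite ({..<i} \<times> W)" "F.subspace (val_ge P (int i))" "(i - 1, w) \<in> {..<i} \<times> W"
        using W'(1) val_ge_subspace[OF P] i w by auto
      fix \<kappa> :: "nat \<times> 'a \<Rightarrow> 'k"
      assume "(\<Sum>l\<in>{..<i} \<times> W. \<iota> (\<kappa> l) * (case l of (j, v) \<Rightarrow> \<omega> v * t ^ j)) \<in> val_ge P (int i)"
      then have "(\<Sum>j<i. \<Sum>v\<in>W. \<iota> (\<kappa> (j, v)) * (\<omega> v * t ^ j)) \<in> val_ge P (int i)"
        by (simp add: sum.cartesian_product split_def)
      then show "\<forall>l\<in>{..<i} \<times> W. \<kappa> l = 0"
        using digits_independent[OF P t lift, of "\<lambda>j v. \<kappa> (j, v)" i] by auto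
    qed
  qed
  then obtain \<psi> where \<psi>_lin: "\<And>w. w \<in> W \<Longrightarrow> F.functional (\<psi> w)"
    and \<psi>_0: "\<And>w u. w \<in> W \<Longrightarrow> u \<in> val_ge P (int i) \<Longrightarrow> \<psi> w u = 0"
    and \<psi>: "\<And>w l. w \<in> W \<Longrightarrow> l \<in> {..<i} \<times> W \<Longrightarrow>
      \<psi> w (case l of (j, v) \<Rightarrow> \<omega> v * t ^ j) = (if l = (i - 1, w) then 1 else 0)" by blast
  define H where "H a = e (?f * (t * a)) - e (t * e (?f * a)) - (\<Sum>w\<in>W. \<iota> (\<psi> w a) * Y w)" for a
  have H_lin: "F.endo H"
  proof (rule F.linearI)
    show "H (x + y) = H x + H y" for x y
    proof -
      have "(\<Sum>w\<in>W. \<iota> (\<psi> w (x + y)) * Y w) = (\<Sum>w\<in>W. \<iota> (\<psi> w x) * Y w) + (\<Sum>w\<in>W. \<iota> (\<psi> w y) * Y w)"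
        unfolding sum.distrib[symmetric]
        by (rule sum.cong) (simp_all add: F.linear_rules[OF \<psi>_lin] distrib_right)
      then show ?thesis unfolding H_def by (simp only: distrib_left F.linear_rules[OF e_lin]) simp
    qed
    show "H (\<iota> c * x) = \<iota> c * H x" for c x
    proof -
      have "(\<Sum>w\<in>W. \<iota> (\<psi> w (\<iota> c * x)) * Y w) = \<iota> c * (\<Sum>w\<in>W. \<iota> (\<psi> w x) * Y w)"
        unfolding sum_distrib_left
        by (rule sum.cong[OF refl]) (simp only: F.linear_rules(3)[OF \<psi>_lin] \<iota>_mult mult.assoc)
      moreover have "?f * (t * (\<iota> c * x)) = \<iota> c * (?f * (t * x))" "?f * (\<iota> c * x) = \<iota> c * (?f * x)"
        "t * (\<iota> c * e (?f * x)) = \<iota> c * (t * e (?f * x))" by (simp_all only: mult_ac)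
      then have "e (?f * (t * (\<iota> c * x))) = \<iota> c * e (?f * (t * x))"
        "e (t * e (?f * (\<iota> c * x))) = \<iota> c * e (t * e (?f * x))"
        by (simp_all only: F.linear_rules(3)[OF e_lin])
      ultimately show ?thesis unfolding H_def by (simp only: right_diff_distrib)
    qed
  qed
  have H_small: "H r = 0" if r: "r \<in> val_ge P (int i)" for r
  proof -
    have fr: "?f * r \<in> \<O> P"
    proof -
      have "r / t ^ i \<in> \<O> P"
        using val_ge_divide_iff[OF P, of "t ^ i" r 0] r t t0 by (simp add: place_power[OF P])
      then show ?thesis using val_ge_mult0[OF P b0, of "r / t ^ i"] by simp
    qed
    have tfr: "t * (?f * r) \<in> \<O> P" by (rule val_ge_mult0[OF P t_val fr])
    have "?f * (t * r) = t * (?f * r)" by simp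
    then have "e (?f * (t * r)) = e (t * e (?f * r))" by (simp only: e_id[OF fr])
    then show ?thesis using \<psi>_0[OF _ r] by (simp add: H_def)
  qed
  have H_digit: "H (\<omega> w * t ^ j) = 0" if w: "w \<in> W" and j: "j < i" for w j
  proof -
    define k where "k = i - Suc j"
    have ij: "i = j + Suc k" "Suc k \<le> n" "k \<le> n" using j i by (auto simp: k_def)
    have bw: "b * \<omega> w = Y w + z w" by (simp add: z_def)
    have zk: "z w / t ^ m \<in> \<O> P" if "m \<le> n" for m
    proof -
      have "z w \<in> val_ge P (int m)" using z[OF w] that by (auto elim!: val_ge_mono[rotated])
      then show ?thesis
        using val_ge_divide_iff[OF P, of "t ^ m" "z w" 0] t t0 by (simp add: place_power[OF P])
    qed
    have "?f * (\<omega> w * t ^ j) = b * \<omega> w / t ^ Suc k" using t0 by (simp add: ij(1) power_add)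
    also have "\<dots> = Y w / t ^ Suc k + z w / t ^ Suc k" by (simp add: bw add_divide_distrib)
    finally have "e (?f * (\<omega> w * t ^ j)) = z w / t ^ Suc k"
      using e_kill[of "Suc k" w] e_id[OF zk[OF ij(2)]] ij(2)
      by (simp only: F.linear_rules[OF e_lin]) simp
    moreover have "t * (z w / t ^ Suc k) = z w / t ^ k" using t0 by simp
    ultimately have 1: "e (t * e (?f * (\<omega> w * t ^ j))) = z w / t ^ k"
      using e_id[OF zk[OF ij(3)]] by simp
    have "?f * (t * (\<omega> w * t ^ j)) = b * \<omega> w / t ^ k" using t0 by (simp add: ij(1) power_add)
    also have "\<dots> = Y w / t ^ k + z w / t ^ k" by (simp add: bw add_divide_distrib)
    finally have "e (?f * (t * (\<omega> w * t ^ j))) = e (Y w / t ^ k) + z w / t ^ k"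
      using e_id[OF zk[OF ij(3)]] by (simp only: F.linear_rules[OF e_lin])
    moreover have "e (Y w / t ^ k) = (if k = 0 then Y w else 0)"
      using e_kill[of k w] e_id[OF Y0] ij(3) by auto
    moreover have "(\<Sum>v\<in>W. \<iota> (\<psi> v (\<omega> w * t ^ j)) * Y v) = (if k = 0 then Y w else 0)"
    proof -
      have "\<psi> v (\<omega> w * t ^ j) = (if v = w \<and> k = 0 then 1 else 0)" if "v \<in> W" for v
        using \<psi>[OF that, of "(j, w)"] w j by (auto simp: k_def)
      then have "(\<Sum>v\<in>W. \<iota> (\<psi> v (\<omega> w * t ^ j)) * Y v) = (\<Sum>v\<in>W. if v = w then (if k = 0 then Y w else 0) else 0)"
        by (intro sum.cong) auto
      then show ?thesis using w W'(1) by simp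
    qed
    ultimately show ?thesis using 1 by (simp add: H_def)
  qed
  have H: "H a = 0" if a: "a \<in> \<O> P" for a
  proof -
    obtain \<kappa> where \<kappa>: "a - (\<Sum>j<i. \<Sum>w\<in>W. \<iota> (\<kappa> j w) * (\<omega> w * t ^ j)) \<in> val_ge P (int i)"
      using digits_span[OF P t lift a] by blast
    let ?s = "\<Sum>j<i. \<Sum>w\<in>W. \<iota> (\<kappa> j w) * (\<omega> w * t ^ j)"
    have "H ?s = (\<Sum>j<i. \<Sum>w\<in>W. \<iota> (\<kappa> j w) * H (\<omega> w * t ^ j))" by (simp only: F.linear_rules[OF H_lin])
    also have "\<dots> = 0" using H_digit by simp
    finally have "H ?s = 0" .
    moreover have "H a = H ?s + H (a - ?s)" by (simp only: F.linear_rules[OF H_lin]) simp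
    ultimately show ?thesis using H_small[OF \<kappa>] by simp
  qed
  have comm: "commutator (\<lambda>v. e (?f * e v)) (\<lambda>v. e (t * e v)) v = (\<Sum>w\<in>W. \<iota> (\<psi> w (e v)) * Y w)" for v
  proof -
    have "e (t * e v) = t * e v" by (rule e_id[OF val_ge_mult0[OF P t_val e_range]])
    moreover have "e (e (?f * e v)) = e (?f * e v)" "e (e (t * e v)) = e (t * e v)"
      using e_id[OF e_range] by blast+
    ultimately show ?thesis
      using H[OF e_range[of v]] unfolding H_def commutator_def by (simp only: right_minus_eq)
  qed
  have \<phi>_lin: "F.functional (\<lambda>v. \<psi> w (e v))" if "w \<in> W" for w
    by (rule F.functionalI) (simp_all only: F.linear_rules[OF e_lin] F.linear_rules[OF \<psi>_lin[OF that]])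
  have "local_symbol P ?f t = (\<Sum>w\<in>W. \<psi> w (e (Y w)))"
    unfolding local_symbol_eq[OF P e(1)] by (rule F.op_trace_sum[OF W'(1) \<phi>_lin comm])
  also have "\<dots> = (\<Sum>w\<in>W. if i = 1 then \<beta>' w w else 0)"
  proof (rule sum.cong[OF refl])
    fix w assume w: "w \<in> W"
    have "\<psi> w (\<omega> v) = (if v = w \<and> i = 1 then 1 else 0)" if "v \<in> W" for v
      using \<psi>[OF w, of "(0, v)"] that i by auto
    then have "\<psi> w (Y w) = (\<Sum>v\<in>W. if v = w then (if i = 1 then \<beta>' w w else 0) else 0)"
      unfolding Y_def F.linear_rules[OF \<psi>_lin[OF w]] by (intro sum.cong) auto
    then show "\<psi> w (e (Y w)) = (if i = 1 then \<beta>' w w else 0)" using e_id[OF Y0] w W'(1) by simp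
  qed
  also have "\<dots> = (if i = 1 then tr P b else 0)"
    using trace_multiplication_matrix[OF P W b0, of "\<lambda>v w. \<beta>' w v"] \<beta>' by simp
  finally show ?thesis .
qed

lemma principal_part_exists:
  assumes P: "P \<in> \<X>" and t: "P t = 1" and u: "u \<in> val_ge P (- int m)"
  shows "\<exists>b. (\<forall>i\<in>{1..m}. teichmueller P n (b i)) \<and> u - (\<Sum>i=1..m. b i / t ^ i) \<in> \<O> P"
  using u
proof (induction m arbitrary: u)
  case (Suc m)
  have t0: "t \<noteq> 0" using t place_0[OF P] by auto
  have "t ^ Suc m * u \<in> \<O> P"
    using val_ge_mult_iff[OF P, of "t ^ Suc m" u 0] t0 t Suc.prems by (simp add: place_mult[OF P] place_power[OF P])
  then obtain c where c: "teichmueller P n c" "c - t ^ Suc m * u \<in> \<m> P"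
    using teichmueller_exists[OF P] by blast
  have "t ^ Suc m * (c / t ^ Suc m - u) \<in> \<m> P" using c(2) t0 by (simp add: right_diff_distrib)
  then have "c / t ^ Suc m - u \<in> val_ge P (- int m)"
    using val_ge_mult_iff[OF P, of "t ^ Suc m" "c / t ^ Suc m - u" 1] t0 t
    by (simp add: place_mult[OF P] place_power[OF P])
  then have "- (c / t ^ Suc m - u) \<in> val_ge P (- int m)" by (rule val_ge_neg[OF P])
  then have "u - c / t ^ Suc m \<in> val_ge P (- int m)" by simp
  then obtain b where b: "\<forall>i\<in>{1..m}. teichmueller P n (b i)"
    "u - c / t ^ Suc m - (\<Sum>i=1..m. b i / t ^ i) \<in> \<O> P" using Suc.IH by blast
  let ?b = "b(Suc m := c)"
  have "(\<Sum>i=1..Suc m. ?b i / t ^ i) = (\<Sum>i=1..m. b i / t ^ i) + c / t ^ Suc m"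
  proof -
    have "(\<Sum>i=1..m. ?b i / t ^ i) = (\<Sum>i=1..m. b i / t ^ i)" by (rule sum.cong) auto
    then show ?thesis by simp
  qed
  then have "u - (\<Sum>i=1..Suc m. ?b i / t ^ i) = u - c / t ^ Suc m - (\<Sum>i=1..m. b i / t ^ i)" by simp
  then have "u - (\<Sum>i=1..Suc m. ?b i / t ^ i) \<in> \<O> P" using b(2) by (simp only:)
  moreover have "\<forall>i\<in>{1..Suc m}. teichmueller P n (?b i)" using b(1) c(1) by auto
  ultimately show ?case by blast
qed simp

lemma local_symbol_expansion:
  assumes P: "P \<in> \<X>" and t: "P t = 1" and n: "1 \<le> n"
    and b: "\<And>i. i \<in> {1..n} \<Longrightarrow> teichmueller P n (b i)" and u: "u - (\<Sum>i=1..n. b i / t ^ i) \<in> \<O> P"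
  shows "local_symbol P u t = tr P (b 1)"
proof -
  have "local_symbol P u t = local_symbol P (\<Sum>i=1..n. b i / t ^ i) t + local_symbol P (u - (\<Sum>i=1..n. b i / t ^ i)) t"
    by (simp flip: local_symbol_add_left[OF P])
  also have "local_symbol P (u - (\<Sum>i=1..n. b i / t ^ i)) t = 0"
    using t by (intro local_symbol_regular[OF P u]) (simp add: val_ge_def)
  also have "local_symbol P (\<Sum>i=1..n. b i / t ^ i) t = (\<Sum>i=1..n. local_symbol P (b i / t ^ i) t)"
    by (rule local_symbol_sum[OF P])
  also have "\<dots> = (\<Sum>i=1..n. if i = 1 then tr P (b 1) else 0)"
  proof (rule sum.cong[OF refl])
    fix i assume i: "i \<in> {1..n}"
    then have "1 \<le> i" "i \<le> n" by auto
    then have "local_symbol P (b i / t ^ i) t = (if i = 1 then tr P (b i) else 0)"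
      by (rule local_symbol_principal_part[OF P t _ _ b[OF i]])
    then show "local_symbol P (b i / t ^ i) t = (if i = 1 then tr P (b 1) else 0)"
      by (cases "i = 1") (simp_all only: if_True if_False refl)
  qed
  also have "\<dots> = tr P (b 1)" using n by simp
  finally show ?thesis by simp
qed

lemma local_symbol_simple_pole:
  assumes P: "P \<in> \<X>" and t: "P t = 1" and c: "c \<in> \<O> P"
  shows "local_symbol P (c / t) t = tr P c"
proof -
  have t0: "t \<noteq> 0" using t place_0[OF P] by auto
  obtain b where b: "teichmueller P 1 b" "b - c \<in> \<m> P" using teichmueller_exists[OF P c] by blast
  have b0: "b \<in> \<O> P" using b(1) by (simp add: teichmueller_def)
  have "t * (c / t - b / t) \<in> \<m> P" using val_ge_neg[OF P b(2)] t0 by (simp add: right_diff_distrib)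
  then have "c / t - b / t \<in> \<O> P" using val_ge_mult_iff[OF P t0, of "c / t - b / t" 1] t by simp
  then have "local_symbol P (c / t) t = tr P b"
    using b(1) local_symbol_expansion[OF P t, of 1 "\<lambda>i. b" "c / t"] by simp
  also have "\<dots> = tr P c" by (rule tr_diff_residue[OF P b0 c b(2)])
  finally show ?thesis .
qed

subsection \<open>Residues of differentials\<close>

lemma derivative_of_derivations:
  assumes P: "P \<in> \<X>" and t: "P t = 1"
  shows "\<exists>u. (f \<in> \<O> P \<longrightarrow> u \<in> \<O> P) \<and> (\<forall>\<delta>\<in>derivations \<iota>. \<delta> f = u * \<delta> t)"
proof (rule derivative_exists[OF P t, of f])
  fix u assume "f \<in> \<O> P \<Longrightarrow> u \<in> \<O> P" "\<And>\<delta>. \<delta> \<in> derivations \<iota> \<Longrightarrow> \<delta> f = u * \<delta> t"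
  then show ?thesis by blast
qed

lemma derivation_uniformizer:
  assumes P: "P \<in> \<X>" and t: "P t = 1" and \<delta>: "\<delta> \<in> derivations \<iota>" "\<delta> f \<noteq> 0"
  shows "\<delta> t \<noteq> 0"
proof -
  obtain u where "\<delta> f = u * \<delta> t" using derivative_of_derivations[OF P t, of f] \<delta>(1) by blast
  then show ?thesis using \<delta>(2) by auto
qed

text \<open>
  Both sides are the symbol of one differential: by the product rule, \<open>local_symbol P v z\<close> is
  \<open>local_symbol P (v * z') t\<close> for the derivative \<open>z'\<close> of \<open>z\<close> by \<open>t\<close>.
\<close>

lemma local_symbol_change:
  assumes P: "P \<in> \<X>" and t: "P t = 1" and \<delta>: "\<delta> \<in> derivations \<iota>" "\<delta> t \<noteq> 0"
    and eq: "u * \<delta> t = v * \<delta> z"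
  shows "local_symbol P u t = local_symbol P v z"
proof (rule derivative_exists[OF P t, of z])
  fix w
  assume w: "\<And>\<delta>. \<delta> \<in> derivations \<iota> \<Longrightarrow> \<delta> z = w * \<delta> t"
    and S: "\<And>S :: 'a \<Rightarrow> 'a \<Rightarrow> 'k. \<And>g. (\<And>f f' g. S (f + f') g = S f g + S f' g) \<Longrightarrow>
      (\<And>f g g'. S f (g + g') = S f g + S f g') \<Longrightarrow>
      (\<And>f g h. S f (g * h) = S (f * g) h + S (f * h) g) \<Longrightarrow> S g z = S (g * w) t"
  have "local_symbol P v z = local_symbol P (v * w) t"
    by (rule S[OF local_symbol_add_left[OF P] local_symbol_add_right[OF P] local_symbol_derivation[OF P]])
  moreover have "u = v * w" using eq w[OF \<delta>(1)] \<delta>(2) by simp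
  ultimately show ?thesis by simp
qed

text \<open>
  The symbol is defined without a choice of \<open>t\<close>, \<open>n\<close> and \<open>b\<close>, so this also shows that the residue does not
  depend on them.
\<close>

theorem residue_trace_eq_symbol:
  assumes P: "P \<in> \<X>" and \<delta>: "\<delta> \<in> derivations \<iota>" "\<delta> z \<noteq> 0"
  shows "residue_trace \<iota> P (form_scale v (dform \<iota> z)) = local_symbol P v z"
  unfolding residue_trace_def
proof (rule the_equality)
  let ?\<eta> = "form_scale v (dform \<iota> z)"
  obtain t where t: "P t = 1" "t \<noteq> 0" using uniformizer_exists[OF P] .
  have dt: "\<delta> t \<noteq> 0" by (rule derivation_uniformizer[OF P t(1) \<delta>])
  have form: "\<exists>u. ?\<eta> = form_scale u (dform \<iota> t)"
  proof -
    obtain w where w: "\<And>\<delta>. \<delta> \<in> derivations \<iota> \<Longrightarrow> \<delta> z = w * \<delta> t"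
      using derivative_of_derivations[OF P t(1), of z] by blast
    then have "?\<eta> = form_scale (v * w) (dform \<iota> t)" by (auto simp: dform_def fun_eq_iff)
    then show ?thesis by blast
  qed
  then obtain u where u: "?\<eta> = form_scale u (dform \<iota> t)" by blast
  have symbol: "local_symbol P u' t' = local_symbol P v z"
    if "P t' = 1" "?\<eta> = form_scale u' (dform \<iota> t')" for u' t'
  proof (rule local_symbol_change[OF P that(1) \<delta>(1)])
    show "\<delta> t' \<noteq> 0" by (rule derivation_uniformizer[OF P that(1) \<delta>])
    show "u' * \<delta> t' = v * \<delta> z" using fun_cong[OF that(2), of \<delta>] \<delta>(1) by (simp add: dform_def)
  qed
  define n where "n = Suc (nat (- P u))"
  have "u \<in> val_ge P (- int n)" by (simp add: val_ge_def n_def)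
  then obtain b where b: "\<forall>i\<in>{1..n}. teichmueller P n (b i)" "u - (\<Sum>i=1..n. b i / t ^ i) \<in> \<O> P"
    using principal_part_exists[OF P t(1)] by blast
  have n: "n \<ge> 1" by (simp add: n_def)
  have b1: "b 1 \<in> \<O> P" using b(1) n by (auto simp: teichmueller_def)
  have "local_symbol P v z = tr P (b 1)"
    using local_symbol_expansion[OF P t(1) n, of b u] b symbol[OF t(1) u] by auto
  then have "(\<Sum>j<place_degree \<iota> P. b 1 ^ (CARD('k) ^ j)) - \<iota> (local_symbol P v z) \<in> \<m> P"
    using tr_cong[OF P b1] by (simp add: residue_frob_sum_def)
  then show "\<exists>t u. \<exists>n\<ge>1. \<exists>b. P t = 1 \<and> ?\<eta> = form_scale u (dform \<iota> t) \<and>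
     (\<forall>i\<in>{1..n}. b i \<in> \<O> P \<and> b i ^ (CARD('k) ^ place_degree \<iota> P) - b i \<in> val_ge P (int n)) \<and>
     u - (\<Sum>i=1..n. b i / t ^ i) \<in> \<O> P \<and>
     (\<Sum>j<place_degree \<iota> P. b 1 ^ (CARD('k) ^ j)) - \<iota> (local_symbol P v z) \<in> \<m> P"
    using t(1) u n b by (intro exI[of _ t] exI[of _ u] exI[of _ n] conjI exI[of _ b])
      (auto simp: teichmueller_def)
next
  let ?\<eta> = "form_scale v (dform \<iota> z)"
  fix c assume "\<exists>t u. \<exists>n\<ge>1. \<exists>b. P t = 1 \<and> ?\<eta> = form_scale u (dform \<iota> t) \<and>
     (\<forall>i\<in>{1..n}. b i \<in> \<O> P \<and> b i ^ (CARD('k) ^ place_degree \<iota> P) - b i \<in> val_ge P (int n)) \<and>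
     u - (\<Sum>i=1..n. b i / t ^ i) \<in> \<O> P \<and>
     (\<Sum>j<place_degree \<iota> P. b 1 ^ (CARD('k) ^ j)) - \<iota> c \<in> \<m> P"
  then obtain t u n b where *: "n \<ge> 1" "P t = 1" "?\<eta> = form_scale u (dform \<iota> t)"
    "\<forall>i\<in>{1..n}. b i \<in> \<O> P \<and> b i ^ (CARD('k) ^ place_degree \<iota> P) - b i \<in> val_ge P (int n)"
    "u - (\<Sum>i=1..n. b i / t ^ i) \<in> \<O> P"
    "(\<Sum>j<place_degree \<iota> P. b 1 ^ (CARD('k) ^ j)) - \<iota> c \<in> \<m> P" by blast
  have b1: "b 1 \<in> \<O> P" using *(1,4) by auto
  have "tr P (b 1) = c" using *(6) by (intro tr_eqI[OF P b1]) (simp add: residue_frob_sum_def)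
  moreover have "local_symbol P u t = tr P (b 1)"
    using *(4) by (intro local_symbol_expansion[OF P *(2,1) _ *(5)]) (auto simp: teichmueller_def)
  moreover have "local_symbol P u t = local_symbol P v z"
  proof (rule local_symbol_change[OF P *(2) \<delta>(1)])
    show "\<delta> t \<noteq> 0" by (rule derivation_uniformizer[OF P *(2) \<delta>])
    show "u * \<delta> t = v * \<delta> z" using fun_cong[OF *(3), of \<delta>] \<delta>(1) by (simp add: dform_def)
  qed
  ultimately show "c = local_symbol P v z" by simp
qed

end

section \<open>The residue theorem\<close>

lemma (in tate) tate_projection_cong:
  assumes e': "endo e'" "\<And>v. e (e' v) = e' v" "\<And>v. e' (e v) = e v"
  shows "tate scale \<iota> m e'" and "symbol f g = tate.symbol scale m e' f g"
proof -
  have idem: "e' (e' v) = e' v" for v using e'(2,3)[of "e' v"] e'(2) by metis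
  show *: "tate scale \<iota> m e'"
  proof (rule tate.intro[OF vector_space_axioms], rule tate_axioms.intro)
    show "endo (m f)" "m (f * g) v = m f (m g v)"
      "m (f + g) v = m f v + m g v" "m (\<iota> c * f) v = scale c (m f v)" for f g v c
      by (rule m_linear m_mult m_add m_scale)+
    show "endo e'" "e' (e' v) = e' v" for v by (rule e'(1) idem)+
    fix f
    have "(\<lambda>v. m f (e' v) - e' (m f (e' v))) =
        (\<lambda>v. (\<lambda>w. w - e' w) (m f (e (e' v)) - e (m f (e (e' v)))))"
      by (rule ext) (simp add: e'(2,3) linear_rules[OF e'(1)])
    moreover have "endo (\<lambda>w. w - e' w)" by (rule linear_minus[OF linearI e'(1)]) simp_all
    ultimately show "finite_rank scale (\<lambda>v. m f (e' v) - e' (m f (e' v)))"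
      using finite_rank_comp_left[OF finite_rank_comp_right[OF e_near e'(1)]] by simp
  qed
  have "tate.toeplitz m e' f = (\<lambda>v. e' (m f (e' v)))" for f
    by (rule ext) (simp add: tate.toeplitz_def[OF *])
  then show "symbol f g = tate.symbol scale m e' f g"
    using symbol_projection_cong[OF e'] by (simp add: tate.symbol_def[OF *])
qed

context curve
begin

abbreviation adele_mult :: "'a \<Rightarrow> (('a \<Rightarrow> int) \<Rightarrow> 'a) \<Rightarrow> ('a \<Rightarrow> int) \<Rightarrow> 'a" where
  "adele_mult f \<equiv> (\<lambda>\<alpha> P. f * \<alpha> P)"

lemma adele_mult_adele:
  assumes "\<alpha> \<in> \<A>"
  shows "adele_mult f \<alpha> \<in> \<A>"
proof -
  have "{P \<in> \<X>. f * \<alpha> P \<notin> \<O> P} \<subseteq>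
      {P \<in> \<X>. P f < 0} \<union> {P \<in> \<X>. \<alpha> P \<notin> \<O> P}"
  proof
    fix P assume P: "P \<in> {P \<in> \<X>. f * \<alpha> P \<notin> \<O> P}"
    show "P \<in> {P \<in> \<X>. P f < 0} \<union> {P \<in> \<X>. \<alpha> P \<notin> \<O> P}"
    proof (rule ccontr)
      assume "\<not> ?thesis"
      then have "f \<in> \<O> P" "\<alpha> P \<in> \<O> P" using P by (auto simp: val_ge_def)
      then show False using P val_ge_mult0 by blast
    qed
  qed
  then show ?thesis using assms finite_poles[of f] by (auto simp: adeles_def intro: finite_subset)
qed

lemma
  fixes S :: "('a \<Rightarrow> int) set"
  assumes S: "finite S" and T: "\<And>P. P \<in> S \<Longrightarrow> finite_rank (const_scale \<iota>) (T P)"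
    and T': "\<And>\<alpha>. T' \<alpha> = (\<lambda>P. if P \<in> S then T P (\<alpha> P) else 0)"
  shows finite_rank_components: "finite_rank (adele_scale \<iota>) T'"
    and op_trace_components:
      "op_trace (adele_scale \<iota>) T' = (\<Sum>P\<in>S. op_trace (const_scale \<iota>) (T P))"
proof -
  have "\<forall>P\<in>S. \<exists>B \<phi>. finite B \<and> (\<forall>b\<in>B. F.functional (\<phi> b)) \<and>
      (\<forall>v. T P v = (\<Sum>b\<in>B. \<iota> (\<phi> b v) * b))"
  proof
    fix P assume "P \<in> S"
    obtain B \<phi> where "finite B" "\<And>b. b \<in> B \<Longrightarrow> F.functional (\<phi> b)"
      "\<And>v. T P v = (\<Sum>b\<in>B. \<iota> (\<phi> b v) * b)" by (rule F.finite_rank_decomp[OF T[OF \<open>P \<in> S\<close>]]) blast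
    then show "\<exists>B \<phi>. finite B \<and> (\<forall>b\<in>B. F.functional (\<phi> b)) \<and>
      (\<forall>v. T P v = (\<Sum>b\<in>B. \<iota> (\<phi> b v) * b))" by blast
  qed
  then obtain B where "\<forall>P\<in>S. \<exists>\<phi>. finite (B P) \<and> (\<forall>b\<in>B P. F.functional (\<phi> b)) \<and>
      (\<forall>v. T P v = (\<Sum>b\<in>B P. \<iota> (\<phi> b v) * b))" by (rule bchoice[THEN exE])
  then obtain \<phi> where *: "\<forall>P\<in>S. finite (B P) \<and> (\<forall>b\<in>B P. F.functional (\<phi> P b)) \<and>
      (\<forall>v. T P v = (\<Sum>b\<in>B P. \<iota> (\<phi> P b v) * b))" by (rule bchoice[THEN exE])
  then have B: "\<And>P. P \<in> S \<Longrightarrow> finite (B P)"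
    and \<phi>: "\<And>P b. P \<in> S \<Longrightarrow> b \<in> B P \<Longrightarrow> F.functional (\<phi> P b)"
    and TP: "\<And>P v. P \<in> S \<Longrightarrow> T P v = (\<Sum>b\<in>B P. \<iota> (\<phi> P b v) * b)" by blast+
  let ?I = "Sigma S B"
  let ?\<phi> = "\<lambda>(P, b) \<alpha>. \<phi> P b (\<alpha> P)"
  let ?w = "\<lambda>(P, b). local_adele P b"
  have I: "finite ?I" using S B by auto
  have lin: "A.functional (?\<phi> i)" if i_I: "i \<in> ?I" for i
  proof -
    obtain P b where i: "i = (P, b)" "P \<in> S" "b \<in> B P" by (rule SigmaE[OF i_I]) blast
    show ?thesis unfolding i(1) prod.case
      using [[show_types]] by (rule A.functionalI) (simp_all add: F.linear_rules[OF \<phi>[OF i(2,3)]])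
  qed
  have sum: "T' \<alpha> = (\<Sum>i\<in>?I. adele_scale \<iota> (?\<phi> i \<alpha>) (?w i))" for \<alpha>
  proof
    fix Q
    have sum_apply: "(\<Sum>i\<in>J. f i) Q = (\<Sum>i\<in>J. f i Q)"
      for J :: "(('a \<Rightarrow> int) \<times> 'a) set" and f :: "_ \<Rightarrow> ('a \<Rightarrow> int) \<Rightarrow> 'a"
      by (induction J rule: infinite_finite_induct) auto
    have "(\<Sum>i\<in>?I. adele_scale \<iota> (?\<phi> i \<alpha>) (?w i)) Q =
        (\<Sum>P\<in>S. \<Sum>b\<in>B P. \<iota> (\<phi> P b (\<alpha> P)) * local_adele P b Q)"
      unfolding sum_apply using S B by (simp add: sum.Sigma split_def)
    also have "\<dots> = (\<Sum>P\<in>S. if P = Q then T P (\<alpha> P) else 0)"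
      by (rule sum.cong) (auto simp: local_adele_def TP)
    also have "\<dots> = T' \<alpha> Q" using S by (simp add: T')
    finally show "T' \<alpha> Q = (\<Sum>i\<in>?I. adele_scale \<iota> (?\<phi> i \<alpha>) (?w i)) Q" ..
  qed
  show "finite_rank (adele_scale \<iota>) T'" by (rule A.finite_rank_sum[OF I lin sum])
  have "op_trace (adele_scale \<iota>) T' = (\<Sum>i\<in>?I. ?\<phi> i (?w i))" by (rule A.op_trace_sum[OF I lin sum])
  also have "\<dots> = (\<Sum>P\<in>S. \<Sum>b\<in>B P. \<phi> P b b)"
    using S B by (simp add: sum.Sigma split_def local_adele_def)
  also have "\<dots> = (\<Sum>P\<in>S. op_trace (const_scale \<iota>) (T P))"
    by (rule sum.cong[OF refl]) (rule F.op_trace_sum[OF B \<phi> TP, symmetric])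
  finally show "op_trace (adele_scale \<iota>) T' = (\<Sum>P\<in>S. op_trace (const_scale \<iota>) (T P))" .
qed

definition adele_projection :: "(('a \<Rightarrow> int) \<Rightarrow> 'a) \<Rightarrow> ('a \<Rightarrow> int) \<Rightarrow> 'a" where
  "adele_projection \<alpha> = (\<lambda>P. if P \<in> \<X> then place_projection P (\<alpha> P) else 0)"

lemma place_projection_rules:
  assumes P: "P \<in> \<X>"
  shows "F.endo (place_projection P)"
    "place_projection P v \<in> \<O> P" "v \<in> \<O> P \<Longrightarrow> place_projection P v = v"
  using place_projection[OF P] by (auto simp: integral_projection_def)

lemma adele_projection_near:
  "finite_rank (adele_scale \<iota>) (\<lambda>\<alpha>. adele_mult f (adele_projection \<alpha>) - adele_projection (adele_mult f (adele_projection \<alpha>)))"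
proof (rule finite_rank_components)
  let ?S = "{P \<in> \<X>. P f < 0}"
  let ?T = "\<lambda>P v. f * place_projection P v - place_projection P (f * place_projection P v)"
  show "finite ?S" by (rule finite_poles)
  show "finite_rank (const_scale \<iota>) (?T P)" if "P \<in> ?S" for P
    using integral_projection_near[OF _ place_projection] that by blast
  fix \<alpha> :: "('a \<Rightarrow> int) \<Rightarrow> 'a"
  show "adele_mult f (adele_projection \<alpha>) - adele_projection (adele_mult f (adele_projection \<alpha>)) =
      (\<lambda>P. if P \<in> ?S then ?T P (\<alpha> P) else 0)"
  proof
    fix P
    have "?T P (\<alpha> P) = 0" if P: "P \<in> \<X>" "\<not> P f < 0"
    proof -
      have "f \<in> \<O> P" using P(2) by (simp add: val_ge_def)
      then have "f * place_projection P (\<alpha> P) \<in> \<O> P"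
        using val_ge_mult0[OF P(1)] place_projection_rules(2)[OF P(1)] by blast
      then show ?thesis using place_projection_rules(3)[OF P(1)] by simp
    qed
    then show "(adele_mult f (adele_projection \<alpha>) - adele_projection (adele_mult f (adele_projection \<alpha>))) P =
        (if P \<in> ?S then ?T P (\<alpha> P) else 0)" by (auto simp: adele_projection_def)
  qed
qed

lemma adele_projection_linear: "A.endo adele_projection"
  by (rule A.linearI)
    (auto simp: adele_projection_def fun_eq_iff F.linear_rules[OF place_projection_rules(1)])

lemma tate_adeles: "tate (adele_scale \<iota>) \<iota> adele_mult adele_projection"
proof (rule tate.intro[OF A.vector_space_axioms], rule tate_axioms.intro)
  show "A.endo (adele_mult f)" for f by (rule A.linearI) (auto simp: fun_eq_iff algebra_simps)
  show "A.endo adele_projection" by (rule adele_projection_linear)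
  show "adele_projection (adele_projection v) = adele_projection v" for v
    by (auto simp: adele_projection_def fun_eq_iff place_projection_rules)
  show "finite_rank (adele_scale \<iota>) (\<lambda>v. adele_mult f (adele_projection v) -
      adele_projection (adele_mult f (adele_projection v)))" for f by (rule adele_projection_near)
qed (auto simp: fun_eq_iff algebra_simps)

text \<open>
  The compressions act on each component.  Outside \<open>S\<close> both functions preserve the local ring, so their
  compressions commute there.
\<close>

lemma adele_symbol_sum:
  assumes S: "finite S" "S \<subseteq> \<X>"
    and reg: "\<And>P. P \<in> \<X> \<Longrightarrow> P \<notin> S \<Longrightarrow> f \<in> \<O> P \<and> g \<in> \<O> P"
  shows "tate.symbol (adele_scale \<iota>) adele_mult adele_projection f g = (\<Sum>P\<in>S. local_symbol P f g)"
proof -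
  interpret T: tate "adele_scale \<iota>" \<iota> adele_mult adele_projection
    by (rule tate_adeles)
  let ?C = "\<lambda>P. commutator (\<lambda>v. place_projection P (f * place_projection P v))
      (\<lambda>v. place_projection P (g * place_projection P v))"
  have fin: "finite_rank (const_scale \<iota>) (?C P)" if "P \<in> S" for P
  proof -
    have P: "P \<in> \<X>" using that S by blast
    interpret L: tate "const_scale \<iota>" \<iota> "(*)" "place_projection P"
      by (rule tate_local[OF P place_projection[OF P]])
    show ?thesis
      using L.finite_rank_toeplitz_commutator[of f g] by (simp add: L.toeplitz_def[abs_def])
  qed
  have comm: "commutator (T.toeplitz f) (T.toeplitz g) \<alpha> = (\<lambda>P. if P \<in> S then ?C P (\<alpha> P) else 0)" for \<alpha>
  proof
    fix P
    show "commutator (T.toeplitz f) (T.toeplitz g) \<alpha> P = (if P \<in> S then ?C P (\<alpha> P) else 0)"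
    proof (cases "P \<in> \<X>")
      case False
      then show ?thesis using S by (auto simp: commutator_def T.toeplitz_def adele_projection_def)
    next
      case P: True
      have "commutator (T.toeplitz f) (T.toeplitz g) \<alpha> P = ?C P (\<alpha> P)"
        using P by (simp add: commutator_def T.toeplitz_def adele_projection_def)
      moreover have "?C P (\<alpha> P) = 0" if "P \<notin> S"
      proof -
        let ?a = "place_projection P (\<alpha> P)"
        have a: "?a \<in> \<O> P" by (rule place_projection_rules(2)[OF P])
        have fg: "f \<in> \<O> P" "g \<in> \<O> P" using reg[OF P that] by auto
        have "f * ?a \<in> \<O> P" "g * ?a \<in> \<O> P" "f * (g * ?a) \<in> \<O> P" "g * (f * ?a) \<in> \<O> P"
          by (intro val_ge_mult0[OF P] fg a)+
        then show ?thesis by (simp add: commutator_def place_projection_rules(3)[OF P])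
      qed
      ultimately show ?thesis by simp
    qed
  qed
  have "T.symbol f g = (\<Sum>P\<in>S. op_trace (const_scale \<iota>) (?C P))"
    unfolding T.symbol_def by (rule op_trace_components[OF S(1) fin comm])
  also have "\<dots> = (\<Sum>P\<in>S. local_symbol P f g)"
    using S(2) by (intro sum.cong refl local_symbol_eq[symmetric] place_projection) auto
  finally show ?thesis .
qed

text \<open>
  \<open>H\<^sup>0 = adeles_at 0 \<inter> F\<close> and \<open>H\<^sup>1 = adeles / (adeles_at 0 + F)\<close> have finite dimension.  So, up to
  finite rank, the projection onto \<open>adeles_at 0\<close> is a projection \<open>e'\<close> along the function field \<open>F\<close>, and
  compression by \<open>e'\<close> is the action of functions on the quotient by \<open>F\<close>, which is commutative.
\<close>

lemma adele_symbol_zero: "tate.symbol (adele_scale \<iota>) adele_mult adele_projection f g = 0"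
proof -
  interpret T: tate "adele_scale \<iota>" \<iota> adele_mult adele_projection
    by (rule tate_adeles)
  let ?V = "\<A>" and ?O = "adeles_at \<iota> 0" and ?F = "\<F>"
  let ?N = "?O \<inter> ?F"
  note V = adeles_subspace and O = adeles_at_subspace[of 0] and F = principal_adeles_subspace
  have OV: "?O \<subseteq> ?V" and FV: "?F \<subseteq> ?V" using principal_adeles_adeles by (auto simp: adeles_at_def)
  have N: "A.subspace ?N" by (rule A.subspace_inter[OF O F])
  have finN: "finite ?N"
  proof -
    have "?N \<subseteq> diagonal ` range \<iota>"
      using diagonal_at_iff[OF divisors_0] RR_space_0 by (auto simp: principal_adeles_def)
    then show ?thesis by (rule finite_subset) simp
  qed
  obtain B where B: "quotient_basis (adele_scale \<iota>) ?V (?O + ?F) B"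
    using h1_dim(1)[OF divisors_0] by (auto simp: finite_h1_def finite_dim_quotient_def)
  let ?W = "A.span B"
  have B': "finite B" "B \<subseteq> ?V" "?V \<subseteq> ?W + (?O + ?F)"
    "\<And>c b. (\<Sum>b\<in>B. adele_scale \<iota> (c b) b) \<in> ?O + ?F \<Longrightarrow> b \<in> B \<Longrightarrow> c b = 0"
    using B by (auto simp: quotient_basis_def)
  have WV: "?W \<subseteq> ?V" by (rule A.span_minimal[OF B'(2) V])
  have W: "A.subspace ?W" by (rule A.subspace_span)
  have W_disj: "w = 0" if w: "w \<in> ?W" "w \<in> ?O + ?F" for w
  proof -
    obtain c where c: "w = (\<Sum>b\<in>B. adele_scale \<iota> (c b) b)" using w(1) A.span_finite[OF B'(1)] by auto
    have "c b = 0" if "b \<in> B" for b using B'(4)[of c b] w(2) c that by blast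
    then show ?thesis unfolding c by (simp add: fun_eq_iff sum.neutral zero_fun_def[symmetric])
  qed
  have OW: "A.subspace (?O + ?W)" and FW: "A.subspace (?F + ?W)"
    by (rule A.subspace_plus[OF O W] A.subspace_plus[OF F W])+
  note O' = A.add_subgroup_subspace[OF O] and F' = A.add_subgroup_subspace[OF F]
    and W' = A.add_subgroup_subspace[OF W]
  have N1: "x \<in> ?N" if x: "x \<in> ?O \<inter> (?F + ?W)" for x
  proof -
    obtain f w where fw: "x = f + w" "f \<in> ?F" "w \<in> ?W" using IntD2[OF x] by (rule set_plus_elim)
    have "w = 0"
      by (rule W_disj[OF fw(3) set_plusI[OF _ IntD1[OF x] A.subspace_neg[OF F fw(2)]]]) (simp add: fw(1))
    then show ?thesis using x fw by simp
  qed
  have N2: "x \<in> ?N" if x: "x \<in> (?O + ?W) \<inter> ?F" for x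
  proof -
    obtain a w where aw: "x = a + w" "a \<in> ?O" "w \<in> ?W" using IntD1[OF x] by (rule set_plus_elim)
    have "w = 0"
      by (rule W_disj[OF aw(3) set_plusI[OF _ A.subspace_neg[OF O aw(2)] IntD2[OF x]]]) (simp add: aw(1))
    then show ?thesis using x aw by simp
  qed
  have zero_disj: "U \<inter> {0} = {0}" if U: "A.subspace U" for U using A.subspace_0[OF U] by blast
  obtain \<pi> where \<pi>: "A.endo \<pi>" "\<And>x. \<pi> x \<in> ?N" "\<And>x. x \<in> ?N \<Longrightarrow> \<pi> x = x"
    using A.exists_projection[OF N A.subspace_single_0 zero_disj[OF N]] by blast
  obtain p where p: "A.endo p" "\<And>x. p x \<in> ?V" "\<And>x. x \<in> ?V \<Longrightarrow> p x = x"
    using A.exists_projection[OF V A.subspace_single_0 zero_disj[OF V]] by blast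
  obtain e1 where e1: "A.endo e1" "\<And>x. e1 x \<in> ?O" "\<And>x. x \<in> ?F + ?W \<Longrightarrow> e1 x = 0"
    "\<And>x. x \<in> ?O \<Longrightarrow> x - e1 x \<in> ?O \<inter> (?F + ?W)" using A.relative_projection[OF O FW] by blast
  obtain e2 where e2: "A.endo e2" "\<And>x. e2 x \<in> ?O + ?W" "\<And>x. x \<in> ?F \<Longrightarrow> e2 x = 0"
    "\<And>x. x \<in> ?O + ?W \<Longrightarrow> x - e2 x \<in> (?O + ?W) \<inter> ?F" using A.relative_projection[OF OW F] by blast
  define e where "e x = e1 (p x) - \<pi> (e1 (p x) - p x)" for x
  define e' where "e' x = e2 (p x)" for x
  have e_lin: "A.endo e" unfolding e_def[abs_def]
    by (rule A.linear_minus[OF A.linear_comp[OF e1(1) p(1)]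
          A.linear_comp[OF \<pi>(1) A.linear_minus[OF A.linear_comp[OF e1(1) p(1)] p(1)]]])
  have e'_lin: "A.endo e'" unfolding e'_def[abs_def] by (rule A.linear_comp[OF e2(1) p(1)])
  have OWV: "?O + ?W \<subseteq> ?V" using OV WV A.subspace_add[OF V] by (auto simp: set_plus_def)
  have e'_V: "e' x \<in> ?V" for x using e2(2) OWV by (auto simp: e'_def)
  have decomp: "\<exists>a\<in>?O. \<exists>w\<in>?W. \<exists>h\<in>?F. x = (a + w) + h \<and> e1 x = e1 a \<and> e2 x = e2 (a + w)"
    if x: "x \<in> ?V" for x
  proof -
    have "x \<in> ?W + (?O + ?F)" using x B'(3) by blast
    then obtain w y where wy: "x = w + y" "w \<in> ?W" "y \<in> ?O + ?F" by (rule set_plus_elim)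
    obtain a h where ah: "y = a + h" "a \<in> ?O" "h \<in> ?F" using wy(3) by (rule set_plus_elim)
    have x_eq: "x = (a + w) + h" using wy(1) ah(1) by (simp only: add_ac)
    have "e1 w = 0" "e1 h = 0"
      using e1(3) subset_plus_left[OF F', of ?W] subset_plus_right[OF W', of ?F] wy(2) ah(3) by blast+
    then have "e1 x = e1 a" "e2 x = e2 (a + w)"
      unfolding x_eq by (simp_all only: A.linear_rules(1)[OF e1(1)] A.linear_rules(1)[OF e2(1)] e2(3)[OF ah(3)] add_0_right)
    then show ?thesis using x_eq wy(2) ah(2,3) by blast
  qed
  have e'_F: "x - e' x \<in> ?F" if x_V: "x \<in> ?V" for x
  proof -
    obtain a w h where *: "a \<in> ?O" "w \<in> ?W" "h \<in> ?F" "x = (a + w) + h" "e2 x = e2 (a + w)"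
      using decomp[OF x_V] by blast
    have "x - e' x = h + ((a + w) - e2 (a + w))"
      unfolding e'_def p(3)[OF x_V] *(5) by (simp add: *(4))
    then show ?thesis using A.subspace_add[OF F *(3)] e2(4)[OF set_plusI[OF refl *(1,2)]] by simp
  qed
  have e'_kill: "e' x = 0" if "x \<in> ?F" for x using that FV p(3) e2(3) by (auto simp: e'_def)
  have e'_idem: "e' (e' x) = e' x" for x
    using e'_kill[OF e'_F[OF e'_V[of x]]] A.linear_rules(2)[OF e'_lin, of "e' x" "e' (e' x)"]
      e'_kill[OF e'_F[OF p(2)[of x]]] A.linear_rules(2)[OF e'_lin, of "p x" "e' (p x)"] p(2,3)
    by (simp add: e'_def)
  have hom: "e' (adele_mult f (e' (adele_mult g (e' v)))) = e' (adele_mult (f * g) (e' v))" for f g v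
  proof -
    let ?x = "adele_mult g (e' v)"
    have "?x \<in> ?V" by (rule adele_mult_adele[OF e'_V])
    then have "?x - e' ?x \<in> ?F" by (rule e'_F)
    then obtain h where "?x - e' ?x = diagonal h" by (auto simp: principal_adeles_def)
    then have "adele_mult f (?x - e' ?x) = diagonal (f * h)" by (simp add: fun_eq_iff)
    then have "adele_mult f (?x - e' ?x) \<in> ?F" by (simp add: principal_adeles_def)
    then have "e' (adele_mult f (?x - e' ?x)) = 0" by (rule e'_kill)
    moreover have "adele_mult f (?x - e' ?x) = adele_mult f ?x - adele_mult f (e' ?x)"
      by (simp add: fun_eq_iff right_diff_distrib)
    ultimately have "e' (adele_mult f ?x) = e' (adele_mult f (e' ?x))"
      by (simp add: A.linear_rules[OF e'_lin])
    moreover have "adele_mult f ?x = adele_mult (f * g) (e' v)" by (simp add: fun_eq_iff mult.assoc)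
    ultimately show ?thesis by simp
  qed
  have near: "finite_rank (adele_scale \<iota>) (\<lambda>x. e x - e' x)"
  proof (rule A.finite_rankI[OF A.linear_minus[OF e_lin e'_lin]])
    show "finite (?N \<union> B)" using finN B'(1) by simp
    fix x
    obtain a w h where *: "a \<in> ?O" "w \<in> ?W" "e1 (p x) = e1 a" "e2 (p x) = e2 (a + w)"
      using decomp[OF p(2)[of x]] by blast
    have mem: "a - e1 a \<in> ?N" "(a + w) - e2 (a + w) \<in> ?N" "\<pi> (e1 (p x) - p x) \<in> ?N"
      by (rule N1[OF e1(4)[OF *(1)]] N2[OF e2(4)[OF set_plusI[OF refl *(1,2)]]] \<pi>(2))+
    have "e x - e' x = ((a + w) - e2 (a + w)) - (a - e1 a) - \<pi> (e1 (p x) - p x) - w"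
      unfolding e_def e'_def *(4) by (simp add: *(3))
    moreover have "w \<in> A.span (?N \<union> B)" using *(2) A.span_mono[of B "?N \<union> B"] by blast
    ultimately show "e x - e' x \<in> A.span (?N \<union> B)"
      using mem by (simp only: A.span_diff A.span_base UnI1)
  qed
  have e_O: "e x \<in> ?O" "x \<in> ?O \<Longrightarrow> e x = x" for x
  proof -
    show "e x \<in> ?O" unfolding e_def using A.subspace_diff[OF O e1(2)] \<pi>(2) by blast
    assume x: "x \<in> ?O"
    have "- (x - e1 x) \<in> ?N" by (rule A.subspace_neg[OF N N1[OF e1(4)[OF x]]])
    then show "e x = x" using \<pi>(3)[of "e1 x - x"] p(3)[of x] x OV by (simp add: e_def subset_eq)
  qed
  have proj_O: "adele_projection x \<in> ?O" for x
    using place_projection_rules(2) by (auto simp: adele_projection_def adeles_at_def adeles_def)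
  have proj_id: "adele_projection x = x" if "x \<in> ?O" for x
    using that place_projection_rules(3) by (auto simp: adele_projection_def adeles_at_def adeles_def fun_eq_iff)
  note change = T.tate_projection_cong[OF e_lin proj_id[OF e_O(1)] e_O(2)[OF proj_O]]
  show ?thesis unfolding change(2)
    by (rule tate.symbol_eq_0_of_near[OF change(1) e'_lin near e'_idem hom])
qed

text \<open>
  Tate's proof: the sum of the local symbols is the symbol of the adeles, which the function field, a
  discrete and cocompact subspace, forces to vanish.
\<close>

theorem residue_theorem:
  assumes "finite S" "S \<subseteq> \<X>"
    and "\<And>P. P \<in> \<X> \<Longrightarrow> P \<notin> S \<Longrightarrow> f \<in> \<O> P \<and> g \<in> \<O> P"
  shows "(\<Sum>P\<in>S. local_symbol P f g) = 0"
  using adele_symbol_sum[OF assms] adele_symbol_zero by simp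

end

section \<open>Divisor and residues of a differential\<close>

lemma form_scale_vector_space: "vector_space (form_scale :: 'a::field \<Rightarrow> 'a differential \<Rightarrow> 'a differential)"
  by unfold_locales (auto simp: fun_eq_iff algebra_simps)

context curve
begin

lemma H1_dualI:
  assumes "\<And>\<alpha>. \<alpha> \<notin> \<A> \<Longrightarrow> \<phi> \<alpha> = 0"
    and add: "\<And>\<alpha> \<beta>. \<alpha> \<in> \<A> \<Longrightarrow> \<beta> \<in> \<A> \<Longrightarrow> \<phi> (\<alpha> + \<beta>) = \<phi> \<alpha> + \<phi> \<beta>"
    and "\<And>c \<alpha>. \<alpha> \<in> \<A> \<Longrightarrow> \<phi> (adele_scale \<iota> c \<alpha>) = c * \<phi> \<alpha>"
    and at: "\<And>\<alpha>. \<alpha> \<in> adeles_at \<iota> B \<Longrightarrow> \<phi> \<alpha> = 0" and diag: "\<And>h. \<phi> (diagonal h) = 0"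
  shows "\<phi> \<in> H1_dual \<iota> B"
proof -
  have "\<phi> \<alpha> = 0" if \<alpha>: "\<alpha> \<in> adeles_at \<iota> B + \<F>" for \<alpha>
  proof -
    obtain \<beta> \<gamma> where *: "\<alpha> = \<beta> + \<gamma>" "\<beta> \<in> adeles_at \<iota> B" "\<gamma> \<in> \<F>" using \<alpha> by (elim set_plus_elim)
    then have "\<phi> \<gamma> = 0" using diag by (auto simp: principal_adeles_def)
    moreover have "\<beta> \<in> \<A>" "\<gamma> \<in> \<A>" using * principal_adeles_adeles by (auto simp: adeles_at_def)
    ultimately show ?thesis using *(1) add at[OF *(2)] by simp
  qed
  then show ?thesis using assms(1,2,3) by (simp add: H1_dual_def)
qed

lemma H1_dualD:
  assumes "\<phi> \<in> H1_dual \<iota> B"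
  shows "\<alpha> \<notin> \<A> \<Longrightarrow> \<phi> \<alpha> = 0"
    and "\<alpha> \<in> \<A> \<Longrightarrow> \<beta> \<in> \<A> \<Longrightarrow> \<phi> (\<alpha> + \<beta>) = \<phi> \<alpha> + \<phi> \<beta>"
    and "\<alpha> \<in> \<A> \<Longrightarrow> \<phi> (adele_scale \<iota> c \<alpha>) = c * \<phi> \<alpha>"
    and "\<alpha> \<in> adeles_at \<iota> B + \<F> \<Longrightarrow> \<phi> \<alpha> = 0"
    and "\<alpha> \<in> adeles_at \<iota> B \<Longrightarrow> \<phi> \<alpha> = 0" and "\<phi> (diagonal h) = 0"
proof -
  show *: "\<alpha> \<in> adeles_at \<iota> B + \<F> \<Longrightarrow> \<phi> \<alpha> = 0" for \<alpha> using assms by (simp add: H1_dual_def)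
  note sub = A.add_subgroup_subspace[OF principal_adeles_subspace]
    A.add_subgroup_subspace[OF adeles_at_subspace]
  show "\<alpha> \<in> adeles_at \<iota> B \<Longrightarrow> \<phi> \<alpha> = 0" by (rule *) (rule subsetD[OF subset_plus_right[OF sub(1)]])
  have "diagonal h \<in> \<F>" by (simp add: principal_adeles_def)
  then show "\<phi> (diagonal h) = 0" by (intro * subsetD[OF subset_plus_left[OF sub(2)]])
qed (use assms in \<open>auto simp: H1_dual_def\<close>)

lemma places_nonempty: "\<exists>P. P \<in> \<X>"
proof -
  obtain x B where "curve_coord \<iota> x B" using coordinates_exist by blast
  then have "x \<notin> range \<iota>" using transcendental_iff curve_coord.x by blast
  then show ?thesis using exists_pole by blast
qed

lemma place_with_uniformizer: "\<exists>P t. P \<in> \<X> \<and> P t = 1"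
proof -
  obtain P where P: "P \<in> \<X>" using places_nonempty by blast
  obtain t where "P t = 1" "t \<noteq> 0" by (rule uniformizer_exists[OF P])
  then show ?thesis using P by blast
qed

lemma dform_uniformizer:
  assumes P: "P \<in> \<X>" and t: "P t = 1"
  shows "\<exists>u. (f \<in> \<O> P \<longrightarrow> u \<in> \<O> P) \<and> dform \<iota> f = form_scale u (dform \<iota> t)"
proof -
  obtain u where u: "f \<in> \<O> P \<longrightarrow> u \<in> \<O> P" "\<forall>\<delta>\<in>derivations \<iota>. \<delta> f = u * \<delta> t"
    using derivative_of_derivations[OF P t] by blast
  have "dform \<iota> f = form_scale u (dform \<iota> t)" using u(2) by (auto simp: dform_def fun_eq_iff)
  then show ?thesis using u(1) by blast
qed

text \<open>
  The multiples of \<open>dt\<close> form a subspace that contains all \<open>df\<close>.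
\<close>

lemma differential_uniformizer:
  assumes \<eta>: "\<eta> \<in> differentials \<iota>" and P: "P \<in> \<X>" and t: "P t = 1"
  shows "\<exists>u. \<eta> = form_scale u (dform \<iota> t)"
proof -
  interpret D: vector_space "form_scale :: 'a \<Rightarrow> 'a differential \<Rightarrow> 'a differential"
    by (rule form_scale_vector_space)
  define S where "S = {\<zeta> :: 'a differential. \<exists>u. \<forall>\<delta>. \<zeta> \<delta> = u * dform \<iota> t \<delta>}"
  have "D.subspace S"
  proof (rule D.subspaceI)
    have "\<forall>\<delta>. (0 :: 'a differential) \<delta> = 0 * dform \<iota> t \<delta>" by simp
    then show "0 \<in> S" unfolding S_def mem_Collect_eq by (rule exI)
    fix x y :: "'a differential" and c :: 'a
    assume x: "x \<in> S"
    obtain u where u: "\<forall>\<delta>. x \<delta> = u * dform \<iota> t \<delta>"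
      using x unfolding S_def mem_Collect_eq by (rule exE)
    have "\<forall>\<delta>. c * x \<delta> = (c * u) * dform \<iota> t \<delta>" by (simp add: u mult.assoc)
    then show "form_scale c x \<in> S" unfolding S_def mem_Collect_eq by (rule exI)
    assume y: "y \<in> S"
    obtain v where v: "\<forall>\<delta>. y \<delta> = v * dform \<iota> t \<delta>"
      using y unfolding S_def mem_Collect_eq by (rule exE)
    have "\<forall>\<delta>. (x + y) \<delta> = (u + v) * dform \<iota> t \<delta>" by (simp add: u v distrib_right)
    then show "x + y \<in> S" unfolding S_def mem_Collect_eq by (rule exI)
  qed
  moreover have "range (dform \<iota>) \<subseteq> S"
  proof (rule image_subsetI)
    fix f
    obtain u where "dform \<iota> f = form_scale u (dform \<iota> t)"
      using dform_uniformizer[OF P t, of f] by (elim exE conjE)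
    then have "\<forall>\<delta>. dform \<iota> f \<delta> = u * dform \<iota> t \<delta>" by simp
    then show "dform \<iota> f \<in> S" unfolding S_def mem_Collect_eq by (rule exI)
  qed
  ultimately have "D.span (range (dform \<iota>)) \<subseteq> S" by (intro D.span_minimal)
  then have "\<eta> \<in> S" using \<eta> by (auto simp: differentials_def)
  then obtain u where "\<forall>\<delta>. \<eta> \<delta> = u * dform \<iota> t \<delta>" unfolding S_def mem_Collect_eq by (rule exE)
  then have "\<eta> = form_scale u (dform \<iota> t)" by (simp add: fun_eq_iff)
  then show ?thesis ..
qed

end

locale curve_differential = curve \<iota> for \<iota> :: "'k::{field,finite} \<Rightarrow> 'a::field" +
  fixes \<eta> :: "'a differential"
  assumes \<eta>: "\<eta> \<in> differentials \<iota>" "\<eta> \<noteq> 0"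
begin

text \<open>Comparison of differentials reduces to comparison of their values on one derivation.\<close>

lemma derivation_exists: "\<exists>\<delta>\<in>derivations \<iota>. \<eta> \<delta> \<noteq> 0"
proof -
  obtain P t where P: "P \<in> \<X>" "P t = 1" using place_with_uniformizer by blast
  obtain u where u: "\<eta> = form_scale u (dform \<iota> t)"
    using differential_uniformizer[OF \<eta>(1) P] by blast
  obtain \<delta> where \<delta>: "\<eta> \<delta> \<noteq> 0" using \<eta>(2) by (auto simp: fun_eq_iff)
  then have "\<delta> \<in> derivations \<iota>" unfolding u by (auto simp: dform_def split: if_splits)
  then show ?thesis using \<delta> by blast
qed

definition \<Delta> :: "'a \<Rightarrow> 'a" where
  "\<Delta> = (SOME \<delta>. \<delta> \<in> derivations \<iota> \<and> \<eta> \<delta> \<noteq> 0)"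

lemma \<Delta>: "\<Delta> \<in> derivations \<iota>" "\<eta> \<Delta> \<noteq> 0"
proof -
  have "\<exists>\<delta>. \<delta> \<in> derivations \<iota> \<and> \<eta> \<delta> \<noteq> 0" using derivation_exists by blast
  then show "\<Delta> \<in> derivations \<iota>" "\<eta> \<Delta> \<noteq> 0" unfolding \<Delta>_def by (rule someI2_ex; simp)+
qed

lemma \<Delta>_form:
  assumes "\<eta> = form_scale u (dform \<iota> z)"
  shows "\<eta> \<Delta> = u * \<Delta> z" "u \<noteq> 0" "\<Delta> z \<noteq> 0"
proof -
  show "\<eta> \<Delta> = u * \<Delta> z" using \<Delta>(1) by (simp add: assms dform_def)
  then show "u \<noteq> 0" "\<Delta> z \<noteq> 0" using \<Delta>(2) by auto
qed

text \<open>
  The derivatives of two uniformizers by each other are regular and inverse to each other.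
\<close>

lemma diff_val_eq:
  assumes P: "P \<in> \<X>" and t: "P t = 1" and u: "\<eta> = form_scale u (dform \<iota> t)"
  shows "diff_val \<iota> P \<eta> = P u"
proof -
  have unique: "P u' = P u" if t': "P t' = 1" and u': "\<eta> = form_scale u' (dform \<iota> t')" for t' u'
  proof -
    have le: "P u2 \<le> P u1" if t1: "P t1 = 1" "\<eta> = form_scale u1 (dform \<iota> t1)"
      and t2: "P t2 = 1" "\<eta> = form_scale u2 (dform \<iota> t2)" for t1 u1 t2 u2
    proof -
      have "t2 \<in> \<O> P" using t2(1) by (simp add: val_ge_def)
      then obtain s where s: "s \<in> \<O> P" "\<Delta> t2 = s * \<Delta> t1"
        using derivative_of_derivations[OF P t1(1)] \<Delta>(1) by blast
      have "u1 * \<Delta> t1 = u2 * \<Delta> t2"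
        using \<Delta>_form(1)[OF t1(2)] \<Delta>_form(1)[OF t2(2)] by (rule trans[OF sym])
      then have "u1 * \<Delta> t1 = u2 * s * \<Delta> t1" by (simp only: s(2) mult.assoc)
      then have "u1 = u2 * s" using \<Delta>_form(3)[OF t1(2)] by simp
      moreover have "s \<noteq> 0" using calculation \<Delta>_form(2)[OF t1(2)] by auto
      ultimately show ?thesis
        using s(1) place_mult[OF P \<Delta>_form(2)[OF t2(2)]] by (simp add: val_ge_def)
    qed
    show ?thesis using le[OF t u t' u'] le[OF t' u' t u] by simp
  qed
  show ?thesis unfolding diff_val_def
  proof (rule the_equality)
    show "\<exists>t ua. P t = 1 \<and> \<eta> = form_scale ua (dform \<iota> t) \<and> P u = P ua"
      by (rule exI[of _ t], rule exI[of _ u]) (rule conjI[OF t conjI[OF u refl]])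
    show "n = P u" if "\<exists>t u. P t = 1 \<and> \<eta> = form_scale u (dform \<iota> t) \<and> n = P u" for n
      using that by (elim exE conjE) (simp only: unique)
  qed
qed

definition K :: "'a dvsr" where
  "K = diff_divisor \<iota> \<eta>"

definition res :: "('a \<Rightarrow> int) \<Rightarrow> 'a \<Rightarrow> 'k" where
  "res P f = residue_trace \<iota> P (form_scale f \<eta>)"

lemma res_symbol:
  assumes P: "P \<in> \<X>" and z: "\<eta> = form_scale u (dform \<iota> z)"
  shows "res P f = local_symbol P (f * u) z"
proof -
  have "form_scale f \<eta> = form_scale (f * u) (dform \<iota> z)" by (simp add: z fun_eq_iff mult.assoc)
  then show ?thesis using residue_trace_eq_symbol[OF P \<Delta>(1) \<Delta>_form(3)[OF z]] by (simp add: res_def)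
qed

lemma local_form:
  assumes P: "P \<in> \<X>"
  obtains t u where "P t = 1" "t \<noteq> 0" "\<eta> = form_scale u (dform \<iota> t)" "u \<noteq> 0" "K P = P u"
    "\<forall>f. res P f = local_symbol P (f * u) t"
proof -
  obtain t where t: "P t = 1" "t \<noteq> 0" using uniformizer_exists[OF P] .
  obtain u where u: "\<eta> = form_scale u (dform \<iota> t)"
    using differential_uniformizer[OF \<eta>(1) P t(1)] by blast
  have "K P = P u" using diff_val_eq[OF P t(1) u] P by (simp add: K_def diff_divisor_def)
  then show ?thesis using res_symbol[OF P u] by (intro that[OF t u \<Delta>_form(2)[OF u]] allI)
qed

lemma
  assumes P: "P \<in> \<X>"
  shows res_add: "res P (f + g) = res P f + res P g"
    and res_scale: "res P (\<iota> c * f) = c * res P f"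
proof -
  obtain t u where "P t = 1" "t \<noteq> 0" "\<eta> = form_scale u (dform \<iota> t)" "u \<noteq> 0" "K P = P u"
    and tu: "\<forall>f. res P f = local_symbol P (f * u) t" by (rule local_form[OF P])
  show "res P (f + g) = res P f + res P g" "res P (\<iota> c * f) = c * res P f"
    using local_symbol_add_left[OF P] local_symbol_scale[OF P]
    by (simp_all add: tu distrib_right mult.assoc)
qed

lemma res_regular:
  assumes P: "P \<in> \<X>" and f: "f \<in> val_ge P (- K P)"
  shows "res P f = 0"
proof -
  obtain t u where t: "P t = 1" "t \<noteq> 0" "\<eta> = form_scale u (dform \<iota> t)"
    and tu: "u \<noteq> 0" "K P = P u" "\<forall>f. res P f = local_symbol P (f * u) t" by (rule local_form[OF P])
  have "u * f \<in> \<O> P" using f by (simp add: val_ge_mult_iff[OF P tu(1)] tu(2))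
  then show ?thesis
    using local_symbol_regular[OF P, of "f * u" t] t(1) tu(3) by (simp add: val_ge_def mult.commute)
qed

text \<open>
  Multiplied by a suitable power of the uniformizer, \<open>f\<eta>\<close> has a simple pole, and its residue can be
  made any element of the residue field; the trace form of the residue field is nondegenerate.
\<close>

lemma res_nondegenerate:
  assumes P: "P \<in> \<X>" and f: "f \<notin> val_ge P (m - K P)"
  shows "\<exists>a\<in>val_ge P (- m). res P (f * a) \<noteq> 0"
proof -
  obtain t u where tu: "P t = 1" "t \<noteq> 0" and form: "\<eta> = form_scale u (dform \<iota> t)"
    and u: "u \<noteq> 0" "K P = P u" "\<forall>f. res P f = local_symbol P (f * u) t" by (rule local_form[OF P])
  have f0: "f \<noteq> 0" and lt: "P f < m - P u" using f by (auto simp: val_ge_def u(2))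
  define n where "n = P f + P u"
  define c where "c = f * u * t powi (- n)"
  have t0: "t powi i \<noteq> 0" "P (t powi i) = i" for i
    using tu(1,2) place_power_int[OF P, of t i] by simp_all
  have c: "c \<noteq> 0" "P c = 0" using f0 u(1) t0 tu(2) by (simp_all add: c_def n_def place_mult[OF P])
  then have "c \<in> \<O> P" "c \<notin> \<m> P" by (simp_all add: val_ge_def)
  then obtain b where b: "b \<in> \<O> P" "tr P (b * c) \<noteq> 0" using tr_nondegenerate[OF P] by blast
  have eq: "t powi (- n - 1) = t powi (- n) / t" using tu(2) by (simp add: power_int_diff)
  have "f * (b * t powi (- n - 1)) * u = b * c / t" unfolding eq c_def by (simp add: mult_ac)
  then have "res P (f * (b * t powi (- n - 1))) = tr P (b * c)"
    using local_symbol_simple_pole[OF P tu(1) val_ge_mult0[OF P b(1) \<open>c \<in> \<O> P\<close>]] u(3) by simp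
  moreover have "b * t powi (- n - 1) \<in> val_ge P (- m)"
  proof -
    have "t powi (- n - 1) \<in> val_ge P (- m)"
      using t0[of "- n - 1"] lt by (simp add: val_ge_def n_def)
    then show ?thesis by (rule val_ge_mult0[OF P b(1)])
  qed
  ultimately show ?thesis
    using b(2) by (intro bexI[of _ "b * t powi (- n - 1)"]) (simp_all only: not_False_eq_True)
qed

text \<open>Almost everywhere, \<open>\<eta> = u dz\<close> with \<open>u\<close> and \<open>z\<close> regular.\<close>

lemma finite_poles_\<eta>: "finite {P \<in> \<X>. K P < 0}"
proof -
  obtain Q z where Q: "Q \<in> \<X>" "Q z = 1" using place_with_uniformizer by blast
  obtain w where w: "\<eta> = form_scale w (dform \<iota> z)"
    using differential_uniformizer[OF \<eta>(1) Q] by blast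
  have "{P \<in> \<X>. K P < 0} \<subseteq> {P \<in> \<X>. P w < 0} \<union> {P \<in> \<X>. P z < 0}"
  proof
    fix P assume P: "P \<in> {P \<in> \<X>. K P < 0}"
    then have P': "P \<in> \<X>" by blast
    obtain t u where tu: "P t = 1" "t \<noteq> 0" "\<eta> = form_scale u (dform \<iota> t)" "u \<noteq> 0" "K P = P u"
      "\<forall>f. res P f = local_symbol P (f * u) t" by (rule local_form[OF P'])
    show "P \<in> {P \<in> \<X>. P w < 0} \<union> {P \<in> \<X>. P z < 0}"
    proof (rule ccontr)
      assume "\<not> ?thesis"
      then have wz: "w \<in> \<O> P" "z \<in> \<O> P" using P' by (auto simp: val_ge_def)
      obtain s where s: "s \<in> \<O> P" "\<Delta> z = s * \<Delta> t"
        using derivative_of_derivations[OF P' tu(1)] \<Delta>(1) wz(2) by blast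
      have "u * \<Delta> t = w * \<Delta> z" using \<Delta>_form(1)[OF tu(3)] \<Delta>_form(1)[OF w] by (rule trans[OF sym])
      then have "u * \<Delta> t = w * s * \<Delta> t" by (simp only: s(2) mult.assoc)
      then have "u = w * s" using \<Delta>_form(3)[OF tu(3)] by simp
      then have "u \<in> \<O> P" using val_ge_mult0[OF P' wz(1) s(1)] by simp
      then show False using P tu(4,5) by (simp add: val_ge_def)
    qed
  qed
  then show ?thesis using finite_poles by (auto intro: finite_subset)
qed

lemma residue_sum_zero: "\<exists>S. finite S \<and> S \<subseteq> \<X> \<and> (\<forall>P\<in>\<X> - S. res P f = 0) \<and> (\<Sum>P\<in>S. res P f) = 0"
proof -
  obtain Q z where Q: "Q \<in> \<X>" "Q z = 1" using place_with_uniformizer by blast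
  obtain w where w: "\<eta> = form_scale w (dform \<iota> z)"
    using differential_uniformizer[OF \<eta>(1) Q] by blast
  define S where "S = {P \<in> \<X>. P (f * w) < 0} \<union> {P \<in> \<X>. P z < 0}"
  have S: "finite S" "S \<subseteq> \<X>" using finite_poles by (auto simp: S_def)
  have reg: "f * w \<in> \<O> P \<and> z \<in> \<O> P" if "P \<in> \<X>" "P \<notin> S" for P
    using that by (auto simp: val_ge_def S_def)
  have 1: "\<forall>P\<in>\<X> - S. res P f = 0"
  proof
    fix P assume "P \<in> \<X> - S"
    then show "res P f = 0"
      using reg[of P] local_symbol_regular[of P "f * w" z] res_symbol[OF _ w] by auto
  qed
  have "(\<Sum>P\<in>S. res P f) = (\<Sum>P\<in>S. local_symbol P (f * w) z)"
    using S(2) by (intro sum.cong refl res_symbol[OF _ w]) auto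
  also have "\<dots> = 0" by (rule residue_theorem[OF S reg])
  finally show ?thesis using S 1 by (intro exI[of _ S] conjI)
qed

section \<open>Serre duality\<close>

abbreviation serre :: "'a \<Rightarrow> (('a \<Rightarrow> int) \<Rightarrow> 'a) \<Rightarrow> 'k" where
  "serre \<equiv> serre_map \<iota> \<eta>"

lemma finite_residues:
  assumes \<alpha>: "\<alpha> \<in> \<A>"
  shows "finite {P \<in> \<X>. res P (\<alpha> P) \<noteq> 0}"
proof -
  have "{P \<in> \<X>. res P (\<alpha> P) \<noteq> 0} \<subseteq> {P \<in> \<X>. \<alpha> P \<notin> \<O> P} \<union> {P \<in> \<X>. K P < 0}"
  proof
    fix P assume P: "P \<in> {P \<in> \<X>. res P (\<alpha> P) \<noteq> 0}"
    show "P \<in> {P \<in> \<X>. \<alpha> P \<notin> \<O> P} \<union> {P \<in> \<X>. K P < 0}"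
    proof (rule ccontr)
      assume "\<not> ?thesis"
      then have "\<alpha> P \<in> \<O> P" "0 \<le> K P" using P by auto
      then have "\<alpha> P \<in> val_ge P (- K P)" using val_ge_mono[of "- K P" 0] by simp
      then show False using P res_regular by blast
    qed
  qed
  then show ?thesis using \<alpha> finite_poles_\<eta> by (auto simp: adeles_def intro: finite_subset)
qed

lemma serre_sum:
  assumes \<alpha>: "\<alpha> \<in> \<A>" and S: "finite S" "S \<subseteq> \<X>" "\<And>P. P \<in> \<X> \<Longrightarrow> P \<notin> S \<Longrightarrow> res P (f * \<alpha> P) = 0"
  shows "serre f \<alpha> = (\<Sum>P\<in>S. res P (f * \<alpha> P))"
proof -
  have "serre f \<alpha> = (\<Sum>P | P \<in> \<X> \<and> res P (f * \<alpha> P) \<noteq> 0. res P (f * \<alpha> P))"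
    using \<alpha> by (simp add: serre_map_def res_def)
  also have "\<dots> = (\<Sum>P\<in>S. res P (f * \<alpha> P))" using S by (intro sum.mono_neutral_left) auto
  finally show ?thesis .
qed

lemma serre_outside: "\<alpha> \<notin> \<A> \<Longrightarrow> serre f \<alpha> = 0"
  by (simp add: serre_map_def)

lemma serre_common_support:
  assumes \<alpha>: "\<alpha> \<in> \<A>" and \<beta>: "\<beta> \<in> \<A>"
  obtains S where "finite S" "S \<subseteq> \<X>" "serre f \<alpha> = (\<Sum>P\<in>S. res P (f * \<alpha> P))"
    "serre g \<beta> = (\<Sum>P\<in>S. res P (g * \<beta> P))"
    "\<forall>P\<in>\<X> - S. res P (f * \<alpha> P) = 0 \<and> res P (g * \<beta> P) = 0"
proof -
  let ?S = "{P \<in> \<X>. res P (f * \<alpha> P) \<noteq> 0} \<union> {P \<in> \<X>. res P (g * \<beta> P) \<noteq> 0}"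
  have fin: "finite ?S" "?S \<subseteq> \<X>"
    using finite_residues[OF adele_mult_adele[OF \<alpha>]] finite_residues[OF adele_mult_adele[OF \<beta>]] by auto
  show ?thesis
  proof (rule that[OF fin])
    show "serre f \<alpha> = (\<Sum>P\<in>?S. res P (f * \<alpha> P))" "serre g \<beta> = (\<Sum>P\<in>?S. res P (g * \<beta> P))"
      by (rule serre_sum[OF \<alpha> fin] serre_sum[OF \<beta> fin]; auto)+
  qed auto
qed

lemma serre_add_right:
  assumes \<alpha>: "\<alpha> \<in> \<A>" and \<beta>: "\<beta> \<in> \<A>"
  shows "serre f (\<alpha> + \<beta>) = serre f \<alpha> + serre f \<beta>"
proof -
  obtain S where S: "finite S" "S \<subseteq> \<X>" "serre f \<alpha> = (\<Sum>P\<in>S. res P (f * \<alpha> P))"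
    "serre f \<beta> = (\<Sum>P\<in>S. res P (f * \<beta> P))"
    "\<forall>P\<in>\<X> - S. res P (f * \<alpha> P) = 0 \<and> res P (f * \<beta> P) = 0"
    by (rule serre_common_support[OF \<alpha> \<beta>, where f=f and g=f])
  have add: "res P (f * (\<alpha> + \<beta>) P) = res P (f * \<alpha> P) + res P (f * \<beta> P)" if "P \<in> \<X>" for P
    using res_add[OF that] by (simp add: distrib_left)
  have "serre f (\<alpha> + \<beta>) = (\<Sum>P\<in>S. res P (f * (\<alpha> + \<beta>) P))"
    using S(5) add by (intro serre_sum[OF A.subspace_add[OF adeles_subspace \<alpha> \<beta>] S(1,2)]) simp
  also have "\<dots> = (\<Sum>P\<in>S. res P (f * \<alpha> P) + res P (f * \<beta> P))"
    using S(2) by (intro sum.cong refl add) auto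
  finally show ?thesis by (simp add: S(3,4) sum.distrib)
qed

lemma serre_add_left: "serre (f + g) \<alpha> = serre f \<alpha> + serre g \<alpha>"
proof (cases "\<alpha> \<in> \<A>")
  case \<alpha>: True
  obtain S where S: "finite S" "S \<subseteq> \<X>" "serre f \<alpha> = (\<Sum>P\<in>S. res P (f * \<alpha> P))"
    "serre g \<alpha> = (\<Sum>P\<in>S. res P (g * \<alpha> P))"
    "\<forall>P\<in>\<X> - S. res P (f * \<alpha> P) = 0 \<and> res P (g * \<alpha> P) = 0"
    by (rule serre_common_support[OF \<alpha> \<alpha>, where f=f and g=g])
  have add: "res P ((f + g) * \<alpha> P) = res P (f * \<alpha> P) + res P (g * \<alpha> P)" if "P \<in> \<X>" for P
    using res_add[OF that] by (simp add: distrib_right)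
  have "serre (f + g) \<alpha> = (\<Sum>P\<in>S. res P ((f + g) * \<alpha> P))"
    using S(5) add by (intro serre_sum[OF \<alpha> S(1,2)]) simp
  also have "\<dots> = (\<Sum>P\<in>S. res P (f * \<alpha> P) + res P (g * \<alpha> P))"
    using S(2) by (intro sum.cong refl add) auto
  finally show ?thesis by (simp add: S(3,4) sum.distrib)
qed (simp add: serre_outside)

lemma serre_mult:
  assumes \<alpha>: "\<alpha> \<in> \<A>"
  shows "serre f (adele_mult g \<alpha>) = serre (f * g) \<alpha>"
  using \<alpha> adele_mult_adele[OF \<alpha>, of g] by (simp add: serre_map_def mult.assoc)

lemma serre_scale_left: "serre (\<iota> c * f) \<alpha> = c * serre f \<alpha>"
proof (cases "\<alpha> \<in> \<A>")
  case \<alpha>: True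
  obtain S where S: "finite S" "S \<subseteq> \<X>" "serre f \<alpha> = (\<Sum>P\<in>S. res P (f * \<alpha> P))"
    "serre f \<alpha> = (\<Sum>P\<in>S. res P (f * \<alpha> P))"
    "\<forall>P\<in>\<X> - S. res P (f * \<alpha> P) = 0 \<and> res P (f * \<alpha> P) = 0"
    by (rule serre_common_support[OF \<alpha> \<alpha>, where f=f and g=f])
  have sc: "res P (\<iota> c * f * \<alpha> P) = c * res P (f * \<alpha> P)" if "P \<in> \<X>" for P
    using res_scale[OF that] by (simp add: mult.assoc)
  have "serre (\<iota> c * f) \<alpha> = (\<Sum>P\<in>S. res P (\<iota> c * f * \<alpha> P))"
    using S(5) sc by (intro serre_sum[OF \<alpha> S(1,2)]) simp
  also have "\<dots> = (\<Sum>P\<in>S. c * res P (f * \<alpha> P))" using S(2) by (intro sum.cong refl sc) auto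
  finally show ?thesis by (simp add: S(3) sum_distrib_left)
qed (simp add: serre_outside)

lemma serre_scale_right:
  assumes \<alpha>: "\<alpha> \<in> \<A>"
  shows "serre f (adele_scale \<iota> c \<alpha>) = c * serre f \<alpha>"
  unfolding serre_mult[OF \<alpha>] by (simp add: mult.commute[of f] serre_scale_left)

lemma serre_diff_left: "serre (f - g) \<alpha> = serre f \<alpha> - serre g \<alpha>"
  using serre_add_left[of "f - g" g \<alpha>] by simp

lemma serre_principal: "serre f (diagonal h) = 0"
proof -
  obtain S where S: "finite S" "S \<subseteq> \<X>" "\<forall>P\<in>\<X> - S. res P (f * h) = 0" "(\<Sum>P\<in>S. res P (f * h)) = 0"
    using residue_sum_zero by blast
  have "serre f (diagonal h) = (\<Sum>P\<in>S. res P (f * diagonal h P))"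
    using S(3) by (intro serre_sum[OF diagonal_adele S(1,2)]) simp
  also have "\<dots> = (\<Sum>P\<in>S. res P (f * h))" using S(2) by (intro sum.cong refl) auto
  finally show ?thesis by (simp add: S(4))
qed

lemma serre_local:
  assumes P: "P \<in> \<X>"
  shows "serre f (local_adele P a) = res P (f * a)"
proof -
  have res0: "res Q 0 = 0" if "Q \<in> \<X>" for Q using res_regular[OF that, of 0] by simp
  have "serre f (local_adele P a) = (\<Sum>Q\<in>{P}. res Q (f * local_adele P a Q))"
    using P res0 by (intro serre_sum[OF local_adele_adele[OF P]]) (auto simp: local_adele_def)
  then show ?thesis by (simp add: local_adele_def)
qed

text \<open>
  The conditions at the single places are necessary, as adeles with one component detect every pole of
  \<open>f\<eta>\<close> that is too large; they suffice by the residue theorem.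
\<close>

lemma serre_in_dual_iff: "serre f \<in> H1_dual \<iota> B \<longleftrightarrow> (\<forall>P\<in>\<X>. f \<in> val_ge P (B P - K P))"
proof
  assume dual: "serre f \<in> H1_dual \<iota> B"
  show "\<forall>P\<in>\<X>. f \<in> val_ge P (B P - K P)"
  proof (rule ballI, rule ccontr)
    fix P assume P: "P \<in> \<X>" and "f \<notin> val_ge P (B P - K P)"
    then obtain a where a: "a \<in> val_ge P (- B P)" "res P (f * a) \<noteq> 0"
      using res_nondegenerate by blast
    then have "local_adele P a \<in> adeles_at \<iota> B" using local_adele_at[OF P] by blast
    then have "serre f (local_adele P a) = 0" by (rule H1_dualD(5)[OF dual])
    then show False using a(2) serre_local[OF P] by simp
  qed
next
  assume f: "\<forall>P\<in>\<X>. f \<in> val_ge P (B P - K P)"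
  show "serre f \<in> H1_dual \<iota> B"
  proof (rule H1_dualI)
    fix \<alpha> assume \<alpha>: "\<alpha> \<in> adeles_at \<iota> B"
    have "res P (f * \<alpha> P) = 0" if P: "P \<in> \<X>" for P
    proof (rule res_regular[OF P])
      have "f \<in> val_ge P (B P - K P)" "\<alpha> P \<in> val_ge P (- B P)"
        using f P \<alpha> by (auto simp: adeles_at_def)
      then have "f * \<alpha> P \<in> val_ge P (B P - K P + - B P)" by (rule val_ge_mult[OF P])
      then show "f * \<alpha> P \<in> val_ge P (- K P)" by simp
    qed
    then show "serre f \<alpha> = 0" using serre_sum[of \<alpha> "{}" f] \<alpha> by (simp add: adeles_at_def)
  qed (simp_all add: serre_outside serre_add_right serre_scale_right serre_principal)
qed

lemma serre_eq_0:
  assumes "\<And>\<alpha>. \<alpha> \<in> \<A> \<Longrightarrow> serre f \<alpha> = 0"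
  shows "f = 0"
proof (rule ccontr)
  assume f: "f \<noteq> 0"
  obtain P where P: "P \<in> \<X>" using places_nonempty by blast
  have "f \<notin> val_ge P ((P f + K P + 1) - K P)" using f by (simp add: val_ge_def)
  then obtain a where "res P (f * a) \<noteq> 0" using res_nondegenerate[OF P] by blast
  then show False using assms[OF local_adele_adele[OF P]] serre_local[OF P] by simp
qed

lemma serre_inj: "inj serre"
proof (rule injI)
  fix f g assume "serre f = serre g"
  then have "f - g = 0" by (intro serre_eq_0) (simp add: serre_diff_left)
  then show "f = g" by simp
qed

end

context curve
begin

lemma H1_dual_sum:
  assumes \<phi>: "\<phi> \<in> H1_dual \<iota> B" and "finite I" and b: "\<And>i. i \<in> I \<Longrightarrow> b i \<in> \<A>"
  shows "\<phi> (\<Sum>i\<in>I. adele_scale \<iota> (c i) (b i)) = (\<Sum>i\<in>I. c i * \<phi> (b i))"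
  using assms(2,3)
proof (induction I)
  case empty
  have "(0 :: ('a \<Rightarrow> int) \<Rightarrow> 'a) \<in> adeles_at \<iota> B" by (rule A.subspace_0[OF adeles_at_subspace])
  then show ?case unfolding sum.empty by (rule H1_dualD(5)[OF \<phi>])
next
  case (insert i I)
  have "adele_scale \<iota> (c i) (b i) \<in> \<A>" "(\<Sum>i\<in>I. adele_scale \<iota> (c i) (b i)) \<in> \<A>"
    using insert.prems by (auto intro!: A.subspace_scale[OF adeles_subspace] A.subspace_sum[OF adeles_subspace])
  then have "\<phi> (adele_scale \<iota> (c i) (b i) + (\<Sum>i\<in>I. adele_scale \<iota> (c i) (b i))) =
      \<phi> (adele_scale \<iota> (c i) (b i)) + \<phi> (\<Sum>i\<in>I. adele_scale \<iota> (c i) (b i))"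
    by (rule H1_dualD(2)[OF \<phi>])
  also have "\<dots> = c i * \<phi> (b i) + (\<Sum>i\<in>I. c i * \<phi> (b i))"
    using insert H1_dualD(3)[OF \<phi>, of "b i" "c i"] by simp
  finally show ?case unfolding sum.insert[OF insert.hyps(1,2)] .
qed

text \<open>
  A functional is given by its values on representatives of a basis of \<open>H\<^sup>1(X, O(B))\<close>.
\<close>

lemma card_H1_dual:
  assumes B: "B \<in> Div"
  shows "finite (H1_dual \<iota> B)" "card (H1_dual \<iota> B) = CARD('k) ^ h1 \<iota> B"
proof -
  let ?W = "adeles_at \<iota> B + \<F>"
  have W: "A.subspace ?W" by (rule A.subspace_plus[OF adeles_at_subspace principal_adeles_subspace])
  obtain S where S: "quotient_basis (adele_scale \<iota>) (\<A>) ?W S"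
    using h1_dim(1)[OF B] by (auto simp: finite_h1_def finite_dim_quotient_def)
  have S': "finite S" "S \<subseteq> \<A>" "\<A> \<subseteq> A.span S + ?W" using S by (auto simp: quotient_basis_def)
  have h1: "h1 \<iota> B = card S" unfolding h1_def
    by (rule A.quotient_dim_eqI[OF adeles_subspace W A.card_quotient_basis(1)[OF adeles_subspace W S]])
  have "inj_on (\<lambda>\<phi>. restrict \<phi> S) (H1_dual \<iota> B)"
  proof (rule inj_onI)
    fix \<phi> \<psi> assume \<phi>: "\<phi> \<in> H1_dual \<iota> B" and \<psi>: "\<psi> \<in> H1_dual \<iota> B" and eq: "restrict \<phi> S = restrict \<psi> S"
    have eqS: "\<phi> b = \<psi> b" if "b \<in> S" for b using fun_cong[OF eq, of b] that by simp
    show "\<phi> = \<psi>"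
    proof
      fix \<alpha>
      show "\<phi> \<alpha> = \<psi> \<alpha>"
      proof (cases "\<alpha> \<in> \<A>")
        case False
        then show ?thesis by (simp add: H1_dualD(1)[OF \<phi>] H1_dualD(1)[OF \<psi>])
      next
        case True
        then have "\<alpha> \<in> A.span S + ?W" using S'(3) by blast
        then obtain s w where sw: "\<alpha> = s + w" "s \<in> A.span S" "w \<in> ?W" by (rule set_plus_elim)
        obtain c where c: "s = (\<Sum>b\<in>S. adele_scale \<iota> (c b) b)"
          using sw(2) A.span_finite[OF S'(1)] by auto
        have s: "s \<in> \<A>" using A.span_minimal[OF S'(2) adeles_subspace] sw(2) by blast
        have "w = \<alpha> - s" using sw(1) by simp
        then have w: "w \<in> \<A>" using A.subspace_diff[OF adeles_subspace True s] by simp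
        have val: "\<theta> \<alpha> = (\<Sum>b\<in>S. c b * \<theta> b)" if \<theta>: "\<theta> \<in> H1_dual \<iota> B" for \<theta>
        proof -
          have "\<theta> \<alpha> = \<theta> s"
            unfolding sw(1) using H1_dualD(2)[OF \<theta> s w] H1_dualD(4)[OF \<theta> sw(3)] by simp
          also have "\<dots> = (\<Sum>b\<in>S. c b * \<theta> b)"
            unfolding c using S'(2) by (intro H1_dual_sum[OF \<theta> S'(1)]) blast
          finally show ?thesis .
        qed
        show ?thesis unfolding val[OF \<phi>] val[OF \<psi>] using eqS by (intro sum.cong) auto
      qed
    qed
  qed
  moreover have "(\<lambda>\<phi>. restrict \<phi> S) ` H1_dual \<iota> B = S \<rightarrow>\<^sub>E (UNIV :: 'k set)"
  proof
    show "S \<rightarrow>\<^sub>E (UNIV :: 'k set) \<subseteq> (\<lambda>\<phi>. restrict \<phi> S) ` H1_dual \<iota> B"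
    proof
      fix c assume c: "c \<in> S \<rightarrow>\<^sub>E (UNIV :: 'k set)"
      obtain \<phi> where \<phi>: "A.functional \<phi>" "\<forall>w\<in>?W. \<phi> w = 0" "\<forall>b\<in>S. \<phi> b = c b"
        using A.quotient_functional[OF W S] by blast
      note lin = A.linear_rules[OF \<phi>(1)]
      define \<psi> where "\<psi> \<alpha> = (if \<alpha> \<in> \<A> then \<phi> \<alpha> else 0)" for \<alpha>
      have W_V: "?W \<subseteq> \<A>" using principal_adeles_adeles A.subspace_add[OF adeles_subspace]
        by (auto simp: adeles_at_def set_plus_def)
      have "\<psi> \<in> H1_dual \<iota> B" unfolding H1_dual_def mem_Collect_eq
      proof (intro conjI allI ballI impI)
        fix \<alpha> \<beta> assume ab: "\<alpha> \<in> \<A>" "\<beta> \<in> \<A>"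
        then have "\<alpha> + \<beta> \<in> \<A>" by (rule A.subspace_add[OF adeles_subspace])
        then show "\<psi> (\<alpha> + \<beta>) = \<psi> \<alpha> + \<psi> \<beta>" using ab by (simp add: \<psi>_def lin)
      next
        fix c \<alpha> assume a: "\<alpha> \<in> \<A>"
        then have "adele_scale \<iota> c \<alpha> \<in> \<A>" by (rule A.subspace_scale[OF adeles_subspace])
        then show "\<psi> (adele_scale \<iota> c \<alpha>) = c * \<psi> \<alpha>" using a lin(3)[of c \<alpha>] by (simp add: \<psi>_def)
      next
        fix \<alpha> assume "\<alpha> \<in> ?W"
        then show "\<psi> \<alpha> = 0" using \<phi>(2) W_V by (auto simp: \<psi>_def)
      qed (simp add: \<psi>_def)
      moreover have "restrict \<psi> S = c"
      proof
        fix b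
        show "restrict \<psi> S b = c b"
          using c S'(2) \<phi>(3) by (cases "b \<in> S") (auto simp: \<psi>_def PiE_def extensional_def)
      qed
      ultimately show "c \<in> (\<lambda>\<phi>. restrict \<phi> S) ` H1_dual \<iota> B" by blast
    qed
  qed auto
  ultimately have bij: "bij_betw (\<lambda>\<phi>. restrict \<phi> S) (H1_dual \<iota> B) (S \<rightarrow>\<^sub>E (UNIV :: 'k set))"
    by (simp add: bij_betw_def)
  have "finite (S \<rightarrow>\<^sub>E (UNIV :: 'k set))" using S'(1) by (simp add: finite_PiE)
  then show "finite (H1_dual \<iota> B)" using bij_betw_finite[OF bij] by simp
  show "card (H1_dual \<iota> B) = CARD('k) ^ h1 \<iota> B"
    using bij_betw_same_card[OF bij] S'(1) by (simp add: h1 card_PiE)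
qed

lemma q_power_le_iff: "CARD('k) ^ m \<le> CARD('k) ^ n \<longleftrightarrow> m \<le> n"
  using q_ge_2 by (simp add: power_increasing_iff)

end

context curve_differential
begin

text \<open>
  If \<open>\<eta>\<close> had infinitely many zeros, there would be divisors \<open>B \<le> K\<close> of arbitrarily large degree,
  and the pairing would embed the spaces \<open>L(B)\<close>, of unbounded dimension, in the dual of \<open>H\<^sup>1(X, O)\<close>.
\<close>

lemma finite_zeros_\<eta>: "finite {P \<in> \<X>. 0 < K P}"
proof (rule ccontr)
  assume inf: "infinite {P \<in> \<X>. 0 < K P}"
  let ?N = "{P \<in> \<X>. K P < 0}"
  define d where "d = (\<Sum>P\<in>?N. K P * int (place_degree \<iota> P))"
  \<comment> \<open>the degree of \<open>B\<close> below is at least \<open>n + d\<close>, which makes \<open>\<ell>(B)\<close> exceed the genus\<close>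
  define n where "n = nat (2 * int (genus \<iota>) - d)"
  obtain S where S: "finite S" "card S = n" "S \<subseteq> {P \<in> \<X>. 0 < K P}"
    using infinite_arbitrarily_large[OF inf] by blast
  define B where "B P = (if P \<in> S then 1 else if P \<in> ?N then K P else 0)" for P
  have SN: "finite (S \<union> ?N)" "S \<inter> ?N = {}" using S finite_poles_\<eta> by auto
  have B: "B \<in> Div" by (rule divisorsI[OF SN(1)]) (use S in \<open>auto simp: B_def\<close>)
  have "deg B = (\<Sum>P\<in>S \<union> ?N. B P * int (place_degree \<iota> P))"
    by (rule divisor_degree_superset[OF SN(1)]) (auto simp: Supp_def B_def)
  also have "\<dots> = (\<Sum>P\<in>S. B P * int (place_degree \<iota> P)) + (\<Sum>P\<in>?N. B P * int (place_degree \<iota> P))"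
    by (rule sum.union_disjoint[OF S(1) finite_poles_\<eta> SN(2)])
  also have "(\<Sum>P\<in>?N. B P * int (place_degree \<iota> P)) = d"
    unfolding d_def using SN(2) by (intro sum.cong refl) (auto simp: B_def)
  also have "(\<Sum>P\<in>S. B P * int (place_degree \<iota> P)) = (\<Sum>P\<in>S. int (place_degree \<iota> P))"
    by (intro sum.cong refl) (simp add: B_def)
  finally have deg: "deg B = (\<Sum>P\<in>S. int (place_degree \<iota> P)) + d" .
  have "int n = (\<Sum>P\<in>S. 1)" by (simp add: S(2))
  also have "\<dots> \<le> (\<Sum>P\<in>S. int (place_degree \<iota> P))"
  proof (rule sum_mono)
    fix P assume "P \<in> S"
    then have "P \<in> \<X>" using S(3) by blast
    then show "1 \<le> int (place_degree \<iota> P)" using place_degree_pos[of P] by simp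
  qed
  finally have "int n + d \<le> deg B" using deg by simp
  moreover have "2 * int (genus \<iota>) - d \<le> int n" by (simp add: n_def)
  ultimately have "genus \<iota> < ell \<iota> B" using riemann_roch_h1[OF B] by linarith
  moreover have "serre ` L B \<subseteq> H1_dual \<iota> 0"
  proof (rule image_subsetI)
    fix f assume f: "f \<in> L B"
    have "f \<in> val_ge P ((0 :: 'a dvsr) P - K P)" if P: "P \<in> \<X>" for P
    proof (rule val_ge_mono)
      show "f \<in> val_ge P (- B P)" using f P by (simp add: RR_space_iff[OF B])
      show "(0 :: 'a dvsr) P - K P \<le> - B P" using S(3) P by (auto simp: B_def)
    qed
    then show "serre f \<in> H1_dual \<iota> 0" unfolding serre_in_dual_iff by blast
  qed
  then have "card (serre ` L B) \<le> card (H1_dual \<iota> 0)"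
    by (rule card_mono[OF card_H1_dual(1)[OF divisors_0]])
  then have "CARD('k) ^ ell \<iota> B \<le> CARD('k) ^ genus \<iota>"
    by (simp add: card_image[OF inj_on_subset[OF serre_inj]] card_RR_space[OF B] card_H1_dual(2)[OF divisors_0] genus_def)
  ultimately show False by (simp add: q_power_le_iff)
qed

lemma K_in_divisors: "K \<in> Div"
proof (rule divisorsI)
  show "finite ({P \<in> \<X>. K P < 0} \<union> {P \<in> \<X>. 0 < K P})" using finite_poles_\<eta> finite_zeros_\<eta> by simp
  show "K P = 0" if "P \<notin> {P \<in> \<X>. K P < 0} \<union> {P \<in> \<X>. 0 < K P}" for P
    using that by (cases "P \<in> \<X>") (auto simp: K_def diff_divisor_def)
qed auto

lemma serre_in_dual:
  assumes B: "B \<in> Div"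
  shows "serre f \<in> H1_dual \<iota> B \<longleftrightarrow> f \<in> L (K - B)"
  unfolding serre_in_dual_iff RR_space_iff[OF divisors_diff[OF K_in_divisors B]] by simp

text \<open>
  The action of \<open>L(E)\<close> on functionals, dual to the multiplication \<open>O(B - E) \<rightarrow> O(B)\<close> by a section of \<open>O(E)\<close>.
\<close>

lemma multiplied_functional:
  assumes E: "E \<in> Div" and \<mu>: "\<mu> \<in> H1_dual \<iota> B" and f: "f \<in> L E"
  shows "(\<lambda>\<alpha>. if \<alpha> \<in> \<A> then \<mu> (adele_mult f \<alpha>) else 0) \<in> H1_dual \<iota> (B - E)"
proof (rule H1_dualI)
  note D = H1_dualD[OF \<mu>]
  show "(if \<alpha> + \<beta> \<in> \<A> then \<mu> (adele_mult f (\<alpha> + \<beta>)) else 0) =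
      (if \<alpha> \<in> \<A> then \<mu> (adele_mult f \<alpha>) else 0) + (if \<beta> \<in> \<A> then \<mu> (adele_mult f \<beta>) else 0)"
    if ab: "\<alpha> \<in> \<A>" "\<beta> \<in> \<A>" for \<alpha> \<beta>
  proof -
    have "adele_mult f (\<alpha> + \<beta>) = adele_mult f \<alpha> + adele_mult f \<beta>"
      by (simp add: fun_eq_iff distrib_left)
    then show ?thesis
      using ab A.subspace_add[OF adeles_subspace ab] D(2)[OF adele_mult_adele[OF ab(1)] adele_mult_adele[OF ab(2)]]
      by simp
  qed
  show "(if adele_scale \<iota> c \<alpha> \<in> \<A> then \<mu> (adele_mult f (adele_scale \<iota> c \<alpha>)) else 0) =
      c * (if \<alpha> \<in> \<A> then \<mu> (adele_mult f \<alpha>) else 0)"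
    if a: "\<alpha> \<in> \<A>" for \<alpha> c
  proof -
    have "adele_mult f (adele_scale \<iota> c \<alpha>) = adele_scale \<iota> c (adele_mult f \<alpha>)"
      by (simp add: fun_eq_iff mult.left_commute)
    then show ?thesis
      using a A.subspace_scale[OF adeles_subspace a, of c] D(3)[OF adele_mult_adele[OF a]] by simp
  qed
  show "(if \<alpha> \<in> \<A> then \<mu> (adele_mult f \<alpha>) else 0) = 0" if a: "\<alpha> \<in> adeles_at \<iota> (B - E)" for \<alpha>
  proof -
    have \<alpha>: "\<alpha> \<in> \<A>" "\<And>P. P \<in> \<X> \<Longrightarrow> \<alpha> P \<in> val_ge P (- (B P - E P))"
      using a by (auto simp: adeles_at_def)
    have "adele_mult f \<alpha> \<in> adeles_at \<iota> B" unfolding adeles_at_def mem_Collect_eq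
    proof (intro conjI ballI)
      fix P assume P: "P \<in> \<X>"
      have "f \<in> val_ge P (- E P)" using f P by (simp add: RR_space_iff[OF E])
      then have "f * \<alpha> P \<in> val_ge P (- E P + - (B P - E P))"
        by (rule val_ge_mult[OF P _ \<alpha>(2)[OF P]])
      then show "f * \<alpha> P \<in> val_ge P (- B P)" by simp
    qed (rule adele_mult_adele[OF \<alpha>(1)])
    then show ?thesis using D(5) by simp
  qed
  show "(if diagonal h \<in> \<A> then \<mu> (adele_mult f (diagonal h)) else 0) = 0" for h
  proof -
    have "adele_mult f (diagonal h) = diagonal (f * h)" by (simp add: fun_eq_iff)
    then show ?thesis using D(6)[of "f * h"] by simp
  qed
qed simp

text \<open>
  If \<open>\<mu>\<close> is not of the form \<open>serre h\<close>, then \<open>F\<mu>\<close> meets the image of the pairing in \<open>0\<close>, so that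
  \<open>L(E)\<mu> \<oplus> L(K - B + E)\<eta>\<close> embeds in the dual of \<open>H\<^sup>1(X, O(B - E))\<close>.  As \<open>E\<close> grows, the dimension of the
  first grows with twice the degree of \<open>E\<close>, that of the second only with the degree of \<open>E\<close>.
\<close>

lemma serre_surjective:
  assumes B: "B \<in> Div" and \<mu>: "\<mu> \<in> H1_dual \<iota> B"
  shows "\<exists>h. \<mu> = serre h"
proof (rule ccontr)
  assume no: "\<nexists>h. \<mu> = serre h"
  obtain P where P: "P \<in> \<X>" using places_nonempty by blast
  let ?g = "int (genus \<iota>)" and ?d = "int (place_degree \<iota> P)"
  \<comment> \<open>larger than the bound on \<open>deg E\<close> that comes out of Riemann-Roch for \<open>E\<close>, \<open>B - E\<close> and \<open>K - B + E\<close>\<close>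
  define n where "n = 1 + nat (int (ell \<iota> B) - deg K - 3 + 3 * ?g)"
  define E where "E = (\<lambda>Q. int n * point_divisor P Q)"
  have E: "E \<in> Div" unfolding E_def by (rule divisors_scale[OF point_divisor_in_divisors[OF P]])
  have degE: "deg E = int n * ?d"
    unfolding E_def divisor_degree_scale[OF point_divisor_in_divisors[OF P]] divisor_degree_point[OF P] ..
  have BE: "B - E \<in> Div" and KBE: "K - (B - E) \<in> Div" by (intro divisors_diff B E K_in_divisors)+
  let ?X = "L E \<times> L (K - (B - E))"
  define m where "m f = (\<lambda>\<alpha>. if \<alpha> \<in> \<A> then \<mu> (adele_mult f \<alpha>) else 0)" for f
  let ?\<Phi> = "\<lambda>(f, h) \<alpha>. m f \<alpha> + serre h \<alpha>"
  have m_diff: "m (f - g) \<alpha> = m f \<alpha> - m g \<alpha>" for f g \<alpha>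
  proof (cases "\<alpha> \<in> \<A>")
    case True
    have "adele_mult f \<alpha> = adele_mult (f - g) \<alpha> + adele_mult g \<alpha>"
      by (simp add: fun_eq_iff left_diff_distrib)
    then show ?thesis
      using True H1_dualD(2)[OF \<mu> adele_mult_adele[OF True, of "f - g"] adele_mult_adele[OF True, of g]]
      by (simp add: m_def)
  qed (simp add: m_def)
  have "inj_on ?\<Phi> ?X"
  proof (rule inj_onI, clarify)
    fix f h f' h' assume eq: "(\<lambda>\<alpha>. m f \<alpha> + serre h \<alpha>) = (\<lambda>\<alpha>. m f' \<alpha> + serre h' \<alpha>)"
    have eq': "m (f - f') \<alpha> = serre (h' - h) \<alpha>" for \<alpha>
      using fun_cong[OF eq, of \<alpha>] by (simp add: m_diff serre_diff_left algebra_simps)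
    have ff': "f - f' = 0"
    proof (rule ccontr)
      assume ne: "f - f' \<noteq> 0"
      let ?g = "f - f'"
      have "\<mu> \<alpha> = serre ((h' - h) * inverse ?g) \<alpha>" for \<alpha>
      proof (cases "\<alpha> \<in> \<A>")
        case False
        then show ?thesis by (simp add: serre_outside H1_dualD(1)[OF \<mu>])
      next
        case True
        have "adele_mult ?g (adele_mult (inverse ?g) \<alpha>) = \<alpha>"
          using ne by (simp add: fun_eq_iff mult.assoc[symmetric])
        then have "\<mu> \<alpha> = m ?g (adele_mult (inverse ?g) \<alpha>)"
          using adele_mult_adele[OF True, of "inverse ?g"] by (simp add: m_def)
        also have "\<dots> = serre ((h' - h) * inverse ?g) \<alpha>" unfolding eq' by (rule serre_mult[OF True])
        finally show ?thesis .
      qed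
      then show False using no by blast
    qed
    have "h' - h = 0"
    proof (rule serre_eq_0)
      fix \<alpha> assume "\<alpha> \<in> \<A>"
      have "serre (h' - h) \<alpha> = m 0 \<alpha>" using eq'[of \<alpha>] ff' by simp
      also have "\<dots> = 0" using m_diff[of 0 0 \<alpha>] by simp
      finally show "serre (h' - h) \<alpha> = 0" .
    qed
    then show "f = f' \<and> h = h'" using ff' by simp
  qed
  moreover have "?\<Phi> ` ?X \<subseteq> H1_dual \<iota> (B - E)"
  proof (rule image_subsetI)
    fix fh assume fh: "fh \<in> ?X"
    obtain f h where fh_eq: "fh = (f, h)" "f \<in> L E" "h \<in> L (K - (B - E))" using fh by (rule SigmaE)
    have m: "m f \<in> H1_dual \<iota> (B - E)"
      unfolding m_def[abs_def] by (rule multiplied_functional[OF E \<mu> fh_eq(2)])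
    have h: "serre h \<in> H1_dual \<iota> (B - E)" using fh_eq(3) serre_in_dual[OF BE] by blast
    show "?\<Phi> fh \<in> H1_dual \<iota> (B - E)"
      unfolding fh_eq(1) prod.case using m h by (auto simp: H1_dual_def distrib_left)
  qed
  ultimately have "card ?X \<le> card (H1_dual \<iota> (B - E))"
    by (rule card_inj_on_le[OF _ _ card_H1_dual(1)[OF BE]])
  then have "CARD('k) ^ (ell \<iota> E + ell \<iota> (K - (B - E))) \<le> CARD('k) ^ h1 \<iota> (B - E)"
    by (simp add: card_cartesian_product card_RR_space[OF E] card_RR_space[OF KBE] card_H1_dual(2)[OF BE] power_add)
  then have le: "int (ell \<iota> E) + int (ell \<iota> (K - (B - E))) \<le> int (h1 \<iota> (B - E))"
    by (simp add: q_power_le_iff)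
  have "0 \<le> E" by (simp add: le_fun_def E_def point_divisor_def)
  then have "L (B - E) \<subseteq> L B" by (intro RR_space_mono[OF BE B]) simp
  then have "card (L (B - E)) \<le> card (L B)" by (rule card_mono[OF RR_space_finite[OF B]])
  then have ell_le: "int (ell \<iota> (B - E)) \<le> int (ell \<iota> B)"
    by (simp add: card_RR_space[OF B] card_RR_space[OF BE] q_power_le_iff)
  have deg: "deg (B - E) = deg B - int n * ?d"
    "deg (K - (B - E)) = deg K - deg B + int n * ?d"
    by (simp_all add: divisor_degree_diff[OF B E] divisor_degree_diff[OF K_in_divisors BE] degE)
  have "int n * ?d \<le> int (ell \<iota> B) - deg K - 3 + 3 * ?g"
    using le ell_le riemann_roch_h1[OF E] riemann_roch_h1[OF BE] riemann_roch_h1[OF KBE]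
    unfolding deg degE by linarith
  moreover have "int n \<le> int n * ?d"
    using mult_left_mono[of 1 ?d "int n"] place_degree_pos[OF P] by simp
  moreover have "int (ell \<iota> B) - deg K - 3 + 3 * ?g < int n" by (simp add: n_def)
  ultimately show False by linarith
qed

text \<open>
  A functional of the form \<open>serre h\<close> has \<open>h \<in> L(K - B)\<close> as soon as it vanishes on \<open>adeles_at B\<close>, so
  surjectivity follows from the previous lemma; the dimensions are those of Riemann's theorem.
\<close>

theorem serre_duality:
  assumes B: "B \<in> Div"
  shows "linear_bij (const_scale \<iota>) (\<lambda>c \<phi> \<alpha>. c * \<phi> \<alpha>) serre (L (K - B)) (H1_dual \<iota> B)"
    and "ell \<iota> (K - B) = h1 \<iota> B"
    and "int (ell \<iota> (K - B)) = int (ell \<iota> B) - deg B - 1 + int (genus \<iota>)"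
proof -
  have "serre ` L (K - B) = H1_dual \<iota> B"
  proof
    show "serre ` L (K - B) \<subseteq> H1_dual \<iota> B" using serre_in_dual[OF B] by blast
    show "H1_dual \<iota> B \<subseteq> serre ` L (K - B)"
    proof
      fix \<mu> assume \<mu>: "\<mu> \<in> H1_dual \<iota> B"
      then obtain h where h: "\<mu> = serre h" using serre_surjective[OF B] by blast
      then have "h \<in> L (K - B)" using \<mu> serre_in_dual[OF B] by blast
      then show "\<mu> \<in> serre ` L (K - B)" unfolding h by (rule imageI)
    qed
  qed
  then have bij: "bij_betw serre (L (K - B)) (H1_dual \<iota> B)"
    using inj_on_subset[OF serre_inj] by (simp add: bij_betw_def)
  then show "linear_bij (const_scale \<iota>) (\<lambda>c \<phi> \<alpha>. c * \<phi> \<alpha>) serre (L (K - B)) (H1_dual \<iota> B)"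
    by (simp add: linear_bij_def fun_eq_iff serre_add_left serre_scale_left)
  have "CARD('k) ^ ell \<iota> (K - B) = CARD('k) ^ h1 \<iota> B" using bij_betw_same_card[OF bij]
    by (simp add: card_RR_space[OF divisors_diff[OF K_in_divisors B]] card_H1_dual(2)[OF B])
  then show *: "ell \<iota> (K - B) = h1 \<iota> B" using q_power_le_iff by (metis order_antisym order_refl)
  show "int (ell \<iota> (K - B)) = int (ell \<iota> B) - deg B - 1 + int (genus \<iota>)"
    using riemann_roch_h1[OF B] by (simp add: *)
qed

end

section \<open>Residue codes\<close>

lemma coset_plus:
  assumes W: "add_subgroup W"
  shows "(x +o W) + (y +o W) = (x + y) +o W"
proof (rule set_eqI)
  note D = add_subgroupD[OF W]
  fix z
  have "z \<in> (x +o W) + (y +o W) \<longleftrightarrow> (\<exists>v\<in>W. \<exists>w\<in>W. z = (x + v) + (y + w))"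
    unfolding set_plus_def elt_set_plus_def by blast
  also have "\<dots> \<longleftrightarrow> (\<exists>v\<in>W. z = (x + y) + v)"
  proof
    assume "\<exists>v\<in>W. \<exists>w\<in>W. z = (x + v) + (y + w)"
    then obtain v w where "v \<in> W" "w \<in> W" "z = (x + v) + (y + w)" by blast
    then show "\<exists>v\<in>W. z = (x + y) + v"
      by (intro bexI[of _ "v + w"]) (simp_all add: D(4) algebra_simps)
  next
    assume "\<exists>v\<in>W. z = (x + y) + v"
    then obtain v where "v \<in> W" "z = (x + y) + v" by blast
    then show "\<exists>v\<in>W. \<exists>w\<in>W. z = (x + v) + (y + w)"
      by (intro bexI[of _ v] bexI[of _ 0]) (simp_all add: D(1) algebra_simps)
  qed
  finally show "z \<in> (x +o W) + (y +o W) \<longleftrightarrow> z \<in> (x + y) +o W" by (simp add: elt_set_plus_def)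
qed

lemma (in vector_space) coset_scale_coset:
  assumes W: "subspace W"
  shows "coset_scale scale W c (x +o W) = scale c x +o W"
proof (rule set_eqI)
  note sub = subspace_0[OF W] subspace_add[OF W] subspace_scale[OF W]
  fix z
  have "z \<in> coset_scale scale W c (x +o W) \<longleftrightarrow> (\<exists>v\<in>W. \<exists>w\<in>W. z = scale c (x + v) + w)"
    unfolding coset_scale_def set_plus_def elt_set_plus_def by blast
  also have "\<dots> \<longleftrightarrow> (\<exists>v\<in>W. z = scale c x + v)"
  proof
    assume "\<exists>v\<in>W. \<exists>w\<in>W. z = scale c (x + v) + w"
    then obtain v w where "v \<in> W" "w \<in> W" "z = scale c (x + v) + w" by blast
    then show "\<exists>v\<in>W. z = scale c x + v"
      by (intro bexI[of _ "scale c v + w"]) (simp_all add: sub scale_right_distrib add.assoc)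
  next
    assume "\<exists>v\<in>W. z = scale c x + v"
    then obtain v where "v \<in> W" "z = scale c x + v" by blast
    then show "\<exists>v\<in>W. \<exists>w\<in>W. z = scale c (x + v) + w"
      by (intro bexI[of _ 0] bexI[of _ v]) (simp_all add: sub)
  qed
  finally show "z \<in> coset_scale scale W c (x +o W) \<longleftrightarrow> z \<in> scale c x +o W"
    by (simp add: elt_set_plus_def)
qed

text \<open>
  The correspondence \<open>\<rho>\<close> becomes a bijection on the quotients, as the class of \<open>y\<close> depends only on that of
  \<open>x\<close> and conversely.
\<close>

lemma quotient_isomorphic_of_correspondence:
  assumes s: "vector_space s" and s': "vector_space s'"
    and V0: "module.subspace s V0" and W0: "module.subspace s' W0"
    and range: "\<And>x y. \<rho> x y \<Longrightarrow> x \<in> V \<and> y \<in> W"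
    and total: "\<And>x. x \<in> V \<Longrightarrow> \<exists>y. \<rho> x y" and onto: "\<And>y. y \<in> W \<Longrightarrow> \<exists>x. \<rho> x y"
    and add: "\<And>x y x' y'. \<rho> x y \<Longrightarrow> \<rho> x' y' \<Longrightarrow> \<rho> (x + x') (y + y')"
    and scale: "\<And>c x y. \<rho> x y \<Longrightarrow> \<rho> (s c x) (s' c y)"
    and ker: "\<And>x y x' y'. \<rho> x y \<Longrightarrow> \<rho> x' y' \<Longrightarrow> x - x' \<in> V0 \<longleftrightarrow> y - y' \<in> W0"
  shows "quotient_isomorphic s V V0 s' W W0"
proof -
  interpret S: vector_space s by (rule s)
  interpret S': vector_space s' by (rule s')
  note V0' = S.add_subgroup_subspace[OF V0] and W0' = S'.add_subgroup_subspace[OF W0]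
  define g where "g X = (SOME y. \<exists>x. \<rho> x y \<and> x +o V0 = X) +o W0" for X
  have g: "g (x +o V0) = y +o W0" if xy: "\<rho> x y" for x y
  proof -
    have "\<exists>x'. \<rho> x' (SOME y. \<exists>x'. \<rho> x' y \<and> x' +o V0 = x +o V0) \<and> x' +o V0 = x +o V0"
      by (rule someI[where P = "\<lambda>y. \<exists>x'. \<rho> x' y \<and> x' +o V0 = x +o V0"]) (use xy in blast)
    then obtain x' where x': "\<rho> x' (SOME y. \<exists>x'. \<rho> x' y \<and> x' +o V0 = x +o V0)" "x' - x \<in> V0"
      unfolding coset_eq_iff[OF V0'] by blast
    then have "(SOME y. \<exists>x'. \<rho> x' y \<and> x' +o V0 = x +o V0) - y \<in> W0" using ker[OF x'(1) xy] by blast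
    then show ?thesis unfolding g_def coset_eq_iff[OF W0'] .
  qed
  have rep: "\<exists>x y. \<rho> x y \<and> X = x +o V0" if "X \<in> quotient_space V V0" for X
    using that total unfolding quotient_space_def by blast
  have bij: "bij_betw g (quotient_space V V0) (quotient_space W W0)" unfolding bij_betw_def
  proof
    show "inj_on g (quotient_space V V0)"
    proof (rule inj_onI)
      fix X X' assume X: "X \<in> quotient_space V V0" "X' \<in> quotient_space V V0" and eq: "g X = g X'"
      obtain x y where xy: "\<rho> x y" "X = x +o V0" using rep[OF X(1)] by blast
      obtain x' y' where xy': "\<rho> x' y'" "X' = x' +o V0" using rep[OF X(2)] by blast
      have "y - y' \<in> W0"
        using eq unfolding xy(2) xy'(2) g[OF xy(1)] g[OF xy'(1)] coset_eq_iff[OF W0'] .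
      then have "x - x' \<in> V0" using ker[OF xy(1) xy'(1)] by blast
      then show "X = X'" unfolding xy(2) xy'(2) coset_eq_iff[OF V0'] .
    qed
    show "g ` quotient_space V V0 = quotient_space W W0"
    proof
      show "g ` quotient_space V V0 \<subseteq> quotient_space W W0"
      proof (rule image_subsetI)
        fix X assume X: "X \<in> quotient_space V V0"
        obtain x y where xy: "\<rho> x y" "X = x +o V0" using rep[OF X] by blast
        show "g X \<in> quotient_space W W0"
          unfolding xy(2) g[OF xy(1)] quotient_space_def using range[OF xy(1)] by blast
      qed
      show "quotient_space W W0 \<subseteq> g ` quotient_space V V0"
      proof
        fix Y assume "Y \<in> quotient_space W W0"
        then obtain y where y: "y \<in> W" "Y = y +o W0" by (auto simp: quotient_space_def)
        obtain x where x: "\<rho> x y" using onto[OF y(1)] by blast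
        have "x +o V0 \<in> quotient_space V V0" using range[OF x] by (auto simp: quotient_space_def)
        then show "Y \<in> g ` quotient_space V V0" unfolding y(2) g[OF x, symmetric] by (rule imageI)
      qed
    qed
  qed
  have "linear_bij (coset_scale s V0) (coset_scale s' W0) g (quotient_space V V0) (quotient_space W W0)"
    unfolding linear_bij_def
  proof (intro conjI bij ballI allI)
    fix X X' assume X: "X \<in> quotient_space V V0" "X' \<in> quotient_space V V0"
    obtain x y where xy: "\<rho> x y" "X = x +o V0" using rep[OF X(1)] by blast
    obtain x' y' where xy': "\<rho> x' y'" "X' = x' +o V0" using rep[OF X(2)] by blast
    show "g (X + X') = g X + g X'"
      unfolding xy(2) xy'(2) coset_plus[OF V0'] g[OF add[OF xy(1) xy'(1)]] g[OF xy(1)] g[OF xy'(1)]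
      by (rule coset_plus[OF W0', symmetric])
  next
    fix c X assume X: "X \<in> quotient_space V V0"
    obtain x y where xy: "\<rho> x y" "X = x +o V0" using rep[OF X] by blast
    show "g (coset_scale s V0 c X) = coset_scale s' W0 c (g X)"
      unfolding xy(2) S.coset_scale_coset[OF V0] g[OF scale[OF xy(1)]] g[OF xy(1)]
      by (rule S'.coset_scale_coset[OF W0, symmetric])
  qed
  then show ?thesis unfolding quotient_isomorphic_def by (rule exI[where x = g])
qed

lemma vec_scale_vector_space: "vector_space (\<lambda>(c :: 'k::field) (x :: 'k ^ 'n). c *s x)"
  by unfold_locales (auto simp: vec_eq_iff algebra_simps)

context curve
begin

lemma
  assumes P: "P \<in> rational_places \<iota>"
  shows rational_place: "P \<in> \<X>"
    and value_at_cong: "f \<in> \<O> P \<Longrightarrow> f - \<iota> (value_at \<iota> P f) \<in> \<m> P"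
proof -
  show P': "P \<in> \<X>" using P by (simp add: rational_places_def)
  assume f: "f \<in> \<O> P"
  have "f ^ CARD('k) - f \<in> \<m> P"
    using residue_power_card[OF P' f] P by (simp add: rational_places_def)
  then obtain c where c: "f - \<iota> c \<in> \<m> P" using residue_constant[OF P' f] by blast
  show "f - \<iota> (value_at \<iota> P f) \<in> \<m> P"
    unfolding value_at_def by (rule theI[of _ c]) (use c \<iota>_cong_unique[OF P'] in blast)+
qed

lemma value_at_eqI: "P \<in> rational_places \<iota> \<Longrightarrow> f \<in> \<O> P \<Longrightarrow> f - \<iota> c \<in> \<m> P \<Longrightarrow> value_at \<iota> P f = c"
  using \<iota>_cong_unique[OF rational_place value_at_cong] by blast

context
  fixes P assumes P: "P \<in> rational_places \<iota>"
begin

lemma value_at_add: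
  assumes "f \<in> \<O> P" "g \<in> \<O> P"
  shows "value_at \<iota> P (f + g) = value_at \<iota> P f + value_at \<iota> P g"
proof (rule value_at_eqI[OF P])
  note P' = rational_place[OF P]
  show "f + g \<in> \<O> P" by (rule val_ge_add[OF P' assms])
  show "f + g - \<iota> (value_at \<iota> P f + value_at \<iota> P g) \<in> \<m> P"
    using val_ge_add[OF P' value_at_cong[OF P assms(1)] value_at_cong[OF P assms(2)]]
    by (simp add: \<iota>_add algebra_simps)
qed

lemma value_at_mult:
  assumes "f \<in> \<O> P" "g \<in> \<O> P"
  shows "value_at \<iota> P (f * g) = value_at \<iota> P f * value_at \<iota> P g"
proof (rule value_at_eqI[OF P])
  note P' = rational_place[OF P]
  show "f * g \<in> \<O> P" by (rule val_ge_mult0[OF P' assms])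
  show "f * g - \<iota> (value_at \<iota> P f * value_at \<iota> P g) \<in> \<m> P" unfolding \<iota>_mult
    by (rule cong_mult[OF P' assms(1) \<iota>_val_ge[OF P'] value_at_cong[OF P assms(1)] value_at_cong[OF P assms(2)]])
qed

lemma value_at_\<iota>: "value_at \<iota> P (\<iota> c) = c"
  by (rule value_at_eqI[OF P \<iota>_val_ge[OF rational_place[OF P]]]) simp

lemma value_at_scale: "f \<in> \<O> P \<Longrightarrow> value_at \<iota> P (\<iota> c * f) = c * value_at \<iota> P f"
  using value_at_mult[OF \<iota>_val_ge[OF rational_place[OF P]]] value_at_\<iota> by simp

lemma value_at_eq_0_iff: "f \<in> \<O> P \<Longrightarrow> value_at \<iota> P f = 0 \<longleftrightarrow> f \<in> \<m> P"
  using value_at_cong[OF P, of f] value_at_eqI[OF P, of f 0] by auto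

lemma value_at_diff:
  assumes "f \<in> \<O> P" "g \<in> \<O> P"
  shows "value_at \<iota> P (f - g) = value_at \<iota> P f - value_at \<iota> P g"
  using value_at_add[OF val_ge_diff[OF rational_place[OF P] assms] assms(2)] by simp

end

end

locale residue_code = curve_differential \<iota> \<eta>
  for \<iota> :: "'k::{field,finite} \<Rightarrow> 'a::field" and \<eta> :: "'a differential" +
  fixes Ps :: "'n::finite \<Rightarrow> ('a \<Rightarrow> int)" and D G :: "'a dvsr"
  assumes Ps_rational: "\<And>i. Ps i \<in> rational_places \<iota>"
    and Ps_distinct: "inj Ps"
    and D_def: "D = (\<Sum>i\<in>UNIV. point_divisor (Ps i))"
    and G: "G \<in> Div"
    and G_D: "Supp G \<inter> Supp D = {}"
    and \<eta>_val: "\<And>P. P \<in> Supp D \<Longrightarrow> diff_val \<iota> P \<eta> = -1"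
    and \<eta>_res: "\<And>P. P \<in> Supp D \<Longrightarrow> residue_trace \<iota> P \<eta> = 1"
begin

lemma Ps_places: "Ps i \<in> \<X>"
  by (rule rational_place[OF Ps_rational])

lemma D_apply: "D P = (if P \<in> range Ps then 1 else 0)"
proof -
  have "(\<Sum>i\<in>I. point_divisor (Ps i)) P = (\<Sum>i\<in>I. point_divisor (Ps i) P)" for I :: "'n set"
    by (induction I rule: infinite_finite_induct) auto
  then have "D P = (\<Sum>i\<in>UNIV. point_divisor (Ps i) P)" by (simp add: D_def)
  also have "\<dots> = (\<Sum>i\<in>UNIV. if P = Ps i then 1 else 0)" by (simp add: point_divisor_def)
  also have "\<dots> = (if P \<in> range Ps then 1 else 0)"
  proof (cases "P \<in> range Ps")
    case True
    then obtain j where j: "P = Ps j" by blast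
    have "(\<Sum>i\<in>UNIV. if P = Ps i then 1 else 0) = (\<Sum>i\<in>UNIV. if i = j then 1 else (0::int))"
      unfolding j using Ps_distinct by (intro sum.cong) (auto simp: inj_eq)
    then show ?thesis using True by simp
  next
    case False
    then have "P \<noteq> Ps i" for i by blast
    then show ?thesis using False by simp
  qed
  finally show ?thesis .
qed

lemma Supp_D: "Supp D = range Ps"
  by (auto simp: Supp_def D_apply)

lemma D: "D \<in> Div"
  by (rule divisorsI[of "range Ps"]) (use Ps_places in \<open>auto simp: D_apply\<close>)

definition A' :: "'a dvsr" where
  "A' = D - G + K"

lemma A': "A' \<in> Div"
  unfolding A'_def by (intro divisors_add divisors_diff D G K_in_divisors)

lemma A'_apply: "A' P = D P - G P + K P"
  by (simp add: A'_def)

lemma at_points: "D (Ps i) = 1" "G (Ps i) = 0" "K (Ps i) = -1" "A' (Ps i) = 0"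
proof -
  show 1: "D (Ps i) = 1" by (simp add: D_apply)
  then have Supp: "Ps i \<in> Supp D" by (simp add: Supp_def)
  then show 2: "G (Ps i) = 0" using G_D by (auto simp: Supp_def)
  show 3: "K (Ps i) = -1" using \<eta>_val[OF Supp] Ps_places by (simp add: K_def diff_divisor_def)
  show "A' (Ps i) = 0" by (simp add: A'_apply 1 2 3)
qed

text \<open>
  Subtract the constant \<open>f(P)\<close>: the remaining differential is regular at \<open>P\<close>.
\<close>

lemma res_value:
  assumes f: "f \<in> \<O> (Ps i)"
  shows "res (Ps i) f = value_at \<iota> (Ps i) f"
proof -
  let ?P = "Ps i" and ?c = "value_at \<iota> (Ps i) f"
  have one: "res ?P 1 = 1" using \<eta>_res[of ?P] by (simp add: res_def Supp_D)
  have "res ?P (f - \<iota> ?c) = 0"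
    using value_at_cong[OF Ps_rational f] by (intro res_regular[OF Ps_places]) (simp add: at_points)
  then have "res ?P f = res ?P (\<iota> ?c * 1)"
    using res_add[OF Ps_places, of i "f - \<iota> ?c" "\<iota> ?c"] by simp
  then show ?thesis unfolding res_scale[OF Ps_places] one by simp
qed

lemma regular_at_points: "B \<in> Div \<Longrightarrow> B (Ps i) = 0 \<Longrightarrow> f \<in> L B \<Longrightarrow> f \<in> \<O> (Ps i)"
  using Ps_places[of i] by (fastforce simp: RR_space_iff)

abbreviation ev :: "'a \<Rightarrow> 'k ^ 'n" where
  "ev h \<equiv> (\<chi> i. value_at \<iota> (Ps i) h)"

text \<open>
  The differential \<open>f h \<eta>\<close> has at most simple poles, only at the points, with residues \<open>f(P) h(P)\<close>.
\<close>

lemma code_orthogonal: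
  assumes f: "f \<in> L G" and h: "h \<in> L A'"
  shows "scalar_product (ev f) (ev h) = 0"
proof -
  have reg: "f \<in> \<O> (Ps i)" "h \<in> \<O> (Ps i)" for i
    by (rule regular_at_points[OF G at_points(2) f] regular_at_points[OF A' at_points(4) h])+
  have "serre (f * h) (diagonal 1) = (\<Sum>P\<in>range Ps. res P (f * h * diagonal 1 P))"
  proof (rule serre_sum[OF diagonal_adele])
    fix P assume P: "P \<in> \<X>" "P \<notin> range Ps"
    have "f * h \<in> val_ge P (- G P + - A' P)"
      by (rule val_ge_mult[OF P(1)]) (use f h P(1) in \<open>simp_all add: RR_space_iff[OF G] RR_space_iff[OF A']\<close>)
    then show "res P (f * h * diagonal 1 P) = 0" using P by (simp add: A'_apply D_apply res_regular)
  qed (use Ps_places in auto)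
  also have "\<dots> = (\<Sum>i\<in>UNIV. res (Ps i) (f * h))"
    using Ps_places by (simp add: sum.reindex[OF Ps_distinct])
  also have "\<dots> = (\<Sum>i\<in>UNIV. value_at \<iota> (Ps i) f * value_at \<iota> (Ps i) h)" by (intro sum.cong refl)
      (simp add: res_value[OF val_ge_mult0[OF Ps_places reg]] value_at_mult[OF Ps_rational reg])
  finally show ?thesis using serre_principal[of "f * h" 1] by (simp add: scalar_product_def)
qed

text \<open>
  A vector orthogonal to the code of \<open>G\<close> defines a functional on \<open>adeles_at G\<close> that vanishes on
  the functions in it.  An extension of it by zero on the function field lies in the dual of
  \<open>H\<^sup>1(X, O(G - D))\<close>, and the section of \<open>O(A')\<close> that represents it takes the given values at the points.
\<close>

lemma dual_code_represented:
  assumes y: "y \<in> dual_code (code_L \<iota> Ps G)"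
  shows "\<exists>h\<in>L A'. y = ev h"
proof -
  let ?O = "adeles_at \<iota> G" and ?F = "\<F>"
  define \<phi> where "\<phi> \<alpha> = (\<Sum>i\<in>UNIV. y $ i * value_at \<iota> (Ps i) (\<alpha> (Ps i)))" for \<alpha> :: "('a \<Rightarrow> int) \<Rightarrow> 'a"
  note O = adeles_at_subspace[of G] and F = principal_adeles_subspace
  have O_reg: "\<alpha> (Ps i) \<in> \<O> (Ps i)" if "\<alpha> \<in> ?O" for \<alpha> i
    using that Ps_places[of i] at_points(2)[of i] by (fastforce simp: adeles_at_def)
  have \<phi>_add: "\<phi> (\<alpha> + \<beta>) = \<phi> \<alpha> + \<phi> \<beta>" if "\<alpha> \<in> ?O" "\<beta> \<in> ?O" for \<alpha> \<beta>
    by (simp add: \<phi>_def value_at_add[OF Ps_rational O_reg[OF that(1)] O_reg[OF that(2)]]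
        distrib_left sum.distrib)
  have \<phi>_scale: "\<phi> (adele_scale \<iota> c \<alpha>) = c * \<phi> \<alpha>" if "\<alpha> \<in> ?O" for c \<alpha>
    by (simp add: \<phi>_def value_at_scale[OF Ps_rational O_reg[OF that]] sum_distrib_left mult.left_commute)
  have \<phi>_F: "\<phi> \<alpha> = 0" if \<alpha>: "\<alpha> \<in> ?O" "\<alpha> \<in> ?F" for \<alpha>
  proof -
    obtain f where f: "\<alpha> = diagonal f" using \<alpha>(2) by (auto simp: principal_adeles_def)
    then have "f \<in> L G" using \<alpha>(1) diagonal_at_iff[OF G] by blast
    then have "scalar_product (ev f) y = 0" using y by (auto simp: dual_code_def code_L_def)
    then show ?thesis using Ps_places by (simp add: \<phi>_def f scalar_product_def mult.commute)
  qed
  obtain e where e: "A.endo e" "\<And>x. e x \<in> ?O" "\<And>x. x \<in> ?F \<Longrightarrow> e x = 0" "\<And>x. x \<in> ?O \<Longrightarrow> x - e x \<in> ?O \<inter> ?F"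
    using A.relative_projection[OF O F] by blast
  note e_lin = A.linear_rules[OF e(1)]
  have \<phi>_e: "\<phi> (e \<alpha>) = \<phi> \<alpha>" if \<alpha>: "\<alpha> \<in> ?O" for \<alpha>
    using \<phi>_add[OF e(2) IntD1[OF e(4)[OF \<alpha>]], of \<alpha>] \<phi>_F[OF IntD1[OF e(4)[OF \<alpha>]] IntD2[OF e(4)[OF \<alpha>]]]
    by simp
  define \<mu> where "\<mu> \<alpha> = (if \<alpha> \<in> \<A> then \<phi> (e \<alpha>) else 0)" for \<alpha>
  have GD: "G - D \<in> Div" by (rule divisors_diff[OF G D])
  have "\<mu> \<in> H1_dual \<iota> (G - D)"
  proof (rule H1_dualI)
    show "\<mu> (\<alpha> + \<beta>) = \<mu> \<alpha> + \<mu> \<beta>" if "\<alpha> \<in> \<A>" "\<beta> \<in> \<A>" for \<alpha> \<beta>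
      using that A.subspace_add[OF adeles_subspace that] by (simp add: \<mu>_def e_lin(1) \<phi>_add[OF e(2,2)])
    show "\<mu> (adele_scale \<iota> c \<alpha>) = c * \<mu> \<alpha>" if "\<alpha> \<in> \<A>" for c \<alpha>
      using that A.subspace_scale[OF adeles_subspace that, of c] \<phi>_scale[OF e(2), of c \<alpha>] by (simp add: \<mu>_def e_lin(3))
    show "\<mu> (diagonal h) = 0" for h
      using e(3)[of "diagonal h"] \<phi>_F[OF A.subspace_0[OF O] A.subspace_0[OF F]]
      by (simp add: \<mu>_def principal_adeles_def)
    fix \<alpha> assume \<alpha>: "\<alpha> \<in> adeles_at \<iota> (G - D)"
    have "G - D \<le> G" by (simp add: le_fun_def D_apply)
    then have \<alpha>_O: "\<alpha> \<in> ?O" using \<alpha> adeles_at_mono by blast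
    have "value_at \<iota> (Ps i) (\<alpha> (Ps i)) = 0" for i
    proof -
      have "\<alpha> (Ps i) \<in> \<m> (Ps i)"
        using \<alpha> Ps_places[of i] at_points[of i] by (fastforce simp: adeles_at_def)
      then show ?thesis using value_at_eq_0_iff[OF Ps_rational O_reg[OF \<alpha>_O]] by blast
    qed
    then have "\<phi> \<alpha> = 0" by (simp add: \<phi>_def)
    then show "\<mu> \<alpha> = 0" using \<phi>_e[OF \<alpha>_O] by (simp add: \<mu>_def)
  qed (simp add: \<mu>_def)
  moreover obtain h where h: "\<mu> = serre h" using serre_surjective[OF GD calculation] by blast
  ultimately have "h \<in> L (K - (G - D))" using serre_in_dual[OF GD] by blast
  moreover have "K - (G - D) = A'" by (simp add: A'_def)
  ultimately have h_A': "h \<in> L A'" by simp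
  have "y $ i = value_at \<iota> (Ps i) h" for i
  proof -
    let ?\<alpha> = "local_adele (Ps i) 1"
    have \<alpha>: "?\<alpha> \<in> ?O"
      unfolding local_adele_at[OF Ps_places] using one_val_ge[OF Ps_places] by (simp add: at_points)
    have v1: "value_at \<iota> (Ps i) 1 = 1" "value_at \<iota> (Ps j) 0 = 0" for j
      using value_at_\<iota>[OF Ps_rational, of i 1] value_at_\<iota>[OF Ps_rational, of j 0] by simp_all
    have "\<phi> ?\<alpha> = (\<Sum>j\<in>UNIV. if j = i then y $ i else 0)"
      unfolding \<phi>_def local_adele_def using Ps_distinct v1 by (intro sum.cong) (auto simp: inj_eq)
    then have "\<mu> ?\<alpha> = y $ i" using \<phi>_e[OF \<alpha>] local_adele_adele[OF Ps_places] by (simp add: \<mu>_def)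
    moreover have "serre h ?\<alpha> = value_at \<iota> (Ps i) h"
      using serre_local[OF Ps_places, of h i 1] res_value[OF regular_at_points[OF A' at_points(4) h_A']] by simp
    ultimately show ?thesis by (simp add: h)
  qed
  then have "y = ev h" by (simp add: vec_eq_iff)
  then show ?thesis using h_A' by blast
qed

lemma code_dual: "code_L \<iota> Ps A' = dual_code (code_L \<iota> Ps G)"
proof
  show "code_L \<iota> Ps A' \<subseteq> dual_code (code_L \<iota> Ps G)"
    using code_orthogonal by (auto simp: code_L_def dual_code_def)
  show "dual_code (code_L \<iota> Ps G) \<subseteq> code_L \<iota> Ps A'"
    using dual_code_represented by (auto simp: code_L_def)
qed

end

section \<open>The hull and the excess\<close>

context residue_code
begin

definition meet :: "'a dvsr" where
  "meet = inf G A'"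

lemma meet: "meet \<in> Div"
  unfolding meet_def by (rule divisors_inf[OF G A'])

lemma sup_diff: "sup G A' - D = K - meet"
  by (auto simp: fun_eq_iff meet_def A'_apply sup_int_def inf_int_def max_def min_def)

lemma K_meet: "K - meet \<in> Div"
  by (rule divisors_diff[OF K_in_divisors meet])

lemma RR_meet: "L meet = L G \<inter> L A'"
proof -
  have "f \<in> val_ge P (- meet P) \<longleftrightarrow> f \<in> val_ge P (- G P) \<and> f \<in> val_ge P (- A' P)" for f P
    by (auto simp: val_ge_def meet_def inf_int_def)
  then show ?thesis by (auto simp: RR_space_iff[OF meet] RR_space_iff[OF G] RR_space_iff[OF A'])
qed

lemma RR_vanishing:
  assumes C: "C \<in> Div" "\<And>i. C (Ps i) = 0" and f: "f \<in> L C"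
  shows "ev f = 0 \<longleftrightarrow> f \<in> L (C - D)"
proof -
  have reg: "f \<in> \<O> (Ps i)" for i by (rule regular_at_points[OF C(1) C(2) f])
  have "ev f = 0 \<longleftrightarrow> (\<forall>i. f \<in> \<m> (Ps i))"
    using value_at_eq_0_iff[OF Ps_rational reg] by (simp add: vec_eq_iff)
  also have "\<dots> \<longleftrightarrow> (\<forall>P\<in>\<X>. f \<in> val_ge P (- (C - D) P))"
  proof
    assume *: "\<forall>i. f \<in> \<m> (Ps i)"
    show "\<forall>P\<in>\<X>. f \<in> val_ge P (- (C - D) P)"
    proof
      fix P assume P: "P \<in> \<X>"
      show "f \<in> val_ge P (- (C - D) P)"
      proof (cases "P \<in> range Ps")
        case True
        then show ?thesis using * C(2) by (auto simp: D_apply)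
      next
        case False
        then show ?thesis using f P by (simp add: D_apply RR_space_iff[OF C(1)])
      qed
    qed
  next
    assume *: "\<forall>P\<in>\<X>. f \<in> val_ge P (- (C - D) P)"
    show "\<forall>i. f \<in> \<m> (Ps i)"
    proof
      fix i
      show "f \<in> \<m> (Ps i)" using *[rule_format, OF Ps_places[of i]] C(2)[of i] by (simp add: D_apply)
    qed
  qed
  finally show ?thesis by (simp add: RR_space_iff[OF divisors_diff[OF C(1) D]])
qed

lemma
  assumes C: "C \<in> Div" "\<And>i. C (Ps i) = 0"
    and C': "C' \<in> Div" "\<And>i. C' (Ps i) = 0"
    and f: "f \<in> L C" and g: "g \<in> L C'"
  shows ev_add: "ev (f + g) = ev f + ev g" and ev_diff: "ev (f - g) = ev f - ev g"
    and ev_scale: "ev (\<iota> c * f) = c *s ev f"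
  using value_at_add[OF Ps_rational regular_at_points[OF C(1) C(2) f] regular_at_points[OF C'(1) C'(2) g]]
    value_at_diff[OF Ps_rational regular_at_points[OF C(1) C(2) f] regular_at_points[OF C'(1) C'(2) g]]
    value_at_scale[OF Ps_rational regular_at_points[OF C(1) C(2) f]]
  by (simp_all add: vec_eq_iff)

lemmas G_points = G at_points(2) and A'_points = A' at_points(4)

lemma meet_points: "meet (Ps i) = 0"
  by (simp add: meet_def inf_int_def at_points)

abbreviation code_hull :: "('k ^ 'n) set" where
  "code_hull \<equiv> hull_code (code_L \<iota> Ps G)"

lemma code_hull: "code_hull = code_L \<iota> Ps G \<inter> code_L \<iota> Ps A'"
  by (simp add: hull_code_def code_dual)

lemma code_meet_hull: "code_L \<iota> Ps meet \<subseteq> code_hull"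
  unfolding code_hull unfolding code_L_def RR_meet by blast

abbreviation R :: "'a set" where
  "R \<equiv> R_space \<iota> D G A'"

abbreviation R0 :: "'a set" where
  "R0 \<equiv> R0_space \<iota> D G A'"

lemma GD: "G - D \<in> Div" and AD: "A' - D \<in> Div"
  by (rule divisors_diff[OF G D] divisors_diff[OF A' D])+

lemma R_subset: "R \<subseteq> L (K - meet)"
  by (auto simp: R_space_def sup_diff)

lemma R_subspace: "F.subspace R" and R0_subspace: "F.subspace R0"
  unfolding R_space_def R0_space_def sup_diff
  by (intro F.subspace_inter F.subspace_plus RR_space_subspace G A' K_meet GD AD)+

lemma R0_subset: "R0 \<subseteq> R"
proof
  fix r assume "r \<in> R0"
  then obtain g a where r: "r = g + a" "g \<in> L (G - D)" "a \<in> L (A' - D)"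
    unfolding R0_space_def by (rule set_plus_elim)
  have "G - D \<le> G" "A' - D \<le> A'" "G - D \<le> K - meet" "A' - D \<le> K - meet"
    unfolding sup_diff[symmetric] by (simp_all add: le_fun_def D_apply sup_int_def)
  then have "g \<in> L G" "a \<in> L A'" "g \<in> L (K - meet)" "a \<in> L (K - meet)"
    using r(2,3) RR_space_mono[OF GD G] RR_space_mono[OF AD A'] RR_space_mono[OF GD K_meet] RR_space_mono[OF AD K_meet]
    by blast+
  then show "r \<in> R" unfolding R_space_def sup_diff r(1)
    using F.subspace_add[OF RR_space_subspace[OF K_meet]] set_plus_intro by blast
qed

text \<open>
  A codeword of the hull is the vector of values of some \<open>f \<in> L(G)\<close> and of some \<open>a \<in> L(A')\<close>.  The
  difference \<open>f - a\<close> vanishes at the points, so it is in \<open>R\<close>, and every element of \<open>R\<close> arises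
  in this way.
\<close>

definition hull_relation :: "'k ^ 'n \<Rightarrow> 'a \<Rightarrow> bool" where
  "hull_relation x r \<longleftrightarrow> (\<exists>f\<in>L G. \<exists>a\<in>L A'. x = ev f \<and> x = ev a \<and> r = f - a)"

lemma difference_in_R_iff:
  assumes f: "f \<in> L G" and a: "a \<in> L A'"
  shows "f - a \<in> R \<longleftrightarrow> ev f = ev a"
proof -
  have S: "sup G A' \<in> Div" "\<And>i. sup G A' (Ps i) = 0"
    by (simp_all add: divisors_sup[OF G A'] at_points sup_int_def)
  have fS: "f \<in> L (sup G A')" "a \<in> L (sup G A')"
    using RR_space_mono[OF G S(1)] RR_space_mono[OF A' S(1)] f a by (auto simp: sup.cobounded1 sup.cobounded2)
  have "f - a \<in> L G + L A'"
    by (rule set_plusI[OF _ f F.subspace_neg[OF RR_space_subspace[OF A'] a]]) simp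
  then have "f - a \<in> R \<longleftrightarrow> f - a \<in> L (sup G A' - D)" by (simp add: R_space_def)
  also have "\<dots> \<longleftrightarrow> ev (f - a) = 0"
    by (rule RR_vanishing[OF S F.subspace_diff[OF RR_space_subspace[OF S(1)] fS], symmetric])
  also have "ev (f - a) = ev f - ev a" by (rule ev_diff[OF S S fS])
  finally show ?thesis by simp
qed

text \<open>
  If \<open>b \<in> L(G) \<inter> L(A')\<close> has the values \<open>x\<close>, then \<open>f - a = (f - b) - (a - b)\<close>, where both terms vanish at the
  points.  Conversely, \<open>f - a = g + c\<close> makes \<open>f - g = a + c\<close> a section of \<open>O(G \<and> A')\<close> with the values \<open>x\<close>.
\<close>

lemma hull_relation_kernel:
  assumes r: "hull_relation x r"
  shows "x \<in> code_L \<iota> Ps meet \<longleftrightarrow> r \<in> R0"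
proof -
  obtain f a where fa: "f \<in> L G" "a \<in> L A'" "x = ev f" "x = ev a" "r = f - a"
    using r unfolding hull_relation_def by blast
  note G_sub = RR_space_subspace[OF G] and A_sub = RR_space_subspace[OF A']
  show ?thesis
  proof
    assume "x \<in> code_L \<iota> Ps meet"
    then obtain b where b: "b \<in> L G" "b \<in> L A'" "x = ev b" unfolding code_L_def RR_meet by blast
    have "ev (f - b) = 0" "ev (a - b) = 0"
      using ev_diff[OF G_points G_points fa(1) b(1)] ev_diff[OF A'_points A'_points fa(2) b(2)] fa b by simp_all
    then have "f - b \<in> L (G - D)" "a - b \<in> L (A' - D)"
      using RR_vanishing[OF G_points F.subspace_diff[OF G_sub fa(1) b(1)]]
        RR_vanishing[OF A'_points F.subspace_diff[OF A_sub fa(2) b(2)]] by blast+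
    then show "r \<in> R0" unfolding R0_space_def
      by (intro set_plusI[of r "f - b" "- (a - b)"] F.subspace_neg[OF RR_space_subspace[OF AD]]) (simp_all add: fa)
  next
    assume "r \<in> R0"
    then obtain g c where gc: "r = g + c" "g \<in> L (G - D)" "c \<in> L (A' - D)"
      unfolding R0_space_def by (rule set_plus_elim)
    have "G - D \<le> G" "A' - D \<le> A'" by (simp_all add: le_fun_def D_apply)
    then have gG: "g \<in> L G" and cA: "c \<in> L A'"
      using gc RR_space_mono[OF GD G] RR_space_mono[OF AD A'] by blast+
    have "f - g = a + c" using fa(5) gc(1) by (simp add: algebra_simps)
    then have "f - g \<in> L meet"
      unfolding RR_meet using F.subspace_diff[OF G_sub fa(1) gG] F.subspace_add[OF A_sub fa(2) cA] by simp
    moreover have "ev (f - g) = x"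
      using ev_diff[OF G_points G_points fa(1) gG] RR_vanishing[OF G_points gG] gc(2) fa(3) by simp
    ultimately show "x \<in> code_L \<iota> Ps meet" unfolding code_L_def by blast
  qed
qed

lemma hull_relation_add:
  assumes "hull_relation x r" "hull_relation x' r'"
  shows "hull_relation (x + x') (r + r')"
proof -
  obtain f a f' a' where *: "f \<in> L G" "a \<in> L A'" "x = ev f" "x = ev a" "r = f - a"
    "f' \<in> L G" "a' \<in> L A'" "x' = ev f'" "x' = ev a'" "r' = f' - a'"
    using assms unfolding hull_relation_def by blast
  have "x + x' = ev (f + f')" using ev_add[OF G_points G_points *(1,6)] *(3,8) by simp
  moreover have "x + x' = ev (a + a')" using ev_add[OF A'_points A'_points *(2,7)] *(4,9) by simp
  moreover have "r + r' = (f + f') - (a + a')" using *(5,10) by simp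
  ultimately show ?thesis unfolding hull_relation_def
    using F.subspace_add[OF RR_space_subspace[OF G] *(1,6)] F.subspace_add[OF RR_space_subspace[OF A'] *(2,7)]
    by blast
qed

lemma hull_relation_scale:
  assumes "hull_relation x r"
  shows "hull_relation (c *s x) (\<iota> c * r)"
proof -
  obtain f a where *: "f \<in> L G" "a \<in> L A'" "x = ev f" "x = ev a" "r = f - a"
    using assms unfolding hull_relation_def by blast
  have "c *s x = ev (\<iota> c * f)" using ev_scale[OF G_points G_points *(1,1)] *(3) by simp
  moreover have "c *s x = ev (\<iota> c * a)" using ev_scale[OF A'_points A'_points *(2,2)] *(4) by simp
  moreover have "\<iota> c * r = \<iota> c * f - \<iota> c * a" using *(5) by (simp add: right_diff_distrib)
  ultimately show ?thesis unfolding hull_relation_def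
    using F.subspace_scale[OF RR_space_subspace[OF G] *(1)] F.subspace_scale[OF RR_space_subspace[OF A'] *(2)]
    by blast
qed

lemma hull_relation_total: "x \<in> code_hull \<Longrightarrow> \<exists>r. hull_relation x r"
  unfolding code_hull unfolding code_L_def hull_relation_def by blast

lemma hull_relation_onto:
  assumes r: "r \<in> R"
  shows "\<exists>x. hull_relation x r"
proof -
  obtain f b where fb: "r = f + b" "f \<in> L G" "b \<in> L A'"
    using r unfolding R_space_def by (blast elim: set_plus_elim)
  have b: "- b \<in> L A'" by (rule F.subspace_neg[OF RR_space_subspace[OF A'] fb(3)])
  have "f - (- b) \<in> R" using r fb(1) by simp
  then have "ev f = ev (- b)" using difference_in_R_iff[OF fb(2) b] by blast
  then show ?thesis unfolding hull_relation_def fb(1) using fb(2) b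
    by (intro exI[of _ "ev f"] bexI[of _ f] bexI[of _ "- b"]) simp_all
qed

lemma hull_relation_range: "hull_relation x r \<Longrightarrow> x \<in> code_hull \<and> r \<in> R"
  unfolding code_hull unfolding code_L_def hull_relation_def using difference_in_R_iff by blast

lemma hull_relation_diff:
  assumes "hull_relation x r" "hull_relation x' r'"
  shows "hull_relation (x - x') (r - r')"
proof -
  have "x + (-1) *s x' = x - x'" by (simp add: vec_eq_iff)
  then show ?thesis
    using hull_relation_add[OF assms(1) hull_relation_scale[OF assms(2), of "-1"]] by simp
qed

lemma code_subspace:
  assumes C: "C \<in> Div" "\<And>i. C (Ps i) = 0"
  shows "module.subspace (\<lambda>c x. c *s x) (code_L \<iota> Ps C)"
proof -
  interpret V: vector_space "\<lambda>(c :: 'k) (x :: 'k ^ 'n). c *s x"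
    by (rule vec_scale_vector_space)
  note S = RR_space_subspace[OF C(1)]
  show ?thesis
  proof (rule V.subspaceI)
    have "ev 0 = 0"
      using RR_vanishing[OF C F.subspace_0[OF S]] F.subspace_0[OF RR_space_subspace[OF divisors_diff[OF C(1) D]]]
      by blast
    then show "0 \<in> code_L \<iota> Ps C"
      unfolding code_L_def by (intro image_eqI[OF _ F.subspace_0[OF S]]) simp
    show "x + y \<in> code_L \<iota> Ps C" if xy: "x \<in> code_L \<iota> Ps C" "y \<in> code_L \<iota> Ps C" for x y
    proof -
      obtain f g where fg: "f \<in> L C" "g \<in> L C" "x = ev f" "y = ev g"
        using xy unfolding code_L_def by blast
      show ?thesis
        unfolding code_L_def fg(3,4) ev_add[OF C C fg(1,2), symmetric] by (intro imageI F.subspace_add[OF S fg(1,2)])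
    qed
    show "c *s x \<in> code_L \<iota> Ps C" if x: "x \<in> code_L \<iota> Ps C" for c x
    proof -
      obtain f where f: "f \<in> L C" "x = ev f" using x unfolding code_L_def by blast
      show ?thesis
        unfolding code_L_def f(2) ev_scale[OF C C f(1,1), symmetric] by (intro imageI F.subspace_scale[OF S f(1)])
    qed
  qed
qed

lemma hull_quotient_isomorphic:
  "quotient_isomorphic (\<lambda>c x. c *s x) code_hull (code_L \<iota> Ps meet) (const_scale \<iota>) R R0"
proof (rule quotient_isomorphic_of_correspondence[where \<rho> = hull_relation])
  show "vector_space (\<lambda>(c :: 'k) (x :: 'k ^ 'n). c *s x)" by (rule vec_scale_vector_space)
  show "module.subspace (\<lambda>c x. c *s x) (code_L \<iota> Ps meet)"
    by (rule code_subspace[OF meet meet_points])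
  show "x - x' \<in> code_L \<iota> Ps meet \<longleftrightarrow> r - r' \<in> R0" if "hull_relation x r" "hull_relation x' r'" for x r x' r'
    by (rule hull_relation_kernel[OF hull_relation_diff[OF that]])
qed (rule F.vector_space_axioms R0_subspace hull_relation_range hull_relation_total hull_relation_onto
    hull_relation_add hull_relation_scale; assumption?)+

lemma excess_le: "excess \<iota> D G A' \<le> ell \<iota> (K - meet)"
proof -
  have fin: "finite (L (K - meet))" by (rule RR_space_finite[OF K_meet])
  then have finR: "finite R" using R_subset finite_subset by blast
  then have "CARD('k) ^ excess \<iota> D G A' = card (quotient_space R R0)" unfolding excess_def
    by (intro F.card_quotient_space[symmetric] R_subspace R0_subspace) (simp add: quotient_space_def)
  also have "\<dots> \<le> card R" unfolding quotient_space_def by (rule card_image_le[OF finR])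
  also have "\<dots> \<le> CARD('k) ^ ell \<iota> (K - meet)"
    unfolding card_RR_space[OF K_meet, symmetric] by (rule card_mono[OF fin R_subset])
  finally show ?thesis by (simp add: q_power_le_iff)
qed

text \<open>
  The sandwich \<open>R0 \<subseteq> R \<subseteq> L(K - G \<and> A')\<close> collapses.
\<close>

lemma nonspecial_hull:
  assumes "nonspecial \<iota> K meet"
  shows "excess \<iota> D G A' = 0" "code_hull = code_L \<iota> Ps meet"
proof -
  have ell0: "ell \<iota> (K - meet) = 0"
    using assms by (simp add: nonspecial_def index_of_speciality_def)
  then show "excess \<iota> D G A' = 0" using excess_le by simp
  have "card (L (K - meet)) = 1" by (simp add: card_RR_space[OF K_meet] ell0)
  then obtain z where "L (K - meet) = {z}" by (rule card_1_singletonE)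
  then have "R \<subseteq> {0}" using R_subset F.subspace_0[OF RR_space_subspace[OF K_meet]] by auto
  moreover have "x \<in> code_L \<iota> Ps meet" if x: "x \<in> code_hull" for x
  proof -
    obtain r where r: "hull_relation x r" using hull_relation_total[OF x] by blast
    then have "r = 0" using hull_relation_range[OF r] \<open>R \<subseteq> {0}\<close> by blast
    then show ?thesis using hull_relation_kernel[OF r] F.subspace_0[OF R0_subspace] by blast
  qed
  ultimately show "code_hull = code_L \<iota> Ps meet" using code_meet_hull by blast
qed

end

theorem theorem3p2:
  fixes \<iota> :: "'k::{field,finite} \<Rightarrow> 'a::field"
    and Ps :: "'n::finite \<Rightarrow> ('a \<Rightarrow> int)"
    and D G A K :: "'a dvsr"
    and \<eta> :: "'a differential"
  assumes curve: "function_field \<iota>"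
    and Ps_rational: "\<And>i. Ps i \<in> rational_places \<iota>"
    and Ps_distinct: "inj Ps"
    and D: "D = (\<Sum>i\<in>UNIV. point_divisor (Ps i))"
    and G: "G \<in> divisors \<iota>"
    and G_D: "Supp G \<inter> Supp D = {}"
    and \<eta>: "\<eta> \<in> differentials \<iota>" "\<eta> \<noteq> 0"
    and \<eta>_val: "\<And>P. P \<in> Supp D \<Longrightarrow> diff_val \<iota> P \<eta> = -1"
    and \<eta>_res: "\<And>P. P \<in> Supp D \<Longrightarrow> residue_trace \<iota> P \<eta> = 1"
    and K: "K = diff_divisor \<iota> \<eta>"
    and A: "A = D - G + K"
  shows
    \<comment> \<open>the facts recalled along with the set-up, followed by (1), (2) and (3)\<close>
    "(code_L \<iota> Ps A = dual_code (code_L \<iota> Ps G)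
     \<and> code_L \<iota> Ps G \<inter> code_L \<iota> Ps A = hull_code (code_L \<iota> Ps G)
     \<and> (\<forall>B\<in>divisors \<iota>. int (index_of_speciality \<iota> K B)
            = int (ell \<iota> B) - divisor_degree \<iota> B - 1 + int (genus \<iota>)))
     \<and> (sup G A - D = K - inf G A
     \<and> RR_space \<iota> (sup G A - D) = RR_space \<iota> (K - inf G A)
     \<and> linear_bij (const_scale \<iota>) (\<lambda>c \<phi> \<alpha>. c * \<phi> \<alpha>) (serre_map \<iota> \<eta>)
          (RR_space \<iota> (K - inf G A)) (H1_dual \<iota> (inf G A)))
     \<and> (R0_space \<iota> D G A \<subseteq> R_space \<iota> D G A
     \<and> R_space \<iota> D G A \<subseteq> RR_space \<iota> (K - inf G A)
     \<and> code_L \<iota> Ps (inf G A) \<subseteq> hull_code (code_L \<iota> Ps G)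
     \<and> quotient_isomorphic (\<lambda>c x. c *s x) (hull_code (code_L \<iota> Ps G)) (code_L \<iota> Ps (inf G A))
          (const_scale \<iota>) (R_space \<iota> D G A) (R0_space \<iota> D G A)
     \<and> finite_dim_quotient (const_scale \<iota>) (RR_space \<iota> (K - inf G A)) {0}
     \<and> finite_h1 \<iota> (inf G A)
     \<and> 0 \<le> excess \<iota> D G A
     \<and> excess \<iota> D G A \<le> ell \<iota> (K - inf G A)
     \<and> ell \<iota> (K - inf G A) = h1 \<iota> (inf G A))
     \<and> (nonspecial \<iota> K (inf G A) \<longrightarrow>
       excess \<iota> D G A = 0 \<and> hull_code (code_L \<iota> Ps G) = code_L \<iota> Ps (inf G A))"
proof -
  interpret C: residue_code \<iota> \<eta> Ps D G
    by unfold_locales (use assms in auto)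
  have K': "K = C.K"
    by (simp add: K C.K_def)
  have A': "A = C.A'"
    by (simp add: A C.A'_def K')
  have inf': "inf G A = C.meet"
    by (simp add: A' C.meet_def)
  have fin: "finite_dim_quotient (const_scale \<iota>) (RR_space \<iota> (C.K - C.meet)) {0}"
    using C.RR_space_finite[OF C.K_meet] C.finite_iff_quotient_zero
    by (simp add: C.F.finite_dim_quotient_iff[OF C.RR_space_subspace[OF C.K_meet] C.F.subspace_single_0])
  have index: "\<forall>B\<in>divisors \<iota>. int (index_of_speciality \<iota> C.K B)
      = int (ell \<iota> B) - divisor_degree \<iota> B - 1 + int (genus \<iota>)"
    using C.serre_duality(3) by (simp add: index_of_speciality_def)
  show ?thesis
    unfolding inf' K' unfolding A'
    using C.sup_diff C.serre_duality(1,2)[OF C.meet] fin index C.h1_dim(1)[OF C.meet] C.code_hull C.code_dual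
      C.R0_subset C.R_subset C.code_meet_hull C.hull_quotient_isomorphic C.excess_le C.nonspecial_hull
    by simp
qed

end
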